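(* Let $j$ be a QS flow on $\mathsf A$, let $F\in B(\widehat{\mathsf k})\,\overline\otimes\,\mathsf A$ and suppose that the process $Y^{j,F}$ is bounded with locally uniform bounds. Then $Y^{j,F}$ is a multiplier cocycle for $j$.
   Context: All Hilbert spaces are complex, with inner products linear in the second argument. $\mathsf A$ is a von Neumann algebra acting faithfully on a Hilbert space $\mathfrak h$; $\mathsf k$ is a Hilbert space and $\widehat{\mathsf k}:=\mathbb C\oplus\mathsf k$; $\widehat c:=(1,c)$ for $c\in\mathsf k$, $\widehat f(s):=\widehat{f(s)}$. $\underline\otimes$ and $\overline\otimes$ denote algebraic and ultraweak tensor products. $\Delta:=\begin{bmatrix}0&0\\0&I_{\mathsf k}\end{bmatrix}\in B(\widehat{\mathsf k})$, $\Delta^\perp:=I-\Delta$; their ampliations are denoted in the same way. Fock space: for a subinterval $J$ of $\mathbb R_+$, $\mathcal F_J$ is the symmetric Fock space over $L^2(J;\mathsf k)$, $\mathsf N_J:=B(\mathcal F_J)$, $I_J$ is the identity on $\mathcal F_J$; subscripts are omitted for $J=\mathbb R_+$; $\mathcal F=\mathcal F_{[0,t[}\otimes\mathcal F_{[t,\infty[}$. $\mathbb S$ is the space of right-continuous step functions in $L^2(\mathbb R_+;\mathsf k)$; $f_J$ equals $f$ on $J$ and $0$ elsewhere; $\varpi(f):=e^{-\|f\|^2/2}\big((n!)^{-1/2}f^{\otimes n}\big)_{n\ge0}$; $\mathcal E$ is the linear span of $\{\varpi(f):f\in\mathbb S\}$. $E_u$ denotes $|u\rangle$ tensored with identity operators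 (e.g. $E_{\varpi(f)}:\mathfrak h\to\mathfrak h\otimes\mathcal F$, $v\mapsto v\otimes\varpi(f)$) and $E^u:=(E_u)^*$. Processes: an (operator) process on $\mathfrak h$ is a family $X=(X_t)_{t\ge0}$ of (possibly unbounded) operators on $\mathfrak h\otimes\mathcal F$ with domain $\mathfrak h\underline\otimes\mathcal E$ that is weakly measurable in $t$ and adapted: $E^{\varpi(f)}X_tE_{\varpi(g)}=\langle\varpi(f_{[t,\infty[}),\varpi(g_{[t,\infty[})\rangle E^{\varpi(f_{[0,t[})}X_tE_{\varpi(g_{[0,t[})}$ for $f,g\in\mathbb S$; it is a process in $\mathsf A$ if $E^{\varpi(f)}X_tE_{\varpi(g)}\in\mathsf A$ for all $f,g,t$, and is bounded if each $X_t$ is bounded (then identified with its extension to $\mathfrak h\otimes\mathcal F$); it has locally uniform bounds if $\sup_{t\le T}\|X_t\|<\infty$ for all $T$. A (mapping) process on $\mathsf A$ is a family $k=(k_t)_{t\ge0}$ of linear maps on $\mathsf A$ with $(k_t(a))_{t\ge0}$ a process in $\mathsf A$ for each $a$. If $k$ is normal and completely bounded (i.e. each $k_t$ is), then $k_r(a)=k_{r)}(a)\otimes I_{[r,\infty[}$ with $k_{r)}:\mathsf A\to\mathsf A\overline\otimes\mathsf N_{[0,r[}$; put $\widehat k_r:=k_{r)}\overline\otimes\operatorname{id}_{\mathsf N_{[r,\infty[}}$ and $\widetilde k_t:=\operatorname{id}_{B(\widehat{\mathsf k})}\overline\otimes k_t$. Let $T_r:\mathcal F\to\mathcal F_{[r,\infty[}$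 be the unitary with $\varpi(f)\mapsto\varpi(f_r)$, $f_r(s)=f(s-r)$, and $\sigma_r:\mathsf A\overline\otimes\mathsf N\to\mathsf A\overline\otimes\mathsf N_{[r,\infty[}$ the normal *-isomorphism with $a\otimes z\mapsto a\otimes T_rzT_r^*$. $k$ is a QS cocycle if $k_0(a)=a\otimes I_{\mathcal F}$ and $k_{r+t}=\widehat k_r\circ\sigma_r\circ k_t$ for all $r,t\ge0$; it is a QS flow if moreover it is pointwise ultraweakly continuous in $t$, *-homomorphic and unital. For the QS flow $j$ put $J_t:=\widehat\jmath_t\circ\sigma_t$, a semigroup of normal unital *-endomorphisms of $\mathsf A\overline\otimes\mathsf N$. A multiplier cocycle for $j$ is a bounded process $Y$ in $\mathsf A$ with $Y_0=I_{\mathfrak h\otimes\mathcal F}$ and $Y_{s+t}=J_s(Y_t)Y_s$ for all $s,t\ge0$. QS integrals: for an operator process $X$, $\widetilde X_t:=I_{\widehat{\mathsf k}}\underline\otimes X_t$. $\widehat\nabla_s$ is the linear operator with domain $\mathfrak h\underline\otimes\mathcal E$, $\widehat\nabla_s(u\varpi(f))=\widehat f(s)u\varpi(f)$. A family $G=(G_t)_{t\ge0}$ of operators on $\widehat{\mathsf k}\otimes\mathfrak h\otimes\mathcal F$ is QS integrable if, for all $\zeta\in\mathfrak h\underline\otimes\mathcal E$: $\widehat\nabla_t\zeta\in\operatorname{Dom}G_t$ for all $t$; $s\mapsto\Delta^\perp G_s\widehat\nabla_s\zeta$ is locally integrable; $s\mapsto\Delta G_s\widehat\nabla_s\zeta$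 is locally square-integrable; and $E^{\varpi(f)}G_t\widehat\nabla_tE_{\varpi(g)}=\langle\varpi(f_{[t,\infty[}),\varpi(g_{[t,\infty[})\rangle E^{\widehat f(t)\varpi(f_{[0,t[})}G_tE_{\widehat g(t)\varpi(g_{[0,t[})}$ for $f,g\in\mathbb S$. Its QS integral is the continuous operator process determined by $\langle\zeta',\int_0^tG_s\,d\Lambda_s\,\zeta\rangle=\int_0^t\langle\widehat\nabla_s\zeta',G_s\widehat\nabla_s\zeta\rangle\,ds$ for $\zeta,\zeta'\in\mathfrak h\underline\otimes\mathcal E$. Perturbation processes: for $F\in B(\widehat{\mathsf k})\overline\otimes\mathsf A$, $Y^{j,F}$ denotes the unique strong solution of $Y_0=I$, $dY_t=\widetilde\jmath_t(F)\widetilde Y_t\,d\Lambda_t$, i.e. the unique operator process $Y$ such that $(\widetilde\jmath_t(F)\widetilde Y_t)_{t\ge0}$ is QS integrable and $Y_t=I+\int_0^t\widetilde\jmath_s(F)\widetilde Y_s\,d\Lambda_s$ for all $t$ (it exists for every $F$). *)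

theory Defs
  imports "HOL-Analysis.Analysis" "HOL-Library.Poly_Mapping"
begin

(* The series notation of HOL-Analysis clashes with the one for finitely supported sums. *)
no_syntax
  "_Sum_any" :: "pttrn \<Rightarrow> 'a \<Rightarrow> 'a::comm_monoid_add"    (\<open>(\<open>indent=2 notation=\<open>binder \<Sum>\<close>\<close>\<Sum>_. _)\<close> [0, 10] 10)

subsection \<open>Complex Hilbert spaces\<close>

class scaleC =
  fixes scaleC :: "complex \<Rightarrow> 'a \<Rightarrow> 'a" (infixr \<open>*\<^sub>C\<close> 75)

class chilbert_space = banach + scaleC +
  fixes cinner :: "'a \<Rightarrow> 'a \<Rightarrow> complex"
  assumes scaleC_add_right: "c *\<^sub>C (x + y) = c *\<^sub>C x + c *\<^sub>C y"
    and scaleC_add_left: "(c + d) *\<^sub>C x = c *\<^sub>C x + d *\<^sub>C x"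
    and scaleC_scaleC: "c *\<^sub>C d *\<^sub>C x = (c * d) *\<^sub>C x"
    and scaleR_scaleC: "r *\<^sub>R x = complex_of_real r *\<^sub>C x"
    and cinner_commute: "cinner y x = cnj (cinner x y)"
    and cinner_add_right: "cinner x (y + z) = cinner x y + cinner x z"
    and cinner_scaleC_right: "cinner x (c *\<^sub>C y) = c * cinner x y"
    and cinner_self: "cinner x x = complex_of_real ((norm x)\<^sup>2)"

locale semi_inner =
  fixes sc :: "complex \<Rightarrow> 'v::ab_group_add \<Rightarrow> 'v" and ip :: "'v \<Rightarrow> 'v \<Rightarrow> complex"
  assumes sc_minus: "sc (-1) x = - x"
    and ip_comm: "ip y x = cnj (ip x y)"
    and ip_add: "ip x (y + z) = ip x y + ip x z"
    and ip_sc: "ip x (sc c y) = c * ip x y"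
    and ip_pos: "0 \<le> Re (ip x x)"
begin

definition "sn x = sqrt (Re (ip x x))"

lemma ip_add_left: "ip (x + y) z = ip x z + ip y z"
  by (subst (1 2 3) ip_comm) (simp add: ip_add)

lemma ip_sc_left: "ip (sc c x) y = cnj c * ip x y"
  by (subst (1 2) ip_comm) (simp add: ip_sc)

lemma ip_minus: "ip x (- y) = - ip x y"
  using ip_sc[of x "-1" y] by (simp add: sc_minus)

lemma ip_minus_left: "ip (- x) y = - ip x y"
  using ip_sc_left[of "-1" x y] by (simp add: sc_minus)

lemma ip_diff: "ip x (y - z) = ip x y - ip x z"
  using ip_add[of x y "- z"] by (simp add: ip_minus)

lemma ip_diff_left: "ip (x - y) z = ip x z - ip y z"
  using ip_add_left[of x "- y" z] by (simp add: ip_minus_left)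

lemma ip_0 [simp]: "ip x 0 = 0" "ip 0 x = 0"
  using ip_diff[of x 0 0] ip_diff_left[of 0 0 x] by simp_all

lemma ip_self: "ip x x = complex_of_real ((sn x)\<^sup>2)"
proof -
  have "Im (ip x x) = 0" using ip_comm[of x x] by (metis complex_cnj_cancel_iff Im_complex_of_real Reals_cnj_iff complex_is_Real_iff)
  thus ?thesis using ip_pos[of x] by (simp add: sn_def complex_eq_iff)
qed

lemma sn_nonneg [simp]: "0 \<le> sn x"
  by (simp add: sn_def ip_pos)

lemma sn_sq: "(sn x)\<^sup>2 = Re (ip x x)"
  by (simp add: sn_def ip_pos)

lemma sn_sc: "sn (sc c x) = cmod c * sn x"
proof -
  have "(sn (sc c x))\<^sup>2 = (cmod c * sn x)\<^sup>2"
  proof -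
    have "ip (sc c x) (sc c x) = (cnj c * c) * complex_of_real ((sn x)\<^sup>2)"
      by (simp add: ip_sc ip_sc_left ip_self[of x] algebra_simps)
    also have "\<dots> = complex_of_real ((cmod c * sn x)\<^sup>2)"
      by (metis complex_norm_square mult.commute of_real_mult power_mult_distrib)
    finally show ?thesis by (metis sn_sq Re_complex_of_real)
  qed
  thus ?thesis by (simp add: power2_eq_iff_nonneg)
qed

lemma sn_expand: "(sn (x + sc c y))\<^sup>2 = (sn x)\<^sup>2 + 2 * Re (c * ip x y) + (cmod c)\<^sup>2 * (sn y)\<^sup>2"
proof -
  have "Re (ip (x + sc c y) (x + sc c y)) = Re (ip x x) + Re (ip x (sc c y)) + Re (ip (sc c y) x) + Re (ip (sc c y) (sc c y))"
    by (simp add: ip_add ip_add_left)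
  moreover have "Re (ip (sc c y) x) = Re (ip x (sc c y))"
    by (subst ip_comm) simp
  moreover have "Re (ip (sc c y) (sc c y)) = (cmod c)\<^sup>2 * (sn y)\<^sup>2"
    by (simp add: sn_sq[symmetric] sn_sc power_mult_distrib)
  ultimately show ?thesis by (simp add: sn_sq ip_sc)
qed

lemma cauchy_schwarz: "cmod (ip x y) \<le> sn x * sn y"
proof -
  define a where "a = ip x y"
  have *: "0 \<le> (sn x)\<^sup>2 - 2 * t * (cmod a)\<^sup>2 + t\<^sup>2 * (cmod a)\<^sup>2 * (sn y)\<^sup>2" for t :: real
  proof -
    have "Re (- complex_of_real t * cnj a * a) = - t * (cmod a)\<^sup>2"
      by (metis (no_types, opaque_lifting) Re_complex_of_real complex_norm_square minus_mult_left mult.assoc mult.commute of_real_minus of_real_mult)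
    moreover have "0 \<le> (sn (x + sc (- complex_of_real t * cnj a) y))\<^sup>2" by simp
    ultimately show ?thesis
      unfolding sn_expand a_def[symmetric] by (simp add: norm_mult power_mult_distrib)
  qed
  show ?thesis
  proof (cases "sn y = 0")
    case True
    have "a = 0"
    proof (rule ccontr)
      assume "a \<noteq> 0"
      hence "(cmod a)\<^sup>2 > 0" by simp
      with *[of "((sn x)\<^sup>2 + 1) / (2 * (cmod a)\<^sup>2)"] True show False by (simp add: field_simps)
    qed
    thus ?thesis by (simp add: a_def[symmetric])
  next
    case False
    hence p: "(sn y)\<^sup>2 > 0" by simp
    define S where "S = (sn y)\<^sup>2"
    have S: "S > 0" using p by (simp add: S_def)
    have "(1 / S)\<^sup>2 * (cmod a)\<^sup>2 * S = (cmod a)\<^sup>2 / S" using S by (simp add: power2_eq_square)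
    with *[of "1 / S"] have "0 \<le> (sn x)\<^sup>2 - (cmod a)\<^sup>2 / (sn y)\<^sup>2"
      unfolding S_def[symmetric] by simp
    hence "(cmod a)\<^sup>2 \<le> (sn x * sn y)\<^sup>2" using p by (simp add: field_simps power_mult_distrib)
    thus ?thesis unfolding a_def by (rule power2_le_imp_le) simp
  qed
qed

lemma sn_triangle: "sn (x + y) \<le> sn x + sn y"
proof (rule power2_le_imp_le)
  have "Re (ip y x) = Re (ip x y)" by (subst ip_comm) simp
  hence "(sn (x + y))\<^sup>2 = (sn x)\<^sup>2 + 2 * Re (ip x y) + (sn y)\<^sup>2"
    by (simp add: sn_sq ip_add ip_add_left)
  also have "\<dots> \<le> (sn x)\<^sup>2 + 2 * (sn x * sn y) + (sn y)\<^sup>2"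
    using cauchy_schwarz[of x y] complex_Re_le_cmod[of "ip x y"] by simp
  finally show "(sn (x + y))\<^sup>2 \<le> (sn x + sn y)\<^sup>2" by (simp add: power2_sum)
qed simp

lemma sn_uminus: "sn (- x) = sn x"
  using sn_sc[of "-1" x] by (simp add: sc_minus)

lemma sn_minus_commute: "sn (x - y) = sn (y - x)"
  by (metis sn_uminus minus_diff_eq)

lemma sn_0 [simp]: "sn 0 = 0" by (simp add: sn_def)

lemma sn_diff3: "sn (x - z) \<le> sn (x - y) + sn (y - z)"
  using sn_triangle[of "x - y" "y - z"] by simp

lemma sn_abs: "\<bar>sn x - sn y\<bar> \<le> sn (x - y)"
  using sn_triangle[of "x - y" y] sn_triangle[of "y - x" x] sn_minus_commute[of x y] by simp

definition "scauchy X \<longleftrightarrow> (\<forall>e>0. \<exists>N. \<forall>m\<ge>N. \<forall>n\<ge>N. sn (X m - X n) < e)" for X :: "nat \<Rightarrow> 'v"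

lemma scauchy_bounded: assumes "scauchy X" shows "\<exists>B. \<forall>n. sn (X n) \<le> B"
proof -
  have "Cauchy (\<lambda>n. sn (X n))"
    using assms unfolding Cauchy_def scauchy_def dist_real_def
    by (meson sn_abs le_less_trans)
  hence "Bseq (\<lambda>n. sn (X n))" by (rule Cauchy_Bseq)
  then obtain K where "\<And>n. norm (sn (X n)) \<le> K" unfolding Bseq_def by blast
  hence "\<forall>n. sn (X n) \<le> K" by simp
  thus ?thesis by blast
qed

lemma scauchy_ip: assumes "scauchy X" "scauchy Y" shows "convergent (\<lambda>n. ip (X n) (Y n))"
proof -
  obtain A where A: "\<And>n. sn (X n) \<le> A" using scauchy_bounded[OF assms(1)] by blast
  obtain B where B: "\<And>n. sn (Y n) \<le> B" using scauchy_bounded[OF assms(2)] by blast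
  define C where "C = max A B + 1"
  have C: "C > 0" "\<And>n. sn (X n) \<le> C" "\<And>n. sn (Y n) \<le> C"
  proof -
    show "C > 0" using sn_nonneg[of "X 0"] A[of 0] unfolding C_def by linarith
    show "sn (X n) \<le> C" "sn (Y n) \<le> C" for n using A[of n] B[of n] unfolding C_def by linarith+
  qed
  have "Cauchy (\<lambda>n. ip (X n) (Y n))"
  proof (rule metric_CauchyI)
    fix e :: real assume "e > 0"
    hence e: "e / (2 * C) > 0" using C by simp
    obtain N1 where N1: "\<And>m n. m \<ge> N1 \<Longrightarrow> n \<ge> N1 \<Longrightarrow> sn (X m - X n) < e / (2 * C)"
      using assms(1) e unfolding scauchy_def by metis
    obtain N2 where N2: "\<And>m n. m \<ge> N2 \<Longrightarrow> n \<ge> N2 \<Longrightarrow> sn (Y m - Y n) < e / (2 * C)"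
      using assms(2) e unfolding scauchy_def by metis
    show "\<exists>M. \<forall>m\<ge>M. \<forall>n\<ge>M. dist (ip (X m) (Y m)) (ip (X n) (Y n)) < e"
    proof (intro exI[of _ "max N1 N2"] allI impI)
      fix m n assume mn: "max N1 N2 \<le> m" "max N1 N2 \<le> n"
      have "ip (X m) (Y m) - ip (X n) (Y n) = ip (X m) (Y m - Y n) + ip (X m - X n) (Y n)"
        by (simp add: ip_diff ip_diff_left)
      hence "cmod (ip (X m) (Y m) - ip (X n) (Y n)) \<le> cmod (ip (X m) (Y m - Y n)) + cmod (ip (X m - X n) (Y n))"
        by (metis norm_triangle_ineq)
      also have "\<dots> \<le> sn (X m) * sn (Y m - Y n) + sn (X m - X n) * sn (Y n)"
        by (intro add_mono cauchy_schwarz)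
      also have "\<dots> \<le> C * sn (Y m - Y n) + sn (X m - X n) * C"
        by (intro add_mono mult_right_mono mult_left_mono C) simp_all
      also have "\<dots> < C * (e / (2 * C)) + (e / (2 * C)) * C"
        using N1[of m n] N2[of m n] mn C by (intro add_strict_mono mult_strict_left_mono mult_strict_right_mono) auto
      also have "\<dots> = e" using C by (simp add: field_simps)
      finally show "dist (ip (X m) (Y m)) (ip (X n) (Y n)) < e" by (simp add: dist_norm)
    qed
  qed
  thus ?thesis by (rule Cauchy_convergent)
qed

lemma scauchy_add: assumes "scauchy X" "scauchy Y" shows "scauchy (\<lambda>n. X n + Y n)"
  unfolding scauchy_def
proof (intro allI impI)
  fix e :: real assume "e > 0"
  hence e: "e / 2 > 0" by simp
  obtain N1 where N1: "\<And>m n. m \<ge> N1 \<Longrightarrow> n \<ge> N1 \<Longrightarrow> sn (X m - X n) < e / 2"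
    using assms(1) e unfolding scauchy_def by metis
  obtain N2 where N2: "\<And>m n. m \<ge> N2 \<Longrightarrow> n \<ge> N2 \<Longrightarrow> sn (Y m - Y n) < e / 2"
    using assms(2) e unfolding scauchy_def by metis
  show "\<exists>N. \<forall>m\<ge>N. \<forall>n\<ge>N. sn (X m + Y m - (X n + Y n)) < e"
  proof (intro exI[of _ "max N1 N2"] allI impI)
    fix m n assume mn: "max N1 N2 \<le> m" "max N1 N2 \<le> n"
    have "sn (X m + Y m - (X n + Y n)) \<le> sn (X m - X n) + sn (Y m - Y n)"
      using sn_triangle[of "X m - X n" "Y m - Y n"] by (simp add: algebra_simps)
    thus "sn (X m + Y m - (X n + Y n)) < e" using N1[of m n] N2[of m n] mn by auto
  qed
qed

end

locale semi_inner_vs = semi_inner sc ip for sc :: "complex \<Rightarrow> 'v::ab_group_add \<Rightarrow> 'v" and ip +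
  assumes sc_add_right: "sc c (x + y) = sc c x + sc c y"
    and sc_add_left: "sc (c + d) x = sc c x + sc d x"
    and sc_sc: "sc c (sc d x) = sc (c * d) x"
    and sc_one: "sc 1 x = x"
begin

lemma sc_diff: "sc c (x - y) = sc c x - sc c y"
  using sc_add_right[of c "x - y" y] by (simp add: algebra_simps)

lemma scauchy_sc: assumes "scauchy X" shows "scauchy (\<lambda>n. sc c (X n))"
  unfolding scauchy_def
proof (intro allI impI)
  fix e :: real assume "e > 0"
  hence "e / (cmod c + 1) > 0" by (simp add: add_nonneg_pos)
  then obtain N where N: "\<And>m n. m \<ge> N \<Longrightarrow> n \<ge> N \<Longrightarrow> sn (X m - X n) < e / (cmod c + 1)"
    using assms unfolding scauchy_def by metis
  show "\<exists>N. \<forall>m\<ge>N. \<forall>n\<ge>N. sn (sc c (X m) - sc c (X n)) < e"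
  proof (intro exI[of _ N] allI impI)
    fix m n assume mn: "N \<le> m" "N \<le> n"
    have "sn (sc c (X m) - sc c (X n)) = cmod c * sn (X m - X n)"
      by (simp add: sc_diff[symmetric] sn_sc)
    also have "\<dots> \<le> (cmod c + 1) * sn (X m - X n)" by (simp add: mult_right_mono)
    also have "\<dots> < e" using N[OF mn] by (simp add: pos_less_divide_eq add_nonneg_pos mult.commute)
    finally show "sn (sc c (X m) - sc c (X n)) < e" .
  qed
qed

end

subsection \<open>Hilbert space completion of a set with a positive semidefinite kernel\<close>

lemma tendsto_0_le: "f \<longlonglongrightarrow> 0" if "g \<longlonglongrightarrow> 0 + 0" "\<And>n. f n \<le> g n" "\<And>n. 0 \<le> f n" for f g :: "nat \<Rightarrow> real"
  by (rule tendsto_sandwich[of "\<lambda>_. 0" f _ g]) (use that in simp_all)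

class pdkernel =
  fixes kern :: "'a \<Rightarrow> 'a \<Rightarrow> complex"
  assumes kern_commute: "kern y x = cnj (kern x y)"
    and kern_pos: "finite S \<Longrightarrow> 0 \<le> Re (\<Sum>x\<in>S. \<Sum>y\<in>S. cnj (c x) * c y * kern x y)"

definition pscale :: "complex \<Rightarrow> ('a \<Rightarrow>\<^sub>0 complex) \<Rightarrow> ('a \<Rightarrow>\<^sub>0 complex)"
  where "pscale c p = Poly_Mapping.map ((*) c) p"

definition pform :: "('a::pdkernel \<Rightarrow>\<^sub>0 complex) \<Rightarrow> ('a \<Rightarrow>\<^sub>0 complex) \<Rightarrow> complex"
  where "pform p q = (\<Sum>x\<in>Poly_Mapping.keys p. \<Sum>y\<in>Poly_Mapping.keys q.
      cnj (Poly_Mapping.lookup p x) * Poly_Mapping.lookup q y * kern x y)"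

lemma lookup_pscale [simp]: "Poly_Mapping.lookup (pscale c p) x = c * Poly_Mapping.lookup p x"
  by (simp add: pscale_def Poly_Mapping.map.rep_eq when_def)

lemma pform_superset:
  assumes "finite A" "Poly_Mapping.keys p \<subseteq> A" "finite B" "Poly_Mapping.keys q \<subseteq> B"
  shows "pform p q = (\<Sum>x\<in>A. \<Sum>y\<in>B. cnj (Poly_Mapping.lookup p x) * Poly_Mapping.lookup q y * kern x y)"
proof -
  have "pform p q = (\<Sum>x\<in>A. \<Sum>y\<in>Poly_Mapping.keys q.
      cnj (Poly_Mapping.lookup p x) * Poly_Mapping.lookup q y * kern x y)"
    unfolding pform_def using assms by (intro sum.mono_neutral_left) (auto simp: in_keys_iff)
  also have "\<dots> = (\<Sum>x\<in>A. \<Sum>y\<in>B. cnj (Poly_Mapping.lookup p x) * Poly_Mapping.lookup q y * kern x y)"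
    using assms by (intro sum.cong refl sum.mono_neutral_left) (auto simp: in_keys_iff)
  finally show ?thesis .
qed

lemma keys_pscale: "Poly_Mapping.keys (pscale c p) \<subseteq> Poly_Mapping.keys p"
  by (auto simp: in_keys_iff)

global_interpretation pf: semi_inner_vs pscale "pform :: ('a::pdkernel \<Rightarrow>\<^sub>0 complex) \<Rightarrow> _"
proof
  fix p q r :: "'a \<Rightarrow>\<^sub>0 complex" and c d :: complex
  show "pscale (-1) p = - p" "pscale c (p + q) = pscale c p + pscale c q"
    "pscale (c + d) p = pscale c p + pscale d p" "pscale c (pscale d p) = pscale (c * d) p" "pscale 1 p = p"
    by (auto intro!: poly_mapping_eqI simp: lookup_add algebra_simps)
  show "pform q p = cnj (pform p q)"
    unfolding pform_def by (subst sum.swap) (auto simp: kern_commute[symmetric] mult_ac intro!: sum.cong)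
  show "pform p (q + r) = pform p q + pform p r"
    by (subst (1 2 3) pform_superset[where A = "Poly_Mapping.keys p" and B = "Poly_Mapping.keys q \<union> Poly_Mapping.keys r"])
      (auto simp: lookup_add algebra_simps sum.distrib dest: set_mp[OF Poly_Mapping.keys_add])
  show "pform p (pscale c q) = c * pform p q"
    by (subst pform_superset[where A = "Poly_Mapping.keys p" and B = "Poly_Mapping.keys q"])
      (auto simp: keys_pscale pform_def sum_distrib_left mult_ac intro!: sum.cong dest: set_mp[OF keys_pscale])
  show "0 \<le> Re (pform p p)"
    unfolding pform_def by (rule kern_pos) simp
qed

lemma pform_single [simp]: "pform (Poly_Mapping.single x a) (Poly_Mapping.single y b) = cnj a * b * kern x y"
  by (subst pform_superset[where A = "{x}" and B = "{y}"]) auto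

definition hrel :: "(nat \<Rightarrow> ('a::pdkernel \<Rightarrow>\<^sub>0 complex)) \<Rightarrow> (nat \<Rightarrow> ('a \<Rightarrow>\<^sub>0 complex)) \<Rightarrow> bool"
  where "hrel X Y \<longleftrightarrow> pf.scauchy X \<and> pf.scauchy Y \<and> (\<lambda>n. pf.sn (X n - Y n)) \<longlonglongrightarrow> 0"

lemma part_equivp_hrel: "part_equivp hrel"
proof (rule part_equivpI)
  show "\<exists>x. hrel x (x :: nat \<Rightarrow> ('a \<Rightarrow>\<^sub>0 complex))"
    by (intro exI[of _ "\<lambda>_. 0"]) (auto simp: hrel_def pf.scauchy_def)
  show "symp (hrel :: (nat \<Rightarrow> ('a \<Rightarrow>\<^sub>0 complex)) \<Rightarrow> _)"
  proof (rule sympI)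
    fix X Y :: "nat \<Rightarrow> ('a \<Rightarrow>\<^sub>0 complex)" assume "hrel X Y"
    moreover have "(\<lambda>n. pf.sn (Y n - X n)) = (\<lambda>n. pf.sn (X n - Y n))" by (rule ext) (rule pf.sn_minus_commute)
    ultimately show "hrel Y X" unfolding hrel_def by simp
  qed
  show "transp (hrel :: (nat \<Rightarrow> ('a \<Rightarrow>\<^sub>0 complex)) \<Rightarrow> _)"
  proof (rule transpI)
    fix X Y Z :: "nat \<Rightarrow> ('a \<Rightarrow>\<^sub>0 complex)"
    assume a: "hrel X Y" "hrel Y Z"
    have "(\<lambda>n. pf.sn (X n - Y n) + pf.sn (Y n - Z n)) \<longlonglongrightarrow> 0 + 0"
      using a by (intro tendsto_add) (auto simp: hrel_def)
    hence "(\<lambda>n. pf.sn (X n - Z n)) \<longlonglongrightarrow> 0"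
      by (rule tendsto_0_le) (simp_all add: pf.sn_diff3)
    thus "hrel X Z" using a unfolding hrel_def by blast
  qed
qed

(* The Hausdorff completion of the free complex vector space over 'a with the sesquilinear form
   extending kern. With hgen :: 'a => 'a hcompl below, it is the Hilbert space generated by vectors
   hgen x subject to cinner (hgen x) (hgen y) = kern x y. *)
quotient_type (overloaded) 'a hcompl = "nat \<Rightarrow> ('a::pdkernel \<Rightarrow>\<^sub>0 complex)" / partial: hrel
  by (rule part_equivp_hrel)

lemma hcompl_rep: obtains X where "x = abs_hcompl X" "hrel X X"
  using Quotient_abs_rep[OF Quotient_hcompl, of x] Quotient_rep_reflp[OF Quotient_hcompl, of x] by metis

lemma hrel_ip:
  assumes "hrel X X'" "hrel Y Y'"
  shows "lim (\<lambda>n. pform (X n) (Y n)) = lim (\<lambda>n. pform (X' n) (Y' n))"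
proof -
  have c: "pf.scauchy X" "pf.scauchy Y" "pf.scauchy X'" "pf.scauchy Y'" using assms by (auto simp: hrel_def)
  obtain B where B: "\<And>n. pf.sn (X n) \<le> B" using pf.scauchy_bounded[OF c(1)] by blast
  obtain B' where B': "\<And>n. pf.sn (Y' n) \<le> B'" using pf.scauchy_bounded[OF c(4)] by blast
  have "(\<lambda>n. pform (X n) (Y n) - pform (X' n) (Y' n)) \<longlonglongrightarrow> 0"
  proof (rule Lim_null_comparison[of _ "\<lambda>n. B * pf.sn (Y n - Y' n) + pf.sn (X n - X' n) * B'"])
    show "\<forall>\<^sub>F n in sequentially. norm (pform (X n) (Y n) - pform (X' n) (Y' n)) \<le> B * pf.sn (Y n - Y' n) + pf.sn (X n - X' n) * B'"
    proof (rule always_eventually, rule allI)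
      fix n
      have "pform (X n) (Y n) - pform (X' n) (Y' n) = pform (X n) (Y n - Y' n) + pform (X n - X' n) (Y' n)"
        by (simp add: pf.ip_diff pf.ip_diff_left)
      hence "cmod (pform (X n) (Y n) - pform (X' n) (Y' n)) \<le> cmod (pform (X n) (Y n - Y' n)) + cmod (pform (X n - X' n) (Y' n))"
        by (metis norm_triangle_ineq)
      also have "\<dots> \<le> pf.sn (X n) * pf.sn (Y n - Y' n) + pf.sn (X n - X' n) * pf.sn (Y' n)"
        by (intro add_mono pf.cauchy_schwarz)
      also have "\<dots> \<le> B * pf.sn (Y n - Y' n) + pf.sn (X n - X' n) * B'"
        by (intro add_mono mult_right_mono mult_left_mono B B') simp_all
      finally show "norm (pform (X n) (Y n) - pform (X' n) (Y' n)) \<le> B * pf.sn (Y n - Y' n) + pf.sn (X n - X' n) * B'" .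
    qed
    have "(\<lambda>n. B * pf.sn (Y n - Y' n) + pf.sn (X n - X' n) * B') \<longlonglongrightarrow> B * 0 + 0 * B'"
      using assms by (intro tendsto_intros) (auto simp: hrel_def)
    thus "(\<lambda>n. B * pf.sn (Y n - Y' n) + pf.sn (X n - X' n) * B') \<longlonglongrightarrow> 0" by simp
  qed
  moreover have "(\<lambda>n. pform (X n) (Y n) - pform (X' n) (Y' n)) \<longlonglongrightarrow> lim (\<lambda>n. pform (X n) (Y n)) - lim (\<lambda>n. pform (X' n) (Y' n))"
    using pf.scauchy_ip[OF c(1,2)] pf.scauchy_ip[OF c(3,4)] by (intro tendsto_diff) (auto simp: convergent_LIMSEQ_iff)
  ultimately show ?thesis using LIMSEQ_unique by fastforce
qed

lift_definition hc_cinner :: "'a::pdkernel hcompl \<Rightarrow> 'a hcompl \<Rightarrow> complex"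
  is "\<lambda>X Y. lim (\<lambda>n. pform (X n) (Y n))"
  by (rule hrel_ip)

lift_definition hc_scaleC :: "complex \<Rightarrow> 'a::pdkernel hcompl \<Rightarrow> 'a hcompl"
  is "\<lambda>c X n. pscale c (X n)"
proof -
  fix c and X Y :: "nat \<Rightarrow> ('a \<Rightarrow>\<^sub>0 complex)"
  assume a: "hrel X Y"
  have "(\<lambda>n. cmod c * pf.sn (X n - Y n)) \<longlonglongrightarrow> cmod c * 0"
    using a by (intro tendsto_intros) (auto simp: hrel_def)
  thus "hrel (\<lambda>n. pscale c (X n)) (\<lambda>n. pscale c (Y n))"
    using a by (auto simp: hrel_def pf.scauchy_sc pf.sc_diff[symmetric] pf.sn_sc)
qed

instantiation hcompl :: (pdkernel) ab_group_add
begin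

lift_definition zero_hcompl :: "'a hcompl" is "\<lambda>_. 0"
  by (auto simp: hrel_def pf.scauchy_def)

lift_definition plus_hcompl :: "'a hcompl \<Rightarrow> 'a hcompl \<Rightarrow> 'a hcompl" is "\<lambda>X Y n. X n + Y n"
proof -
  fix X X' Y Y' :: "nat \<Rightarrow> ('a \<Rightarrow>\<^sub>0 complex)"
  assume a: "hrel X X'" "hrel Y Y'"
  have "(\<lambda>n. pf.sn (X n - X' n) + pf.sn (Y n - Y' n)) \<longlonglongrightarrow> 0 + 0"
    using a by (intro tendsto_add) (auto simp: hrel_def)
  moreover have "pf.sn (X n + Y n - (X' n + Y' n)) \<le> pf.sn (X n - X' n) + pf.sn (Y n - Y' n)" for n
    using pf.sn_triangle[of "X n - X' n" "Y n - Y' n"] by (simp add: algebra_simps)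
  ultimately have "(\<lambda>n. pf.sn (X n + Y n - (X' n + Y' n))) \<longlonglongrightarrow> 0"
    by (rule tendsto_0_le) simp_all
  thus "hrel (\<lambda>n. X n + Y n) (\<lambda>n. X' n + Y' n)"
    using a by (auto simp: hrel_def pf.scauchy_add)
qed

definition uminus_hcompl :: "'a hcompl \<Rightarrow> 'a hcompl" where "uminus_hcompl x = hc_scaleC (-1) x"
definition minus_hcompl :: "'a hcompl \<Rightarrow> 'a hcompl \<Rightarrow> 'a hcompl" where "minus_hcompl x y = x + - y"

lemma hrel_refl: "pf.scauchy X \<Longrightarrow> hrel X X" by (simp add: hrel_def)
lemma hrel_scauchy: "hrel X Y \<Longrightarrow> pf.scauchy X" by (simp add: hrel_def)

instance
proof
  fix x y z :: "'a hcompl"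
  show "x + y + z = x + (y + z)"
    by transfer (auto intro!: hrel_refl pf.scauchy_add simp: add.assoc hrel_scauchy)
  show "x + y = y + x"
    by transfer (auto intro!: hrel_refl pf.scauchy_add simp: add.commute hrel_scauchy)
  show "0 + x = x" by transfer (auto intro!: hrel_refl simp: hrel_scauchy)
  show "- x + x = 0" unfolding uminus_hcompl_def
    by transfer (auto simp: hrel_def pf.scauchy_def pf.sc_minus)
  show "x - y = x + - y" by (simp add: minus_hcompl_def)
qed

end

global_interpretation hc: semi_inner_vs "hc_scaleC" "hc_cinner :: 'a::pdkernel hcompl \<Rightarrow> _"
proof
  fix x y z :: "'a hcompl" and c d :: complex
  show "hc_scaleC (-1) x = - x" by (simp add: uminus_hcompl_def)
  show "hc_cinner y x = cnj (hc_cinner x y)"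
  proof (transfer)
    fix X Y :: "nat \<Rightarrow> ('a \<Rightarrow>\<^sub>0 complex)" assume "hrel Y Y" "hrel X X"
    hence "(\<lambda>n. pform (X n) (Y n)) \<longlonglongrightarrow> lim (\<lambda>n. pform (X n) (Y n))"
      using pf.scauchy_ip by (auto simp: convergent_LIMSEQ_iff[symmetric] hrel_def)
    hence "(\<lambda>n. cnj (pform (X n) (Y n))) \<longlonglongrightarrow> cnj (lim (\<lambda>n. pform (X n) (Y n)))" by (rule tendsto_cnj)
    thus "lim (\<lambda>n. pform (Y n) (X n)) = cnj (lim (\<lambda>n. pform (X n) (Y n)))"
      by (simp add: pf.ip_comm[symmetric] limI)
  qed
  show "hc_cinner x (y + z) = hc_cinner x y + hc_cinner x z"
  proof (transfer)
    fix X Y Z :: "nat \<Rightarrow> ('a \<Rightarrow>\<^sub>0 complex)" assume "hrel X X" "hrel Y Y" "hrel Z Z"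
    hence "(\<lambda>n. pform (X n) (Y n) + pform (X n) (Z n)) \<longlonglongrightarrow> lim (\<lambda>n. pform (X n) (Y n)) + lim (\<lambda>n. pform (X n) (Z n))"
      using pf.scauchy_ip by (intro tendsto_add) (auto simp: convergent_LIMSEQ_iff[symmetric] hrel_def)
    thus "lim (\<lambda>n. pform (X n) (Y n + Z n)) = lim (\<lambda>n. pform (X n) (Y n)) + lim (\<lambda>n. pform (X n) (Z n))"
      by (simp add: pf.ip_add limI)
  qed
  show "hc_cinner x (hc_scaleC c y) = c * hc_cinner x y"
  proof (transfer)
    fix X Y :: "nat \<Rightarrow> ('a \<Rightarrow>\<^sub>0 complex)" and c :: complex assume "hrel X X" "hrel Y Y"
    hence "(\<lambda>n. c * pform (X n) (Y n)) \<longlonglongrightarrow> c * lim (\<lambda>n. pform (X n) (Y n))"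
      using pf.scauchy_ip by (intro tendsto_mult tendsto_const) (auto simp: convergent_LIMSEQ_iff[symmetric] hrel_def)
    thus "lim (\<lambda>n. pform (X n) (pscale c (Y n))) = c * lim (\<lambda>n. pform (X n) (Y n))"
      by (simp add: pf.ip_sc limI)
  qed
  show "0 \<le> Re (hc_cinner x x)"
  proof (transfer)
    fix X :: "nat \<Rightarrow> ('a \<Rightarrow>\<^sub>0 complex)" assume "hrel X X"
    hence "(\<lambda>n. Re (pform (X n) (X n))) \<longlonglongrightarrow> Re (lim (\<lambda>n. pform (X n) (X n)))"
      using pf.scauchy_ip by (intro tendsto_Re) (auto simp: convergent_LIMSEQ_iff[symmetric] hrel_def)
    thus "0 \<le> Re (lim (\<lambda>n. pform (X n) (X n)))" by (rule LIMSEQ_le_const) (auto simp: pf.ip_pos)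
  qed
  show "hc_scaleC c (x + y) = hc_scaleC c x + hc_scaleC c y"
    by transfer (auto intro!: hrel_refl pf.scauchy_add pf.scauchy_sc simp: pf.sc_add_right hrel_scauchy)
  show "hc_scaleC (c + d) x = hc_scaleC c x + hc_scaleC d x"
    by transfer (auto intro!: hrel_refl pf.scauchy_add pf.scauchy_sc simp: pf.sc_add_left hrel_scauchy)
  show "hc_scaleC c (hc_scaleC d x) = hc_scaleC (c * d) x"
    by transfer (auto intro!: hrel_refl pf.scauchy_add pf.scauchy_sc simp: pf.sc_sc hrel_scauchy)
  show "hc_scaleC 1 x = x"
    by transfer (auto intro!: hrel_refl simp: pf.sc_one hrel_scauchy)
qed

lemma hc_sn_lim:
  assumes "pf.scauchy X"
  shows "(\<lambda>n. pf.sn (X n)) \<longlonglongrightarrow> hc.sn (abs_hcompl X)"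
proof -
  have "(\<lambda>n. pform (X n) (X n)) \<longlonglongrightarrow> hc_cinner (abs_hcompl X) (abs_hcompl X)"
    using assms pf.scauchy_ip by (simp add: hc_cinner.abs_eq hrel_refl convergent_LIMSEQ_iff[symmetric])
  thus ?thesis unfolding pf.sn_def hc.sn_def by (intro tendsto_intros)
qed

lemma hc_sn_eq_0: assumes "hc.sn x = 0" shows "x = 0"
proof -
  obtain X where X: "x = abs_hcompl X" "hrel X X"
    by (rule hcompl_rep)
  have "hrel X (\<lambda>_. 0)"
    using X hc_sn_lim[of X] assms by (auto simp: hrel_def pf.scauchy_def)
  thus ?thesis unfolding X zero_hcompl.abs_eq using Quotient_rel_abs[OF Quotient_hcompl] by blast
qed

instantiation hcompl :: (pdkernel) real_normed_vector
begin

definition scaleR_hcompl :: "real \<Rightarrow> 'a hcompl \<Rightarrow> 'a hcompl" where "scaleR_hcompl r x = hc_scaleC (complex_of_real r) x"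
definition norm_hcompl :: "'a hcompl \<Rightarrow> real" where "norm_hcompl x = sqrt (Re (hc_cinner x x))"
definition dist_hcompl :: "'a hcompl \<Rightarrow> 'a hcompl \<Rightarrow> real" where "dist_hcompl x y = norm (x - y)"
definition sgn_hcompl :: "'a hcompl \<Rightarrow> 'a hcompl" where "sgn_hcompl x = inverse (norm x) *\<^sub>R x"
definition uniformity_hcompl :: "('a hcompl \<times> 'a hcompl) filter"
  where "uniformity_hcompl = (INF e\<in>{0 <..}. principal {(x, y). dist x y < e})"
definition open_hcompl :: "'a hcompl set \<Rightarrow> bool"
  where "open_hcompl U = (\<forall>x\<in>U. eventually (\<lambda>(x', y). x' = x \<longrightarrow> y \<in> U) uniformity)"

lemma norm_hcompl_sn: "norm x = hc.sn x" by (simp add: norm_hcompl_def hc.sn_def)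

instance
proof
  fix x y :: "'a hcompl" and a b :: real and U :: "'a hcompl set"
  show "a *\<^sub>R (x + y) = a *\<^sub>R x + a *\<^sub>R y" by (simp add: scaleR_hcompl_def hc.sc_add_right)
  show "(a + b) *\<^sub>R x = a *\<^sub>R x + b *\<^sub>R x" by (simp add: scaleR_hcompl_def hc.sc_add_left)
  show "a *\<^sub>R b *\<^sub>R x = (a * b) *\<^sub>R x" by (simp add: scaleR_hcompl_def hc.sc_sc)
  show "1 *\<^sub>R x = x" by (simp add: scaleR_hcompl_def hc.sc_one)
  show "dist x y = norm (x - y)" by (simp add: dist_hcompl_def)
  show "sgn x = inverse (norm x) *\<^sub>R x" by (simp add: sgn_hcompl_def)
  show "uniformity = (INF e\<in>{0 <..}. principal {(x, y). dist x (y::'a hcompl) < e})" by (simp add: uniformity_hcompl_def)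
  show "open U = (\<forall>x\<in>U. \<forall>\<^sub>F (x', y) in uniformity. x' = x \<longrightarrow> y \<in> U)" by (simp add: open_hcompl_def)
  show "(norm x = 0) = (x = 0)" using hc_sn_eq_0[of x] by (auto simp: norm_hcompl_sn)
  show "norm (x + y) \<le> norm x + norm y" by (simp add: norm_hcompl_sn hc.sn_triangle)
  show "norm (a *\<^sub>R x) = \<bar>a\<bar> * norm x" by (simp add: norm_hcompl_sn scaleR_hcompl_def hc.sn_sc)
qed

end

lemma hc_const_dist: "dist (abs_hcompl (\<lambda>_. p)) (abs_hcompl (\<lambda>_. q)) = pf.sn (p - q)"
proof -
  have s: "pf.scauchy (\<lambda>_. p)" for p by (simp add: pf.scauchy_def)
  have "abs_hcompl (\<lambda>_. p) - abs_hcompl (\<lambda>_. q) = abs_hcompl (\<lambda>_. p - q)"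
    unfolding minus_hcompl_def uminus_hcompl_def
    by (simp add: hc_scaleC.abs_eq plus_hcompl.abs_eq hrel_refl s pf.sc_minus)
  moreover have "hc.sn (abs_hcompl (\<lambda>_. p - q)) = pf.sn (p - q)"
    by (rule LIMSEQ_unique[OF hc_sn_lim[OF s] tendsto_const])
  ultimately show ?thesis by (simp add: dist_norm norm_hcompl_sn)
qed

lemma hc_const_lim:
  assumes "pf.scauchy X" shows "(\<lambda>n. abs_hcompl (\<lambda>_. X n)) \<longlonglongrightarrow> abs_hcompl X"
proof (rule metric_LIMSEQ_I)
  fix e :: real assume "0 < e"
  then obtain N where N: "\<And>m n. m \<ge> N \<Longrightarrow> n \<ge> N \<Longrightarrow> pf.sn (X m - X n) < e / 2"
    using assms unfolding pf.scauchy_def by (meson half_gt_zero)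
  show "\<exists>N. \<forall>n\<ge>N. dist (abs_hcompl (\<lambda>_. X n)) (abs_hcompl X) < e"
  proof (intro exI[of _ N] allI impI)
    fix n assume n: "N \<le> n"
    have s: "pf.scauchy (\<lambda>_. p)" for p by (simp add: pf.scauchy_def)
    have e: "pf.sn (X n - X m) = pf.sn (X n + pscale (-1) (X m))" for m by (simp add: pf.sc_minus)
    have "abs_hcompl (\<lambda>_. X n) - abs_hcompl X = abs_hcompl (\<lambda>m. X n + pscale (-1) (X m))"
      unfolding minus_hcompl_def uminus_hcompl_def
      by (simp add: hc_scaleC.abs_eq plus_hcompl.abs_eq hrel_refl s assms pf.scauchy_sc)
    moreover have "(\<lambda>m. pf.sn (X n - X m)) \<longlonglongrightarrow> hc.sn (abs_hcompl (\<lambda>m. X n + pscale (-1) (X m)))"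
      unfolding e by (intro hc_sn_lim pf.scauchy_add s pf.scauchy_sc assms)
    ultimately have "(\<lambda>m. pf.sn (X n - X m)) \<longlonglongrightarrow> dist (abs_hcompl (\<lambda>_. X n)) (abs_hcompl X)"
      by (simp add: dist_norm norm_hcompl_sn)
    hence "dist (abs_hcompl (\<lambda>_. X n)) (abs_hcompl X) \<le> e / 2"
      by (rule LIMSEQ_le_const2) (use N n in \<open>auto intro!: exI[of _ N] less_imp_le\<close>)
    thus "dist (abs_hcompl (\<lambda>_. X n)) (abs_hcompl X) < e" using \<open>0 < e\<close> by simp
  qed
qed

instantiation hcompl :: (pdkernel) chilbert_space
begin

definition scaleC_hcompl :: "complex \<Rightarrow> 'a hcompl \<Rightarrow> 'a hcompl" where "scaleC_hcompl = hc_scaleC"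
definition cinner_hcompl :: "'a hcompl \<Rightarrow> 'a hcompl \<Rightarrow> complex" where "cinner_hcompl = hc_cinner"

instance
proof
  fix x y z :: "'a hcompl" and c d :: complex and r :: real
  show "c *\<^sub>C (x + y) = c *\<^sub>C x + c *\<^sub>C y" by (simp add: scaleC_hcompl_def hc.sc_add_right)
  show "(c + d) *\<^sub>C x = c *\<^sub>C x + d *\<^sub>C x" by (simp add: scaleC_hcompl_def hc.sc_add_left)
  show "c *\<^sub>C d *\<^sub>C x = (c * d) *\<^sub>C x" by (simp add: scaleC_hcompl_def hc.sc_sc)
  show "r *\<^sub>R x = complex_of_real r *\<^sub>C x" by (simp add: scaleC_hcompl_def scaleR_hcompl_def)
  show "cinner y x = cnj (cinner x y)" unfolding cinner_hcompl_def by (rule hc.ip_comm)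
  show "cinner x (y + z) = cinner x y + cinner x z" by (simp add: cinner_hcompl_def hc.ip_add)
  show "cinner x (c *\<^sub>C y) = c * cinner x y" by (simp add: cinner_hcompl_def scaleC_hcompl_def hc.ip_sc)
  show "cinner x x = complex_of_real ((norm x)\<^sup>2)" by (simp add: cinner_hcompl_def norm_hcompl_sn hc.ip_self)
next
  fix \<xi> :: "nat \<Rightarrow> 'a hcompl" assume C: "Cauchy \<xi>"
  have "\<exists>p. dist (\<xi> m) (abs_hcompl (\<lambda>_. p)) < 1 / real (Suc m)" for m
  proof -
    obtain X where X: "\<xi> m = abs_hcompl X" "hrel X X"
      by (rule hcompl_rep)
    have "(\<lambda>n. abs_hcompl (\<lambda>_. X n)) \<longlonglongrightarrow> \<xi> m" using hc_const_lim[of X] X by (simp add: hrel_def)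
    hence "\<exists>n. dist (abs_hcompl (\<lambda>_. X n)) (\<xi> m) < 1 / real (Suc m)"
      using metric_LIMSEQ_D[of _ "\<xi> m" "1 / real (Suc m)"] by fastforce
    thus ?thesis by (auto simp: dist_commute)
  qed
  then obtain p where p: "\<And>m. dist (\<xi> m) (abs_hcompl (\<lambda>_. p m)) < 1 / real (Suc m)" by metis
  have d: "(\<lambda>m. dist (\<xi> m) (abs_hcompl (\<lambda>_. p m))) \<longlonglongrightarrow> 0"
    by (rule tendsto_sandwich[OF _ _ tendsto_const LIMSEQ_inverse_real_of_nat])
      (use p in \<open>auto simp: inverse_eq_divide less_imp_le\<close>)
  have "pf.scauchy p"
    unfolding pf.scauchy_def
  proof (intro allI impI)
    fix e :: real assume e: "0 < e"
    obtain N1 where N1: "\<And>m n. m \<ge> N1 \<Longrightarrow> n \<ge> N1 \<Longrightarrow> dist (\<xi> m) (\<xi> n) < e / 3"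
      using metric_CauchyD[OF C, of "e / 3"] e by auto
    obtain N2 where N2: "\<And>m. m \<ge> N2 \<Longrightarrow> dist (\<xi> m) (abs_hcompl (\<lambda>_. p m)) < e / 3"
      using metric_LIMSEQ_D[OF d, of "e / 3"] e by auto
    show "\<exists>N. \<forall>m\<ge>N. \<forall>n\<ge>N. pf.sn (p m - p n) < e"
    proof (intro exI[of _ "max N1 N2"] allI impI)
      fix m n assume mn: "max N1 N2 \<le> m" "max N1 N2 \<le> n"
      have "dist (abs_hcompl (\<lambda>_. p m)) (abs_hcompl (\<lambda>_. p n)) < e"
        using N1[of m n] N2[of m] N2[of n] mn
          dist_triangle[of "abs_hcompl (\<lambda>_. p m)" "abs_hcompl (\<lambda>_. p n)" "\<xi> m"]
          dist_triangle[of "\<xi> m" "abs_hcompl (\<lambda>_. p n)" "\<xi> n"]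
        by (auto simp: dist_commute)
      thus "pf.sn (p m - p n) < e" by (simp add: hc_const_dist)
    qed
  qed
  hence "(\<lambda>n. abs_hcompl (\<lambda>_. p n)) \<longlonglongrightarrow> abs_hcompl p" by (rule hc_const_lim)
  hence "(\<lambda>n. dist (abs_hcompl (\<lambda>_. p n)) (abs_hcompl p)) \<longlonglongrightarrow> 0" by (simp add: tendsto_dist_iff[symmetric])
  hence "(\<lambda>n. dist (\<xi> n) (abs_hcompl (\<lambda>_. p n)) + dist (abs_hcompl (\<lambda>_. p n)) (abs_hcompl p)) \<longlonglongrightarrow> 0 + 0"
    using d by (intro tendsto_add)
  hence "(\<lambda>n. dist (\<xi> n) (abs_hcompl p)) \<longlonglongrightarrow> 0"
    by (rule tendsto_0_le) (simp_all add: dist_triangle)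
  hence "\<xi> \<longlonglongrightarrow> abs_hcompl p" by (subst tendsto_dist_iff)
  thus "convergent \<xi>" by (auto simp: convergent_def)
qed

end

lift_definition hgen :: "'a::pdkernel \<Rightarrow> 'a hcompl" is "\<lambda>x _. Poly_Mapping.single x 1"
  by (simp add: hrel_def pf.scauchy_def)

lemma cinner_hgen: "cinner (hgen x) (hgen y) = kern x y"
  unfolding cinner_hcompl_def by transfer simp

instantiation complex :: chilbert_space
begin
definition scaleC_complex :: "complex \<Rightarrow> complex \<Rightarrow> complex" where "scaleC_complex = (*)"
definition cinner_complex :: "complex \<Rightarrow> complex \<Rightarrow> complex" where "cinner_complex x y = cnj x * y"
instance
proof
  fix x y z c d :: complex and r :: real
  show "c *\<^sub>C (x + y) = c *\<^sub>C x + c *\<^sub>C y" "(c + d) *\<^sub>C x = c *\<^sub>C x + d *\<^sub>C x"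
    "c *\<^sub>C d *\<^sub>C x = (c * d) *\<^sub>C x"
    by (simp_all add: scaleC_complex_def algebra_simps)
  show "r *\<^sub>R x = complex_of_real r *\<^sub>C x" by (simp add: scaleC_complex_def scaleR_conv_of_real)
  show "cinner y x = cnj (cinner x y)" by (simp add: cinner_complex_def mult.commute)
  show "cinner x (y + z) = cinner x y + cinner x z" by (simp add: cinner_complex_def distrib_left)
  show "cinner x (c *\<^sub>C y) = c * cinner x y" by (simp add: cinner_complex_def scaleC_complex_def)
  show "cinner x x = complex_of_real ((norm x)\<^sup>2)"
    unfolding cinner_complex_def complex_norm_square by (rule mult.commute)
qed
end

instantiation prod :: (chilbert_space, chilbert_space) chilbert_space
begin
definition scaleC_prod :: "complex \<Rightarrow> 'a \<times> 'b \<Rightarrow> 'a \<times> 'b" where "scaleC_prod c x = (c *\<^sub>C fst x, c *\<^sub>C snd x)"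
definition cinner_prod :: "'a \<times> 'b \<Rightarrow> 'a \<times> 'b \<Rightarrow> complex"
  where "cinner_prod x y = cinner (fst x) (fst y) + cinner (snd x) (snd y)"
instance
proof
  fix x y z :: "'a \<times> 'b" and c d :: complex and r :: real
  show "c *\<^sub>C (x + y) = c *\<^sub>C x + c *\<^sub>C y" "(c + d) *\<^sub>C x = c *\<^sub>C x + d *\<^sub>C x"
    "c *\<^sub>C d *\<^sub>C x = (c * d) *\<^sub>C x"
    by (simp_all add: scaleC_prod_def scaleC_add_right scaleC_add_left scaleC_scaleC)
  show "r *\<^sub>R x = complex_of_real r *\<^sub>C x" by (simp add: scaleC_prod_def scaleR_prod_def scaleR_scaleC)
  show "cinner y x = cnj (cinner x y)" by (simp add: cinner_prod_def cinner_commute[symmetric])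
  show "cinner x (y + z) = cinner x y + cinner x z" by (simp add: cinner_prod_def cinner_add_right)
  show "cinner x (c *\<^sub>C y) = c * cinner x y"
    by (simp add: cinner_prod_def scaleC_prod_def cinner_scaleC_right distrib_left)
  show "cinner x x = complex_of_real ((norm x)\<^sup>2)"
    by (simp add: cinner_prod_def cinner_self norm_prod_def)
qed
end

global_interpretation ch: semi_inner_vs scaleC "cinner :: 'a::chilbert_space \<Rightarrow> 'a \<Rightarrow> complex"
  rewrites "semi_inner.sn cinner = (norm :: 'a \<Rightarrow> real)"
proof -
  have one: "1 *\<^sub>C x = x" for x :: 'a using scaleR_scaleC[of 1 x] by simp
  have neg: "(-1) *\<^sub>C x = - x" for x :: 'a using scaleR_scaleC[of "-1" x] by simp
  show i: "semi_inner_vs scaleC (cinner :: 'a \<Rightarrow> _)"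
    by standard (auto simp: one neg cinner_commute[symmetric] cinner_add_right cinner_scaleC_right cinner_self
        scaleC_add_right scaleC_add_left scaleC_scaleC)
  interpret semi_inner_vs scaleC "cinner :: 'a \<Rightarrow> 'a \<Rightarrow> complex" by (rule i)
  show "semi_inner.sn cinner = (norm :: 'a \<Rightarrow> real)"
    by (rule ext) (simp add: sn_def cinner_self)
qed

lemma tendsto_cinner:
  fixes X Y :: "nat \<Rightarrow> 'a::chilbert_space"
  assumes "X \<longlonglongrightarrow> x" "Y \<longlonglongrightarrow> y"
  shows "(\<lambda>n. cinner (X n) (Y n)) \<longlonglongrightarrow> cinner x y"
proof -
  have "(\<lambda>n. norm (X n) * norm (Y n - y) + norm (X n - x) * norm y) \<longlonglongrightarrow> norm x * norm (y - y) + norm (x - x) * norm y"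
    by (intro tendsto_intros assms)
  hence l: "(\<lambda>n. norm (X n) * norm (Y n - y) + norm (X n - x) * norm y) \<longlonglongrightarrow> 0 + 0" by simp
  have "cmod (cinner (X n) (Y n) - cinner x y) \<le> norm (X n) * norm (Y n - y) + norm (X n - x) * norm y" for n
  proof -
    have "cinner (X n) (Y n) - cinner x y = cinner (X n) (Y n - y) + cinner (X n - x) y"
      by (simp add: ch.ip_diff ch.ip_diff_left)
    thus ?thesis by (metis norm_triangle_mono ch.cauchy_schwarz)
  qed
  hence "(\<lambda>n. cmod (cinner (X n) (Y n) - cinner x y)) \<longlonglongrightarrow> 0" by (intro tendsto_0_le[OF l]) simp_all
  thus ?thesis by (simp add: LIM_zero_iff tendsto_norm_zero_iff)
qed

subsection \<open>Products of positive semidefinite kernels\<close>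

definition psdon :: "'i set \<Rightarrow> ('i \<Rightarrow> 'i \<Rightarrow> complex) \<Rightarrow> bool"
  where "psdon S K \<longleftrightarrow> (\<forall>x\<in>S. \<forall>y\<in>S. K y x = cnj (K x y)) \<and>
    (\<forall>c. 0 \<le> Re (\<Sum>x\<in>S. \<Sum>y\<in>S. cnj (c x) * c y * K x y))"

lemma psdon_gram: "psdon S (\<lambda>x y. cinner (f x) (f y :: 'a::chilbert_space))"
proof (cases "finite S")
  case True
  have r: "cinner u (\<Sum>y\<in>S. c y *\<^sub>C f y) = (\<Sum>y\<in>S. c y * cinner u (f y))" for u c
    using True by (induction S) (auto simp: cinner_add_right cinner_scaleC_right)
  have l: "cinner (\<Sum>y\<in>S. c y *\<^sub>C f y) u = (\<Sum>y\<in>S. cnj (c y) * cinner (f y) u)" for u c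
    using True by (induction S) (auto simp: ch.ip_add_left ch.ip_sc_left)
  have "(\<Sum>x\<in>S. \<Sum>y\<in>S. cnj (c x) * c y * cinner (f x) (f y)) = cinner (\<Sum>y\<in>S. c y *\<^sub>C f y) (\<Sum>y\<in>S. c y *\<^sub>C f y)" for c
    unfolding l by (simp only: r sum_distrib_left mult.assoc)
  thus ?thesis by (auto simp: psdon_def ch.ip_pos cinner_commute[symmetric])
qed (auto simp: psdon_def cinner_commute[symmetric])

lemma psdon_expand:
  assumes "psdon (insert a S) K" "finite S" "a \<notin> S"
  shows "0 \<le> (cmod s)\<^sup>2 * Re (K a a) + 2 * Re (cnj s * (\<Sum>y\<in>S. c y * K a y))
      + Re (\<Sum>x\<in>S. \<Sum>y\<in>S. cnj (c x) * c y * K x y)"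
proof -
  define d where "d = c(a := s)"
  define Z where "Z = cnj s * (\<Sum>y\<in>S. c y * K a y)"
  define Q where "Q = (\<Sum>x\<in>S. \<Sum>y\<in>S. cnj (c x) * c y * K x y)"
  have da: "d a = s" by (simp add: d_def)
  have dS: "x \<in> S \<Longrightarrow> d x = c x" for x using assms by (auto simp: d_def)
  have h: "x \<in> S \<Longrightarrow> K x a = cnj (K a x)" for x using assms unfolding psdon_def by blast
  have "0 \<le> Re (\<Sum>x\<in>insert a S. \<Sum>y\<in>insert a S. cnj (d x) * d y * K x y)"
    using assms unfolding psdon_def by blast
  also have "(\<Sum>x\<in>insert a S. \<Sum>y\<in>insert a S. cnj (d x) * d y * K x y)
    = cnj s * s * K a a + (\<Sum>y\<in>S. cnj s * c y * K a y) + ((\<Sum>x\<in>S. cnj (c x) * s * K x a) + (\<Sum>x\<in>S. \<Sum>y\<in>S. cnj (c x) * c y * K x y))"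
    using assms by (simp add: da dS sum.distrib)
  also have "(\<Sum>x\<in>S. cnj (c x) * s * K x a) = cnj (\<Sum>y\<in>S. cnj s * c y * K a y)"
    by (simp add: h mult_ac)
  also have "(\<Sum>y\<in>S. cnj s * c y * K a y) = cnj s * (\<Sum>y\<in>S. c y * K a y)"
    by (simp add: sum_distrib_left mult_ac)
  also note Z_def[symmetric]
  also note Q_def[symmetric]
  also have "cnj s * s = complex_of_real ((cmod s)\<^sup>2)" by (metis complex_norm_square mult.commute)
  finally show ?thesis unfolding Z_def[symmetric] Q_def[symmetric] by simp
qed

lemma psdon_diag: assumes "psdon S K" "a \<in> S" "finite S" shows "0 \<le> Re (K a a)"
proof -
  have "insert a (S - {a}) = S" using assms by blast
  hence "psdon (insert a (S - {a})) K" using assms by simp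
  from psdon_expand[OF this, of 1 "\<lambda>_. 0"] assms show ?thesis by simp
qed

lemma psdon_decomp:
  assumes "finite S" "psdon S K"
  shows "\<exists>n v. \<forall>x\<in>S. \<forall>y\<in>S. K x y = (\<Sum>i<(n::nat). v i x * cnj (v i y))"
  using assms
proof (induction S arbitrary: K rule: finite_induct)
  case empty
  show ?case by simp
next
  case (insert a S)
  define d where "d = Re (K a a)"
  have d0: "d \<ge> 0" unfolding d_def by (rule psdon_diag[OF insert.prems]) (use insert in auto)
  have h: "x \<in> insert a S \<Longrightarrow> y \<in> insert a S \<Longrightarrow> K y x = cnj (K x y)" for x y
    using insert.prems unfolding psdon_def by blast
  have "K a a = cnj (K a a)" by (rule h) auto
  hence Kaa: "K a a = complex_of_real d" unfolding d_def by (metis Reals_cnj_iff of_real_Re)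
  note ex = psdon_expand[OF insert.prems insert.hyps, folded d_def]
  have z: "K a y = 0" if "d = 0" "y \<in> S" for y
  proof (rule ccontr)
    assume n: "K a y \<noteq> 0"
    define c :: "'a \<Rightarrow> complex" where "c = (\<lambda>z. if z = y then 1 else 0)"
    have L: "(\<Sum>z\<in>S. c z * K a z) = K a y"
    proof -
      have "(\<Sum>z\<in>S. c z * K a z) = (\<Sum>z\<in>S. if z = y then K a z else 0)" by (rule sum.cong) (auto simp: c_def)
      thus ?thesis using that insert.hyps by simp
    qed
    define q where "q = Re (\<Sum>x\<in>S. \<Sum>z\<in>S. cnj (c x) * c z * K x z)"
    define m where "m = (cmod (K a y))\<^sup>2"
    have m: "m > 0" using n by (simp add: m_def)
    have "0 \<le> - 2 * t * m + q" for t :: real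
    proof -
      have "cnj (- complex_of_real t * K a y) * K a y = complex_of_real (- t * m)"
        unfolding m_def of_real_mult complex_norm_square by simp
      hence "Re (cnj (- complex_of_real t * K a y) * K a y) = - t * m" by (metis Re_complex_of_real)
      with ex[of "- complex_of_real t * K a y" c] show ?thesis unfolding L q_def[symmetric] using that by simp
    qed
    from this[of "(q + 1) / (2 * m)"] m show False by (simp add: field_simps)
  qed
  define v where "v = (\<lambda>x. K x a / complex_of_real (sqrt d))"
  define K' where "K' = (\<lambda>x y. K x y - v x * cnj (v y))"
  have va: "v a = complex_of_real (sqrt d)"
    unfolding v_def Kaa using d0 by (cases "d = 0") (simp_all add: real_div_sqrt flip: of_real_divide)
  have sq: "complex_of_real (sqrt d) * complex_of_real (sqrt d) = complex_of_real d"
    using d0 by (simp flip: of_real_mult)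
  have K'a: "K' a y = 0" if "y \<in> insert a S" for y
  proof (cases "d = 0")
    case True
    have "K a y = 0" using that z[OF True] Kaa True by auto
    thus ?thesis by (simp add: K'_def va True)
  next
    case False
    hence "complex_of_real (sqrt d) \<noteq> 0" by simp
    moreover have "K y a = cnj (K a y)" using h that by blast
    ultimately show ?thesis unfolding K'_def va by (simp add: v_def)
  qed
  have K'h: "K' y x = cnj (K' x y)" if "x \<in> insert a S" "y \<in> insert a S" for x y
    using h[OF that] by (simp add: K'_def mult.commute)
  have "psdon S K'"
    unfolding psdon_def
  proof (intro conjI ballI allI)
    fix x y assume "x \<in> S" "y \<in> S"
    thus "K' y x = cnj (K' x y)" by (intro K'h) auto
  next
    fix c :: "'a \<Rightarrow> complex"
    define L where "L = (\<Sum>y\<in>S. c y * K a y)"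
    define q where "q = (\<Sum>x\<in>S. \<Sum>y\<in>S. cnj (c x) * c y * K x y)"
    define w where "w = (\<Sum>y\<in>S. c y * cnj (v y))"
    have w: "w = L / complex_of_real (sqrt d)"
    proof -
      have "y \<in> S \<Longrightarrow> K y a = cnj (K a y)" for y using h by blast
      thus ?thesis unfolding w_def L_def v_def sum_divide_distrib by (intro sum.cong) auto
    qed
    have "(\<Sum>x\<in>S. \<Sum>y\<in>S. cnj (c x) * c y * K' x y) = q - (\<Sum>x\<in>S. \<Sum>y\<in>S. (cnj (c x) * v x) * (c y * cnj (v y)))"
      by (simp add: K'_def q_def right_diff_distrib sum_subtractf mult_ac)
    also have "(\<Sum>x\<in>S. \<Sum>y\<in>S. (cnj (c x) * v x) * (c y * cnj (v y))) = cnj w * w"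
      by (simp add: w_def sum_product)
    also have "\<dots> = complex_of_real ((cmod w)\<^sup>2)" by (metis complex_norm_square mult.commute)
    finally have e: "Re (\<Sum>x\<in>S. \<Sum>y\<in>S. cnj (c x) * c y * K' x y) = Re q - (cmod w)\<^sup>2" by simp
    have "(cmod w)\<^sup>2 \<le> Re q"
    proof (cases "d = 0")
      case True
      with ex[of 0 c] show ?thesis by (simp add: w q_def)
    next
      case False
      hence d: "d > 0" using d0 by simp
      have cw: "(cmod w)\<^sup>2 = (cmod L)\<^sup>2 / d" using d by (simp add: w norm_divide power_divide)
      have "cnj (- L / complex_of_real d) * L = complex_of_real (- ((cmod L)\<^sup>2 / d))"
        unfolding of_real_minus of_real_divide complex_norm_square by (simp add: mult.commute)
      hence e1: "Re (cnj (- L / complex_of_real d) * L) = - ((cmod L)\<^sup>2 / d)" by (metis Re_complex_of_real)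
      have e2: "(cmod (- L / complex_of_real d))\<^sup>2 * d = (cmod L)\<^sup>2 / d"
        using d by (simp add: norm_divide power_divide power2_eq_square)
      show ?thesis
        using ex[of "- L / complex_of_real d" c] unfolding L_def[symmetric] q_def[symmetric] cw e1 e2 by linarith
    qed
    thus "0 \<le> Re (\<Sum>x\<in>S. \<Sum>y\<in>S. cnj (c x) * c y * K' x y)" unfolding e by simp
  qed
  then obtain n u where u: "\<And>x y. x \<in> S \<Longrightarrow> y \<in> S \<Longrightarrow> K' x y = (\<Sum>i<(n::nat). u i x * cnj (u i y))"
    using insert.IH[of K'] by blast
  define u' where "u' = (\<lambda>i x. if i = n then v x else if x = a then 0 else u i x)"
  have "K x y = (\<Sum>i<Suc n. u' i x * cnj (u' i y))" if xy: "x \<in> insert a S" "y \<in> insert a S" for x y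
  proof -
    have "K' x y = (\<Sum>i<n. u' i x * cnj (u' i y))"
    proof (cases "x = a \<or> y = a")
      case True
      have "K' x y = 0" using True K'a[OF xy(2)] K'a[OF xy(1)] K'h[OF xy] by auto
      moreover have "(\<Sum>i<n. u' i x * cnj (u' i y)) = 0" using True by (intro sum.neutral) (auto simp: u'_def)
      ultimately show ?thesis by simp
    next
      case False
      hence "K' x y = (\<Sum>i<n. u i x * cnj (u i y))" using xy u by blast
      also have "\<dots> = (\<Sum>i<n. u' i x * cnj (u' i y))" using False by (intro sum.cong) (auto simp: u'_def)
      finally show ?thesis .
    qed
    moreover have "u' n x = v x" "u' n y = v y" by (simp_all add: u'_def)
    moreover have "K x y = K' x y + v x * cnj (v y)" by (simp add: K'_def)
    ultimately show ?thesis by simp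
  qed
  thus ?case by blast
qed

lemma sum_swap3: "(\<Sum>x\<in>A. \<Sum>y\<in>B. \<Sum>i\<in>I. f x y i) = (\<Sum>i\<in>I. \<Sum>x\<in>A. \<Sum>y\<in>B. f x y i)"
proof -
  have "(\<Sum>x\<in>A. \<Sum>y\<in>B. \<Sum>i\<in>I. f x y i) = (\<Sum>x\<in>A. \<Sum>i\<in>I. \<Sum>y\<in>B. f x y i)"
    by (rule sum.cong[OF refl], rule sum.swap)
  also have "\<dots> = (\<Sum>i\<in>I. \<Sum>x\<in>A. \<Sum>y\<in>B. f x y i)" by (rule sum.swap)
  finally show ?thesis .
qed

lemma psdon_mult:
  assumes "finite S" "psdon S K" "psdon S L" shows "psdon S (\<lambda>x y. K x y * L x y)"
  unfolding psdon_def
proof (intro conjI ballI allI)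
  fix x y assume "x \<in> S" "y \<in> S"
  hence "K y x = cnj (K x y)" "L y x = cnj (L x y)" using assms unfolding psdon_def by blast+
  thus "K y x * L y x = cnj (K x y * L x y)" by (simp only: complex_cnj_mult)
next
  fix c :: "'a \<Rightarrow> complex"
  obtain n v where v: "\<And>x y. x \<in> S \<Longrightarrow> y \<in> S \<Longrightarrow> K x y = (\<Sum>i<(n::nat). v i x * cnj (v i y))"
    using psdon_decomp[OF assms(1,2)] by blast
  define d where "d = (\<lambda>i x. c x * cnj (v i x))"
  have "(\<Sum>x\<in>S. \<Sum>y\<in>S. cnj (c x) * c y * (K x y * L x y)) = (\<Sum>x\<in>S. \<Sum>y\<in>S. \<Sum>i<n. cnj (d i x) * d i y * L x y)"
    by (intro sum.cong refl) (simp add: v d_def sum_distrib_left sum_distrib_right mult_ac)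
  also have "\<dots> = (\<Sum>i<n. \<Sum>x\<in>S. \<Sum>y\<in>S. cnj (d i x) * d i y * L x y)"
    by (rule sum_swap3)
  finally have "(\<Sum>x\<in>S. \<Sum>y\<in>S. cnj (c x) * c y * (K x y * L x y)) = (\<Sum>i<n. \<Sum>x\<in>S. \<Sum>y\<in>S. cnj (d i x) * d i y * L x y)" .
  moreover have "0 \<le> Re (\<Sum>x\<in>S. \<Sum>y\<in>S. cnj (d i x) * d i y * L x y)" for i
    using assms(3) unfolding psdon_def by blast
  ultimately show "0 \<le> Re (\<Sum>x\<in>S. \<Sum>y\<in>S. cnj (c x) * c y * (K x y * L x y))"
    by (simp only: Re_sum[of _ "{..<n}"] sum_nonneg)
qed

lemma psdon_sum:
  fixes K :: "'j \<Rightarrow> 'i \<Rightarrow> 'i \<Rightarrow> complex"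
  assumes "\<And>i. i \<in> I \<Longrightarrow> psdon S (K i)" shows "psdon S (\<lambda>x y. \<Sum>i\<in>I. K i x y)"
  unfolding psdon_def
proof (intro conjI ballI allI)
  fix x y :: 'i assume "x \<in> S" "y \<in> S"
  hence "K i y x = cnj (K i x y)" if "i \<in> I" for i using assms[OF that] unfolding psdon_def by blast
  thus "(\<Sum>i\<in>I. K i y x) = cnj (\<Sum>i\<in>I. K i x y)" unfolding cnj_sum by (rule sum.cong[OF refl])
next
  fix c :: "'i \<Rightarrow> complex"
  have "(\<Sum>x\<in>S. \<Sum>y\<in>S. cnj (c x) * c y * (\<Sum>i\<in>I. K i x y)) = (\<Sum>i\<in>I. \<Sum>x\<in>S. \<Sum>y\<in>S. cnj (c x) * c y * K i x y)"
    unfolding sum_distrib_left by (rule sum_swap3)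
  moreover have "0 \<le> Re (\<Sum>x\<in>S. \<Sum>y\<in>S. cnj (c x) * c y * K i x y)" if "i \<in> I" for i
    using assms[OF that] unfolding psdon_def by blast
  ultimately show "0 \<le> Re (\<Sum>x\<in>S. \<Sum>y\<in>S. cnj (c x) * c y * (\<Sum>i\<in>I. K i x y))"
    by (simp only: Re_sum[of _ I] sum_nonneg)
qed

subsection \<open>Tensor products, symmetric Fock space and L2\<close>

datatype ('a, 'b) tgen = TGen 'a 'b

instantiation tgen :: (chilbert_space, chilbert_space) pdkernel
begin

fun kern_tgen :: "('a, 'b) tgen \<Rightarrow> ('a, 'b) tgen \<Rightarrow> complex"
  where "kern_tgen (TGen u v) (TGen u' v') = cinner u u' * cinner v v'"

instance
proof
  fix x y :: "('a, 'b) tgen" and S :: "('a, 'b) tgen set" and c :: "('a, 'b) tgen \<Rightarrow> complex"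
  show "kern y x = cnj (kern x y)" by (cases x; cases y) (simp add: cinner_commute[symmetric])
  assume "finite S"
  define f :: "('a, 'b) tgen \<Rightarrow> 'a" where "f z = (case z of TGen u v \<Rightarrow> u)" for z
  define g :: "('a, 'b) tgen \<Rightarrow> 'b" where "g z = (case z of TGen u v \<Rightarrow> v)" for z
  have k: "kern x y = cinner (f x) (f y) * cinner (g x) (g y)" for x y :: "('a, 'b) tgen"
    by (cases x; cases y) (simp add: f_def g_def)
  show "0 \<le> Re (\<Sum>x\<in>S. \<Sum>y\<in>S. cnj (c x) * c y * kern x y)"
    using psdon_mult[OF \<open>finite S\<close> psdon_gram[of S f] psdon_gram[of S g]] unfolding psdon_def k by blast
qed

end

type_synonym ('a, 'b) htens = "('a, 'b) tgen hcompl"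

definition tens :: "'a::chilbert_space \<Rightarrow> 'b::chilbert_space \<Rightarrow> ('a, 'b) htens" (infixr \<open>\<otimes>\<^sub>H\<close> 75)
  where "u \<otimes>\<^sub>H v = hgen (TGen u v)"

lemma cinner_tens: "cinner (u \<otimes>\<^sub>H v) (u' \<otimes>\<^sub>H v') = cinner u u' * cinner v v'"
  by (simp add: tens_def cinner_hgen)

(* SymPow n f stands for the n-fold tensor power of f. The closed linear span of these powers
   is the n-fold symmetric tensor product, so 'a sympow hcompl is the orthogonal sum of the
   symmetric tensor powers of (the completion of) 'a, that is, the symmetric Fock space over it;
   SymPow 0 f is the vacuum vector for every f. *)
datatype 'a sympow = SymPow nat 'a

instantiation sympow :: (pdkernel) pdkernel
begin

fun kern_sympow :: "'a sympow \<Rightarrow> 'a sympow \<Rightarrow> complex"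
  where "kern_sympow (SymPow m f) (SymPow n g) = (if m = n then kern f g ^ n else 0)"

instance
proof
  fix x y :: "'a sympow" and S :: "'a sympow set" and c :: "'a sympow \<Rightarrow> complex"
  show "kern y x = cnj (kern x y)" by (cases x; cases y) (simp add: kern_commute[symmetric])
  assume S: "finite S"
  define dg :: "'a sympow \<Rightarrow> nat" where "dg z = (case z of SymPow n f \<Rightarrow> n)" for z
  define el :: "'a sympow \<Rightarrow> 'a" where "el z = (case z of SymPow n f \<Rightarrow> f)" for z
  define P where "P k x y = cinner (if dg x = k then 1 else 0 :: complex) (if dg y = k then 1 else 0)
    * cinner (hgen (el x)) (hgen (el y)) ^ k" for k x y
  have pw: "psdon S (\<lambda>x y. cinner (hgen (el x)) (hgen (el y)) ^ k)" for k :: nat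
  proof (induction k)
    case 0
    show ?case using psdon_gram[of S "\<lambda>_. 1 :: complex"] by (simp add: cinner_complex_def)
  next
    case (Suc k)
    show ?case using psdon_mult[OF S psdon_gram[of S "\<lambda>x. hgen (el x)"] Suc] by simp
  qed
  have "psdon S (P k)" for k unfolding P_def by (rule psdon_mult[OF S psdon_gram pw])
  hence p: "psdon S (\<lambda>x y. \<Sum>k\<in>dg ` S. P k x y)" by (rule psdon_sum)
  have "kern x y = (\<Sum>k\<in>dg ` S. P k x y)" if "x \<in> S" "y \<in> S" for x y
  proof -
    have "(\<Sum>k\<in>dg ` S. P k x y) = (\<Sum>k\<in>dg ` S. if k = dg x then P k x y else 0)"
      by (intro sum.cong) (auto simp: P_def cinner_complex_def)
    also have "\<dots> = P (dg x) x y" using that S by simp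
    also have "\<dots> = kern x y"
      by (cases x; cases y) (auto simp: P_def cinner_hgen cinner_complex_def dg_def el_def)
    finally show ?thesis by simp
  qed
  hence "(\<Sum>x\<in>S. \<Sum>y\<in>S. cnj (c x) * c y * kern x y) = (\<Sum>x\<in>S. \<Sum>y\<in>S. cnj (c x) * c y * (\<Sum>k\<in>dg ` S. P k x y))"
    by (intro sum.cong) auto
  moreover have "0 \<le> Re (\<Sum>x\<in>S. \<Sum>y\<in>S. cnj (c x) * c y * (\<Sum>k\<in>dg ` S. P k x y))"
    using p unfolding psdon_def by blast
  ultimately show "0 \<le> Re (\<Sum>x\<in>S. \<Sum>y\<in>S. cnj (c x) * c y * kern x y)" by (simp only:)
qed

end

definition strongly_measurable :: "'a measure \<Rightarrow> ('a \<Rightarrow> 'b::real_normed_vector) \<Rightarrow> bool"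
  where "strongly_measurable M f \<longleftrightarrow>
    (\<exists>F. (\<forall>i. simple_function M (F i)) \<and> (AE x in M. (\<lambda>i::nat. F i x) \<longlonglongrightarrow> f x))"

lemma strongly_measurable_cinner:
  fixes f g :: "real \<Rightarrow> 'b::chilbert_space"
  assumes "strongly_measurable lebesgue f" "strongly_measurable lebesgue g"
  shows "(\<lambda>x. cinner (f x) (g x)) \<in> borel_measurable lebesgue"
proof -
  obtain F where F: "\<And>i. simple_function lebesgue (F i)" "AE x in lebesgue. (\<lambda>i::nat. F i x) \<longlonglongrightarrow> f x"
    using assms(1) unfolding strongly_measurable_def by blast
  obtain G where G: "\<And>i. simple_function lebesgue (G i)" "AE x in lebesgue. (\<lambda>i::nat. G i x) \<longlonglongrightarrow> g x"
    using assms(2) unfolding strongly_measurable_def by blast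
  define h where "h = (\<lambda>i x. cinner (F i x) (G i x))"
  have m: "h i \<in> borel_measurable lebesgue" for i unfolding h_def
    by (rule borel_measurable_simple_function, rule simple_function_compose2) (rule F G)+
  have "(\<lambda>x. lim (\<lambda>i. h i x)) \<in> borel_measurable lebesgue"
    by (rule borel_measurable_lim_metric) (rule m)
  moreover have "AE x in lebesgue. lim (\<lambda>i. h i x) = cinner (f x) (g x)"
    using F(2) G(2) by eventually_elim (auto simp: h_def intro!: limI tendsto_cinner)
  ultimately show ?thesis by (rule borel_measurable_AE)
qed

(* Square-integrable functions on the half-line, extended by 0 to the negative reals. Functions
   are not identified almost everywhere here: kern_l2 below is only semidefinite, and a.e. equal
   functions have the same tensor powers in the Fock space. *)
typedef (overloaded) 'k l2 = "{f :: real \<Rightarrow> 'k::chilbert_space. (\<forall>s<0. f s = 0) \<and>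
    strongly_measurable lebesgue f \<and> integrable lebesgue (\<lambda>s. (norm (f s))\<^sup>2)}"
  by (intro exI[of _ "\<lambda>_. 0"]) (auto simp: strongly_measurable_def intro!: exI[of _ "\<lambda>_ _. 0"])

lemma l2_integrable: "integrable lebesgue (\<lambda>s. cinner (Rep_l2 f s) (Rep_l2 g s))"
proof (rule Bochner_Integration.integrable_bound)
  show "integrable lebesgue (\<lambda>s. (norm (Rep_l2 f s))\<^sup>2 + (norm (Rep_l2 g s))\<^sup>2)"
    using Rep_l2[of f] Rep_l2[of g] by auto
  show "(\<lambda>s. cinner (Rep_l2 f s) (Rep_l2 g s)) \<in> borel_measurable lebesgue"
    using Rep_l2[of f] Rep_l2[of g] by (intro strongly_measurable_cinner) auto
  have "cmod (cinner a b) \<le> (norm a)\<^sup>2 + (norm b)\<^sup>2" for a b :: 'a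
  proof -
    have "cmod (cinner a b) \<le> norm a * norm b" by (rule ch.cauchy_schwarz)
    moreover have "0 \<le> norm a * norm b" by simp
    moreover have "2 * (norm a * norm b) \<le> (norm a)\<^sup>2 + (norm b)\<^sup>2"
      using sum_squares_bound[of "norm a" "norm b"] by (simp only: mult.assoc)
    ultimately show ?thesis by linarith
  qed
  thus "AE s in lebesgue. norm (cinner (Rep_l2 f s) (Rep_l2 g s)) \<le> norm ((norm (Rep_l2 f s))\<^sup>2 + (norm (Rep_l2 g s))\<^sup>2)"
    by simp
qed

instantiation l2 :: (chilbert_space) pdkernel
begin

definition kern_l2 :: "'a l2 \<Rightarrow> 'a l2 \<Rightarrow> complex"
  where "kern_l2 f g = (LINT s|lebesgue. cinner (Rep_l2 f s) (Rep_l2 g s))"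

instance
proof
  fix x y :: "'a l2" and S :: "'a l2 set" and c :: "'a l2 \<Rightarrow> complex"
  show "kern y x = cnj (kern x y)"
  proof -
    have "kern y x = (LINT s|lebesgue. cnj (cinner (Rep_l2 x s) (Rep_l2 y s)))"
      unfolding kern_l2_def by (simp only: cinner_commute[symmetric])
    also have "\<dots> = cnj (kern x y)" unfolding kern_l2_def by (rule Bochner_Integration.integral_cnj)
    finally show ?thesis .
  qed
  assume S: "finite S"
  define t where "t x y s = cnj (c x) * c y * cinner (Rep_l2 x s) (Rep_l2 y s)" for x y s
  have t: "integrable lebesgue (t x y)" for x y
    unfolding t_def by (rule Bochner_Integration.integrable_mult_right) (rule l2_integrable)
  have t': "integrable lebesgue (\<lambda>s. \<Sum>y\<in>S. t x y s)" for x
    by (intro Bochner_Integration.integrable_sum t)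
  have I: "integrable lebesgue (\<lambda>s. \<Sum>x\<in>S. \<Sum>y\<in>S. t x y s)"
    by (intro Bochner_Integration.integrable_sum t)
  have "cnj (c x) * c y * kern x y = (LINT s|lebesgue. t x y s)" for x y
    unfolding kern_l2_def t_def by (rule Bochner_Integration.integral_mult_right_zero[symmetric])
  hence "(\<Sum>x\<in>S. \<Sum>y\<in>S. cnj (c x) * c y * kern x y) = (LINT s|lebesgue. (\<Sum>x\<in>S. \<Sum>y\<in>S. t x y s))"
    by (simp only: Bochner_Integration.integral_sum[OF t'] Bochner_Integration.integral_sum[OF t])
  hence "Re (\<Sum>x\<in>S. \<Sum>y\<in>S. cnj (c x) * c y * kern x y) = (LINT s|lebesgue. Re (\<Sum>x\<in>S. \<Sum>y\<in>S. t x y s))"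
    by (simp only: Bochner_Integration.integral_Re[OF I])
  moreover have "0 \<le> Re (\<Sum>x\<in>S. \<Sum>y\<in>S. t x y s)" for s
    using psdon_gram[of S "\<lambda>x. Rep_l2 x s"] unfolding psdon_def t_def by blast
  ultimately show "0 \<le> Re (\<Sum>x\<in>S. \<Sum>y\<in>S. cnj (c x) * c y * kern x y)"
    by (simp only: Bochner_Integration.integral_nonneg)
qed

end

type_synonym 'k fock = "'k l2 sympow hcompl"

subsection \<open>Operators on Hilbert spaces\<close>

definition csubspace :: "'a::chilbert_space set \<Rightarrow> bool"
  where "csubspace V \<longleftrightarrow> 0 \<in> V \<and> (\<forall>x\<in>V. \<forall>y\<in>V. x + y \<in> V) \<and> (\<forall>c. \<forall>x\<in>V. c *\<^sub>C x \<in> V)"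

definition cspan :: "'a::chilbert_space set \<Rightarrow> 'a set"
  where "cspan S = csubspace hull S"

definition bounded_clinear :: "('a::chilbert_space \<Rightarrow> 'b::chilbert_space) \<Rightarrow> bool"
  where "bounded_clinear T \<longleftrightarrow> bounded_linear T \<and> (\<forall>c x. T (c *\<^sub>C x) = c *\<^sub>C T x)"

definition bounded_ops :: "('a::chilbert_space \<Rightarrow> 'a) set"
  where "bounded_ops = {T. bounded_clinear T}"

definition cadj :: "('a::chilbert_space \<Rightarrow> 'b::chilbert_space) \<Rightarrow> 'b \<Rightarrow> 'a"
  where "cadj T = (THE S. \<forall>x y. cinner (S y) x = cinner y (T x))"

definition commutant :: "('a::chilbert_space \<Rightarrow> 'a) set \<Rightarrow> ('a \<Rightarrow> 'a) set"
  where "commutant S = {x \<in> bounded_ops. \<forall>s\<in>S. x \<circ> s = s \<circ> x}"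

definition von_neumann_algebra :: "('a::chilbert_space \<Rightarrow> 'a) set \<Rightarrow> bool"
  where "von_neumann_algebra A \<longleftrightarrow>
    A \<subseteq> bounded_ops \<and> (\<forall>a\<in>A. cadj a \<in> A) \<and> commutant (commutant A) = A"

definition op_tensor :: "('a::chilbert_space \<Rightarrow> 'c::chilbert_space) \<Rightarrow> ('b::chilbert_space \<Rightarrow> 'd::chilbert_space)
    \<Rightarrow> ('a, 'b) htens \<Rightarrow> ('c, 'd) htens" (infixr \<open>\<otimes>\<^sub>O\<close> 75)
  where "a \<otimes>\<^sub>O b = (THE x. bounded_clinear x \<and> (\<forall>u v. x (u \<otimes>\<^sub>H v) = a u \<otimes>\<^sub>H b v))"

definition ultraweak_functional :: "(('a::chilbert_space \<Rightarrow> 'a) \<Rightarrow> complex) \<Rightarrow> bool"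
  where "ultraweak_functional \<phi> \<longleftrightarrow> (\<exists>(\<xi> :: nat \<Rightarrow> 'a) (\<eta> :: nat \<Rightarrow> 'a).
    summable (\<lambda>n. (norm (\<xi> n))\<^sup>2) \<and> summable (\<lambda>n. (norm (\<eta> n))\<^sup>2) \<and>
    \<phi> = (\<lambda>x. \<Sum>n. cinner (\<xi> n) (x (\<eta> n))))"

definition ultraweak :: "('a::chilbert_space \<Rightarrow> 'a) topology"
  where "ultraweak = topology_generated_by
    {{x \<in> bounded_ops. \<phi> x \<in> U} | \<phi> U. ultraweak_functional \<phi> \<and> open U}"

definition vn_tensor :: "('a::chilbert_space \<Rightarrow> 'a) set \<Rightarrow> ('b::chilbert_space \<Rightarrow> 'b) set
    \<Rightarrow> (('a, 'b) htens \<Rightarrow> ('a, 'b) htens) set"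
  where "vn_tensor A B = ultraweak closure_of
    {\<lambda>\<zeta>. \<Sum>i<n. (a i \<otimes>\<^sub>O b i) \<zeta> | (n::nat) a b. \<forall>i<n. a i \<in> A \<and> b i \<in> B}"

definition linear_map_on :: "('a::chilbert_space \<Rightarrow> 'a) set \<Rightarrow> (('a \<Rightarrow> 'a) \<Rightarrow> ('b::chilbert_space \<Rightarrow> 'b)) \<Rightarrow> bool"
  where "linear_map_on M \<kappa> \<longleftrightarrow> (\<forall>x\<in>M. \<forall>y\<in>M. \<forall>c.
    \<kappa> (\<lambda>\<xi>. x \<xi> + c *\<^sub>C y \<xi>) = (\<lambda>\<xi>. \<kappa> x \<xi> + c *\<^sub>C \<kappa> y \<xi>))"

definition normal_map :: "('a::chilbert_space \<Rightarrow> 'a) set \<Rightarrow> (('a \<Rightarrow> 'a) \<Rightarrow> ('b::chilbert_space \<Rightarrow> 'b)) \<Rightarrow> bool"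
  where "normal_map M \<kappa> \<longleftrightarrow>
    linear_map_on M \<kappa> \<and> continuous_map (subtopology ultraweak M) ultraweak \<kappa>"

(* The operator matrix [x i j] (i, j < n), acting on the n-fold direct sum, has norm at most C. *)
definition op_matrix_bound :: "nat \<Rightarrow> (nat \<Rightarrow> nat \<Rightarrow> ('a::chilbert_space \<Rightarrow> 'a)) \<Rightarrow> real \<Rightarrow> bool"
  where "op_matrix_bound n x C \<longleftrightarrow> 0 \<le> C \<and> (\<forall>\<xi>.
    (\<Sum>i<n. (norm (\<Sum>j<n. x i j (\<xi> j)))\<^sup>2) \<le> C\<^sup>2 * (\<Sum>j<n. (norm (\<xi> j))\<^sup>2))"

definition completely_bounded :: "('a::chilbert_space \<Rightarrow> 'a) set \<Rightarrow> (('a \<Rightarrow> 'a) \<Rightarrow> ('b::chilbert_space \<Rightarrow> 'b)) \<Rightarrow> bool"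
  where "completely_bounded M \<kappa> \<longleftrightarrow> (\<exists>K\<ge>0. \<forall>n x C. (\<forall>i<n. \<forall>j<n. x i j \<in> M) \<and> op_matrix_bound n x C
    \<longrightarrow> op_matrix_bound n (\<lambda>i j. \<kappa> (x i j)) (K * C))"

(* The normal linear map on the ultraweak tensor product that is determined by its values
   \<Phi> a b on the elementary tensors. *)
definition normal_tensor_map :: "('a::chilbert_space \<Rightarrow> 'a) set \<Rightarrow> ('b::chilbert_space \<Rightarrow> 'b) set
    \<Rightarrow> (('a \<Rightarrow> 'a) \<Rightarrow> ('b \<Rightarrow> 'b) \<Rightarrow> ('c::chilbert_space \<Rightarrow> 'c))
    \<Rightarrow> (('a, 'b) htens \<Rightarrow> ('a, 'b) htens) \<Rightarrow> ('c \<Rightarrow> 'c)"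
  where "normal_tensor_map A B \<Phi> = (THE \<kappa>. \<kappa> \<in> extensional (vn_tensor A B) \<and>
    normal_map (vn_tensor A B) \<kappa> \<and> (\<forall>a\<in>A. \<forall>b\<in>B. \<kappa> (a \<otimes>\<^sub>O b) = \<Phi> a b))"

subsection \<open>Exponential vectors and subintervals\<close>

definition restr_to :: "real set \<Rightarrow> (real \<Rightarrow> 'k::chilbert_space) \<Rightarrow> real \<Rightarrow> 'k"
  where "restr_to J f s = (if s \<in> J then f s else 0)"

definition step_fun :: "(real \<Rightarrow> 'k::chilbert_space) set"
  where "step_fun = {f. \<exists>(n::nat) t. t 0 = 0 \<and> (\<forall>i<n. t i < t (Suc i) \<and> (\<forall>s\<in>{t i..<t (Suc i)}. f s = f (t i))) \<and>
    (\<forall>s\<ge>t n. f s = 0) \<and> (\<forall>s<0. f s = 0)}"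

definition expv :: "(real \<Rightarrow> 'k::chilbert_space) \<Rightarrow> 'k fock"
  where "expv f = exp (- (LINT s|lebesgue. (norm (f s))\<^sup>2) / 2) *\<^sub>R
    (\<Sum>n. (1 / sqrt (fact n)) *\<^sub>R hgen (SymPow n (Abs_l2 f)))"

(* The Fock space over L2(J;k) is realised inside the Fock space over L2(R+;k), and the
   operators on it as the corner consisting of the operators that vanish on its orthogonal
   complement and have range in it; the identity of fock_ops J is the projection fock_id J. *)
definition fock_on :: "real set \<Rightarrow> 'k::chilbert_space fock set"
  where "fock_on J = closure (cspan {hgen (SymPow n f) | n f. \<forall>s. s \<notin> J \<longrightarrow> Rep_l2 f s = 0})"

definition fock_ops :: "real set \<Rightarrow> ('k::chilbert_space fock \<Rightarrow> 'k fock) set"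
  where "fock_ops J = {z \<in> bounded_ops. range z \<subseteq> fock_on J \<and>
    (\<forall>x. (\<forall>y\<in>fock_on J. cinner y x = 0) \<longrightarrow> z x = 0)}"

definition fock_id :: "real set \<Rightarrow> 'k::chilbert_space fock \<Rightarrow> 'k fock"
  where "fock_id J = (THE p. p \<in> fock_ops J \<and> (\<forall>x\<in>fock_on J. p x = x))"

type_synonym ('h, 'k) sp = "('h, 'k fock) htens"
type_synonym ('h, 'k) hsp = "(complex \<times> 'k, ('h, 'k) sp) htens"

(* The identification of (h \<otimes> F[0,r[) \<otimes> F[r,\<infinity>[ with h \<otimes> F, extended by zero to a
   partial isometry. *)
definition fock_split :: "real \<Rightarrow> (('h::chilbert_space, 'k::chilbert_space) sp, 'k fock) htens \<Rightarrow> ('h, 'k) sp"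
  where "fock_split r = (let e = \<lambda>u f g. (u \<otimes>\<^sub>H expv (restr_to {0..<r} f)) \<otimes>\<^sub>H expv (restr_to {r..} g) in
    THE V. bounded_clinear V \<and>
      (\<forall>u. \<forall>f\<in>step_fun. \<forall>g\<in>step_fun.
        V (e u f g) = u \<otimes>\<^sub>H expv (\<lambda>s. restr_to {0..<r} f s + restr_to {r..} g s)) \<and>
      (\<forall>x. (\<forall>u. \<forall>f\<in>step_fun. \<forall>g\<in>step_fun. cinner (e u f g) x = 0) \<longrightarrow> V x = 0))"

(* x \<otimes> z for x in B(h \<otimes> F[0,r[) and z in B(F[r,\<infinity>[), as an operator on h \<otimes> F. *)
definition split_tensor :: "real \<Rightarrow> (('h::chilbert_space, 'k::chilbert_space) sp \<Rightarrow> ('h, 'k) sp)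
    \<Rightarrow> ('k fock \<Rightarrow> 'k fock) \<Rightarrow> ('h, 'k) sp \<Rightarrow> ('h, 'k) sp"
  where "split_tensor r x z = fock_split r \<circ> (x \<otimes>\<^sub>O z) \<circ> cadj (fock_split r)"

definition fock_shift :: "real \<Rightarrow> 'k::chilbert_space fock \<Rightarrow> 'k fock"
  where "fock_shift r = (THE T. bounded_clinear T \<and> (\<forall>f\<in>step_fun. T (expv f) = expv (\<lambda>s. f (s - r))))"

definition sigma_shift :: "real \<Rightarrow> (('h::chilbert_space, 'k::chilbert_space) sp \<Rightarrow> ('h, 'k) sp)
    \<Rightarrow> ('h, 'k) sp \<Rightarrow> ('h, 'k) sp"
  where "sigma_shift r x = (id \<otimes>\<^sub>O fock_shift r) \<circ> x \<circ> cadj (id \<otimes>\<^sub>O fock_shift r)"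

subsection \<open>Processes\<close>

(* Unbounded operators are partial functions; the domain of the operator is dom X. *)
definition lin_op :: "('a::chilbert_space \<rightharpoonup> 'b::chilbert_space) \<Rightarrow> bool"
  where "lin_op X \<longleftrightarrow> csubspace (dom X) \<and> (\<forall>x\<in>dom X. \<forall>y\<in>dom X. \<forall>c.
    the (X (x + c *\<^sub>C y)) = the (X x) + c *\<^sub>C the (X y))"

definition bounded_op :: "('a::chilbert_space \<rightharpoonup> 'b::chilbert_space) \<Rightarrow> bool"
  where "bounded_op X \<longleftrightarrow> (\<exists>C. \<forall>\<zeta>\<in>dom X. norm (the (X \<zeta>)) \<le> C * norm \<zeta>)"

definition op_ext :: "('a::chilbert_space \<rightharpoonup> 'b::chilbert_space) \<Rightarrow> 'a \<Rightarrow> 'b"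
  where "op_ext X = (THE T. bounded_clinear T \<and> (\<forall>\<zeta>\<in>dom X. the (X \<zeta>) = T \<zeta>))"

definition exp_dom :: "('h::chilbert_space, 'k::chilbert_space) sp set"
  where "exp_dom = cspan {u \<otimes>\<^sub>H expv f | u f. f \<in> step_fun}"

definition E_ket :: "'b::chilbert_space \<Rightarrow> 'h::chilbert_space \<Rightarrow> ('h, 'b) htens"
  where "E_ket x = (\<lambda>v. v \<otimes>\<^sub>H x)"

definition E_hat_ket :: "complex \<times> 'k::chilbert_space \<Rightarrow> 'k fock \<Rightarrow> 'h::chilbert_space \<Rightarrow> ('h, 'k) hsp"
  where "E_hat_ket c x = (\<lambda>v. c \<otimes>\<^sub>H (v \<otimes>\<^sub>H x))"

(* The operator E^{expv f} X E_{expv g} on h. *)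
definition slice :: "(real \<Rightarrow> 'k::chilbert_space) \<Rightarrow> (('h::chilbert_space, 'k) sp \<rightharpoonup> ('h, 'k) sp)
    \<Rightarrow> (real \<Rightarrow> 'k) \<Rightarrow> 'h \<Rightarrow> 'h"
  where "slice f X g = cadj (E_ket (expv f)) \<circ> (\<lambda>\<zeta>. the (X \<zeta>)) \<circ> E_ket (expv g)"

definition op_process :: "(real \<Rightarrow> ('h::chilbert_space, 'k::chilbert_space) sp \<rightharpoonup> ('h, 'k) sp) \<Rightarrow> bool"
  where "op_process X \<longleftrightarrow>
    (\<forall>t\<ge>0. lin_op (X t) \<and> dom (X t) = exp_dom) \<and>
    (\<forall>\<zeta>'. \<forall>\<zeta>\<in>exp_dom. (\<lambda>t. cinner \<zeta>' (the (X t \<zeta>))) \<in> borel_measurable (lebesgue_on {0..})) \<and>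
    (\<forall>t\<ge>0. \<forall>f\<in>step_fun. \<forall>g\<in>step_fun. slice f (X t) g =
      (\<lambda>u. cinner (expv (restr_to {t..} f)) (expv (restr_to {t..} g)) *\<^sub>C
        slice (restr_to {0..<t} f) (X t) (restr_to {0..<t} g) u))"

definition process_in :: "('h::chilbert_space \<Rightarrow> 'h) set
    \<Rightarrow> (real \<Rightarrow> ('h, 'k::chilbert_space) sp \<rightharpoonup> ('h, 'k) sp) \<Rightarrow> bool"
  where "process_in A X \<longleftrightarrow> op_process X \<and>
    (\<forall>t\<ge>0. \<forall>f\<in>step_fun. \<forall>g\<in>step_fun. slice f (X t) g \<in> A)"

definition bounded_process :: "(real \<Rightarrow> ('h::chilbert_space, 'k::chilbert_space) sp \<rightharpoonup> ('h, 'k) sp) \<Rightarrow> bool"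
  where "bounded_process X \<longleftrightarrow> op_process X \<and> (\<forall>t\<ge>0. bounded_op (X t))"

definition locally_uniform_bounds :: "(real \<Rightarrow> ('h::chilbert_space, 'k::chilbert_space) sp \<rightharpoonup> ('h, 'k) sp) \<Rightarrow> bool"
  where "locally_uniform_bounds X \<longleftrightarrow> (\<forall>T\<ge>0. bdd_above ((\<lambda>t. onorm (op_ext (X t))) ` {0..T}))"

(* Bounded mapping processes only: each k t a is the extension to h \<otimes> F of a bounded operator
   with domain exp_dom. *)
definition mapping_process :: "('h::chilbert_space \<Rightarrow> 'h) set
    \<Rightarrow> (real \<Rightarrow> ('h \<Rightarrow> 'h) \<Rightarrow> ('h, 'k::chilbert_space) sp \<Rightarrow> ('h, 'k) sp) \<Rightarrow> bool"
  where "mapping_process A k \<longleftrightarrow>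
    (\<forall>t\<ge>0. linear_map_on A (k t) \<and> k t ` A \<subseteq> bounded_ops) \<and>
    (\<forall>a\<in>A. process_in A (\<lambda>t. (\<lambda>\<zeta>. Some (k t a \<zeta>)) |` exp_dom))"

subsection \<open>Cocycles and flows\<close>

definition past_part :: "('h::chilbert_space \<Rightarrow> 'h) set
    \<Rightarrow> (real \<Rightarrow> ('h \<Rightarrow> 'h) \<Rightarrow> ('h, 'k::chilbert_space) sp \<Rightarrow> ('h, 'k) sp)
    \<Rightarrow> real \<Rightarrow> ('h \<Rightarrow> 'h) \<Rightarrow> ('h, 'k) sp \<Rightarrow> ('h, 'k) sp"
  where "past_part A k r a =
    (THE x. x \<in> vn_tensor A (fock_ops {0..<r}) \<and> k r a = split_tensor r x (fock_id {r..}))"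

definition hat_map :: "('h::chilbert_space \<Rightarrow> 'h) set
    \<Rightarrow> (real \<Rightarrow> ('h \<Rightarrow> 'h) \<Rightarrow> ('h, 'k::chilbert_space) sp \<Rightarrow> ('h, 'k) sp)
    \<Rightarrow> real \<Rightarrow> (('h, 'k) sp \<Rightarrow> ('h, 'k) sp) \<Rightarrow> ('h, 'k) sp \<Rightarrow> ('h, 'k) sp"
  where "hat_map A k r =
    normal_tensor_map A (fock_ops {r..}) (\<lambda>a z. split_tensor r (past_part A k r a) z)"

definition tilde_map :: "('h::chilbert_space \<Rightarrow> 'h) set
    \<Rightarrow> (real \<Rightarrow> ('h \<Rightarrow> 'h) \<Rightarrow> ('h, 'k::chilbert_space) sp \<Rightarrow> ('h, 'k) sp)
    \<Rightarrow> real \<Rightarrow> ((complex \<times> 'k, 'h) htens \<Rightarrow> (complex \<times> 'k, 'h) htens) \<Rightarrow> ('h, 'k) hsp \<Rightarrow> ('h, 'k) hsp"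
  where "tilde_map A k t = normal_tensor_map bounded_ops A (\<lambda>b a. b \<otimes>\<^sub>O k t a)"

definition qs_cocycle :: "('h::chilbert_space \<Rightarrow> 'h) set
    \<Rightarrow> (real \<Rightarrow> ('h \<Rightarrow> 'h) \<Rightarrow> ('h, 'k::chilbert_space) sp \<Rightarrow> ('h, 'k) sp) \<Rightarrow> bool"
  where "qs_cocycle A k \<longleftrightarrow> mapping_process A k \<and>
    (\<forall>t\<ge>0. normal_map A (k t) \<and> completely_bounded A (k t)) \<and>
    (\<forall>a\<in>A. k 0 a = a \<otimes>\<^sub>O id) \<and>
    (\<forall>r\<ge>0. \<forall>t\<ge>0. \<forall>a\<in>A. k (r + t) a = hat_map A k r (sigma_shift r (k t a)))"

definition qs_flow :: "('h::chilbert_space \<Rightarrow> 'h) set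
    \<Rightarrow> (real \<Rightarrow> ('h \<Rightarrow> 'h) \<Rightarrow> ('h, 'k::chilbert_space) sp \<Rightarrow> ('h, 'k) sp) \<Rightarrow> bool"
  where "qs_flow A j \<longleftrightarrow> qs_cocycle A j \<and>
    (\<forall>a\<in>A. continuous_map (top_of_set {0..}) ultraweak (\<lambda>t. j t a)) \<and>
    (\<forall>t\<ge>0. (\<forall>a\<in>A. \<forall>b\<in>A. j t (a \<circ> b) = j t a \<circ> j t b) \<and> (\<forall>a\<in>A. j t (cadj a) = cadj (j t a)) \<and> j t id = id)"

definition flow_endo :: "('h::chilbert_space \<Rightarrow> 'h) set
    \<Rightarrow> (real \<Rightarrow> ('h \<Rightarrow> 'h) \<Rightarrow> ('h, 'k::chilbert_space) sp \<Rightarrow> ('h, 'k) sp)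
    \<Rightarrow> real \<Rightarrow> (('h, 'k) sp \<Rightarrow> ('h, 'k) sp) \<Rightarrow> ('h, 'k) sp \<Rightarrow> ('h, 'k) sp"
  where "flow_endo A j t = hat_map A j t \<circ> sigma_shift t"

definition multiplier_cocycle :: "('h::chilbert_space \<Rightarrow> 'h) set
    \<Rightarrow> (real \<Rightarrow> ('h \<Rightarrow> 'h) \<Rightarrow> ('h, 'k::chilbert_space) sp \<Rightarrow> ('h, 'k) sp)
    \<Rightarrow> (real \<Rightarrow> ('h, 'k) sp \<rightharpoonup> ('h, 'k) sp) \<Rightarrow> bool"
  where "multiplier_cocycle A j Y \<longleftrightarrow> bounded_process Y \<and> process_in A Y \<and> op_ext (Y 0) = id \<and>
    (\<forall>s\<ge>0. \<forall>t\<ge>0. op_ext (Y (s + t)) = flow_endo A j s (op_ext (Y t)) \<circ> op_ext (Y s))"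

subsection \<open>Quantum stochastic integrals\<close>

definition khat :: "(real \<Rightarrow> 'k::chilbert_space) \<Rightarrow> real \<Rightarrow> complex \<times> 'k"
  where "khat f s = (1, f s)"

definition Delta :: "complex \<times> 'k::chilbert_space \<Rightarrow> complex \<times> 'k"
  where "Delta x = (0, snd x)"

definition Delta_perp :: "complex \<times> 'k::chilbert_space \<Rightarrow> complex \<times> 'k"
  where "Delta_perp x = x - Delta x"

definition nabla :: "real \<Rightarrow> ('h::chilbert_space, 'k::chilbert_space) sp \<rightharpoonup> ('h, 'k) hsp"
  where "nabla s = (THE D. lin_op D \<and> dom D = exp_dom \<and>
    (\<forall>u. \<forall>f\<in>step_fun. the (D (u \<otimes>\<^sub>H expv f)) = khat f s \<otimes>\<^sub>H (u \<otimes>\<^sub>H expv f)))"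

definition ampliation :: "('a::chilbert_space \<rightharpoonup> 'a) \<Rightarrow> ('c::chilbert_space, 'a) htens \<rightharpoonup> ('c, 'a) htens"
  where "ampliation X = (THE Z. lin_op Z \<and> dom Z = cspan {c \<otimes>\<^sub>H \<zeta> | c \<zeta>. \<zeta> \<in> dom X} \<and>
    (\<forall>c. \<forall>\<zeta>\<in>dom X. the (Z (c \<otimes>\<^sub>H \<zeta>)) = c \<otimes>\<^sub>H the (X \<zeta>)))"

definition locally_integrable :: "(real \<Rightarrow> 'a::chilbert_space) \<Rightarrow> bool"
  where "locally_integrable f \<longleftrightarrow> (\<forall>T\<ge>0. strongly_measurable (lebesgue_on {0..T}) f \<and>
    integrable (lebesgue_on {0..T}) (\<lambda>s. norm (f s)))"

definition locally_square_integrable :: "(real \<Rightarrow> 'a::chilbert_space) \<Rightarrow> bool"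
  where "locally_square_integrable f \<longleftrightarrow> (\<forall>T\<ge>0. strongly_measurable (lebesgue_on {0..T}) f \<and>
    integrable (lebesgue_on {0..T}) (\<lambda>s. (norm (f s))\<^sup>2))"

(* Adaptedness is stated as the identity between operators on h
     E^{f^(t) expv f} G_t E_{g^(t) expv g} =
       < expv f[t,\<infinity>[, expv g[t,\<infinity>[ > E^{f^(t) expv f[0,t[} G_t E_{g^(t) expv g[0,t[},
   where E_{g^(t) expv g} is the composition of nabla t and E_{expv g}. *)
definition qs_integrable :: "(real \<Rightarrow> ('h::chilbert_space, 'k::chilbert_space) hsp \<rightharpoonup> ('h, 'k) hsp) \<Rightarrow> bool"
  where "qs_integrable G \<longleftrightarrow>
    (\<forall>t\<ge>0. lin_op (G t)) \<and>
    (\<forall>\<zeta>\<in>exp_dom.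
      (\<forall>t\<ge>0. the (nabla t \<zeta>) \<in> dom (G t)) \<and>
      locally_integrable (\<lambda>s. (Delta_perp \<otimes>\<^sub>O id) (the (G s (the (nabla s \<zeta>))))) \<and>
      locally_square_integrable (\<lambda>s. (Delta \<otimes>\<^sub>O id) (the (G s (the (nabla s \<zeta>)))))) \<and>
    (\<forall>t\<ge>0. \<forall>f\<in>step_fun. \<forall>g\<in>step_fun. \<forall>u.
      E_hat_ket (khat g t) (expv (restr_to {0..<t} g)) u \<in> dom (G t) \<and>
      cadj (E_hat_ket (khat f t) (expv f)) (the (G t (the (nabla t (E_ket (expv g) u))))) =
        cinner (expv (restr_to {t..} f)) (expv (restr_to {t..} g)) *\<^sub>C
        cadj (E_hat_ket (khat f t) (expv (restr_to {0..<t} f)))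
          (the (G t (E_hat_ket (khat g t) (expv (restr_to {0..<t} g)) u))))"

definition is_qs_integral :: "(real \<Rightarrow> ('h::chilbert_space, 'k::chilbert_space) hsp \<rightharpoonup> ('h, 'k) hsp)
    \<Rightarrow> (real \<Rightarrow> ('h, 'k) sp \<rightharpoonup> ('h, 'k) sp) \<Rightarrow> bool"
  where "is_qs_integral G X \<longleftrightarrow> op_process X \<and>
    (\<forall>\<zeta>\<in>exp_dom. continuous_on {0..} (\<lambda>t. the (X t \<zeta>))) \<and>
    (\<forall>t\<ge>0. \<forall>\<zeta>'\<in>exp_dom. \<forall>\<zeta>\<in>exp_dom. cinner \<zeta>' (the (X t \<zeta>)) =
      (LINT s|lebesgue_on {0..t}. cinner (the (nabla s \<zeta>')) (the (G s (the (nabla s \<zeta>))))))"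

definition pert_integrand :: "('h::chilbert_space \<Rightarrow> 'h) set
    \<Rightarrow> (real \<Rightarrow> ('h \<Rightarrow> 'h) \<Rightarrow> ('h, 'k::chilbert_space) sp \<Rightarrow> ('h, 'k) sp)
    \<Rightarrow> ((complex \<times> 'k, 'h) htens \<Rightarrow> (complex \<times> 'k, 'h) htens)
    \<Rightarrow> (real \<Rightarrow> ('h, 'k) sp \<rightharpoonup> ('h, 'k) sp) \<Rightarrow> real \<Rightarrow> ('h, 'k) hsp \<rightharpoonup> ('h, 'k) hsp"
  where "pert_integrand A j F Y t = (\<lambda>\<eta>. map_option (tilde_map A j t F) (ampliation (Y t) \<eta>))"

definition strong_solution :: "('h::chilbert_space \<Rightarrow> 'h) set
    \<Rightarrow> (real \<Rightarrow> ('h \<Rightarrow> 'h) \<Rightarrow> ('h, 'k::chilbert_space) sp \<Rightarrow> ('h, 'k) sp)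
    \<Rightarrow> ((complex \<times> 'k, 'h) htens \<Rightarrow> (complex \<times> 'k, 'h) htens)
    \<Rightarrow> (real \<Rightarrow> ('h, 'k) sp \<rightharpoonup> ('h, 'k) sp) \<Rightarrow> bool"
  where "strong_solution A j F Y \<longleftrightarrow> op_process Y \<and> qs_integrable (pert_integrand A j F Y) \<and>
    (\<exists>X. is_qs_integral (pert_integrand A j F Y) X \<and>
      (\<forall>t\<ge>0. \<forall>\<zeta>\<in>exp_dom. the (Y t \<zeta>) = \<zeta> + the (X t \<zeta>)))"

(* Y is the unique strong solution. *)
definition perturbation_process :: "('h::chilbert_space \<Rightarrow> 'h) set
    \<Rightarrow> (real \<Rightarrow> ('h \<Rightarrow> 'h) \<Rightarrow> ('h, 'k::chilbert_space) sp \<Rightarrow> ('h, 'k) sp)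
    \<Rightarrow> ((complex \<times> 'k, 'h) htens \<Rightarrow> (complex \<times> 'k, 'h) htens)
    \<Rightarrow> (real \<Rightarrow> ('h, 'k) sp \<rightharpoonup> ('h, 'k) sp) \<Rightarrow> bool"
  where "perturbation_process A j F Y \<longleftrightarrow> strong_solution A j F Y \<and>
    (\<forall>Z. strong_solution A j F Z \<longrightarrow> (\<forall>t\<ge>0. Z t = Y t))"

end

theory Submission
  imports Defs
begin

text \<open>Uniqueness of the strong solution is part of the hypothesis, so both assertions follow by exhibiting
  further strong solutions. If \<open>b\<close> commutes with \<open>A\<close>, then \<open>Y + (b \<otimes> 1) Y - Y (b \<otimes> 1)\<close> is a strong
  solution; hence it equals \<open>Y\<close>, and \<open>Y\<close> is a process in \<open>A\<close>. For the cocycle identity at \<open>r\<close>, let \<open>Z\<close> be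
  \<open>Y\<close> up to \<open>r\<close> and \<open>Z (r + t) = J r (Y t) Y r\<close>. In matrix elements between exponential vectors,
  \<open>J r (Y t)\<close> is \<open>j r\<close> of a slice of \<open>Y t\<close>; as \<open>j r\<close> is normal, it passes under the integral in the equation
  of that slice, and \<open>J r\<close> is multiplicative with \<open>J r (j t a) = j (r + t) a\<close>. So \<open>Z\<close> is a strong solution.

  The tensor extensions of \<open>j t\<close> are made explicit by a dilation: a normal unital representation \<open>\<pi>\<close> of \<open>A\<close>
  admits an isometry \<open>W\<close> with \<open>W \<pi>(a) = (a \<otimes> 1) W\<close>, so \<open>x \<mapsto> (W \<otimes> 1)\<^sup>* (x \<otimes> 1) (W \<otimes> 1)\<close>, up to the order
  of the tensor factors, is the extension of \<open>\<pi>\<close>.\<close>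

text \<open>The obstacle is less to guess the further solutions than to handle the objects in them.
  \<open>flow_endo\<close>, \<open>tilde_map\<close>, \<open>fock_split\<close> and
  \<open>nabla\<close> are definite descriptions, so each use rests on existence and uniqueness. For
  the tensor extensions, a compressed ampliation supplies existence on the whole ultraweak tensor
  product, together with norm bounds, multiplicativity and a formula for slices. \<open>J r\<close>
  is only specified on operators affiliated with \<open>A\<close> in this sense, hence the cocycle
  identity has to wait until Y is known to be a process in A.

  A candidate solution must also satisfy measurability and integrability conditions, in spaces that
  may be nonseparable. This is where the locally uniform bounds enter: they make Y strongly
  continuous on all vectors, not only on exponential ones. Strong continuity passes to products and
  through \<open>J r\<close>, and the coefficient has it because the norms of its values on
  elementary tensors are matrix elements of \<open>j t\<close> again. The integrands are then right
  continuous, jumping only with the step functions, and right continuity yields approximation by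
  simple functions.\<close>

notation scaleC (infixr \<open>*C\<close> 75) and tens (infixr \<open>\<otimes>\<close> 75) and op_tensor (infixr \<open>\<odot>\<close> 75)

abbreviation "bc \<equiv> bounded_clinear"
abbreviation "sqsum x \<equiv> summable (%n. (norm (x n))\<^sup>2)"
abbreviation "lincomb x c y \<equiv> (%xi. x xi + c *C y xi)"
abbreviation "ev u f \<equiv> u \<otimes> expv f"
abbreviation "before r \<equiv> restr_to {0..<r}"
abbreviation "after r \<equiv> restr_to {r..}"

text \<open>The operator \<open>E\<^sup>v x E\<^sub>w\<close>.\<close>

abbreviation "block v x w \<equiv> cadj (E_ket v) o x o E_ket w"

section \<open>Hilbert space geometry, bounded operators and tensor products\<close>

subsection \<open>Hilbert space basics\<close>

lemmas [simp] = ch.sc_one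
lemmas norm_scaleC = ch.sn_sc

lemma scaleC_zero_right [simp]: "c *C (0::'a::chilbert_space) = 0" using ch.sc_diff[of c "0::'a" 0] by simp

lemma scaleC_zero_left [simp]: "0 *C (x::'a::chilbert_space) = 0" using scaleR_scaleC[of 0 x] by simp

lemma scaleC_minus_left: "(- c) *C (x::'a::chilbert_space) = - (c *C x)" using scaleC_scaleC[of "-1" c x] ch.sc_minus[of "c *C x"] by simp

lemma scaleC_diff_left: "(c - d) *C (x::'a::chilbert_space) = c *C x - d *C x"
  using scaleC_add_left[of c "-d" x] by (simp add: scaleC_minus_left)

lemma cinner_eq_0_iff: "cinner x x = 0 \<longleftrightarrow> x = 0" by (simp add: cinner_self)

lemma cinner_ext: assumes "\<And>y. cinner y x = cinner y z" shows "x = z"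
  using assms[of "x - z"] cinner_eq_0_iff[of "x - z"] by (simp add: ch.ip_diff)

lemma cinner_ext_left: assumes "\<And>y. cinner x y = cinner z y" shows "x = z"
  by (rule cinner_ext) (metis assms cinner_commute)

lemma cinner_0_commute: "cinner x y = 0 \<longleftrightarrow> cinner y x = 0" by (metis cinner_commute complex_cnj_zero)

lemma bounded_bilinear_cinner: "bounded_bilinear (cinner :: 'a::chilbert_space => 'a => complex)"
proof
  fix a b c d :: 'a and r :: real
  show "cinner (a + b) c = cinner a c + cinner b c" by (rule ch.ip_add_left)
  show "cinner a (c + d) = cinner a c + cinner a d" by (rule cinner_add_right)
  show "cinner (r *\<^sub>R a) b = r *\<^sub>R cinner a b" by (simp add: scaleR_scaleC ch.ip_sc_left scaleC_complex_def)
  show "cinner a (r *\<^sub>R b) = r *\<^sub>R cinner a b" by (simp add: scaleR_scaleC cinner_scaleC_right scaleC_complex_def)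
  show "\<exists>K. \<forall>a b. norm (cinner a (b::'a)) <= norm a * norm b * K" by (intro exI[of _ 1]) (simp add: ch.cauchy_schwarz)
qed

lemma bounded_bilinear_scaleC: "bounded_bilinear (scaleC :: complex => 'a::chilbert_space => 'a)"
proof
  fix a b :: 'a and c d :: complex and r :: real
  show "(c + d) *C a = c *C a + d *C a" by (rule scaleC_add_left)
  show "c *C (a + b) = c *C a + c *C b" by (rule scaleC_add_right)
  show "(r *\<^sub>R c) *C a = r *\<^sub>R c *C a" by (simp add: scaleR_scaleC scaleC_scaleC scaleC_complex_def)
  show "c *C r *\<^sub>R a = r *\<^sub>R c *C a" by (simp add: scaleR_scaleC scaleC_scaleC mult.commute)
  show "\<exists>K. \<forall>c a. norm (c *C (a::'a)) <= norm c * norm a * K" by (intro exI[of _ 1]) (simp add: norm_scaleC)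
qed

lemmas tendsto_cinner' = bounded_bilinear.tendsto[OF bounded_bilinear_cinner]
lemmas tendsto_scaleC = bounded_bilinear.tendsto[OF bounded_bilinear_scaleC]
lemmas continuous_on_cinner = bounded_bilinear.continuous_on[OF bounded_bilinear_cinner]
lemmas continuous_on_scaleC = bounded_bilinear.continuous_on[OF bounded_bilinear_scaleC]

lemma cinner_sum_right: "cinner x (\<Sum>i\<in>F. f i) = (\<Sum>i\<in>F. cinner x (f i))"
  using bounded_bilinear.sum_right[OF bounded_bilinear_cinner] .

lemma cinner_sum_left: "cinner (\<Sum>i\<in>F. f i) x = (\<Sum>i\<in>F. cinner (f i) x)"
  using bounded_bilinear.sum_left[OF bounded_bilinear_cinner] .

text \<open>Norm bounds for linear combinations of generators thereby become positivity statements
  about kernels, which is how operators are bounded on generated spaces.\<close>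

lemma cinner_lincomb:
  "cinner (\<Sum>i\<in>F. c i *C g i) (\<Sum>j\<in>F. c j *C g j) = (\<Sum>i\<in>F. \<Sum>j\<in>F. cnj (c i) * c j * cinner (g i) (g j))"
  by (subst sum.swap) (simp add: cinner_sum_left cinner_sum_right ch.ip_sc_left cinner_scaleC_right sum_distrib_left mult_ac)

lemma norm_sq_cinner: "(norm x)\<^sup>2 = Re (cinner x x)" by (simp add: cinner_self)

lemma pythagoras: "cinner x y = 0 ==> (norm (x + y))\<^sup>2 = (norm x)\<^sup>2 + (norm y)\<^sup>2" using ch.sn_expand[of x 1 y] by simp

lemma fst_scaleC [simp]: "fst (c *C x) = c *C fst x" and snd_scaleC [simp]: "snd (c *C x) = c *C snd x" by (simp_all add: scaleC_prod_def)

subsection \<open>Subspaces and spans\<close>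

lemma csubspace_cspan: "csubspace (cspan S)" unfolding cspan_def by (rule hull_in) (auto simp: csubspace_def)

lemma cspan_superset: "S \<subseteq> cspan S" unfolding cspan_def by (rule hull_subset)

lemma cspan_base: "x \<in> S ==> x \<in> cspan S" using cspan_superset by blast

lemma cspan_minimal: "S \<subseteq> T ==> csubspace T ==> cspan S \<subseteq> T" unfolding cspan_def by (rule hull_minimal)

lemma cspan_mono: "S \<subseteq> T ==> cspan S \<subseteq> cspan T" using cspan_minimal[of S "cspan T"] csubspace_cspan cspan_superset by blast

lemma csubspace_add: "csubspace V ==> x \<in> V ==> y \<in> V ==> x + y \<in> V" and csubspace_scale: "csubspace V ==> x \<in> V ==> c *C x \<in> V"
  and csubspace_0: "csubspace V ==> 0 \<in> V" by (auto simp: csubspace_def)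

lemma csubspace_diff: "csubspace V ==> x \<in> V ==> y \<in> V ==> x - y \<in> V"
  using csubspace_add[of V x "(-1) *C y"] csubspace_scale[of V y "-1"] by (simp add: ch.sc_minus)

lemma csubspace_sum: "csubspace V ==> (\<And>i. i \<in> F ==> f i \<in> V) ==> (\<Sum>i\<in>F. f i) \<in> V"
  by (induction F rule: infinite_finite_induct) (auto simp: csubspace_0 csubspace_add)

lemma csubspace_closure: assumes "csubspace V" shows "csubspace (closure V)" unfolding csubspace_def
proof (intro conjI ballI allI)
  show "0 \<in> closure V" using assms closure_subset by (auto simp: csubspace_def)
next
  fix x y assume "x \<in> closure V" "y \<in> closure V"
  then obtain X Y where "\<And>n. X n \<in> V" "X \<longlonglongrightarrow> x" "\<And>n. Y n \<in> V" "Y \<longlonglongrightarrow> y" unfolding closure_sequential by blast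
  thus "x + y \<in> closure V" unfolding closure_sequential
    by (intro exI[of _ "%n. X n + Y n"] conjI tendsto_add) (auto intro: csubspace_add assms)
next
  fix c x assume "x \<in> closure V"
  then obtain X where "\<And>n. X n \<in> V" "X \<longlonglongrightarrow> x" unfolding closure_sequential by blast
  thus "c *C x \<in> closure V" unfolding closure_sequential
    by (intro exI[of _ "%n. c *C X n"] conjI tendsto_scaleC tendsto_const) (auto intro: csubspace_scale assms)
qed

lemma cspan_finite:
  assumes "v \<in> cspan (g ` I)" shows "\<exists>F c. finite F \<and> F \<subseteq> I \<and> v = (\<Sum>i\<in>F. c i *C g i)"
proof -
  define T where "T = {v. \<exists>F c. finite F \<and> F \<subseteq> I \<and> v = (\<Sum>i\<in>F. c i *C g i)}"
  have "csubspace T" unfolding csubspace_def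
  proof (intro conjI ballI allI)
    show "0 \<in> T" unfolding T_def by (auto intro!: exI[of _ "{}"])
  next
    fix x y assume "x \<in> T" "y \<in> T"
    then obtain F c G d where h: "finite F" "F \<subseteq> I" "x = (\<Sum>i\<in>F. c i *C g i)" "finite G" "G \<subseteq> I" "y = (\<Sum>i\<in>G. d i *C g i)"
      unfolding T_def by blast
    have "x = (\<Sum>i\<in>F \<union> G. (if i \<in> F then c i else 0) *C g i)" unfolding h by (rule sum.mono_neutral_cong_left) (use h in auto)
    moreover have "y = (\<Sum>i\<in>F \<union> G. (if i \<in> G then d i else 0) *C g i)" unfolding h by (rule sum.mono_neutral_cong_left) (use h in auto)
    ultimately have "x + y = (\<Sum>i\<in>F \<union> G. ((if i \<in> F then c i else 0) + (if i \<in> G then d i else 0)) *C g i)"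
      by (simp only: scaleC_add_left sum.distrib)
    thus "x + y \<in> T" unfolding T_def using h(1,2,4,5)
      by (intro CollectI exI[of _ "F \<union> G"] exI[of _ "%i. (if i \<in> F then c i else 0) + (if i \<in> G then d i else 0)"] conjI) auto
  next
    fix a x assume "x \<in> T"
    then obtain F c where h: "finite F" "F \<subseteq> I" "x = (\<Sum>i\<in>F. c i *C g i)" unfolding T_def by blast
    have "a *C x = (\<Sum>i\<in>F. (a * c i) *C g i)" unfolding h bounded_bilinear.sum_right[OF bounded_bilinear_scaleC] by (simp add: scaleC_scaleC)
    thus "a *C x \<in> T" unfolding T_def using h(1,2) by (intro CollectI exI[of _ F] exI[of _ "%i. a * c i"] conjI)
  qed
  moreover have "g ` I \<subseteq> T"
  proof
    fix x assume "x \<in> g ` I"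
    then obtain i where "i \<in> I" "x = g i" by blast
    thus "x \<in> T" unfolding T_def by (intro CollectI exI[of _ "{i}"] exI[of _ "%_. 1"]) auto
  qed
  ultimately have "v \<in> T" using assms cspan_minimal by blast
  thus ?thesis unfolding T_def by blast
qed

lemma csubspace_orth_left: "csubspace {x. \<forall>s\<in>S. cinner x s = 0}" by (auto simp: csubspace_def ch.ip_add_left ch.ip_sc_left)

lemma closed_orth_left: "closed {x::'a::chilbert_space. \<forall>s\<in>S. cinner x s = 0}"
proof -
  have "closed {x::'a. cinner x s = 0}" for s by (intro closed_Collect_eq continuous_on_cinner continuous_on_id continuous_on_const)
  moreover have "{x. \<forall>s\<in>S. cinner x s = 0} = (\<Inter>s\<in>S. {x. cinner x s = 0})" by auto
  ultimately show ?thesis by auto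
qed

lemma orth_closure_cspan:
  assumes "\<And>s. s \<in> S ==> cinner s x = 0" "y \<in> closure (cspan S)" shows "cinner y x = 0"
proof -
  have "cspan S \<subseteq> {y. \<forall>s\<in>{x}. cinner y s = 0}" using assms by (intro cspan_minimal csubspace_orth_left) auto
  hence "closure (cspan S) \<subseteq> {y. \<forall>s\<in>{x}. cinner y s = 0}" by (rule closure_minimal) (rule closed_orth_left)
  thus ?thesis using assms by auto
qed

lemma parallelogram: "(norm (x + y))\<^sup>2 + (norm (x - y))\<^sup>2 = 2 * (norm x)\<^sup>2 + 2 * (norm (y::'a::chilbert_space))\<^sup>2"
  using ch.sn_expand[of x 1 y] ch.sn_expand[of x "-1" y] by (simp add: ch.sc_minus)

text \<open>A minimizing sequence for the distance from \<open>x\<close> is Cauchy by the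
  parallelogram law, because midpoints stay in \<open>S\<close>. Its limit leaves an orthogonal
  remainder, because moving it along any \<open>y\<close> in \<open>S\<close> cannot decrease the
  distance.\<close>

theorem projection_exists:
  fixes S :: "'a::chilbert_space set" assumes S: "csubspace S" "closed S" shows "\<exists>p\<in>S. \<forall>y\<in>S. cinner y (x - p) = 0"
proof -
  define D where "D = (%s. (norm (x - s))\<^sup>2) ` S"
  define d where "d = Inf D"
  have D: "D \<noteq> {}" "bdd_below D" unfolding D_def using csubspace_0[OF S(1)] by (auto intro!: bdd_belowI[of _ 0])
  have dle: "d <= (norm (x - s))\<^sup>2" if "s \<in> S" for s unfolding d_def using that D by (intro cInf_lower) (auto simp: D_def)
  have "\<exists>s\<in>S. (norm (x - s))\<^sup>2 < d + 1 / real (Suc n)" for n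
    using cInf_lessD[OF D(1), of "d + 1 / real (Suc n)"] unfolding d_def D_def by auto
  then obtain s where s: "\<And>n. s n \<in> S" "\<And>n. (norm (x - s n))\<^sup>2 < d + 1 / real (Suc n)" by metis
  have est: "(norm (s m - s n))\<^sup>2 <= 2 / real (Suc m) + 2 / real (Suc n)" for m n
  proof -
    have "(norm ((x - s m) + (x - s n)))\<^sup>2 + (norm ((x - s m) - (x - s n)))\<^sup>2 = 2 * (norm (x - s m))\<^sup>2 + 2 * (norm (x - s n))\<^sup>2"
      by (rule parallelogram)
    moreover have "(norm ((x - s m) + (x - s n)))\<^sup>2 = 4 * (norm (x - (1/2) *C (s m + s n)))\<^sup>2"
    proof -
      have "2 *C (1/2) *C z = z" for z :: 'a by (simp add: scaleC_scaleC)
      hence "(x - s m) + (x - s n) = 2 *C (x - (1/2) *C (s m + s n))" using scaleC_add_left[of 1 1 x] by (simp add: ch.sc_diff)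
      thus ?thesis by (simp add: norm_scaleC power_mult_distrib)
    qed
    moreover have "d <= (norm (x - (1/2) *C (s m + s n)))\<^sup>2" by (intro dle csubspace_scale csubspace_add S s)
    moreover have "(norm ((x - s m) - (x - s n)))\<^sup>2 = (norm (s m - s n))\<^sup>2" by (simp add: norm_minus_commute)
    ultimately show ?thesis using s(2)[of m] s(2)[of n] by simp
  qed
  have "Cauchy s"
  proof (rule metric_CauchyI)
    fix e :: real assume e: "0 < e"
    obtain N where N: "4 / e\<^sup>2 < real N" using reals_Archimedean2 by blast
    have N0: "real N > 0" using N e by (meson divide_pos_pos less_trans zero_less_numeral zero_less_power)
    show "\<exists>M. \<forall>m\<ge>M. \<forall>n\<ge>M. dist (s m) (s n) < e"
    proof (intro exI[of _ N] allI impI)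
      fix m n assume mn: "N <= m" "N <= n"
      have "1 / real (Suc m) <= 1 / real N" "1 / real (Suc n) <= 1 / real N" using mn N0 by (auto intro!: divide_left_mono)
      hence "(norm (s m - s n))\<^sup>2 <= 4 / real N" using est[of m n] by simp
      also have "\<dots> < e\<^sup>2" using N N0 e by (simp add: field_simps)
      finally show "dist (s m) (s n) < e" using e by (simp add: dist_norm power2_less_imp_less)
    qed
  qed
  then obtain p where p: "s \<longlonglongrightarrow> p" using convergent_eq_Cauchy by blast
  have pS: "p \<in> S" using closed_sequentially[OF S(2) s(1) p] .
  have "(%n. (norm (x - s n))\<^sup>2) \<longlonglongrightarrow> (norm (x - p))\<^sup>2" by (intro tendsto_intros p)
  moreover have "(%n. d + 1 / real (Suc n)) \<longlonglongrightarrow> d + 0"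
    by (intro tendsto_intros) (use LIMSEQ_inverse_real_of_nat in \<open>simp add: inverse_eq_divide\<close>)
  ultimately have pd: "(norm (x - p))\<^sup>2 <= d" by (intro LIMSEQ_le[of _ _ "%n. d + 1 / real (Suc n)"]) (use s(2) less_imp_le in auto)
  have "cinner y (x - p) = 0" if y: "y \<in> S" for y
  proof (rule ccontr)
    define z where "z = cinner (x - p) y"
    assume "cinner y (x - p) \<noteq> 0"
    hence z0: "(cmod z)\<^sup>2 > 0" unfolding z_def using cinner_0_commute[of y "x - p"] by simp
    have *: "0 <= - 2 * t * (cmod z)\<^sup>2 + t\<^sup>2 * (cmod z)\<^sup>2 * (norm y)\<^sup>2" for t :: real
    proof -
      \<comment> \<open>The phase of \<open>c\<close> makes the first-order term of the squared
        distance equal to \<open>- 2 * t * (cmod z)^2\<close>.\<close>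
      define c where "c = - (complex_of_real t) * cnj z"
      have "d <= (norm (x - (p - c *C y)))\<^sup>2" by (intro dle csubspace_diff csubspace_scale S pS y)
      also have "x - (p - c *C y) = (x - p) + c *C y" by simp
      also have "(norm \<dots>)\<^sup>2 = (norm (x - p))\<^sup>2 + 2 * Re (c * z) + (cmod c)\<^sup>2 * (norm y)\<^sup>2" unfolding z_def by (rule ch.sn_expand)
      also have "Re (c * z) = - t * (cmod z)\<^sup>2"
        unfolding c_def by (metis (no_types, opaque_lifting) Re_complex_of_real complex_norm_square minus_mult_left mult.assoc mult.commute of_real_minus of_real_mult)
      finally show ?thesis using pd by (simp add: c_def norm_mult power_mult_distrib)
    qed
    define B where "B = (norm y)\<^sup>2"
    have B: "B >= 0" by (simp add: B_def)
    \<comment> \<open>Any positive \<open>t\<close> with \<open>t * B < 2\<close> makes the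
      quadratic expression negative; adding 1 in the denominator secures this without a case
      distinction on \<open>B\<close>.\<close>
    define t where "t = 1 / (B + 1)"
    have t: "t > 0" "t * B < 1" using B by (auto simp: t_def)
    have "- 2 * t * (cmod z)\<^sup>2 + t\<^sup>2 * (cmod z)\<^sup>2 * B = (t * (cmod z)\<^sup>2) * (t * B - 2)" by (simp add: power2_eq_square algebra_simps)
    moreover have "(t * (cmod z)\<^sup>2) * (t * B - 2) < 0" using t z0 by (intro mult_pos_neg) auto
    ultimately show False using *[of t] unfolding B_def by linarith
  qed
  thus ?thesis using pS by blast
qed

text \<open>The remainder of \<open>x\<close> after projection onto the closed span is orthogonal to
  \<open>S\<close>, so the hypothesis forces it to vanish.\<close>

lemma dense_if_total:
  assumes "\<And>x. (\<And>s. s \<in> S ==> cinner s x = 0) ==> x = 0" shows "closure (cspan S) = UNIV"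
proof -
  have "x \<in> closure (cspan S)" for x
  proof -
    obtain p where p: "p \<in> closure (cspan S)" "\<And>y. y \<in> closure (cspan S) ==> cinner y (x - p) = 0"
      using projection_exists[OF csubspace_closure[OF csubspace_cspan] closed_closure, of S x] by blast
    have "x - p = 0" by (rule assms, rule p(2)) (use closure_subset cspan_superset in blast)
    thus ?thesis using p by simp
  qed
  thus ?thesis by blast
qed

lemma total_if_dense:
  assumes "closure (cspan S) = UNIV" "\<And>s. s \<in> S ==> cinner s x = cinner s y" shows "x = y"
proof -
  have "cinner (x - y) (x - y) = 0" by (rule orth_closure_cspan[of S]) (use assms in \<open>auto simp: ch.ip_diff\<close>)
  thus ?thesis by (simp add: cinner_eq_0_iff)
qed

subsection \<open>Bounded operators and adjoints\<close>

lemma bounded_clinearI: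
  assumes "\<And>x y. T (x + y) = T x + T y" "\<And>c x. T (c *C x) = c *C T x" "\<And>x. norm (T x) <= C * norm x" shows "bc T"
  unfolding bounded_clinear_def using assms by (auto simp: scaleR_scaleC mult.commute intro!: bounded_linear_intro[of _ C])

lemma bounded_clinear_bounded_linear: "bc T ==> bounded_linear T" by (simp add: bounded_clinear_def)

lemma bc_add: "bc T ==> T (x + y) = T x + T y" and bc_diff: "bc T ==> T (x - y) = T x - T y" and bc_zero: "bc T ==> T 0 = 0"
  and bc_sum: "bc T ==> T (\<Sum>i\<in>F. f i) = (\<Sum>i\<in>F. T (f i))" and bc_scale: "bc T ==> T (c *C x) = c *C T x"
  by (auto simp: bounded_clinear_def linear_simps bounded_linear.linear linear_sum)

lemma bc_bound: assumes "bc T" obtains C where "0 <= C" "\<And>x. norm (T x) <= C * norm x"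
  using bounded_linear.nonneg_bounded[OF bounded_clinear_bounded_linear[OF assms]] by (auto simp: mult.commute)

lemma bc_onorm: "bc T ==> norm (T x) <= onorm T * norm x" by (rule onorm) (rule bounded_clinear_bounded_linear)

lemma bc_continuous_on: "bc T ==> continuous_on S T" by (intro linear_continuous_on bounded_clinear_bounded_linear)

lemma bc_tendsto: "bc T ==> (f \<longlongrightarrow> x) F' ==> ((%n. T (f n)) \<longlongrightarrow> T x) F'" by (rule bounded_linear.tendsto[OF bounded_clinear_bounded_linear])

lemma bc_compose: "bc T ==> bc S ==> bc (T o S)" unfolding bounded_clinear_def by (auto simp: o_def bounded_linear_compose)

lemma bc_id [simp]: "bc id" and bc_ident [simp]: "bc (%x. x)" by (auto intro!: bounded_clinearI[of _ 1])

lemma bc_const0 [simp]: "bc (%x. 0)" by (auto intro!: bounded_clinearI[of _ 0])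

lemma bc_plus: "bc T ==> bc S ==> bc (%x. T x + S x)" unfolding bounded_clinear_def by (auto simp: bounded_linear_add scaleC_add_right)

lemma bc_minus: "bc T ==> bc S ==> bc (%x. T x - S x)" unfolding bounded_clinear_def by (auto simp: bounded_linear_sub ch.sc_diff)

lemma bc_scaled: "bc T ==> bc (%x. c *C T x)" unfolding bounded_clinear_def
  by (auto simp: bounded_linear_compose[OF bounded_bilinear.bounded_linear_right[OF bounded_bilinear_scaleC]] scaleC_scaleC mult.commute)

lemma bc_sums: "(\<And>i. i \<in> F ==> bc (T i)) ==> bc (%x. \<Sum>i\<in>F. T i x)" by (induction F rule: infinite_finite_induct) (auto intro: bc_plus)

lemma bounded_clinear_cinner: "bc (cinner x)" by (rule bounded_clinearI[of _ "norm x"])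
    (auto simp: cinner_add_right cinner_scaleC_right scaleC_complex_def ch.cauchy_schwarz)

text \<open>The kernel of \<open>f\<close> is closed, and any \<open>x0\<close> outside it leaves a
  nonzero component \<open>w\<close> orthogonal to it. Subtracting from \<open>x\<close> the
  multiple of \<open>w\<close> that carries the value \<open>f x\<close> lands in the kernel, which
  determines \<open>f\<close>.\<close>

theorem riesz:
  fixes f :: "'a::chilbert_space => complex" assumes f: "bc f" shows "\<exists>z. \<forall>x. f x = cinner z x"
proof (cases "\<forall>x. f x = 0")
  case True
  thus ?thesis by (intro exI[of _ 0]) simp
next
  case False
  then obtain x0 where x0: "f x0 \<noteq> 0" by blast
  define N where "N = {x. f x = 0}"
  have N: "csubspace N" unfolding N_def csubspace_def by (auto simp: bc_zero[OF f] bc_add[OF f] bc_scale[OF f])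
  have "closed N" unfolding N_def by (intro closed_Collect_eq bc_continuous_on f continuous_on_const)
  then obtain p where p: "p \<in> N" "\<And>y. y \<in> N ==> cinner y (x0 - p) = 0" using projection_exists[OF N, of x0] by blast
  define w where "w = x0 - p"
  have fw: "f w \<noteq> 0" using x0 p(1) by (simp add: w_def bc_diff[OF f] N_def)
  have w0: "cinner w w \<noteq> 0" using fw bc_zero[OF f] by (auto simp: cinner_eq_0_iff)
  have "f x = cinner (cnj (f w / cinner w w) *C w) x" for x
  proof -
    have "x - (f x / f w) *C w \<in> N" using fw by (simp add: N_def bc_diff[OF f] bc_scale[OF f] scaleC_complex_def)
    hence "cinner (x - (f x / f w) *C w) w = 0" using p(2) unfolding w_def by blast
    hence "cinner w (x - (f x / f w) *C w) = 0" using cinner_0_commute by blast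
    hence "cinner w x = f x / f w * cinner w w" by (simp add: ch.ip_diff cinner_scaleC_right)
    thus ?thesis using fw w0 by (simp add: ch.ip_sc_left)
  qed
  thus ?thesis by blast
qed

lemma cadj_ex:
  fixes T :: "'a::chilbert_space => 'b::chilbert_space" assumes T: "bc T" shows "\<exists>!S. \<forall>x y. cinner (S y) x = cinner y (T x)"
proof -
  have "\<exists>z. \<forall>x. cinner y (T x) = cinner z x" for y using riesz[OF bc_compose[OF bounded_clinear_cinner T], of y] by simp
  then obtain S where S: "\<And>y x. cinner y (T x) = cinner (S y) x" by metis
  show ?thesis
  proof (rule ex1I[of _ S])
    show "\<forall>x y. cinner (S y) x = cinner y (T x)" by (intro allI) (rule S[symmetric])
    fix S' assume "\<forall>x y. cinner (S' y) x = cinner y (T x)"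
    hence "cinner (S' y) x = cinner (S y) x" for x y by (simp only: S)
    thus "S' = S" by (intro ext) (rule cinner_ext_left)
  qed
qed

lemma cadj_left: assumes "bc T" shows "cinner (cadj T y) x = cinner y (T x)"
proof -
  have "\<forall>x y. cinner (cadj T y) x = cinner y (T x)" unfolding cadj_def by (rule theI'[OF cadj_ex[OF assms]])
  thus ?thesis by blast
qed

lemma cadj_right: "bc T ==> cinner x (cadj T y) = cinner (T x) y" by (subst (1 2) cinner_commute) (simp add: cadj_left)

lemma cadj_eqI:
  assumes "bc T" "\<And>x y. cinner (S y) x = cinner y (T x)" shows "cadj T = S"
  by (rule ext, rule cinner_ext_left) (simp only: cadj_left[OF assms(1)] assms(2))

lemma norm_cadj_le:
  assumes "bc T" "0 <= C" "\<And>x. norm (T x) <= C * norm x" shows "norm (cadj T y) <= C * norm y"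
proof (cases "cadj T y = 0")
  case True
  thus ?thesis using assms by simp
next
  case False
  have "(norm (cadj T y))\<^sup>2 = Re (cinner y (T (cadj T y)))" by (simp add: norm_sq_cinner cadj_left assms)
  also have "\<dots> <= norm y * norm (T (cadj T y))" using ch.cauchy_schwarz complex_Re_le_cmod order_trans by blast
  also have "\<dots> <= norm y * (C * norm (cadj T y))" by (intro mult_left_mono assms) simp
  finally have "norm (cadj T y) * norm (cadj T y) <= (C * norm y) * norm (cadj T y)" by (simp add: power2_eq_square mult_ac)
  thus ?thesis using False by simp
qed

lemma bc_cadj: assumes T: "bc T" shows "bc (cadj T)"
proof -
  obtain C where C: "0 <= C" "\<And>x. norm (T x) <= C * norm x" using bc_bound[OF T] by blast
  show ?thesis
  proof (rule bounded_clinearI[of _ C])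
    show "cadj T (x + y) = cadj T x + cadj T y" for x y by (rule cinner_ext_left) (simp add: cadj_left[OF T] ch.ip_add_left)
    show "cadj T (c *C x) = c *C cadj T x" for c x by (rule cinner_ext_left) (simp add: cadj_left[OF T] ch.ip_sc_left)
    show "norm (cadj T x) <= C * norm x" for x by (intro norm_cadj_le T C)
  qed
qed

lemma cadj_cadj: "bc T ==> cadj (cadj T) = T" by (intro cadj_eqI bc_cadj) (simp_all add: cadj_right)

lemma cadj_comp: "bc T ==> bc S ==> cadj (T o S) = cadj S o cadj T" by (intro cadj_eqI bc_compose) (auto simp: cadj_left)

lemma cadj_id [simp]: "cadj id = id" by (intro cadj_eqI) auto

lemma orth_decomp_bound:
  assumes "cinner p (x - p) = (0::complex)" shows "norm p <= norm x"
proof -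
  have "(norm p)\<^sup>2 + (norm (x - p))\<^sup>2 = (norm x)\<^sup>2" using pythagoras[OF assms] by simp
  hence "(norm p)\<^sup>2 <= (norm x)\<^sup>2" by (metis le_add_same_cancel1 zero_le_power2)
  thus ?thesis by (rule power2_le_imp_le) simp
qed

text \<open>The operator is given by its graph. The bound survives closure of the graph, makes the
  closed graph single-valued and its domain closed; the projection theorem then extends by zero on
  the orthogonal complement, as the definite descriptions of partial isometries demand.\<close>

theorem extension_of_relation:
  fixes R :: "('a::chilbert_space \<times> 'b::chilbert_space) set"
  assumes R: "csubspace R" and C: "0 <= C" and bd: "\<forall>v w. (v, w) \<in> R --> norm w <= C * norm v"
  shows "\<exists>T. bc T \<and> (\<forall>v w. (v, w) \<in> R --> T v = w) \<and> (\<forall>x. norm (T x) <= C * norm x) \<and>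
    (\<forall>x. (\<forall>v w. (v, w) \<in> R --> cinner v x = 0) --> T x = 0)"
proof -
  define R' where "R' = closure R"
  have R': "csubspace R'" "closed R'" "R \<subseteq> R'" unfolding R'_def by (auto intro: csubspace_closure R set_mp[OF closure_subset])
  have "closed {z::'a \<times> 'b. norm (snd z) <= C * norm (fst z)}"
    by (rule closed_Collect_le) (rule continuous_on_norm[OF continuous_on_snd[OF continuous_on_id]], rule continuous_on_mult[OF continuous_on_const continuous_on_norm[OF continuous_on_fst[OF continuous_on_id]]])
  hence "R' \<subseteq> {z. norm (snd z) <= C * norm (fst z)}" unfolding R'_def by (rule closure_minimal[rotated]) (use bd in auto)
  hence bd': "(v, w) \<in> R' ==> norm w <= C * norm v" for v w by auto
  define D where "D = fst ` R'"
  have D: "csubspace D" unfolding csubspace_def D_def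
  proof (intro conjI ballI allI)
    show "0 \<in> fst ` R'" using csubspace_0[OF R'(1)] by force
    show "x \<in> fst ` R' ==> y \<in> fst ` R' ==> x + y \<in> fst ` R'" for x y using csubspace_add[OF R'(1)] by (force simp: image_iff)
    show "x \<in> fst ` R' ==> c *C x \<in> fst ` R'" for c x
    proof (elim imageE)
      fix z assume "x = fst z" "z \<in> R'"
      thus ?thesis using csubspace_scale[OF R'(1), of z c] by (intro image_eqI[of _ fst "c *C z"]) auto
    qed
  qed
  have "subspace R'" using csubspace_0[OF R'(1)] csubspace_add[OF R'(1)] csubspace_scale[OF R'(1)] by (simp add: subspace_def scaleR_scaleC)
  \<comment> \<open>On the closed graph the first coordinate is bounded below, so its image
    \<open>D\<close> is complete and hence closed.\<close>
  moreover have "\<forall>z\<in>R'. norm (fst z) >= 1 / (1 + C) * norm z"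
  proof
    fix z assume "z \<in> R'"
    hence "norm (snd z) <= C * norm (fst z)" using bd'[of "fst z" "snd z"] by simp
    hence "norm z <= (1 + C) * norm (fst z)" using norm_Pair_le[of "fst z" "snd z"] by (simp add: algebra_simps)
    thus "norm (fst z) >= 1 / (1 + C) * norm z" using C by (simp add: pos_divide_le_eq mult.commute)
  qed
  ultimately have "complete D" unfolding D_def
    using C R'(2) by (intro complete_isometric_image[of "1 / (1 + C)"] bounded_linear_fst) (simp_all add: complete_eq_closed)
  hence "closed D" by (simp add: complete_eq_closed)
  \<comment> \<open>The graph of the extension by zero: \<open>w\<close> is the value at the
    projection \<open>p\<close> of \<open>x\<close> onto \<open>D\<close>.\<close>
  define Q where "Q x w \<longleftrightarrow> (\<exists>p. (p, w) \<in> R' \<and> (\<forall>y\<in>D. cinner y (x - p) = 0))" for x w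
  have ex: "\<exists>w. Q x w" for x
  proof -
    obtain p where p: "p \<in> D" "\<forall>y\<in>D. cinner y (x - p) = 0" using projection_exists[OF D \<open>closed D\<close>, of x] by blast
    obtain z where "z \<in> R'" "p = fst z" using p(1) unfolding D_def by blast
    thus ?thesis using p unfolding Q_def by (intro exI[of _ "snd z"] exI[of _ p]) simp
  qed
  have add: "Q (x + y) (w + w')" if "Q x w" "Q y w'" for x y w w'
  proof -
    obtain p p' where p: "(p, w) \<in> R'" "\<forall>y\<in>D. cinner y (x - p) = 0" "(p', w') \<in> R'" "\<forall>z\<in>D. cinner z (y - p') = 0"
      using \<open>Q x w\<close> \<open>Q y w'\<close> unfolding Q_def by blast
    have "(p + p', w + w') \<in> R'" using csubspace_add[OF R'(1) p(1) p(3)] by simp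
    moreover have "\<forall>z\<in>D. cinner z (x + y - (p + p')) = 0" using p by (simp add: ch.ip_diff cinner_add_right)
    ultimately show ?thesis unfolding Q_def by blast
  qed
  have scale: "Q (c *C x) (c *C w)" if "Q x w" for c x w
  proof -
    obtain p where p: "(p, w) \<in> R'" "\<forall>y\<in>D. cinner y (x - p) = 0" using \<open>Q x w\<close> unfolding Q_def by blast
    have "(c *C p, c *C w) \<in> R'" using csubspace_scale[OF R'(1) p(1), of c] by (simp add: scaleC_prod_def)
    moreover have "\<forall>z\<in>D. cinner z (c *C x - c *C p) = 0" using p by (simp add: ch.sc_diff[symmetric] cinner_scaleC_right)
    ultimately show ?thesis unfolding Q_def by blast
  qed
  have bdQ: "norm w <= C * norm x" if "Q x w" for x w
  proof -
    obtain p where p: "(p, w) \<in> R'" "\<forall>y\<in>D. cinner y (x - p) = 0" using \<open>Q x w\<close> unfolding Q_def by blast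
    have "p \<in> D" unfolding D_def using p by force
    hence "norm p <= norm x" using p(2) by (intro orth_decomp_bound) blast
    thus ?thesis using bd'[OF p(1)] C by (meson mult_left_mono order_trans)
  qed
  have uniq: "w = w'" if "Q x w" "Q x w'" for x w w'
  proof -
    have "Q (x + (-1) *C x) (w + (-1) *C w')" by (intro add scale that)
    hence "norm (w + (-1) *C w') <= C * norm (x + (-1) *C x)" by (rule bdQ)
    thus ?thesis by (simp add: ch.sc_minus)
  qed
  define T where "T x = (THE w. Q x w)" for x
  have QT: "Q x (T x)" for x unfolding T_def by (rule theI') (use ex uniq in blast)
  have TQ: "Q x w ==> T x = w" for x w using uniq QT by blast
  show ?thesis
  proof (intro exI[of _ T] conjI allI impI)
    show "bc T" by (rule bounded_clinearI[of _ C]) (auto intro!: TQ add scale QT bdQ)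
    show "norm (T x) <= C * norm x" for x by (rule bdQ) (rule QT)
    show "T v = w" if "(v, w) \<in> R" for v w by (rule TQ) (use that R' in \<open>auto simp: Q_def intro!: exI[of _ v]\<close>)
    show "T x = 0" if o: "\<forall>v w. (v, w) \<in> R --> cinner v x = 0" for x
    proof (rule TQ)
      have "cinner y x = 0" if y: "y \<in> D" for y
      proof -
        obtain w where "(y, w) \<in> R'" using y unfolding D_def by force
        moreover have "closed {z::'a \<times> 'b. cinner (fst z) x = 0}"
          by (rule closed_Collect_eq) (rule continuous_on_cinner[OF continuous_on_fst[OF continuous_on_id] continuous_on_const], rule continuous_on_const)
        hence "R' \<subseteq> {z. cinner (fst z) x = 0}" unfolding R'_def by (rule closure_minimal[rotated]) (use o in auto)
        ultimately show ?thesis by auto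
      qed
      thus "Q x 0" unfolding Q_def using csubspace_0[OF R'(1)] by (intro exI[of _ 0]) (auto simp: zero_prod_def)
    qed
  qed
qed

text \<open>The span of the pairs \<open>(g i, d i)\<close> serves as graph. Consistency on linearly
  dependent generators is contained in the bound, as the case where the combination of the
  \<open>g i\<close> is zero.\<close>

theorem extension_from_generators:
  fixes g :: "'i => 'a::chilbert_space" and d :: "'i => 'b::chilbert_space" assumes C: "0 <= C"
    and bd: "\<And>F c. finite F ==> F \<subseteq> I ==> norm (\<Sum>i\<in>F. c i *C d i) <= C * norm (\<Sum>i\<in>F. c i *C g i)"
  shows "\<exists>T. bc T \<and> (\<forall>i\<in>I. T (g i) = d i) \<and> (\<forall>x. norm (T x) <= C * norm x) \<and>
    (\<forall>x. (\<forall>i\<in>I. cinner (g i) x = 0) --> T x = 0)"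
proof -
  define R where "R = cspan ((%i. (g i, d i)) ` I)"
  have comb: "\<exists>F c. finite F \<and> F \<subseteq> I \<and> v = (\<Sum>i\<in>F. c i *C g i) \<and> w = (\<Sum>i\<in>F. c i *C d i)"
    if vw: "(v, w) \<in> R" for v w
  proof -
    obtain F c where h: "finite F" "F \<subseteq> I" "(v, w) = (\<Sum>i\<in>F. c i *C (g i, d i))" using cspan_finite[OF vw[unfolded R_def]] by blast
    have "v = (\<Sum>i\<in>F. c i *C g i)" using arg_cong[OF h(3), of fst] by (simp add: fst_sum)
    moreover have "w = (\<Sum>i\<in>F. c i *C d i)" using arg_cong[OF h(3), of snd] by (simp add: snd_sum)
    ultimately show ?thesis using h(1,2) by (intro exI[of _ F] exI[of _ c] conjI)
  qed
  have R: "csubspace R" unfolding R_def by (rule csubspace_cspan)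
  have bdR: "\<forall>v w. (v, w) \<in> R --> norm w <= C * norm v"
  proof (intro allI impI)
    fix v w assume vw: "(v, w) \<in> R"
    obtain F c where h: "finite F" "F \<subseteq> I" "v = (\<Sum>i\<in>F. c i *C g i)" "w = (\<Sum>i\<in>F. c i *C d i)" using comb[OF vw] by (elim exE conjE)
    show "norm w <= C * norm v" unfolding h(3,4) by (rule bd[OF h(1,2)])
  qed
  obtain T where T: "bc T" "\<forall>v w. (v, w) \<in> R --> T v = w" "\<forall>x. norm (T x) <= C * norm x"
    "\<forall>x. (\<forall>v w. (v, w) \<in> R --> cinner v x = 0) --> T x = 0" using extension_of_relation[OF R C bdR] by (elim exE conjE)
  show ?thesis
  proof (intro exI[of _ T] conjI allI impI ballI)
    show "bc T" by fact
    show "norm (T x) <= C * norm x" for x using T(3) by blast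
    show "T (g i) = d i" if i: "i \<in> I" for i
    proof -
      have "(g i, d i) \<in> R" unfolding R_def using i by (intro cspan_base) auto
      thus ?thesis using T(2) by blast
    qed
    show "T x = 0" if h: "\<forall>i\<in>I. cinner (g i) x = 0" for x
    proof (rule T(4)[rule_format])
      fix v w assume vw: "(v, w) \<in> R"
      obtain F c where F: "F \<subseteq> I" "v = (\<Sum>i\<in>F. c i *C g i)" using comb[OF vw] by (elim exE conjE)
      show "cinner v x = 0" unfolding F(2) cinner_sum_left ch.ip_sc_left by (rule sum.neutral) (use F(1) h in auto)
    qed
  qed
qed

text \<open>Equal Gram matrices give equal norms of all finite combinations. The flip, rearranging,
  splitting and shift operators all arise in this way.\<close>

theorem isometry_from_generators:
  fixes g :: "'i => 'a::chilbert_space" and d :: "'i => 'b::chilbert_space"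
  assumes ip: "\<And>i j. i \<in> I ==> j \<in> I ==> cinner (d i) (d j) = cinner (g i) (g j)"
  shows "\<exists>T. bc T \<and> (\<forall>i\<in>I. T (g i) = d i) \<and> (\<forall>x. norm (T x) <= 1 * norm x) \<and>
    (\<forall>x. (\<forall>i\<in>I. cinner (g i) x = 0) --> T x = 0)"
proof (rule extension_from_generators[OF zero_le_one])
  fix F c assume F: "finite F" "F \<subseteq> I"
  have "cinner (\<Sum>i\<in>F. c i *C d i) (\<Sum>i\<in>F. c i *C d i) = cinner (\<Sum>i\<in>F. c i *C g i) (\<Sum>i\<in>F. c i *C g i)" unfolding cinner_lincomb
  proof (intro sum.cong refl)
    fix i j assume "i \<in> F" "j \<in> F"
    hence "cinner (d i) (d j) = cinner (g i) (g j)" using F by (intro ip) auto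
    thus "cnj (c i) * c j * cinner (d i) (d j) = cnj (c i) * c j * cinner (g i) (g j)" by simp
  qed
  hence "(norm (\<Sum>i\<in>F. c i *C d i))\<^sup>2 = (norm (\<Sum>i\<in>F. c i *C g i))\<^sup>2" by (simp only: norm_sq_cinner)
  thus "norm (\<Sum>i\<in>F. c i *C d i) <= 1 * norm (\<Sum>i\<in>F. c i *C g i)" by (simp add: power2_eq_iff_nonneg)
qed

lemma bc_eq_on_total:
  assumes "bc T" "bc S" "closure (cspan G) = UNIV" "\<And>g. g \<in> G ==> T g = S g" shows "T = S"
proof
  fix x
  have "cspan G \<subseteq> {x. T x = S x}" by (rule cspan_minimal) (use assms in \<open>auto simp: csubspace_def bc_zero bc_add bc_scale\<close>)
  hence "closure (cspan G) \<subseteq> {x. T x = S x}" by (rule closure_minimal) (intro closed_Collect_eq bc_continuous_on assms)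
  thus "T x = S x" using assms by auto
qed

subsection \<open>Tensor products\<close>

lemma pform_expand_left:
  "pform p q = (\<Sum>y\<in>Poly_Mapping.keys p. cnj (Poly_Mapping.lookup p y) * pform (Poly_Mapping.single y 1) q)"
  unfolding pform_def by (simp add: sum_distrib_left mult.assoc)

lemma scauchy_const [simp]: "pf.scauchy (%_. p)" by (simp add: pf.scauchy_def)

text \<open>A vector orthogonal to all generators is orthogonal to every constant sequence, that is,
  to the uncompleted space, and elements of that space approximate the vector itself.\<close>

lemma hgen_total: "closure (cspan (range (hgen :: 'a::pdkernel => _))) = UNIV"
proof (rule dense_if_total)
  fix x :: "'a hcompl" assume o: "\<And>s. s \<in> range hgen ==> cinner s x = 0"
  obtain X where X: "x = abs_hcompl X" "hrel X X" by (rule hcompl_rep)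
  have sX: "pf.scauchy X" using X(2) by (rule hrel_scauchy)
  have lim: "(%n. pform p (X n)) \<longlonglongrightarrow> cinner (abs_hcompl (%_. p)) x" for p
  proof -
    have "cinner (abs_hcompl (%_. p)) x = lim (%n. pform p (X n))"
      unfolding X(1) cinner_hcompl_def by (simp add: hc_cinner.abs_eq hrel_refl sX)
    thus ?thesis using pf.scauchy_ip[OF scauchy_const[of p] sX] by (simp add: convergent_LIMSEQ_iff)
  qed
  have z: "(%n. pform (Poly_Mapping.single y 1) (X n)) \<longlonglongrightarrow> 0" for y
    using lim[of "Poly_Mapping.single y 1"] o[of "hgen y"] by (simp add: hgen.abs_eq)
  have 0: "cinner (abs_hcompl (%_. p)) x = 0" for p
  proof -
    have "(%n. pform p (X n)) \<longlonglongrightarrow> (\<Sum>y\<in>Poly_Mapping.keys p. cnj (Poly_Mapping.lookup p y) * 0)"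
      unfolding pform_expand_left[of p] by (intro tendsto_sum tendsto_mult tendsto_const z)
    thus ?thesis using LIMSEQ_unique lim by fastforce
  qed
  have "(%n. cinner (abs_hcompl (%_. X n)) x) \<longlonglongrightarrow> cinner x x"
    using hc_const_lim[OF sX] unfolding X(1) by (intro tendsto_cinner' tendsto_const)
  hence "cinner x x = 0" unfolding 0 using LIMSEQ_unique tendsto_const by blast
  thus "x = 0" by (simp add: cinner_eq_0_iff)
qed

definition tensors :: "('a::chilbert_space, 'b::chilbert_space) htens set" where "tensors = {u \<otimes> v | u v. True}"

lemma tensors_total: "closure (cspan (tensors :: ('a::chilbert_space, 'b::chilbert_space) htens set)) = UNIV"
proof -
  have "range hgen \<subseteq> (tensors :: ('a, 'b) htens set)"
  proof
    fix x :: "('a, 'b) htens" assume "x \<in> range hgen"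
    then obtain t where "x = hgen t" by blast
    thus "x \<in> tensors" by (cases t) (auto simp: tensors_def tens_def)
  qed
  hence "closure (cspan (range hgen)) \<subseteq> closure (cspan (tensors :: ('a, 'b) htens set))" by (intro closure_mono cspan_mono)
  thus ?thesis unfolding hgen_total by blast
qed

lemma cinner_tens_ext:
  assumes "\<And>u v. cinner (u \<otimes> v) x = cinner (u \<otimes> v) y" shows "x = y"
  by (rule total_if_dense[OF tensors_total]) (use assms in \<open>auto simp: tensors_def\<close>)

lemma tens_op_ext:
  assumes "bc T" "bc S" "\<And>u v. T (u \<otimes> v) = S (u \<otimes> v)" shows "T = S"
  by (rule bc_eq_on_total[OF assms(1,2) tensors_total]) (use assms(3) in \<open>auto simp: tensors_def\<close>)

text \<open>Bilinearity is not built into the generators of the tensor product. It holds because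
  both sides have the same inner products with all elementary tensors, which are total.\<close>

lemma tens_add_left: "(u + u') \<otimes> v = u \<otimes> v + u' \<otimes> v" and tens_add_right: "u \<otimes> (v + v') = u \<otimes> v + u \<otimes> v'"
  and tens_scale_left: "(c *C u) \<otimes> v = c *C (u \<otimes> v)" and tens_scale_right: "u \<otimes> (c *C v) = c *C (u \<otimes> v)"
  by (rule cinner_tens_ext; simp add: cinner_tens cinner_add_right cinner_scaleC_right algebra_simps)+

lemma norm_tens: "norm (u \<otimes> v) = norm u * norm v"
proof -
  have "cinner (u \<otimes> v) (u \<otimes> v) = complex_of_real ((norm u * norm v)\<^sup>2)" unfolding cinner_tens by (simp add: cinner_self power_mult_distrib)
  hence "(norm (u \<otimes> v))\<^sup>2 = (norm u * norm v)\<^sup>2" unfolding norm_sq_cinner by simp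
  thus ?thesis by (simp add: power2_eq_iff_nonneg)
qed

lemma tens_zero [simp]: "0 \<otimes> v = 0" "u \<otimes> 0 = 0" using norm_tens[of 0 v] norm_tens[of u 0] by simp_all

lemma bc_tens_left: "bc (%v. u \<otimes> v)" by (rule bounded_clinearI[of _ "norm u"]) (auto simp: tens_add_right tens_scale_right norm_tens)

lemma bc_tens_right: "bc (%u. u \<otimes> v)" by (rule bounded_clinearI[of _ "norm v"]) (auto simp: tens_add_left tens_scale_left norm_tens)

lemma bounded_bilinear_tens: "bounded_bilinear (\<otimes>)"
proof
  show "\<exists>K. \<forall>a b. norm (a \<otimes> b) <= norm a * norm b * K" by (intro exI[of _ 1]) (simp add: norm_tens)
qed (simp_all add: tens_add_left tens_add_right scaleR_scaleC tens_scale_left tens_scale_right)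

lemmas tendsto_tens = bounded_bilinear.tendsto[OF bounded_bilinear_tens]

text \<open>This is the kernel of the form \<open>C^2 - a* a\<close>, which is positive because
  \<open>C\<close> bounds \<open>a\<close>.\<close>

lemma psdon_diff:
  fixes a :: "'a::chilbert_space => 'c::chilbert_space" assumes a: "bc a" "\<And>x. norm (a x) <= C * norm x"
  shows "psdon S (%i j. complex_of_real (C\<^sup>2) * cinner (u i) (u j) - cinner (a (u i)) (a (u j)))" unfolding psdon_def
proof (intro conjI ballI allI)
  fix c
  have "(\<Sum>i\<in>S. \<Sum>j\<in>S. cnj (c i) * c j * (complex_of_real (C\<^sup>2) * cinner (u i) (u j) - cinner (a (u i)) (a (u j))))
    = complex_of_real (C\<^sup>2) * (\<Sum>i\<in>S. \<Sum>j\<in>S. cnj (c i) * c j * cinner (u i) (u j)) - (\<Sum>i\<in>S. \<Sum>j\<in>S. cnj (c i) * c j * cinner (a (u i)) (a (u j)))"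
    by (simp add: sum_distrib_left sum_subtractf algebra_simps)
  also have "\<dots> = complex_of_real (C\<^sup>2) * cinner (\<Sum>i\<in>S. c i *C u i) (\<Sum>i\<in>S. c i *C u i)
     - cinner (\<Sum>i\<in>S. c i *C a (u i)) (\<Sum>i\<in>S. c i *C a (u i))" by (simp only: cinner_lincomb)
  also have "(\<Sum>i\<in>S. c i *C a (u i)) = a (\<Sum>i\<in>S. c i *C u i)" by (simp add: bc_sum[OF a(1)] bc_scale[OF a(1)])
  finally have e: "Re (\<Sum>i\<in>S. \<Sum>j\<in>S. cnj (c i) * c j * (complex_of_real (C\<^sup>2) * cinner (u i) (u j) - cinner (a (u i)) (a (u j))))
    = C\<^sup>2 * (norm (\<Sum>i\<in>S. c i *C u i))\<^sup>2 - (norm (a (\<Sum>i\<in>S. c i *C u i)))\<^sup>2" by (simp add: norm_sq_cinner del: of_real_power)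
  have "(norm (a (\<Sum>i\<in>S. c i *C u i)))\<^sup>2 <= (C * norm (\<Sum>i\<in>S. c i *C u i))\<^sup>2" by (intro power_mono a norm_ge_zero)
  thus "0 <= Re (\<Sum>i\<in>S. \<Sum>j\<in>S. cnj (c i) * c j * (complex_of_real (C\<^sup>2) * cinner (u i) (u j) - cinner (a (u i)) (a (u j))))"
    unfolding e by (simp add: power_mult_distrib)
qed (simp add: cinner_commute[symmetric])

text \<open>The bound is obtained one factor at a time: in the quadratic form, replacing
  \<open>u\<close> by \<open>a u\<close> costs \<open>A^2\<close>, and then replacing
  \<open>v\<close> by \<open>b v\<close> costs \<open>B^2\<close>. Each step is the Schur product
  theorem \<open>psdon_mult\<close> for a kernel from \<open>psdon_diff\<close> and a Gram
  kernel.\<close>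

lemma op_tensor_ex:
  fixes a :: "'a::chilbert_space => 'c::chilbert_space" and b :: "'b::chilbert_space => 'd::chilbert_space"
  assumes a: "bc a" "\<And>x. norm (a x) <= A * norm x" "0 <= A" and b: "bc b" "\<And>x. norm (b x) <= B * norm x" "0 <= B"
  shows "\<exists>T. bc T \<and> (\<forall>i\<in>UNIV. T ((%(u, v). u \<otimes> v) i) = (%(u, v). a u \<otimes> b v) i) \<and>
    (\<forall>x. norm (T x) <= (A * B) * norm x) \<and> (\<forall>x. (\<forall>i\<in>UNIV. cinner ((%(u, v). u \<otimes> v) i) x = 0) --> T x = 0)"
proof (rule extension_from_generators)
  fix F :: "('a \<times> 'b) set" and c assume F: "finite F"
  define Q where "Q K = Re (\<Sum>i\<in>F. \<Sum>j\<in>F. cnj (c i) * c j * K i j)" for K :: "'a \<times> 'b => 'a \<times> 'b => complex"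
  have Qd: "Q (%i j. (complex_of_real r * K i j - L i j) * M i j) = r * Q (%i j. K i j * M i j) - Q (%i j. L i j * M i j)" for K L M r
  proof -
    have "(\<Sum>i\<in>F. \<Sum>j\<in>F. cnj (c i) * c j * ((complex_of_real r * K i j - L i j) * M i j))
      = complex_of_real r * (\<Sum>i\<in>F. \<Sum>j\<in>F. cnj (c i) * c j * (K i j * M i j)) - (\<Sum>i\<in>F. \<Sum>j\<in>F. cnj (c i) * c j * (L i j * M i j))"
      by (simp add: sum_distrib_left sum_subtractf algebra_simps)
    thus ?thesis unfolding Q_def by simp
  qed
  have pos: "psdon F K ==> 0 <= Q K" for K unfolding Q_def psdon_def by blast
  have 1: "0 <= Q (%i j. (complex_of_real (A\<^sup>2) * cinner (fst i) (fst j) - cinner (a (fst i)) (a (fst j))) * cinner (snd i) (snd j))"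
    by (intro pos psdon_mult F psdon_diff a psdon_gram)
  have 2: "0 <= Q (%i j. (complex_of_real (B\<^sup>2) * cinner (snd i) (snd j) - cinner (b (snd i)) (b (snd j))) * cinner (a (fst i)) (a (fst j)))"
    by (intro pos psdon_mult F psdon_diff b psdon_gram)
  define X where "X = Q (%i j. cinner (fst i) (fst j) * cinner (snd i) (snd j))"
  define Y where "Y = Q (%i j. cinner (a (fst i)) (a (fst j)) * cinner (snd i) (snd j))"
  define Z where "Z = Q (%i j. cinner (a (fst i)) (a (fst j)) * cinner (b (snd i)) (b (snd j)))"
  have "Y <= A\<^sup>2 * X" using 1 unfolding Qd X_def Y_def by simp
  moreover have "Z <= B\<^sup>2 * Y" using 2 unfolding Qd Z_def Y_def by (simp add: mult.commute)
  ultimately have "Z <= B\<^sup>2 * (A\<^sup>2 * X)" by (meson mult_left_mono order_trans zero_le_power2)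
  hence "Z <= (A * B)\<^sup>2 * X" by (simp add: power_mult_distrib mult_ac)
  moreover have "(norm (\<Sum>i\<in>F. c i *C (%(u, v). u \<otimes> v) i))\<^sup>2 = X"
    unfolding norm_sq_cinner cinner_lincomb X_def Q_def by (simp add: split_def cinner_tens)
  moreover have "(norm (\<Sum>i\<in>F. c i *C (%(u, v). a u \<otimes> b v) i))\<^sup>2 = Z"
    unfolding norm_sq_cinner cinner_lincomb Z_def Q_def by (simp add: split_def cinner_tens)
  ultimately have "(norm (\<Sum>i\<in>F. c i *C (%(u, v). a u \<otimes> b v) i))\<^sup>2 <= (A * B * norm (\<Sum>i\<in>F. c i *C (%(u, v). u \<otimes> v) i))\<^sup>2"
    by (simp only: power_mult_distrib)
  thus "norm (\<Sum>i\<in>F. c i *C (%(u, v). a u \<otimes> b v) i) <= A * B * norm (\<Sum>i\<in>F. c i *C (%(u, v). u \<otimes> v) i)"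
    by (rule power2_le_imp_le) (use a b in simp)
qed (use a b in simp)

lemma op_tensor_eqI:
  assumes "bc T" "\<And>u v. T (u \<otimes> v) = a u \<otimes> b v" shows "a \<odot> b = T" unfolding op_tensor_def
proof (rule the_equality)
  show "bc T \<and> (\<forall>u v. T (u \<otimes> v) = a u \<otimes> b v)" using assms by blast
  fix S assume S: "bc S \<and> (\<forall>u v. S (u \<otimes> v) = a u \<otimes> b v)"
  show "S = T" by (rule tens_op_ext) (use S assms in auto)
qed

lemma op_tensor_props:
  assumes a: "bc a" "\<And>x. norm (a x) <= A * norm x" "0 <= A" and b: "bc b" "\<And>x. norm (b x) <= B * norm x" "0 <= B"
  shows "bc (a \<odot> b) \<and> (a \<odot> b) (u \<otimes> v) = a u \<otimes> b v \<and> norm ((a \<odot> b) x) <= A * B * norm x"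
proof -
  obtain T where T: "bc T" "\<forall>i\<in>UNIV. T ((%(u, v). u \<otimes> v) i) = (%(u, v). a u \<otimes> b v) i"
    "\<forall>x. norm (T x) <= (A * B) * norm x" using op_tensor_ex[OF a b] by (elim exE conjE)
  have T2: "T (u \<otimes> v) = a u \<otimes> b v" for u v using bspec[OF T(2), of "(u, v)"] by simp
  have "a \<odot> b = T" by (rule op_tensor_eqI) (fact T(1), rule T2)
  thus ?thesis using T T2 by simp
qed

lemma bc_op_tensor:
  assumes "bc a" "bc b" shows "bc (a \<odot> b)"
proof -
  obtain A where A: "0 <= A" "\<And>x. norm (a x) <= A * norm x" using bc_bound[OF assms(1)] by blast
  obtain B where B: "0 <= B" "\<And>x. norm (b x) <= B * norm x" using bc_bound[OF assms(2)] by blast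
  show ?thesis by (rule op_tensor_props[OF assms(1) A(2,1) assms(2) B(2,1), THEN conjunct1])
qed

lemma op_tensor_apply:
  assumes "bc a" "bc b" shows "(a \<odot> b) (u \<otimes> v) = a u \<otimes> b v"
proof -
  obtain A where A: "0 <= A" "\<And>x. norm (a x) <= A * norm x" using bc_bound[OF assms(1)] by blast
  obtain B where B: "0 <= B" "\<And>x. norm (b x) <= B * norm x" using bc_bound[OF assms(2)] by blast
  show ?thesis by (rule op_tensor_props[OF assms(1) A(2,1) assms(2) B(2,1), THEN conjunct2, THEN conjunct1])
qed

lemmas norm_op_tensor = op_tensor_props[THEN conjunct2, THEN conjunct2]

lemma op_tensor_comp:
  assumes "bc a" "bc b" "bc c" "bc d" shows "(a \<odot> b) o (c \<odot> d) = (a o c) \<odot> (b o d)"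
  by (rule op_tensor_eqI[symmetric]) (auto simp: assms bc_compose bc_op_tensor op_tensor_apply)

lemma op_tensor_comp_apply:
  assumes "bc a" "bc b" "bc c" "bc d" shows "(a \<odot> b) ((c \<odot> d) x) = ((a o c) \<odot> (b o d)) x"
  using fun_cong[OF op_tensor_comp[OF assms], of x] by simp

lemma op_tensor_id [simp]: "id \<odot> id = id" by (rule op_tensor_eqI) auto

lemma cadj_op_tensor:
  assumes "bc a" "bc b" shows "cadj (a \<odot> b) = cadj a \<odot> cadj b"
proof (rule op_tensor_eqI[symmetric])
  show "bc (cadj (a \<odot> b))" by (intro bc_cadj bc_op_tensor assms)
  show "cadj (a \<odot> b) (u \<otimes> v) = cadj a u \<otimes> cadj b v" for u v
    by (rule cinner_tens_ext) (simp add: cadj_right assms bc_op_tensor op_tensor_apply cinner_tens)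
qed

lemma op_tensor_lincomb_left:
  assumes "bc a" "bc a'" "bc b" shows "(%xi. a xi + c *C a' xi) \<odot> b = (%xi. (a \<odot> b) xi + c *C (a' \<odot> b) xi)" by (rule op_tensor_eqI)
    (auto simp: assms bc_op_tensor op_tensor_apply tens_add_left tens_scale_left intro!: bc_plus bc_scaled)

lemma E_ket_bc: "bc (E_ket x)" unfolding E_ket_def by (rule bc_tens_right)

lemma cadj_E_ket: "cadj (E_ket x) (u \<otimes> w) = cinner x w *C u"
proof (rule cinner_ext)
  fix y
  have "cinner y (cadj (E_ket x) (u \<otimes> w)) = cinner (y \<otimes> x) (u \<otimes> w)" unfolding cadj_right[OF E_ket_bc] by (simp add: E_ket_def)
  thus "cinner y (cadj (E_ket x) (u \<otimes> w)) = cinner y (cinner x w *C u)" by (simp add: cinner_tens cinner_scaleC_right)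
qed

lemma tflip_ex:
  "\<exists>T :: ('a::chilbert_space, 'b::chilbert_space) htens => ('b, 'a) htens. bc T \<and> (\<forall>u v. T (u \<otimes> v) = v \<otimes> u)"
proof -
  have "\<exists>T :: ('a, 'b) htens => ('b, 'a) htens. bc T \<and> (\<forall>i\<in>UNIV. T ((%(u, v). u \<otimes> v) i) = (%(u, v). v \<otimes> u) i) \<and> (\<forall>x. norm (T x) <= 1 * norm x) \<and>
    (\<forall>x. (\<forall>i\<in>UNIV. cinner ((%(u, v). u \<otimes> v) i) x = 0) --> T x = 0)" by (rule isometry_from_generators) (auto simp: cinner_tens)
  thus ?thesis by (elim exE conjE) (intro exI conjI, auto)
qed

definition tflip :: "('a::chilbert_space, 'b::chilbert_space) htens => ('b, 'a) htens"
  where "tflip = (SOME T. bc T \<and> (\<forall>u v. T (u \<otimes> v) = v \<otimes> u))"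

lemma bc_tflip [simp]: "bc tflip" and tflip_tens [simp]: "tflip (u \<otimes> v) = v \<otimes> u"
  using someI_ex[OF tflip_ex] unfolding tflip_def[symmetric] by auto

lemma tflip_tflip_comp: "tflip o tflip = id" by (rule tens_op_ext) (auto intro: bc_compose)

lemma tflip_tflip [simp]: "tflip (tflip x) = x" using fun_cong[OF tflip_tflip_comp, of x] by simp

lemma cadj_tflip [simp]: "cadj (tflip :: ('a::chilbert_space, 'b::chilbert_space) htens => _) = tflip"
proof (rule tens_op_ext)
  show "cadj tflip (u \<otimes> v) = tflip (u \<otimes> v)" for u :: 'b and v :: 'a by (rule cinner_tens_ext) (simp add: cadj_right cinner_tens)
qed (simp_all add: bc_cadj)

lemma tflip_op_tensor:
  assumes "bc a" "bc b" shows "tflip o (a \<odot> b) o tflip = b \<odot> a"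
  by (rule op_tensor_eqI[symmetric]) (auto simp: assms op_tensor_apply intro!: bc_compose bc_op_tensor)

text \<open>The Kronecker delta kernel generates the space of square-summable families over
  \<open>'i\<close>. Arbitrary index types occur because the multiplicity space of the dilation is
  indexed by pairs of a vector and a natural number.\<close>

datatype 'i delta = Delta 'i

instantiation delta :: (type) pdkernel
begin
definition kern_delta :: "'a delta => 'a delta => complex" where "kern_delta m n = (if m = n then 1 else 0)"
instance
proof
  fix x y :: "'a delta" and S :: "'a delta set" and c :: "'a delta => complex"
  show "kern y x = cnj (kern x y)" by (simp add: kern_delta_def)
  assume "finite S"
  hence "(\<Sum>x\<in>S. \<Sum>y\<in>S. cnj (c x) * c y * kern x y) = (\<Sum>x\<in>S. cnj (c x) * c x)"
    by (intro sum.cong refl) (simp add: kern_delta_def if_distrib cong: if_cong)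
  thus "0 <= Re (\<Sum>x\<in>S. \<Sum>y\<in>S. cnj (c x) * c y * kern x y)" by (simp add: sum_nonneg)
qed
end

type_synonym 'i ell2 = "'i delta hcompl"

definition basis :: "'i => 'i ell2" where "basis i = hgen (Delta i)"

lemma cinner_basis: "cinner (basis i) (basis j) = (if i = j then 1 else 0)" by (simp add: basis_def cinner_hgen kern_delta_def)

lemma basis_total: "closure (cspan (range (basis :: 'i => _))) = UNIV"
proof -
  have "range hgen = range (basis :: 'i => _)"
  proof
    show "range hgen \<subseteq> range (basis :: 'i => _)"
    proof
      fix x :: "'i ell2" assume "x \<in> range hgen"
      then obtain d where "x = hgen d" by blast
      thus "x \<in> range basis" by (cases d) (simp add: basis_def)
    qed
  qed (auto simp: basis_def)
  thus ?thesis using hgen_total[where 'a = "'i delta"] by simp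
qed

section \<open>The ultraweak topology and ultraweak tensor products\<close>

subsection \<open>Ultraweakly continuous functionals\<close>

text \<open>\<open>ultraweak_functional\<close> prescribes the value on every function, bounded
  operator or not. Comparing values on bounded operators only makes the notion stable under
  rewriting of the functional.\<close>

definition uw_fun :: "(('a::chilbert_space => 'a) => complex) => bool"
  where "uw_fun phi \<longleftrightarrow> (\<exists>(xi :: nat => 'a) eta. sqsum xi \<and> sqsum eta \<and>
    (\<forall>x\<in>bounded_ops. phi x = (\<Sum>n. cinner (xi n) (x (eta n)))))"

lemma ultraweak_functional_uw_fun: "ultraweak_functional phi ==> uw_fun phi" unfolding ultraweak_functional_def uw_fun_def by blast

lemma uw_fun_ultraweak: assumes "uw_fun phi" obtains psi where "ultraweak_functional psi" "\<And>x. x \<in> bounded_ops ==> phi x = psi x"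
  using assms unfolding ultraweak_functional_def uw_fun_def by blast

lemma uw_fun_cong: "uw_fun phi ==> (\<And>x. x \<in> bounded_ops ==> psi x = phi x) ==> uw_fun psi"
  unfolding uw_fun_def by (elim exE conjE, intro exI conjI ballI, assumption, assumption) simp

lemma bounded_opsD: "x \<in> bounded_ops ==> bc x" and bounded_opsI: "bc x ==> x \<in> bounded_ops" by (auto simp: bounded_ops_def)

lemma cinner_op_bound:
  assumes "\<And>z. norm (x z) <= C * norm z" "0 <= C" shows "norm (cinner a (x b)) <= C * ((norm a)\<^sup>2 + (norm b)\<^sup>2)"
proof -
  have "norm (cinner a (x b)) <= norm a * norm (x b)" by (rule ch.cauchy_schwarz)
  also have "\<dots> <= norm a * (C * norm b)" by (intro mult_left_mono assms) simp
  also have "\<dots> = C * (norm a * norm b)" by simp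
  also have "\<dots> <= C * ((norm a)\<^sup>2 + (norm b)\<^sup>2)"
  proof (intro mult_left_mono assms)
    have "2 * (norm a * norm b) <= (norm a)\<^sup>2 + (norm b)\<^sup>2" using sum_squares_bound[of "norm a" "norm b"] by (simp only: mult.assoc)
    moreover have "0 <= norm a * norm b" by simp
    ultimately show "norm a * norm b <= (norm a)\<^sup>2 + (norm b)\<^sup>2" by linarith
  qed
  finally show ?thesis .
qed

lemma family_abs_summable:
  fixes xi eta :: "'i => 'a::chilbert_space" assumes "(%i. (norm (xi i))\<^sup>2) summable_on S" "(%i. (norm (eta i))\<^sup>2) summable_on S" "bc x"
  shows "(%i. norm (cinner (xi i) (x (eta i)))) summable_on S"
proof -
  obtain C where C: "0 <= C" "\<And>z. norm (x z) <= C * norm z" using bc_bound[OF assms(3)] by blast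
  show ?thesis
  proof (rule Infinite_Sum.abs_summable_on_comparison_test)
    show "(%i. norm (C * ((norm (xi i))\<^sup>2 + (norm (eta i))\<^sup>2))) summable_on S"
      using summable_on_cmult_right[OF summable_on_add[OF assms(1,2)], of C] C by simp
    show "norm (cinner (xi i) (x (eta i))) <= norm (C * ((norm (xi i))\<^sup>2 + (norm (eta i))\<^sup>2))" for i
      using cinner_op_bound[of x C "xi i" "eta i"] C by auto
  qed
qed

lemma uw_summable:
  fixes xi eta :: "nat => 'a::chilbert_space" assumes "sqsum xi" "sqsum eta" "bc x"
  shows "summable (%n. norm (cinner (xi n) (x (eta n))))"
proof -
  have "(%i. norm (cinner (xi i) (x (eta i)))) summable_on UNIV"
    using assms by (intro family_abs_summable) (simp_all add: summable_on_UNIV_nonneg_real_iff)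
  thus ?thesis by (simp add: summable_on_UNIV_nonneg_real_iff)
qed

text \<open>Summability leaves only countably many nonzero \<open>xi i\<close>, so the family can be
  renumbered by natural numbers. Uncountable families arise from bases of large multiplicity
  spaces.\<close>

theorem uw_fun_family:
  fixes xi eta :: "'i => 'a::chilbert_space" assumes "(%i. (norm (xi i))\<^sup>2) summable_on UNIV" "(%i. (norm (eta i))\<^sup>2) summable_on UNIV"
  shows "uw_fun (%x. \<Sum>\<^sub>\<infinity>i. cinner (xi i) (x (eta i)))"
proof -
  \<comment> \<open>Indices with \<open>xi i = 0\<close> contribute nothing to the pairing, whatever
    \<open>eta i\<close> is.\<close>
  define D where "D = {i. (norm (xi i))\<^sup>2 \<noteq> 0}"
  have cD: "countable D" using summable_countable_real[OF assms(1)] by (simp add: D_def)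
  define f where "f = to_nat_on D"
  define g where "g = the_inv_into D f"
  have inj: "inj_on f D" unfolding f_def by (rule inj_on_to_nat_on[OF cD])
  have gf: "i \<in> D ==> g (f i) = i" for i unfolding g_def by (rule the_inv_into_f_f[OF inj])
  define xi' where "xi' n = (if n \<in> f ` D then xi (g n) else 0)" for n
  define eta' where "eta' n = (if n \<in> f ` D then eta (g n) else 0)" for n
  have s: "summable (%n. (norm (if n \<in> f ` D then h (g n) else 0))\<^sup>2)" if h: "(%i. (norm (h i :: 'a))\<^sup>2) summable_on UNIV" for h
  proof -
    have "(%i. (norm (h i))\<^sup>2) summable_on D" using h by (rule summable_on_subset_banach) simp
    moreover have "((%n. (norm (h (g n)))\<^sup>2) o f) summable_on D \<longleftrightarrow> (%i. (norm (h i))\<^sup>2) summable_on D"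
      by (intro summable_on_cong) (simp add: gf)
    ultimately have "(%n. (norm (h (g n)))\<^sup>2) summable_on (f ` D)" by (simp add: summable_on_reindex[OF inj])
    also have "?this \<longleftrightarrow> (%n. (norm (if n \<in> f ` D then h (g n) else 0))\<^sup>2) summable_on UNIV" by (rule summable_on_cong_neutral) auto
    finally show ?thesis by (simp add: summable_on_UNIV_nonneg_real_iff)
  qed
  have "(\<Sum>\<^sub>\<infinity>i. cinner (xi i) (x (eta i))) = (\<Sum>n. cinner (xi' n) (x (eta' n)))" if x: "x \<in> bounded_ops" for x
  proof -
    have bx: "bc x" using x by (rule bounded_opsD)
    have "((%i. cinner (xi i) (x (eta i))) has_sum (\<Sum>\<^sub>\<infinity>i. cinner (xi i) (x (eta i)))) UNIV"
      by (rule has_sum_infsum) (rule abs_summable_summable[OF family_abs_summable[OF assms bx]])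
    also have "?this \<longleftrightarrow> ((%n. cinner (xi (g n)) (x (eta (g n)))) o f has_sum (\<Sum>\<^sub>\<infinity>i. cinner (xi i) (x (eta i)))) D"
      by (rule has_sum_cong_neutral) (auto simp: D_def gf)
    also have "\<dots> \<longleftrightarrow> ((%n. cinner (xi (g n)) (x (eta (g n)))) has_sum (\<Sum>\<^sub>\<infinity>i. cinner (xi i) (x (eta i)))) (f ` D)"
      by (rule has_sum_reindex[OF inj, symmetric])
    also have "\<dots> \<longleftrightarrow> ((%n. cinner (xi' n) (x (eta' n))) has_sum (\<Sum>\<^sub>\<infinity>i. cinner (xi i) (x (eta i)))) UNIV"
      by (rule has_sum_cong_neutral) (auto simp: xi'_def eta'_def)
    finally have "(%n. cinner (xi' n) (x (eta' n))) sums (\<Sum>\<^sub>\<infinity>i. cinner (xi i) (x (eta i)))" by (rule has_sum_imp_sums)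
    thus ?thesis by (simp add: sums_iff)
  qed
  moreover have "summable (%n. (norm (xi' n))\<^sup>2)" unfolding xi'_def by (rule s[OF assms(1)])
  moreover have "summable (%n. (norm (eta' n))\<^sup>2)" unfolding eta'_def by (rule s[OF assms(2)])
  ultimately show ?thesis unfolding uw_fun_def by blast
qed

lemma uw_fun_repr:
  assumes "uw_fun phi" obtains xi eta :: "nat => 'a::chilbert_space" where "sqsum xi" "sqsum eta"
    "\<And>x. x \<in> bounded_ops ==> (%n. cinner (xi n) (x (eta n))) sums phi x"
    "\<And>x. x \<in> bounded_ops ==> ((%n. cinner (xi n) (x (eta n))) has_sum phi x) UNIV"
proof -
  obtain xi eta :: "nat => 'a" where h: "sqsum xi" "sqsum eta"
    "\<forall>x\<in>bounded_ops. phi x = (\<Sum>n. cinner (xi n) (x (eta n)))" using assms unfolding uw_fun_def by (elim exE conjE)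
  have s: "summable (%n. norm (cinner (xi n) (x (eta n))))" if "x \<in> bounded_ops" for x by (rule uw_summable[OF h(1,2) bounded_opsD[OF that]])
  have a: "(%n. cinner (xi n) (x (eta n))) sums phi x" if "x \<in> bounded_ops" for x
    unfolding bspec[OF h(3) that] by (rule summable_sums) (rule summable_norm_cancel[OF s[OF that]])
  have b: "((%n. cinner (xi n) (x (eta n))) has_sum phi x) UNIV" if "x \<in> bounded_ops" for x
    using norm_summable_imp_has_sum[OF s[OF that] a[OF that]] .
  show ?thesis using that h(1,2) a b by blast
qed

lemma uw_fun_vec: "uw_fun (%x. cinner xi (x eta))" using uw_fun_family[of "%_::unit. xi" "%_. eta"] by (simp add: UNIV_unit)

text \<open>The two vector sequences are placed side by side over the index type
  \<open>nat + nat\<close>; the scalar goes, conjugated, into the left-hand vectors.\<close>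

lemma uw_fun_add_scale:
  assumes "uw_fun phi" "uw_fun psi" shows "uw_fun (%x. phi x + c * psi (x :: 'a::chilbert_space => 'a))"
proof -
  obtain xi eta :: "nat => 'a" where 1: "sqsum xi" "sqsum eta"
    "\<And>x. x \<in> bounded_ops ==> ((%n. cinner (xi n) (x (eta n))) has_sum phi x) UNIV" using uw_fun_repr[OF assms(1)] by metis
  obtain xi' eta' :: "nat => 'a" where 2: "summable (%n. (norm (xi' n))\<^sup>2)" "summable (%n. (norm (eta' n))\<^sup>2)"
    "\<And>x. x \<in> bounded_ops ==> ((%n. cinner (xi' n) (x (eta' n))) has_sum psi x) UNIV" using uw_fun_repr[OF assms(2)] by metis
  define alpha where "alpha = case_sum xi (%n. cnj c *C xi' n)"
  define beta where "beta = case_sum eta eta'"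
  have U: "(UNIV :: (nat + nat) set) = range Inl \<union> range Inr" "range Inl \<inter> range Inr = ({} :: (nat + nat) set)" by (auto simp: UNIV_sum)
  have hs: "(f has_sum (s + t)) UNIV" if "(f o Inl has_sum s) UNIV" "(f o Inr has_sum t) UNIV"
    for f :: "nat + nat => 'c::{topological_comm_monoid_add,t2_space}" and s t
    unfolding U(1) by (rule has_sum_Un_disjoint[OF _ _ U(2)]) (use that in \<open>simp_all add: has_sum_reindex\<close>)
  have sm: "(%i. (norm (f i))\<^sup>2) summable_on UNIV"
    if "summable (%n. (norm (f (Inl n)))\<^sup>2)" "summable (%n. (norm (f (Inr n)))\<^sup>2)" for f :: "nat + nat => 'a"
  proof -
    have "(%i. (norm (f (Inl i)))\<^sup>2) summable_on UNIV" "(%i. (norm (f (Inr i)))\<^sup>2) summable_on UNIV"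
      using that by (simp_all add: summable_on_UNIV_nonneg_real_iff)
    hence "((%i. (norm (f i))\<^sup>2) o Inl has_sum (\<Sum>\<^sub>\<infinity>i. (norm (f (Inl i)))\<^sup>2)) UNIV"
      "((%i. (norm (f i))\<^sup>2) o Inr has_sum (\<Sum>\<^sub>\<infinity>i. (norm (f (Inr i)))\<^sup>2)) UNIV" by (simp_all add: o_def)
    from hs[OF this] show ?thesis by (rule has_sum_imp_summable)
  qed
  have "uw_fun (%x. \<Sum>\<^sub>\<infinity>i. cinner (alpha i) (x (beta i)))"
    by (rule uw_fun_family; rule sm) (use 1 2 in \<open>simp_all add: alpha_def beta_def norm_scaleC power_mult_distrib summable_mult\<close>)
  moreover have "phi x + c * psi x = (\<Sum>\<^sub>\<infinity>i. cinner (alpha i) (x (beta i)))" if x: "x \<in> bounded_ops" for x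
  proof -
    have "((%i. cinner (alpha i) (x (beta i))) has_sum (phi x + c * psi x)) UNIV"
    proof (rule hs)
      show "((%i. cinner (alpha i) (x (beta i))) o Inl has_sum phi x) UNIV" using 1(3)[OF x] by (simp add: alpha_def beta_def o_def)
      show "((%i. cinner (alpha i) (x (beta i))) o Inr has_sum c * psi x) UNIV"
        using has_sum_cmult_right[OF 2(3)[OF x], of c] by (simp add: alpha_def beta_def o_def ch.ip_sc_left)
    qed
    thus ?thesis by (simp add: infsumI)
  qed
  ultimately show ?thesis by (rule uw_fun_cong) auto
qed

lemma uw_fun_zero: "uw_fun (%_ :: 'a::chilbert_space => 'a. 0)" using uw_fun_vec[of "0::'a" "0::'a"] by simp

lemma uw_fun_conj:
  fixes T :: "'b::chilbert_space => 'a::chilbert_space" and S :: "'a => 'b" assumes "uw_fun phi" "bc T" "bc S"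
  shows "uw_fun (%x. phi (T o x o S))"
proof -
  obtain xi eta :: "nat => 'a" where 1: "sqsum xi" "sqsum eta"
    "\<And>x. x \<in> bounded_ops ==> (%n. cinner (xi n) (x (eta n))) sums phi x" using uw_fun_repr[OF assms(1)] by metis
  have sm: "summable (%n. (norm (R (f n)))\<^sup>2)" if f: "sqsum f" and R: "bc R"
    for R :: "'a => 'b" and f :: "nat => 'a"
  proof -
    obtain C where C: "0 <= C" "\<And>z. norm (R z) <= C * norm z" using bc_bound[OF R] by blast
    show ?thesis
    proof (rule summable_comparison_test')
      show "summable (%n. C\<^sup>2 * (norm (f n))\<^sup>2)" by (intro summable_mult f)
      show "norm ((norm (R (f n)))\<^sup>2) <= C\<^sup>2 * (norm (f n))\<^sup>2" for n
        using power_mono[OF C(2)[of "f n"] norm_ge_zero, of 2] by (simp add: power_mult_distrib)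
    qed
  qed
  have "phi (T o x o S) = (\<Sum>n. cinner (cadj T (xi n)) (x (S (eta n))))" if x: "x \<in> bounded_ops" for x
  proof -
    have "T o x o S \<in> bounded_ops" by (intro bounded_opsI bc_compose assms bounded_opsD[OF x])
    from 1(3)[OF this] show ?thesis by (simp add: sums_iff cadj_left[OF assms(2)])
  qed
  thus ?thesis unfolding uw_fun_def by (intro exI[of _ "%n. cadj T (xi n)"] exI[of _ "%n. S (eta n)"] conjI sm 1(1,2) bc_cadj assms ballI)
qed

text \<open>Dominated convergence for series: the uniform bound on the operators dominates all terms
  by one summable sequence.\<close>

lemma uw_fun_sequence:
  assumes xi: "sqsum xi" and eta: "sqsum eta"
    and C: "0 <= C" "\<And>m z. norm (x m z) <= C * norm z" and lim: "\<And>n. (%m. cinner (xi n) (x m (eta n))) \<longlonglongrightarrow> cinner (xi n) (y (eta n))"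
  shows "(%m. \<Sum>n. cinner (xi n) (x m (eta n))) \<longlonglongrightarrow> (\<Sum>n. cinner (xi n) (y (eta n)))"
proof -
  have "eventually (%(n, m). norm (cinner (xi n) (x m (eta n))) <= C * ((norm (xi n))\<^sup>2 + (norm (eta n))\<^sup>2)) (at_top \<times>\<^sub>F sequentially)"
    by (rule always_eventually) (auto intro!: cinner_op_bound C)
  moreover have "summable (%n. C * ((norm (xi n))\<^sup>2 + (norm (eta n))\<^sup>2))" by (intro summable_mult summable_add xi eta)
  ultimately show ?thesis using tannerys_theorem[where a = "%n m. cinner (xi n) (x m (eta n))" and F = sequentially, OF lim] by simp
qed

subsection \<open>The ultraweak topology\<close>

lemma topspace_ultraweak [simp]: "topspace ultraweak = (bounded_ops :: ('a::chilbert_space => 'a) set)"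
proof -
  have "ultraweak_functional (%x::'a=>'a. \<Sum>n::nat. cinner 0 (x 0))" unfolding ultraweak_functional_def by (intro exI[of _ "%_. 0"]) simp
  hence "bounded_ops \<in> {{x \<in> bounded_ops. phi x \<in> U} | phi U. ultraweak_functional (phi :: ('a => 'a) => complex) \<and> open U}"
    by (intro CollectI exI[of _ "%x::'a=>'a. \<Sum>n::nat. cinner 0 (x 0)"] exI[of _ UNIV]) auto
  thus ?thesis unfolding ultraweak_def topology_generated_by_topspace by blast
qed

lemma openin_ultraweak_basic:
  assumes "uw_fun phi" "open U" shows "openin ultraweak {x \<in> bounded_ops. phi x \<in> U}"
proof -
  obtain psi where p: "ultraweak_functional psi" "\<And>x. x \<in> bounded_ops ==> phi x = psi x" using uw_fun_ultraweak[OF assms(1)] by blast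
  have "{x \<in> bounded_ops. phi x \<in> U} = {x \<in> bounded_ops. psi x \<in> U}" using p(2) by auto
  thus ?thesis unfolding ultraweak_def using p(1) assms(2) by (intro topology_generated_by_Basis) blast
qed

lemma continuous_uw_fun: "uw_fun phi ==> continuous_map ultraweak euclidean phi" unfolding continuous_map by (auto simp: openin_ultraweak_basic)

text \<open>The generating sets are preimages of open sets under single functionals. Only finite
  intersections and unions occur in the generation of \<open>U\<close>, so finitely many functionals
  and one radius suffice at each point.\<close>

lemma ultraweak_nbhd:
  fixes U :: "('a::chilbert_space => 'a) set" assumes "openin ultraweak U" "x \<in> U"
  shows "\<exists>\<Phi> e. finite \<Phi> \<and> (\<forall>phi\<in>\<Phi>. uw_fun phi) \<and> e > 0 \<and> (\<forall>y\<in>bounded_ops. (\<forall>phi\<in>\<Phi>. norm (phi y - phi x) < e) --> y \<in> U)"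
proof -
  have "generate_topology_on {{x \<in> bounded_ops. phi x \<in> U} | phi U. ultraweak_functional (phi :: ('a => 'a) => complex) \<and> open U} U"
    using assms(1) unfolding ultraweak_def openin_topology_generated_by_iff .
  thus ?thesis using assms(2)
  proof (induction arbitrary: x rule: generate_topology_on.induct)
    case Empty thus ?case by simp
  next
    case (Int a b)
    obtain \<Phi> e where 1: "finite \<Phi>" "\<forall>phi\<in>\<Phi>. uw_fun phi" "e > 0" "\<forall>y\<in>bounded_ops. (\<forall>phi\<in>\<Phi>. norm (phi y - phi x) < e) --> y \<in> a"
      using Int.IH(1)[of x] Int.prems by auto
    obtain \<Psi> d where 2: "finite \<Psi>" "\<forall>phi\<in>\<Psi>. uw_fun phi" "d > 0" "\<forall>y\<in>bounded_ops. (\<forall>phi\<in>\<Psi>. norm (phi y - phi x) < d) --> y \<in> b"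
      using Int.IH(2)[of x] Int.prems by auto
    show ?case by (rule exI[of _ "\<Phi> \<union> \<Psi>"], rule exI[of _ "min e d"]) (use 1 2 in auto)
  next
    case (UN K)
    then obtain k where k: "k \<in> K" "x \<in> k" by blast
    from UN.IH[OF this] obtain \<Phi> e where 1: "finite \<Phi>" "\<forall>phi\<in>\<Phi>. uw_fun phi" "e > 0"
      "\<forall>y\<in>bounded_ops. (\<forall>phi\<in>\<Phi>. norm (phi y - phi x) < e) --> y \<in> k" by (elim exE conjE)
    show ?case by (rule exI[of _ \<Phi>], rule exI[of _ e]) (use 1 k in auto)
  next
    case (Basis s)
    then obtain phi V where s: "s = {x \<in> bounded_ops. phi x \<in> V}" "ultraweak_functional phi" "open V" by blast
    hence "phi x \<in> V" using Basis by simp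
    then obtain e where e: "e > 0" "\<And>z. dist z (phi x) < e ==> z \<in> V" using s(3) unfolding open_dist by blast
    show ?case by (rule exI[of _ "{phi}"], rule exI[of _ e]) (use e s ultraweak_functional_uw_fun in \<open>auto simp: dist_norm\<close>)
  qed
qed

lemma in_closure_ultraweak:
  assumes "x \<in> bounded_ops" "S \<subseteq> bounded_ops"
    and "\<And>\<Phi> e. finite \<Phi> ==> (\<And>phi. phi \<in> \<Phi> ==> uw_fun phi) ==> e > 0 ==> \<exists>y\<in>S. \<forall>phi\<in>\<Phi>. norm (phi y - phi x) < e" shows "x \<in> ultraweak closure_of S"
  unfolding in_closure_of
proof (intro conjI allI impI)
  show "x \<in> topspace ultraweak" using assms by simp
  fix U assume U: "x \<in> U \<and> openin ultraweak U"
  obtain \<Phi> e where h: "finite \<Phi>" "\<forall>phi\<in>\<Phi>. uw_fun phi" "e > 0" "\<forall>y\<in>bounded_ops. (\<forall>phi\<in>\<Phi>. norm (phi y - phi x) < e) --> y \<in> U"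
    using ultraweak_nbhd[of U x] U by (elim conjE exE) auto
  obtain y where "y \<in> S" "\<forall>phi\<in>\<Phi>. norm (phi y - phi x) < e" using assms(3)[of \<Phi> e] h by blast
  thus "\<exists>y. y \<in> S \<and> y \<in> U" using h(4) assms(2) by blast
qed

lemma closure_ultraweak_eq:
  assumes "x \<in> ultraweak closure_of S" "uw_fun phi" "uw_fun psi" "\<And>s. s \<in> S ==> phi s = psi s" shows "phi x = psi x"
  by (rule forall_in_closure_of_eq[OF assms(1) _ continuous_uw_fun[OF assms(2)] continuous_uw_fun[OF assms(3)] assms(4)]) simp

lemma closure_ultraweak_bounded: "x \<in> ultraweak closure_of S ==> x \<in> bounded_ops" using closure_of_subset_topspace[of ultraweak S] by auto

lemma continuous_map_ultraweakI:
  assumes "M \<subseteq> bounded_ops" "\<And>x. x \<in> M ==> kappa x \<in> bounded_ops" and "\<And>phi. uw_fun phi ==> \<exists>psi. uw_fun psi \<and> (\<forall>x\<in>M. phi (kappa x) = psi x)"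
  shows "continuous_map (subtopology ultraweak M) ultraweak kappa"
proof -
  have top: "topspace (subtopology ultraweak M) = M" using assms(1) by auto
  show ?thesis unfolding ultraweak_def[where 'a = 'b]
  proof (rule continuous_on_generated_topo)
    fix V assume "V \<in> {{x \<in> bounded_ops. phi x \<in> U} | phi U. ultraweak_functional (phi :: ('b => 'b) => complex) \<and> open U}"
    then obtain phi U where V: "V = {x \<in> bounded_ops. phi x \<in> U}" "ultraweak_functional phi" "open U" by blast
    obtain psi where psi: "uw_fun psi" "\<forall>x\<in>M. phi (kappa x) = psi x" using assms(3)[OF ultraweak_functional_uw_fun[OF V(2)]] by blast
    have "kappa -` V \<inter> M = M \<inter> {x \<in> bounded_ops. psi x \<in> U}" unfolding V(1) using psi(2) assms(1,2) by auto
    thus "openin (subtopology ultraweak M) (kappa -` V \<inter> topspace (subtopology ultraweak M))"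
      unfolding top using openin_subtopology_Int2[OF openin_ultraweak_basic[OF psi(1) V(3)], of M] by (simp only:)
  next
    have U: "\<Union> {{x \<in> bounded_ops. phi x \<in> U} | phi U. ultraweak_functional (phi :: ('b => 'b) => complex) \<and> open U} = bounded_ops"
      using topspace_ultraweak[where 'a = 'b] unfolding ultraweak_def topology_generated_by_topspace .
    show "kappa ` topspace (subtopology ultraweak M) \<subseteq> \<Union> {{x \<in> bounded_ops. phi x \<in> U} | phi U. ultraweak_functional (phi :: ('b => 'b) => complex) \<and> open U}"
      unfolding top U using assms(2) by blast
  qed
qed

lemma continuous_map_ultraweak_uw_fun:
  assumes "continuous_map X ultraweak kappa" "uw_fun phi" shows "continuous_map X euclidean (%x. phi (kappa x))"
  using continuous_map_compose[OF assms(1) continuous_uw_fun[OF assms(2)]] by (simp add: o_def)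

subsection \<open>Von Neumann algebras and their tensor products\<close>

lemma op_ext_cinner: assumes "\<And>a b. cinner a (T b) = cinner a (S b)" shows "T = S" by (rule ext, rule cinner_ext) (rule assms)

lemma commutantI: "bc x ==> (\<And>s. s \<in> S ==> x o s = s o x) ==> x \<in> commutant S" by (simp add: commutant_def bounded_ops_def)

lemma commutantD: "x \<in> commutant S ==> bc x" "x \<in> commutant S ==> s \<in> S ==> x o s = s o x" by (auto simp: commutant_def bounded_ops_def)

lemma commutant_id: assumes "S \<subseteq> bounded_ops" shows "id \<in> commutant S" by (rule commutantI) auto

lemma commutant_comp: assumes "x \<in> commutant S" "y \<in> commutant S" shows "x o y \<in> commutant S"
proof (rule commutantI)
  show "bc (x o y)" by (intro bc_compose commutantD(1)[OF assms(1)] commutantD(1)[OF assms(2)])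
  fix s assume s: "s \<in> S"
  show "x o y o s = s o (x o y)" by (metis commutantD(2)[OF assms(1) s] commutantD(2)[OF assms(2) s] comp_assoc)
qed

lemma commutant_lincomb:
  assumes "x \<in> commutant S" "y \<in> commutant S" "S \<subseteq> bounded_ops" shows "(lincomb x c y) \<in> commutant S"
proof (rule commutantI)
  show "bc (lincomb x c y)" by (intro bc_plus bc_scaled commutantD(1)[OF assms(1)] commutantD(1)[OF assms(2)])
  fix s assume s: "s \<in> S"
  hence bs: "bc s" using assms(3) bounded_opsD by blast
  show "(lincomb x c y) o s = s o (lincomb x c y)"
    using fun_cong[OF commutantD(2)[OF assms(1) s]] fun_cong[OF commutantD(2)[OF assms(2) s]] by (auto simp: bc_add[OF bs] bc_scale[OF bs])
qed

lemma commutant_cadj: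
  assumes "x \<in> commutant S" "S \<subseteq> bounded_ops" "\<And>s. s \<in> S ==> cadj s \<in> S" shows "cadj x \<in> commutant S"
proof (rule commutantI)
  note bx = commutantD(1)[OF assms(1)]
  show "bc (cadj x)" by (rule bc_cadj[OF bx])
  fix s assume s: "s \<in> S"
  hence bs: "bc s" using assms(2) bounded_opsD by blast
  have "cadj (x o cadj s) = cadj (cadj s o x)" using commutantD(2)[OF assms(1) assms(3)[OF s]] by simp
  thus "cadj x o s = s o cadj x" by (simp add: cadj_comp bx bs bc_cadj cadj_cadj)
qed

locale vn_algebra =
  fixes A :: "('h::chilbert_space => 'h) set" assumes vn: "von_neumann_algebra A"
begin

lemma A_bounded: "A \<subseteq> bounded_ops" and A_cadj: "a \<in> A ==> cadj a \<in> A" and bicommutant: "commutant (commutant A) = A"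
  using vn by (auto simp: von_neumann_algebra_def)

lemma A_bc: "a \<in> A ==> bc a" using A_bounded bounded_opsD by blast

lemma commutant_bounded: "commutant S \<subseteq> bounded_ops" by (auto simp: commutant_def)

lemma A_id: "id \<in> A" using commutant_id[OF commutant_bounded, of A] by (simp add: bicommutant)

lemma A_comp: "a \<in> A ==> b \<in> A ==> a o b \<in> A" using commutant_comp[of a "commutant A" b] by (simp add: bicommutant)

lemma A_lincomb: "a \<in> A ==> b \<in> A ==> (lincomb a c b) \<in> A"
  using commutant_lincomb[OF _ _ commutant_bounded, of a A b c] by (simp add: bicommutant)

lemma A_I: "bc a ==> (\<And>b. b \<in> commutant A ==> a o b = b o a) ==> a \<in> A" using commutantI[of a "commutant A"] by (simp add: bicommutant)

lemma A_zero: "(%_. 0) \<in> A" using A_lincomb[OF A_id A_id, of "-1"] by (simp add: ch.sc_minus)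

lemma A_commute: "a \<in> A ==> b \<in> commutant A ==> a o b = b o a" using commutantD(2) by metis

end

definition alg_tensor :: "('a::chilbert_space => 'a) set => ('b::chilbert_space => 'b) set
    => (('a, 'b) htens => ('a, 'b) htens) set" where "alg_tensor A B = {%zeta. \<Sum>i<n. (a i \<odot> b i) zeta | (n::nat) a b. \<forall>i<n. a i \<in> A \<and> b i \<in> B}"

lemma alg_tensorE:
  assumes "x \<in> alg_tensor A B" obtains n :: nat and a b where "x = (%zeta. \<Sum>i<n. (a i \<odot> b i) zeta)" "\<forall>i<n. a i \<in> A \<and> b i \<in> B"
  using assms unfolding alg_tensor_def mem_Collect_eq by (elim exE conjE) (rule that)

lemma vn_tensor_alg: "vn_tensor A B = ultraweak closure_of alg_tensor A B" unfolding vn_tensor_def alg_tensor_def ..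

lemma alg_tensor_bounded: assumes "A \<subseteq> bounded_ops" "B \<subseteq> bounded_ops" shows "alg_tensor A B \<subseteq> bounded_ops"
proof
  fix x assume x: "x \<in> alg_tensor A B"
  obtain n :: nat and a b where h: "x = (%zeta. \<Sum>i<n. (a i \<odot> b i) zeta)" "\<forall>i<n. a i \<in> A \<and> b i \<in> B" by (rule alg_tensorE[OF x])
  have "bc (a i)" "bc (b i)" if "i < n" for i using h(2) that assms bounded_opsD by blast+
  thus "x \<in> bounded_ops" unfolding h(1) by (intro bounded_opsI bc_sums bc_op_tensor) auto
qed

lemma alg_tensorI:
  assumes "finite I" "\<And>i. i \<in> I ==> a i \<in> A" "\<And>i. i \<in> I ==> b i \<in> B" shows "(%zeta. \<Sum>i\<in>I. (a i \<odot> b i) zeta) \<in> alg_tensor A B"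
proof -
  obtain h where h: "bij_betw h {0..<card I} I" using ex_bij_betw_nat_finite[OF assms(1)] by blast
  have e: "(%zeta. \<Sum>i\<in>I. (a i \<odot> b i) zeta) = (%zeta. \<Sum>i<card I. (a (h i) \<odot> b (h i)) zeta)"
    by (rule ext, subst sum.reindex_bij_betw[OF h, symmetric]) (simp add: atLeast0LessThan)
  have "h i \<in> I" if "i < card I" for i using h that by (auto simp: bij_betw_def)
  hence m: "\<forall>i<card I. a (h i) \<in> A \<and> b (h i) \<in> B" using assms(2,3) by blast
  show ?thesis unfolding e alg_tensor_def
    by (intro CollectI exI[of _ "card I"] exI[of _ "%i. a (h i)"] exI[of _ "%i. b (h i)"] conjI refl m)
qed

lemma vn_tensor_bounded: "x \<in> vn_tensor A B ==> x \<in> bounded_ops" unfolding vn_tensor_alg by (rule closure_ultraweak_bounded)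

lemma alg_in_vn_tensor:
  assumes "A \<subseteq> bounded_ops" "B \<subseteq> bounded_ops" shows "alg_tensor A B \<subseteq> vn_tensor A B"
  unfolding vn_tensor_alg by (rule closure_of_subset) (simp add: alg_tensor_bounded[OF assms])

lemma elem_in_alg: "a \<in> A ==> b \<in> B ==> a \<odot> b \<in> alg_tensor A B" using alg_tensorI[of "{()}" "%_. a" A "%_. b" B] by simp

text \<open>The algebraic tensor product is ultraweakly dense by definition, so identities between
  ultraweakly continuous functionals need only be checked on it.\<close>

lemma vn_tensor_induct:
  fixes phi psi :: "(('a::chilbert_space, 'b::chilbert_space) htens => ('a, 'b) htens) => complex"
  assumes "x \<in> vn_tensor A B" "uw_fun phi" "uw_fun psi" "A \<subseteq> bounded_ops" "B \<subseteq> bounded_ops"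
    and lin: "\<And>n a b. \<forall>i<n. a i \<in> A \<and> b i \<in> B ==> phi (%zeta. \<Sum>i<(n::nat). (a i \<odot> b i) zeta) = psi (%zeta. \<Sum>i<n. (a i \<odot> b i) zeta)" shows "phi x = psi x"
proof (rule closure_ultraweak_eq[OF assms(1)[unfolded vn_tensor_alg] assms(2,3)])
  fix s assume s: "s \<in> alg_tensor A B"
  obtain n :: nat and a b where h: "s = (%zeta. \<Sum>i<n. (a i \<odot> b i) zeta)" "\<forall>i<n. a i \<in> A \<and> b i \<in> B" by (rule alg_tensorE[OF s])
  show "phi s = psi s" unfolding h(1) by (rule lin[OF h(2)])
qed

lemma vn_tensor_identity:
  fixes A :: "('a::chilbert_space => 'a) set" and B :: "('b::chilbert_space => 'b) set"
  assumes x: "x \<in> vn_tensor A B" and AB: "A \<subseteq> bounded_ops" "B \<subseteq> bounded_ops"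
    and T: "bc T1" "bc T2" "\<And>a b. a \<in> A ==> b \<in> B ==> T1 o (a \<odot> b) o S1 = T2 o (a \<odot> b) o S2" shows "T1 o x o S1 = T2 o x o S2"
proof (rule op_ext_cinner)
  fix xi eta
  have "cinner (cadj T1 xi) (x (S1 eta)) = cinner (cadj T2 xi) (x (S2 eta))"
  proof (rule vn_tensor_induct[OF x uw_fun_vec uw_fun_vec AB])
    fix n :: nat and a b assume h: "\<forall>i<n. a i \<in> A \<and> b i \<in> B"
    have "T1 ((a i \<odot> b i) (S1 eta)) = T2 ((a i \<odot> b i) (S2 eta))" if "i < n" for i using fun_cong[OF T(3)[of "a i" "b i"], of eta] h that by simp
    hence "(\<Sum>i<n. cinner xi (T1 ((a i \<odot> b i) (S1 eta)))) = (\<Sum>i<n. cinner xi (T2 ((a i \<odot> b i) (S2 eta))))" by (intro sum.cong) auto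
    thus "cinner (cadj T1 xi) (\<Sum>i<n. (a i \<odot> b i) (S1 eta)) = cinner (cadj T2 xi) (\<Sum>i<n. (a i \<odot> b i) (S2 eta))"
      by (simp add: cadj_left T bc_sum[OF T(1)] bc_sum[OF T(2)] cinner_sum_right)
  qed
  thus "cinner xi ((T1 o x o S1) eta) = cinner xi ((T2 o x o S2) eta)" by (simp add: cadj_left T)
qed

text \<open>Conjugation with the flip is ultraweakly continuous and exchanges the two algebraic
  tensor products, hence also their closures.\<close>

lemma vn_tensor_flip:
  fixes A :: "('a::chilbert_space => 'a) set" and B :: "('b::chilbert_space => 'b) set"
  assumes AB: "A \<subseteq> bounded_ops" "B \<subseteq> bounded_ops" and x: "x \<in> vn_tensor A B" shows "tflip o x o tflip \<in> vn_tensor B A"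
proof -
  define c :: "(('a, 'b) htens => ('a, 'b) htens) => ('b, 'a) htens => ('b, 'a) htens" where "c = (%x. tflip o x o tflip)"
  have "continuous_map (subtopology ultraweak bounded_ops) ultraweak c"
  proof (rule continuous_map_ultraweakI)
    show "c x \<in> bounded_ops" if x: "x \<in> bounded_ops" for x unfolding c_def by (intro bounded_opsI bc_compose bc_tflip bounded_opsD[OF x])
    show "\<exists>psi. uw_fun psi \<and> (\<forall>x\<in>bounded_ops. phi (c x) = psi x)" if "uw_fun phi" for phi
      unfolding c_def using uw_fun_conj[OF that bc_tflip bc_tflip] by blast
  qed simp
  hence cont: "continuous_map ultraweak ultraweak c"
    using subtopology_topspace[of "ultraweak :: (('a, 'b) htens => ('a, 'b) htens) topology"] by simp
  have "c ` alg_tensor A B \<subseteq> alg_tensor B A"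
  proof
    fix y assume "y \<in> c ` alg_tensor A B"
    then obtain x where x: "y = c x" "x \<in> alg_tensor A B" by blast
    obtain n :: nat and a b where h': "x = (%zeta. \<Sum>i<n. (a i \<odot> b i) zeta)" and h2: "\<forall>i<n. a i \<in> A \<and> b i \<in> B" by (rule alg_tensorE[OF x(2)])
    note h = x(1)[unfolded h'] h2
    have "y = (%zeta. \<Sum>i<n. (b i \<odot> a i) zeta)"
    proof
      fix zeta
      have "tflip ((a i \<odot> b i) (tflip zeta)) = (b i \<odot> a i) zeta" if "i < n" for i
      proof -
        have "bc (a i)" "bc (b i)" using h(2) that AB bounded_opsD by blast+
        from fun_cong[OF tflip_op_tensor[OF this], of zeta] show ?thesis by simp
      qed
      thus "y zeta = (\<Sum>i<n. (b i \<odot> a i) zeta)" unfolding h(1) c_def by (simp add: bc_sum)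
    qed
    thus "y \<in> alg_tensor B A" unfolding alg_tensor_def using h(2) by (intro CollectI exI[of _ n] exI[of _ b] exI[of _ a] conjI) auto
  qed
  hence "c ` vn_tensor A B \<subseteq> vn_tensor B A"
    unfolding vn_tensor_alg using continuous_map_image_closure_subset[OF cont, of "alg_tensor A B"] closure_of_mono by blast
  thus ?thesis using x unfolding c_def by blast
qed

subsection \<open>Finite rank projections\<close>


definition orthonormal :: "'a::chilbert_space set => bool" where "orthonormal B \<longleftrightarrow> (\<forall>e\<in>B. \<forall>f\<in>B. cinner e f = (if e = f then 1 else 0))"

definition fproj :: "'a::chilbert_space set => 'a => 'a" where "fproj B x = (\<Sum>e\<in>B. cinner e x *C e)"

lemma bc_rank1: "bc (%v. cinner f v *C e)"
proof (rule bounded_clinearI[of _ "norm f * norm e"])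
  fix v :: 'a
  have "norm (cinner f v) * norm e <= (norm f * norm v) * norm e" by (intro mult_right_mono ch.cauchy_schwarz) simp
  thus "norm (cinner f v *C e) <= norm f * norm e * norm v" by (simp add: norm_scaleC mult_ac)
qed (simp_all add: cinner_add_right cinner_scaleC_right scaleC_add_left scaleC_scaleC)

lemma bc_fproj: "bc (fproj B)" unfolding fproj_def by (intro bc_sums bc_rank1)

lemma cinner_fproj: "cinner (fproj B y) x = cinner y (fproj B x)"
  unfolding fproj_def cinner_sum_left cinner_sum_right ch.ip_sc_left cinner_scaleC_right
  by (intro sum.cong refl) (metis cinner_commute mult.commute)

lemma cadj_fproj: "cadj (fproj B) = fproj B" by (rule cadj_eqI[OF bc_fproj]) (rule cinner_fproj)

lemma fproj_cspan:
  assumes "finite B" "orthonormal B" "x \<in> cspan B" shows "fproj B x = x"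
proof -
  have "B \<subseteq> {x. fproj B x = x}"
  proof
    fix f assume f: "f \<in> B"
    have "fproj B f = (\<Sum>e\<in>B. if e = f then f else 0)" unfolding fproj_def using assms(2) f by (intro sum.cong) (auto simp: orthonormal_def)
    thus "f \<in> {x. fproj B x = x}" using f assms(1) by simp
  qed
  hence "cspan B \<subseteq> {x. fproj B x = x}"
    by (rule cspan_minimal) (auto simp: csubspace_def bc_zero[OF bc_fproj] bc_add[OF bc_fproj] bc_scale[OF bc_fproj])
  thus ?thesis using assms(3) by blast
qed

lemma norm_fproj_le: assumes "finite B" "orthonormal B" shows "norm (fproj B x) <= norm x"
proof (rule orth_decomp_bound)
  have "fproj B x \<in> cspan B" unfolding fproj_def by (intro csubspace_sum csubspace_scale csubspace_cspan cspan_base)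
  hence "fproj B (fproj B x) = fproj B x" by (rule fproj_cspan[OF assms])
  thus "cinner (fproj B x) (x - fproj B x) = 0" unfolding cinner_fproj by (simp add: bc_diff[OF bc_fproj])
qed

lemma gram_schmidt:
  assumes "finite V" shows "\<exists>B. finite B \<and> orthonormal B \<and> V \<subseteq> cspan (B :: 'a::chilbert_space set)" using assms
proof (induction V rule: finite_induct)
  case empty
  show ?case by (intro exI[of _ "{}"]) (simp add: orthonormal_def)
next
  case (insert v V)
  then obtain B where B: "finite B" "orthonormal B" "V \<subseteq> cspan B" by blast
  define w where "w = v - fproj B v"
  have pB: "fproj B v \<in> cspan B" unfolding fproj_def by (intro csubspace_sum csubspace_scale csubspace_cspan cspan_base)
  have orth: "cinner e w = 0" if "e \<in> B" for e
  proof -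
    have "cinner e w = cinner (fproj B e) w" using fproj_cspan[OF B(1,2) cspan_base[OF that]] by simp
    also have "\<dots> = 0" unfolding cinner_fproj w_def using fproj_cspan[OF B(1,2) pB] by (simp add: bc_diff[OF bc_fproj])
    finally show ?thesis .
  qed
  show ?case
  proof (cases "w = 0")
    case True
    hence "v \<in> cspan B" using pB by (simp add: w_def)
    thus ?thesis using B by blast
  next
    case False
    define e where "e = complex_of_real (1 / norm w) *C w"
    have ee: "cinner e e = 1"
      unfolding e_def ch.ip_sc_left cinner_scaleC_right cinner_self[of w] using False by (simp add: power2_eq_square)
    have eo: "cinner f e = 0" if "f \<in> B" for f using orth[OF that] by (simp add: e_def cinner_scaleC_right)
    hence eo': "cinner e f = 0" if "f \<in> B" for f using that cinner_0_commute by blast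
    have "orthonormal (insert e B)" using B(2) ee eo eo' unfolding orthonormal_def by (metis insert_iff zero_neq_one)
    moreover have "insert v V \<subseteq> cspan (insert e B)"
    proof -
      have sub: "cspan B \<subseteq> cspan (insert e B)" by (rule cspan_mono) blast
      have "w = complex_of_real (norm w) *C e" using False by (simp add: e_def scaleC_scaleC)
      also have "\<dots> \<in> cspan (insert e B)" by (intro csubspace_scale csubspace_cspan cspan_base) simp
      finally have "w + fproj B v \<in> cspan (insert e B)" using pB sub by (intro csubspace_add csubspace_cspan) auto
      thus ?thesis using B(3) sub by (auto simp: w_def)
    qed
    ultimately show ?thesis using B(1) by blast
  qed
qed

text \<open>Each vector of \<open>V\<close> is close to a finite sum of elementary tensors.
  Orthonormalizing the second legs of these sums gives a projection that fixes the sums; being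
  contractive, it moves the original vectors by at most twice the distance.\<close>

lemma fproj_approx:
  fixes V :: "('a::chilbert_space, 'b::chilbert_space) htens set" assumes "finite V" "0 < \<epsilon>"
  shows "\<exists>B. finite B \<and> orthonormal B \<and> (\<forall>xi\<in>V. norm (xi - (id \<odot> fproj B) xi) < \<epsilon>)"
proof -
  have "\<exists>zeta\<in>cspan tensors. norm (xi - zeta) < \<epsilon> / 2" for xi :: "('a, 'b) htens"
  proof -
    have "xi \<in> closure (cspan tensors)" using tensors_total by blast
    moreover have "\<epsilon> / 2 > 0" using assms(2) by simp
    ultimately obtain y where "y \<in> cspan tensors" "dist y xi < \<epsilon> / 2" unfolding closure_approachable by blast
    thus ?thesis by (auto simp: dist_norm norm_minus_commute)
  qed
  then obtain z :: "('a, 'b) htens => ('a, 'b) htens" where z: "\<And>xi. z xi \<in> cspan tensors" "\<And>xi. norm (xi - z xi) < \<epsilon> / 2" by metis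
  have exF: "\<forall>xi. \<exists>F. finite F \<and> z xi \<in> cspan {u \<otimes> v | u v. v \<in> F}"
  proof
    fix xi
    have "tensors = (%(u, v). u \<otimes> v) ` (UNIV :: ('a \<times> 'b) set)" unfolding tensors_def by auto
    hence zi: "z xi \<in> cspan ((%(u, v). u \<otimes> v) ` (UNIV :: ('a \<times> 'b) set))" using z(1)[of xi] by simp
    obtain G c where G: "finite G" "z xi = (\<Sum>i\<in>G. c i *C (%(u, v). u \<otimes> v) i)" using cspan_finite[OF zi] by (elim exE conjE)
    have "z xi \<in> cspan {u \<otimes> v | u v. v \<in> snd ` G}" unfolding G(2)
    proof (intro csubspace_sum csubspace_scale csubspace_cspan cspan_base)
      fix i assume "i \<in> G"
      thus "(%(u, v). u \<otimes> v) i \<in> {u \<otimes> v | u v. v \<in> snd ` G}" by (intro CollectI exI[of _ "fst i"] exI[of _ "snd i"]) (simp add: split_def)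
    qed
    thus "\<exists>F. finite F \<and> z xi \<in> cspan {u \<otimes> v | u v. v \<in> F}" using G(1) by (intro exI[of _ "snd ` G"] conjI) auto
  qed
  obtain F where F': "\<forall>xi. finite (F xi) \<and> z xi \<in> cspan {u \<otimes> v | u v. v \<in> F xi}" using choice[OF exF] by (elim exE)
  note F = conjunct1[OF F'[THEN spec]] conjunct2[OF F'[THEN spec]]
  obtain B where B: "finite B" "orthonormal B" "(\<Union>xi\<in>V. F xi) \<subseteq> cspan B" using gram_schmidt[of "\<Union>xi\<in>V. F xi"] assms(1) F(1) by auto
  define P :: "('a, 'b) htens => ('a, 'b) htens" where "P = id \<odot> fproj B"
  have bP: "bc P" unfolding P_def by (intro bc_op_tensor bc_fproj) simp
  have nP: "norm (P x) <= norm x" for x using norm_op_tensor[of id 1 "fproj B" 1 x] bc_fproj norm_fproj_le[OF B(1,2)] unfolding P_def by auto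
  have "norm (xi - P xi) < \<epsilon>" if xi: "xi \<in> V" for xi
  proof -
    have "{u \<otimes> v | u v. v \<in> F xi} \<subseteq> {x. P x = x}"
    proof
      fix x :: "('a, 'b) htens" assume "x \<in> {u \<otimes> v | u v. v \<in> F xi}"
      then obtain u v where x: "x = u \<otimes> v" "v \<in> F xi" by blast
      have "fproj B v = v" using B x(2) xi by (intro fproj_cspan) auto
      thus "x \<in> {x. P x = x}" unfolding P_def x(1) by (simp add: op_tensor_apply bc_fproj)
    qed
    hence "cspan {u \<otimes> v | u v. v \<in> F xi} \<subseteq> {x. P x = x}"
      by (rule cspan_minimal) (auto simp: csubspace_def bc_zero[OF bP] bc_add[OF bP] bc_scale[OF bP])
    hence "P (z xi) = z xi" using F(2) by blast
    hence "xi - P xi = (xi - z xi) - P (xi - z xi)" by (simp add: bc_diff[OF bP])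
    hence "norm (xi - P xi) <= norm (xi - z xi) + norm (P (xi - z xi))" by (metis norm_triangle_ineq4)
    thus ?thesis using nP[of "xi - z xi"] z(2)[of xi] by linarith
  qed
  thus ?thesis using B(1,2) unfolding P_def by blast
qed

text \<open>Cutting the second factor down to finitely many basis vectors turns \<open>x\<close>
  into a finite operator matrix, whose entries are slices of \<open>x\<close> tensored with
  compressed matrix units.\<close>

lemma sandwich_fproj:
  fixes x :: "('a::chilbert_space, 'b::chilbert_space) htens => ('a, 'b) htens" assumes x: "bc x" and p: "bc p"
  shows "(id \<odot> p) o (id \<odot> fproj B) o x o (id \<odot> fproj B) o (id \<odot> p)
    = (%zeta. \<Sum>(e, f)\<in>B \<times> B. ((block e x f) \<odot> (p o (%v. cinner f v *C e) o p)) zeta)"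
proof (rule tens_op_ext)
  have s1: "bc (block e x f)" for e f by (intro bc_compose bc_cadj E_ket_bc x)
  have t1: "bc (p o (%v. cinner f v *C e) o p)" for e f by (intro bc_compose bc_rank1 p)
  have iP: "(id \<odot> fproj B) zeta = (\<Sum>e\<in>B. E_ket e (cadj (E_ket e) zeta))" for zeta :: "('a, 'b) htens"
  proof -
    have "id \<odot> fproj B = (%zeta::('a, 'b) htens. \<Sum>e\<in>B. E_ket e (cadj (E_ket e) zeta))"
    proof (rule op_tensor_eqI)
      show "bc (%zeta::('a, 'b) htens. \<Sum>e\<in>B. E_ket e (cadj (E_ket e) zeta))"
        by (rule bc_sums) (use bc_compose[OF E_ket_bc bc_cadj[OF E_ket_bc]] in \<open>simp add: o_def\<close>)
      show "(\<Sum>e\<in>B. E_ket e (cadj (E_ket e) (u \<otimes> v))) = id u \<otimes> fproj B v" for u :: 'a and v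
        by (simp add: cadj_E_ket fproj_def bc_sum[OF bc_tens_left] tens_scale_right bc_scale[OF E_ket_bc]) (simp add: E_ket_def)
    qed
    thus ?thesis by simp
  qed
  show "bc ((id \<odot> p) o (id \<odot> fproj B) o x o (id \<odot> fproj B) o (id \<odot> p))" by (intro bc_compose bc_op_tensor bc_fproj p x bc_id)
  show "bc (%zeta. \<Sum>(e, f)\<in>B \<times> B. ((block e x f) \<odot> (p o (%v. cinner f v *C e) o p)) zeta)"
    unfolding split_def by (intro bc_sums bc_op_tensor s1 t1)
  fix u v
  have 1: "x ((id \<odot> fproj B) (u \<otimes> p v)) = (\<Sum>f\<in>B. cinner f (p v) *C x (E_ket f u))"
    by (simp add: iP cadj_E_ket bc_scale[OF E_ket_bc] bc_sum[OF x] bc_scale[OF x])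
  have 2: "(id \<odot> p) ((id \<odot> fproj B) eta) = (\<Sum>e\<in>B. cadj (E_ket e) eta \<otimes> p e)" for eta :: "('a, 'b) htens"
    by (simp add: iP bc_sum[OF bc_op_tensor[OF bc_id p]] E_ket_def op_tensor_apply[OF bc_id p])
  have "((id \<odot> p) o (id \<odot> fproj B) o x o (id \<odot> fproj B) o (id \<odot> p)) (u \<otimes> v)
    = (\<Sum>e\<in>B. cadj (E_ket e) (\<Sum>f\<in>B. cinner f (p v) *C x (E_ket f u)) \<otimes> p e)" by (simp add: op_tensor_apply[OF bc_id p] 1 2)
  also have "\<dots> = (\<Sum>e\<in>B. \<Sum>f\<in>B. cinner f (p v) *C (cadj (E_ket e) (x (E_ket f u)) \<otimes> p e))"
    by (simp add: bc_sum[OF bc_cadj[OF E_ket_bc]] bc_scale[OF bc_cadj[OF E_ket_bc]] bc_sum[OF bc_tens_right] tens_scale_left)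
  also have "\<dots> = (\<Sum>(e, f)\<in>B \<times> B. ((block e x f) \<odot> (p o (%v. cinner f v *C e) o p)) (u \<otimes> v))" unfolding sum.cartesian_product split_def
    by (simp add: op_tensor_apply[OF s1 t1] bc_scale[OF p] tens_scale_right)
  finally show "((id \<odot> p) o (id \<odot> fproj B) o x o (id \<odot> fproj B) o (id \<odot> p)) (u \<otimes> v)
    = (\<Sum>(e, f)\<in>B \<times> B. ((block e x f) \<odot> (p o (%v. cinner f v *C e) o p)) (u \<otimes> v))" .
qed

text \<open>Truncations by finite-rank projections of the second factor are finite matrices over
  \<open>A\<close>, hence in the algebraic tensor product. They are uniformly bounded and can be
  made to converge on the countably many vectors that occur in finitely many functionals, which is
  ultraweak approximation.\<close>

theorem vn_tensor_if_slices:
  fixes x :: "('a::chilbert_space, 'b::chilbert_space) htens => ('a, 'b) htens"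
  assumes A: "A \<subseteq> bounded_ops" and N: "N \<subseteq> bounded_ops" and p: "bc p" and pN: "\<And>z. bc z ==> p o z o p \<in> N"
    and x: "bc x" "(id \<odot> p) o x o (id \<odot> p) = x" and slices: "\<And>v w. block v x w \<in> A" shows "x \<in> vn_tensor A N" unfolding vn_tensor_alg
proof (rule in_closure_ultraweak)
  show "x \<in> bounded_ops" using x(1) by (rule bounded_opsI)
  show "alg_tensor A N \<subseteq> bounded_ops" by (rule alg_tensor_bounded[OF A N])
  fix \<Phi> :: "((('a, 'b) htens => ('a, 'b) htens) => complex) set" and \<epsilon> :: real
  assume \<Phi>: "finite \<Phi>" "\<And>phi. phi \<in> \<Phi> ==> uw_fun phi" and \<epsilon>: "\<epsilon> > 0"
  define Q :: "('a, 'b) htens => ('a, 'b) htens" where "Q = id \<odot> p"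
  have bQ: "bc Q" unfolding Q_def by (intro bc_op_tensor p bc_id)
  define R where "R phi p \<longleftrightarrow> summable (%n. (norm (fst p n))\<^sup>2) \<and> summable (%n. (norm (snd p n))\<^sup>2) \<and>
    (\<forall>x\<in>bounded_ops. phi x = (\<Sum>n. cinner (fst p n) (x (snd p n))))"
    for phi :: "(('a, 'b) htens => ('a, 'b) htens) => complex" and p :: "(nat => ('a, 'b) htens) \<times> (nat => ('a, 'b) htens)"
  have exR: "\<forall>phi\<in>\<Phi>. \<exists>p. R phi p"
  proof
    fix phi assume "phi \<in> \<Phi>"
    from \<Phi>(2)[OF this] obtain xi eta :: "nat => ('a, 'b) htens" where "sqsum xi" "sqsum eta"
      "\<forall>x\<in>bounded_ops. phi x = (\<Sum>n. cinner (xi n) (x (eta n)))" unfolding uw_fun_def by (elim exE conjE)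
    thus "\<exists>p. R phi p" unfolding R_def by (intro exI[of _ "(xi, eta)"]) simp
  qed
  obtain xieta where xieta: "\<forall>phi\<in>\<Phi>. R phi (xieta phi)" using bchoice[OF exR] by (elim exE)
  define xi where "xi phi = fst (xieta phi)" for phi
  define eta where "eta phi = snd (xieta phi)" for phi
  have r: "summable (%n. (norm (xi phi n))\<^sup>2)" "summable (%n. (norm (eta phi n))\<^sup>2)"
    "x \<in> bounded_ops ==> phi x = (\<Sum>n. cinner (xi phi n) (x (eta phi n)))" if "phi \<in> \<Phi>" for phi x
    using bspec[OF xieta that] unfolding R_def xi_def eta_def by blast+
  \<comment> \<open>Stage \<open>m\<close> takes care of the first \<open>m\<close> vectors of every
    representation, so each fixed vector is treated from some stage on, with error tending to
    0.\<close>
  define V where "V m = (\<Union>phi\<in>\<Phi>. \<Union>n<m. {cadj Q (xi phi n), Q (eta phi n)})" for m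
  have V: "finite (V m)" for m unfolding V_def using \<Phi>(1) by auto
  have "\<exists>B. finite B \<and> orthonormal B \<and> (\<forall>xi\<in>V m. norm (xi - (id \<odot> fproj B) xi) < 1 / real (Suc m))" for m by (rule fproj_approx[OF V]) simp
  then obtain B where B: "\<And>m. finite (B m)" "\<And>m. orthonormal (B m)"
    "\<And>m xi. xi \<in> V m ==> norm (xi - (id \<odot> fproj (B m)) xi) < 1 / real (Suc m)" by metis
  define P :: "nat => ('a, 'b) htens => ('a, 'b) htens" where "P m = id \<odot> fproj (B m)" for m
  have bP: "bc (P m)" for m unfolding P_def by (intro bc_op_tensor bc_fproj bc_id)
  have nP: "norm (P m x) <= norm x" for m x
    using norm_op_tensor[of id 1 "fproj (B m)" 1 x] bc_fproj norm_fproj_le[OF B(1,2)] unfolding P_def by auto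
  have aP: "cinner a (P m b) = cinner (P m a) b" for m a b
  proof -
    have "cadj (P m) = P m" unfolding P_def by (simp add: cadj_op_tensor bc_fproj cadj_fproj)
    thus ?thesis using cadj_left[OF bP, of m a b] by simp
  qed
  define y where "y m = Q o P m o x o P m o Q" for m
  have yalg: "y m \<in> alg_tensor A N" for m
  proof -
    show ?thesis unfolding y_def Q_def P_def sandwich_fproj[OF x(1) p] split_def
      by (rule alg_tensorI) (use B(1) in \<open>auto intro: slices pN bc_rank1\<close>)
  qed
  obtain C where C: "0 <= C" "\<And>z. norm (x z) <= C * norm z" using bc_bound[OF x(1)] by blast
  obtain D where D: "0 <= D" "\<And>z. norm (Q z) <= D * norm z" using bc_bound[OF bQ] by blast
  have ny: "norm (y m z) <= (D * (C * D)) * norm z" for m z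
  proof -
    have "norm (y m z) <= D * norm (P m (x (P m (Q z))))" unfolding y_def o_def by (rule D)
    also have "\<dots> <= D * norm (x (P m (Q z)))" by (intro mult_left_mono nP D)
    also have "\<dots> <= D * (C * norm (P m (Q z)))" by (intro mult_left_mono C D)
    also have "\<dots> <= D * (C * (D * norm z))" by (intro mult_left_mono C D order_trans[OF nP])
    finally show ?thesis by (simp add: mult.assoc)
  qed
  have Plim: "(%m. P m zeta) \<longlonglongrightarrow> zeta" if zeta: "\<And>m. m > k ==> zeta \<in> V m" for zeta and k :: nat
  proof -
    have "(%m. norm (zeta - P m zeta)) \<longlonglongrightarrow> 0"
    proof (rule tendsto_sandwich[OF _ _ tendsto_const LIMSEQ_inverse_real_of_nat])
      show "\<forall>\<^sub>F m in sequentially. norm (zeta - P m zeta) <= inverse (real (Suc m))" using eventually_gt_at_top[of k]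
      proof eventually_elim
        case (elim m)
        show ?case using B(3)[OF zeta[OF elim]] unfolding P_def by (simp add: inverse_eq_divide)
      qed
    qed simp
    hence "(%m. zeta - (zeta - P m zeta)) \<longlonglongrightarrow> zeta - 0" by (intro tendsto_diff tendsto_const) (simp add: tendsto_norm_zero_iff)
    thus ?thesis by simp
  qed
  have "(%m. phi (y m)) \<longlonglongrightarrow> phi x" if phi: "phi \<in> \<Phi>" for phi
  proof -
    have "(%m. \<Sum>n. cinner (xi phi n) (y m (eta phi n))) \<longlonglongrightarrow> (\<Sum>n. cinner (xi phi n) (x (eta phi n)))"
    proof (rule uw_fun_sequence[OF r(1,2)[OF phi] _ ny])
      fix n
      have "(%m. P m (cadj Q (xi phi n))) \<longlonglongrightarrow> cadj Q (xi phi n)" by (rule Plim[of n]) (use phi in \<open>auto simp: V_def\<close>)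
      moreover have "(%m. P m (Q (eta phi n))) \<longlonglongrightarrow> Q (eta phi n)" by (rule Plim[of n]) (use phi in \<open>auto simp: V_def\<close>)
      ultimately have "(%m. cinner (P m (cadj Q (xi phi n))) (x (P m (Q (eta phi n))))) \<longlonglongrightarrow> cinner (cadj Q (xi phi n)) (x (Q (eta phi n)))"
        by (rule tendsto_cinner'[OF _ bc_tendsto[OF x(1)]])
      also have "cinner (cadj Q (xi phi n)) (x (Q (eta phi n))) = cinner (xi phi n) (x (eta phi n))"
        using fun_cong[OF x(2), of "eta phi n"] unfolding cadj_left[OF bQ] by (simp add: Q_def)
      also have "(%m. cinner (P m (cadj Q (xi phi n))) (x (P m (Q (eta phi n))))) = (%m. cinner (xi phi n) (y m (eta phi n)))"
        unfolding y_def by (simp add: aP[symmetric] cadj_left[OF bQ])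
      finally show "(%m. cinner (xi phi n) (y m (eta phi n))) \<longlonglongrightarrow> cinner (xi phi n) (x (eta phi n))" .
    qed (use C D in simp)
    moreover have "y m \<in> bounded_ops" for m using yalg alg_tensor_bounded[OF A N] by blast
    ultimately show ?thesis using r(3)[OF phi] bounded_opsI[OF x(1)] by simp
  qed
  hence "\<forall>phi\<in>\<Phi>. \<forall>\<^sub>F m in sequentially. dist (phi (y m)) (phi x) < \<epsilon>" using \<epsilon> by (intro ballI, rule tendstoD)
  hence "\<forall>\<^sub>F m in sequentially. \<forall>phi\<in>\<Phi>. dist (phi (y m)) (phi x) < \<epsilon>" by (rule eventually_ball_finite[OF \<Phi>(1)])
  from eventually_happens[OF this] obtain m where m: "\<forall>phi\<in>\<Phi>. dist (phi (y m)) (phi x) < \<epsilon>" by auto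
  thus "\<exists>y\<in>alg_tensor A N. \<forall>phi\<in>\<Phi>. norm (phi y - phi x) < \<epsilon>" by (intro bexI[of _ "y m"] yalg) (simp only: dist_norm)
qed

subsection \<open>Continuous functionals on a subspace\<close>

lemma uw_fun_linear:
  assumes "uw_fun phi" "x \<in> bounded_ops" "y \<in> bounded_ops" shows "phi (lincomb x c y) = phi x + c * phi (y :: 'a::chilbert_space => 'a)"
proof -
  obtain xi eta :: "nat => 'a" where r: "\<And>x. x \<in> bounded_ops ==> (%n. cinner (xi n) (x (eta n))) sums phi x" using uw_fun_repr[OF assms(1)] by blast
  have "(%n. cinner (xi n) (x (eta n)) + c * cinner (xi n) (y (eta n))) sums (phi x + c * phi y)" by (intro sums_add sums_mult r assms)
  moreover have "(lincomb x c y) \<in> bounded_ops"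
    by (intro bounded_opsI bc_plus bc_scaled bounded_opsD[OF assms(2)] bounded_opsD[OF assms(3)])
  ultimately show ?thesis using r sums_unique2 by (fastforce simp: cinner_add_right cinner_scaleC_right)
qed

lemma uw_fun_op0: "uw_fun phi ==> phi (%_. 0) = 0" unfolding uw_fun_def using bounded_opsI[OF bc_const0] by fastforce

text \<open>Linear algebra: a functional that vanishes on the joint kernel of finitely many
  functionals is a combination of them. The induction passes to the kernel of one functional in
  \<open>A\<close> and corrects by a multiple of it.\<close>

lemma functional_from_kernels:
  fixes phi :: "('a::chilbert_space => 'a) => complex" assumes "finite \<Phi>" "\<And>psi. psi \<in> \<Phi> ==> uw_fun psi" "A \<subseteq> bounded_ops"
    "\<And>a b c. a \<in> A ==> b \<in> A ==> (lincomb a c b) \<in> A"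
    "\<And>a b c. a \<in> A ==> b \<in> A ==> phi (lincomb a c b) = phi a + c * phi b"
    "\<And>a. a \<in> A ==> (\<And>psi. psi \<in> \<Phi> ==> psi a = 0) ==> phi a = 0" shows "\<exists>psi. uw_fun psi \<and> (\<forall>a\<in>A. phi a = psi a)" using assms
proof (induction \<Phi> arbitrary: A rule: finite_induct)
  case empty
  show ?case using empty.prems(5) uw_fun_zero by (intro exI[of _ "%_. 0"]) auto
next
  case (insert psi1 \<Phi>)
  have u1: "uw_fun psi1" using insert.prems(1) by simp
  define A1 where "A1 = {a \<in> A. psi1 a = 0}"
  have "\<exists>psi. uw_fun psi \<and> (\<forall>a\<in>A1. phi a = psi a)"
  proof (rule insert.IH)
    show "(lincomb a c b) \<in> A1" if "a \<in> A1" "b \<in> A1" for a b c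
      using that insert.prems(2,3) uw_fun_linear[OF u1, of a b c] by (auto simp: A1_def)
    show "phi a = 0" if "a \<in> A1" "\<And>psi. psi \<in> \<Phi> ==> psi a = 0" for a by (rule insert.prems(5)) (use that in \<open>auto simp: A1_def\<close>)
  qed (use insert.prems(1,2,4) in \<open>auto simp: A1_def\<close>)
  then obtain psi where psi: "uw_fun psi" "\<And>a. a \<in> A1 ==> phi a = psi a" by blast
  show ?case
  proof (cases "A1 = A")
    case True
    thus ?thesis using psi by blast
  next
    case False
    then obtain a0 where a0: "a0 \<in> A" "psi1 a0 \<noteq> 0" unfolding A1_def by blast
    define c where "c = (phi a0 - psi a0) / psi1 a0"
    have "phi a = psi a + c * psi1 a" if a: "a \<in> A" for a
    proof -
      define t where "t = - (psi1 a / psi1 a0)"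
      have ab: "a \<in> bounded_ops" "a0 \<in> bounded_ops" using a a0 insert.prems(2) by auto
      have "(%xi. a xi + t *C a0 xi) \<in> A1"
        unfolding A1_def using insert.prems(3)[OF a a0(1)] uw_fun_linear[OF u1 ab, of t] a0(2) by (simp add: t_def)
      hence "phi (%xi. a xi + t *C a0 xi) = psi (%xi. a xi + t *C a0 xi)" by (rule psi(2))
      hence "phi a + t * phi a0 = psi a + t * psi a0" using insert.prems(4)[OF a a0(1)] uw_fun_linear[OF psi(1) ab, of t] by simp
      thus ?thesis using a0(2) by (simp add: c_def t_def field_simps)
    qed
    thus ?thesis using uw_fun_add_scale[OF psi(1) u1, of c] by blast
  qed
qed

text \<open>Near 0, continuity bounds \<open>phi\<close> by 1 in terms of finitely many ultraweak
  functionals. On their joint kernel \<open>phi\<close> vanishes, since an element scaled to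
  \<open>phi b = 1\<close> would still lie in the neighbourhood. This converts the topological
  normality of \<open>j t\<close> into vector sequences.\<close>

theorem continuous_functional_uw_fun:
  fixes phi :: "('a::chilbert_space => 'a) => complex"
  assumes A: "A \<subseteq> bounded_ops" "(%_. 0) \<in> A" "\<And>a b c. a \<in> A ==> b \<in> A ==> (lincomb a c b) \<in> A"
    and lin: "\<And>a b c. a \<in> A ==> b \<in> A ==> phi (lincomb a c b) = phi a + c * phi b"
    and cont: "continuous_map (subtopology ultraweak A) euclidean phi" shows "\<exists>psi. uw_fun psi \<and> (\<forall>a\<in>A. phi a = psi a)"
proof -
  have top: "topspace (subtopology ultraweak A) = A" using A(1) by auto
  have p0: "phi (%_. 0) = 0" using lin[OF A(2) A(2), of "-1"] by simp
  have "openin (subtopology ultraweak A) {a \<in> A. phi a \<in> ball 0 1}"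
    using openin_continuous_map_preimage[OF cont, of "ball 0 1"] unfolding top by simp
  then obtain U where U: "openin ultraweak U" "{a \<in> A. phi a \<in> ball 0 1} = U \<inter> A" unfolding openin_subtopology by (elim exE conjE)
  have "(%_. 0) \<in> {a \<in> A. phi a \<in> ball 0 1}" using A(2) p0 by simp
  hence "(%_. 0) \<in> U" unfolding U(2) by (rule IntD1)
  from ultraweak_nbhd[OF U(1) this] obtain \<Phi> e where \<Phi>: "finite \<Phi>" "\<forall>phi\<in>\<Phi>. uw_fun phi" "e > 0"
    "\<forall>y\<in>bounded_ops. (\<forall>phi\<in>\<Phi>. norm (phi y - phi (%_. 0)) < e) --> y \<in> U" by (elim exE conjE)
  show ?thesis
  proof (rule functional_from_kernels[OF \<Phi>(1) _ A(1,3) lin])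
    show "uw_fun psi" if "psi \<in> \<Phi>" for psi using that \<Phi>(2) by blast
    fix a assume a: "a \<in> A" and z: "\<And>psi. psi \<in> \<Phi> ==> psi a = 0"
    show "phi a = 0"
    proof (rule ccontr)
      assume n: "phi a \<noteq> 0"
      define b where "b = (%xi. 0 + (1 / phi a) *C a xi)"
      have bA: "b \<in> A" unfolding b_def by (rule A(3)[OF A(2) a])
      note z0 = subsetD[OF A(1,2)] and ab = subsetD[OF A(1) a]
      have "\<forall>psi\<in>\<Phi>. norm (psi b - psi (%_. 0)) < e"
      proof
        fix psi assume p: "psi \<in> \<Phi>"
        have u: "uw_fun psi" using bspec[OF \<Phi>(2) p] .
        have "psi b = 0" unfolding b_def uw_fun_linear[OF u z0 ab] uw_fun_op0[OF u] z[OF p] by simp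
        thus "norm (psi b - psi (%_. 0)) < e" using uw_fun_op0[OF u] \<Phi>(3) by simp
      qed
      hence "b \<in> U" using bspec[OF \<Phi>(4) subsetD[OF A(1) bA]] by (rule mp[rotated])
      hence "b \<in> {a \<in> A. phi a \<in> ball 0 1}" unfolding U(2) using bA by (rule IntI)
      hence "phi b \<in> ball 0 1" by simp
      moreover have "phi b = 1" unfolding b_def using lin[OF A(2) a, of "1 / phi a"] p0 n by simp
      ultimately show False by simp
    qed
  qed
qed

section \<open>Normal representations as compressed ampliations, and their tensor extensions\<close>

subsection \<open>Strong convergence and orthogonal expansions\<close>

text \<open>The usual three-term estimate with approximation from the span of \<open>G\<close>. A
  general filter covers both limits in time and limits over finite index sets.\<close>

lemma strong_convergence:
  fixes T :: "'t => 'a::chilbert_space => 'b::chilbert_space" assumes ev: "eventually (%t. bc (T t) \<and> (\<forall>x. norm (T t x) <= C * norm x)) Fl"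
    and S: "bc S" and G: "closure (cspan G) = UNIV" and lim: "\<And>g. g \<in> G ==> ((%t. T t g) \<longlongrightarrow> S g) Fl" shows "((%t. T t x) \<longlongrightarrow> S x) Fl"
proof -
  have evb: "eventually (%t. bc (T t)) Fl" using ev by eventually_elim simp
  define V where "V = {x. ((%t. T t x) \<longlongrightarrow> S x) Fl}"
  have "csubspace V" unfolding csubspace_def
  proof (intro conjI ballI allI)
    have "eventually (%t. S 0 = T t 0) Fl" using evb by eventually_elim (simp add: bc_zero S)
    hence "((%t. T t 0) \<longlongrightarrow> S 0) Fl" by (rule Lim_transform_eventually[OF tendsto_const])
    thus "0 \<in> V" by (simp add: V_def)
  next
    fix x y assume "x \<in> V" "y \<in> V"
    hence "((%t. T t x + T t y) \<longlongrightarrow> S x + S y) Fl" unfolding V_def by (intro tendsto_add) auto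
    moreover have "eventually (%t. T t x + T t y = T t (x + y)) Fl" using evb by eventually_elim (simp add: bc_add)
    ultimately have "((%t. T t (x + y)) \<longlongrightarrow> S x + S y) Fl" by (rule Lim_transform_eventually)
    thus "x + y \<in> V" by (simp add: V_def bc_add[OF S])
  next
    fix c x assume "x \<in> V"
    hence "((%t. c *C T t x) \<longlongrightarrow> c *C S x) Fl" unfolding V_def by (intro tendsto_scaleC tendsto_const) auto
    moreover have "eventually (%t. c *C T t x = T t (c *C x)) Fl" using evb by eventually_elim (simp add: bc_scale)
    ultimately have "((%t. T t (c *C x)) \<longlongrightarrow> c *C S x) Fl" by (rule Lim_transform_eventually)
    thus "c *C x \<in> V" by (simp add: V_def bc_scale[OF S])
  qed
  hence GV: "cspan G \<subseteq> V" by (rule cspan_minimal[rotated]) (use lim in \<open>auto simp: V_def\<close>)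
  obtain D where D: "0 <= D" "\<And>x. norm (S x) <= D * norm x" using bc_bound[OF S] by blast
  define K where "K = \<bar>C\<bar> + D + 1"
  have K: "K > 0" using D by (simp add: K_def)
  show ?thesis
  proof (rule tendstoI)
    fix e :: real assume e: "0 < e"
    have "e / (2 * K) > 0" using e K by simp
    moreover have "x \<in> closure (cspan G)" using G by simp
    ultimately obtain y where y: "y \<in> cspan G" "dist y x < e / (2 * K)" unfolding closure_approachable by blast
    have yV: "((%t. T t y) \<longlongrightarrow> S y) Fl" using y(1) GV unfolding V_def by blast
    have "eventually (%t. dist (T t y) (S y) < e / 2) Fl" by (rule tendstoD[OF yV]) (use e in simp)
    with ev show "eventually (%t. dist (T t x) (S x) < e) Fl"
    proof eventually_elim
      case (elim t)
      hence bT: "bc (T t)" "norm (T t (x - y)) <= C * norm (x - y)" by blast+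
      have "norm (T t (x - y)) <= \<bar>C\<bar> * norm (x - y)" using bT(2) by (meson abs_ge_self mult_right_mono norm_ge_zero order_trans)
      moreover have "norm (S (y - x)) <= D * norm (x - y)" using D(2)[of "y - x"] by (simp add: norm_minus_commute)
      moreover have "T t x - S x = T t (x - y) + ((T t y - S y) + S (y - x))" by (simp add: bc_diff[OF bT(1)] bc_diff[OF S])
      hence "norm (T t x - S x) <= norm (T t (x - y)) + (norm (T t y - S y) + norm (S (y - x)))"
        by (metis norm_triangle_mono norm_triangle_ineq order_refl)
      ultimately have "norm (T t x - S x) <= (\<bar>C\<bar> + D) * norm (x - y) + norm (T t y - S y)" by (simp add: distrib_right)
      also have "(\<bar>C\<bar> + D) * norm (x - y) <= K * norm (x - y)" by (simp add: K_def mult_right_mono)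
      also have "K * norm (x - y) < e / 2" using y(2) K by (simp add: dist_norm norm_minus_commute field_simps)
      finally show ?case using elim(2) by (simp add: dist_norm)
    qed
  qed
qed

lemma pythagoras_sum:
  assumes "finite F" "\<And>i j. i \<in> F ==> j \<in> F ==> i \<noteq> j ==> cinner (x i) (x j) = 0"
  shows "(norm (\<Sum>i\<in>F. x i))\<^sup>2 = (\<Sum>i\<in>F. (norm (x i))\<^sup>2)" using assms
proof (induction F rule: finite_induct)
  case (insert i F)
  have "cinner (x i) (\<Sum>j\<in>F. x j) = 0" unfolding cinner_sum_right by (rule sum.neutral) (use insert in auto)
  from pythagoras[OF this] show ?case using insert by simp
qed simp

lemma orthogonal_summable:
  fixes x :: "nat => 'a::chilbert_space" assumes o: "\<And>m n. m \<noteq> n ==> cinner (x m) (x n) = 0" and s: "sqsum x"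
  shows "summable x" unfolding summable_Cauchy
proof (intro allI impI)
  fix e :: real assume e: "0 < e"
  hence "e\<^sup>2 > 0" by simp
  then obtain N where N: "\<And>m n. m >= N ==> norm (\<Sum>k\<in>{m..<n}. (norm (x k))\<^sup>2) < e\<^sup>2" using s unfolding summable_Cauchy by blast
  show "\<exists>N. \<forall>m\<ge>N. \<forall>n. norm (sum x {m..<n}) < e"
  proof (intro exI[of _ N] allI impI)
    fix m n assume m: "N <= m"
    have "(norm (sum x {m..<n}))\<^sup>2 = (\<Sum>k\<in>{m..<n}. (norm (x k))\<^sup>2)" by (rule pythagoras_sum) (use o in auto)
    also have "\<dots> < e\<^sup>2" using N[OF m, of n] by simp
    finally show "norm (sum x {m..<n}) < e" using e by (simp add: power2_less_imp_less)
  qed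
qed

lemma cadj_E_ket_op_tensor:
  assumes "bc a" "bc b" shows "cadj (E_ket v) ((a \<odot> b) x) = a (cadj (E_ket (cadj b v)) x)"
proof -
  have "cadj (E_ket v) o (a \<odot> b) = a o cadj (E_ket (cadj b v))" by (rule tens_op_ext)
      (auto intro!: bc_compose bc_op_tensor bc_cadj E_ket_bc assms simp: op_tensor_apply assms cadj_E_ket cadj_left bc_scale)
  from fun_cong[OF this, of x] show ?thesis by simp
qed

lemma cadj_E_ket_amp: "bc a ==> cadj (E_ket v) ((a \<odot> id) x) = a (cadj (E_ket v) x)" using cadj_E_ket_op_tensor[of a id v x] by simp

lemma norm_basis [simp]: "norm (basis i) = 1"
proof -
  have "(norm (basis i))\<^sup>2 = 1" by (simp add: norm_sq_cinner cinner_basis)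
  thus ?thesis using norm_ge_zero[of "basis i"] by (simp add: power2_eq_1_iff)
qed

lemma tens_basis_total: "closure (cspan {u \<otimes> basis i | u i. True}) = (UNIV :: ('a::chilbert_space, 'i ell2) htens set)"
proof (rule dense_if_total)
  fix x :: "('a, 'i ell2) htens" assume o: "\<And>s. s \<in> {u \<otimes> basis i | u i. True} ==> cinner s x = 0"
  have "cadj (%v. u \<otimes> v) x = 0" for u
  proof (rule total_if_dense[OF basis_total])
    fix s assume "s \<in> range (basis :: 'i => _)"
    then obtain i where "s = basis i" by blast
    thus "cinner s (cadj (%v. u \<otimes> v) x) = cinner s 0" using o by (auto simp: cadj_right[OF bc_tens_left])
  qed
  hence "cinner (u \<otimes> v) x = cinner (u \<otimes> v) 0" for u v using cadj_right[OF bc_tens_left, of v u x] by simp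
  thus "x = 0" by (rule cinner_tens_ext)
qed

lemma finite_expansion:
  fixes Z :: "('a::chilbert_space, 'i ell2) htens" assumes "finite F"
  shows "norm (\<Sum>i\<in>F. E_ket (basis i) (cadj (E_ket (basis i)) Z)) <= norm Z"
    "(norm (\<Sum>i\<in>F. E_ket (basis i) (cadj (E_ket (basis i)) Z)))\<^sup>2 = (\<Sum>i\<in>F. (norm (cadj (E_ket (basis i)) Z))\<^sup>2)"
proof -
  define p where "p = (\<Sum>i\<in>F. E_ket (basis i) (cadj (E_ket (basis i)) Z))"
  have ce: "cadj (E_ket (basis i)) (E_ket (basis j) u) = (if i = j then u else 0)" for i j :: 'i and u :: 'a
    by (subst E_ket_def[of "basis j"]) (simp add: cadj_E_ket cinner_basis)
  have "cadj (E_ket (basis i)) p = cadj (E_ket (basis i)) Z" if "i \<in> F" for i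
    unfolding p_def bc_sum[OF bc_cadj[OF E_ket_bc]] ce using assms that by simp
  hence "cinner p (Z - p) = 0" unfolding p_def cinner_sum_left
    by (intro sum.neutral ballI) (simp add: cadj_right[OF E_ket_bc, symmetric] bc_diff[OF bc_cadj[OF E_ket_bc]])
  thus "norm (\<Sum>i\<in>F. E_ket (basis i) (cadj (E_ket (basis i)) Z)) <= norm Z" unfolding p_def[symmetric] by (rule orth_decomp_bound)
  have "(norm p)\<^sup>2 = (\<Sum>i\<in>F. (norm (E_ket (basis i) (cadj (E_ket (basis i)) Z)))\<^sup>2)" unfolding p_def
    by (rule pythagoras_sum[OF assms]) (simp add: cadj_right[OF E_ket_bc, symmetric] ce)
  also have "\<dots> = (\<Sum>i\<in>F. (norm (cadj (E_ket (basis i)) Z))\<^sup>2)" by (intro sum.cong refl) (simp add: E_ket_def norm_tens norm_basis)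
  finally show "(norm (\<Sum>i\<in>F. E_ket (basis i) (cadj (E_ket (basis i)) Z)))\<^sup>2 = (\<Sum>i\<in>F. (norm (cadj (E_ket (basis i)) Z))\<^sup>2)" unfolding p_def .
qed

text \<open>The finite partial sums are contractions and are eventually exact on the vectors
  \<open>u \<otimes> basis j\<close>, which are total.\<close>

lemma expansion_has_sum:
  "((%i. E_ket (basis i) (cadj (E_ket (basis i)) Z)) has_sum Z) (UNIV :: 'i set)" for Z :: "('a::chilbert_space, 'i ell2) htens"
proof -
  have "((%F. \<Sum>i\<in>F. E_ket (basis i) (cadj (E_ket (basis i)) Z)) \<longlongrightarrow> id Z) (finite_subsets_at_top (UNIV :: 'i set))"
  proof (rule strong_convergence[where C = 1 and T = "%F Z. \<Sum>i\<in>F. E_ket (basis i) (cadj (E_ket (basis i)) Z)", OF _ bc_id tens_basis_total])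
    show "\<forall>\<^sub>F F in finite_subsets_at_top UNIV. bc (%Z::('a, 'i ell2) htens. \<Sum>i\<in>F. E_ket (basis i) (cadj (E_ket (basis i)) Z)) \<and>
        (\<forall>x::('a, 'i ell2) htens. norm (\<Sum>i\<in>F. E_ket (basis i) (cadj (E_ket (basis i)) x)) <= 1 * norm x)"
    proof (rule eventually_finite_subsets_at_top_weakI, intro conjI allI)
      fix F :: "'i set" assume F: "finite F"
      show "bc (%Z::('a, 'i ell2) htens. \<Sum>i\<in>F. E_ket (basis i) (cadj (E_ket (basis i)) Z))"
        by (rule bc_sums) (use bc_compose[OF E_ket_bc bc_cadj[OF E_ket_bc]] in \<open>simp add: o_def\<close>)
      show "norm (\<Sum>i\<in>F. E_ket (basis i) (cadj (E_ket (basis i)) x)) <= 1 * norm x" for x :: "('a, 'i ell2) htens"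
        using finite_expansion(1)[OF F, of x] by simp
    qed
    fix g :: "('a, 'i ell2) htens" assume "g \<in> {u \<otimes> basis i | u i. True}"
    then obtain u and j :: 'i where g: "g = u \<otimes> basis j" by blast
    have t: "E_ket (basis i) (cadj (E_ket (basis i)) g) = (if i = j then g else 0)" for i
      unfolding g cadj_E_ket cinner_basis by (simp add: E_ket_def)
    have "\<forall>\<^sub>F F in finite_subsets_at_top UNIV. g = (\<Sum>i\<in>F. E_ket (basis i) (cadj (E_ket (basis i)) g))"
      unfolding eventually_finite_subsets_at_top t by (intro exI[of _ "{j}"]) auto
    thus "((%F. \<Sum>i\<in>F. E_ket (basis i) (cadj (E_ket (basis i)) g)) \<longlongrightarrow> id g) (finite_subsets_at_top UNIV)"
      unfolding id_def by (rule Lim_transform_eventually[OF tendsto_const])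
  qed
  thus ?thesis unfolding has_sum_def id_def .
qed

lemma parseval:
  fixes Z Z' :: "('a::chilbert_space, 'i ell2) htens"
  shows "((%i. cinner (cadj (E_ket (basis i)) Z') (cadj (E_ket (basis i)) Z)) has_sum cinner Z' Z) UNIV"
    "((%i. (norm (cadj (E_ket (basis i)) Z))\<^sup>2) has_sum (norm Z)\<^sup>2) UNIV"
proof -
  have h: "((%i. cinner (cadj (E_ket (basis i)) Y) (cadj (E_ket (basis i)) Z)) has_sum cinner Y Z) UNIV"
    for Y Z :: "('a, 'i ell2) htens"
    using has_sum_bounded_linear[OF bounded_clinear_bounded_linear[OF bounded_clinear_cinner] expansion_has_sum, of Y Z]
    by (simp add: o_def cadj_left[OF E_ket_bc, symmetric])
  show "((%i. cinner (cadj (E_ket (basis i)) Z') (cadj (E_ket (basis i)) Z)) has_sum cinner Z' Z) UNIV" by (rule h)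
  show "((%i. (norm (cadj (E_ket (basis i)) Z))\<^sup>2) has_sum (norm Z)\<^sup>2) UNIV" using has_sum_Re[OF h[of Z Z]] by (simp only: norm_sq_cinner)
qed

subsection \<open>Square roots of positive operators\<close>

text \<open>The square root of T is 1 - B, where B solves 2 B = (1 - T) + B^2. The Picard iterates for B
  are polynomials in 1 - T with non-negative coefficients, so they are dominated in norm by the
  corresponding scalar iterates for T = 0, which increase to 1.\<close>

lemma sqrt_scalar_iterates:
  fixes b :: "nat => real" assumes b: "b 0 = 0" "\<And>n. b (Suc n) = (1 + (b n)\<^sup>2) / 2"
  shows "0 <= b n" "b n <= 1" "b n <= b (Suc n)" "convergent b"
proof -
  have 0: "0 <= b n" for n by (cases n) (simp_all add: b)
  have 1: "b n <= 1" for n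
  proof (induction n)
    case (Suc n)
    have "(b n)\<^sup>2 <= 1" using power_mono[OF Suc 0[of n], of 2] by simp
    thus ?case by (simp add: b)
  qed (simp add: b)
  have 2: "b n <= b (Suc n)" for n using sum_squares_bound[of "b n" 1] by (simp add: b)
  show "0 <= b n" "b n <= 1" "b n <= b (Suc n)" by (rule 0 1 2)+
  have "incseq b" using 2 by (rule incseq_SucI)
  thus "convergent b" using 1 by (intro Bseq_mono_convergent BseqI'[of _ 1]) (auto simp: 0 incseq_def)
qed

text \<open>Cauchy-Schwarz for the semi-inner product \<open>cinner x (A y)\<close>, applied to
  \<open>A x\<close> and \<open>x\<close>; by the upper bound on the form, its seminorm is at most
  the norm.\<close>

lemma positive_contraction_norm:
  assumes A: "bc A" "\<And>x y. cinner (A x) y = cinner x (A y :: 'a::chilbert_space)"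
    "\<And>x. 0 <= Re (cinner x (A x))" "\<And>x. Re (cinner x (A x)) <= (norm x)\<^sup>2" shows "norm (A x) <= norm x"
proof -
  interpret q: semi_inner scaleC "%x y. cinner x (A y)"
  proof
    fix x y z :: 'a and c :: complex
    show "(- 1) *C x = - x" by (rule ch.sc_minus)
    show "cinner y (A x) = cnj (cinner x (A y))" by (metis A(2) cinner_commute)
    show "cinner x (A (y + z)) = cinner x (A y) + cinner x (A z)" by (simp add: bc_add[OF A(1)] cinner_add_right)
    show "cinner x (A (c *C y)) = c * cinner x (A y)" by (simp add: bc_scale[OF A(1)] cinner_scaleC_right)
    show "0 <= Re (cinner x (A x))" by (rule A(3))
  qed
  have qn: "q.sn z <= norm z" for z unfolding q.sn_def using real_sqrt_le_mono[OF A(4)[of z]] by simp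
  have "(norm (A x))\<^sup>2 = norm (cinner (A x) (A x))" by (simp add: cinner_self norm_power)
  also have "\<dots> <= q.sn (A x) * q.sn x" by (rule q.cauchy_schwarz)
  also have "\<dots> <= norm (A x) * norm x" by (intro mult_mono qn) simp_all
  finally have "norm (A x) * norm (A x) <= norm (A x) * norm x" by (simp add: power2_eq_square)
  thus ?thesis by (cases "norm (A x) = 0") (simp_all add: mult_le_cancel_left)
qed

fun sqrt_iter :: "('a::chilbert_space => 'a) => nat => 'a => 'a" where "sqrt_iter A 0 = (%x. 0)"
  | "sqrt_iter A (Suc n) = (%x. (1/2) *C (A x + sqrt_iter A n (sqrt_iter A n x)))"

theorem sqrt_exists:
  fixes T :: "'a::chilbert_space => 'a" assumes T: "bc T" "\<And>x y. cinner (T x) y = cinner x (T y)"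
    "\<And>x. 0 <= Re (cinner x (T x))" "\<And>x. Re (cinner x (T x)) <= (norm x)\<^sup>2"
  shows "\<exists>S. bc S \<and> (\<forall>x y. cinner (S x) y = cinner x (S y)) \<and> (\<forall>x. S (S x) = T x) \<and>
    (\<forall>R. bc R --> (\<forall>x. R (T x) = T (R x)) --> (\<forall>x. R (S x) = S (R x)))"
proof -
  define A where "A x = x - T x" for x
  have A: "bc A" unfolding A_def by (intro bc_minus bc_ident T)
  have As: "cinner (A x) y = cinner x (A y)" for x y by (simp add: A_def ch.ip_diff ch.ip_diff_left T(2))
  have An: "norm (A x) <= norm x" for x
  proof (rule positive_contraction_norm[OF A As])
    show "0 <= Re (cinner x (A x))" "Re (cinner x (A x)) <= (norm x)\<^sup>2" for x
      using T(3)[of x] T(4)[of x] by (simp_all add: A_def ch.ip_diff norm_sq_cinner)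
  qed
  define B where "B = sqrt_iter A"
  have B0: "B 0 = (%x. 0)" and BS: "B (Suc n) x = (1/2) *C (A x + B n (B n x))" for n x by (simp_all add: B_def)
  define b where "b = rec_nat 0 (%_ r. (1 + r\<^sup>2) / (2::real))"
  have b: "b 0 = 0" "b (Suc n) = (1 + (b n)\<^sup>2) / 2" for n by (simp_all add: b_def)
  note sb = sqrt_scalar_iterates[of b, OF b]
  have bB: "bc (B n)" for n
  proof (induction n)
    case (Suc n)
    have "B (Suc n) = (%x. (1/2) *C (A x + (B n o B n) x))" by (rule ext) (simp add: BS)
    thus ?case by (simp only:) (intro bc_scaled bc_plus bc_compose A Suc)
  qed (simp add: B0)
  have com: "R (B n x) = B n (R x)" if R: "bc R" "\<And>x. R (A x) = A (R x)" for R n x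
    by (induction n arbitrary: x) (simp_all add: B0 BS bc_zero[OF R(1)] bc_scale[OF R(1)] bc_add[OF R(1)] R(2))
  have BA: "B m (A x) = A (B m x)" for m x by (rule com[OF A, symmetric]) simp
  have BB: "B m (B n x) = B n (B m x)" for m n x by (rule com[OF bB]) (rule BA)
  have Bs: "cinner (B n x) y = cinner x (B n y)" for n x y
    by (induction n arbitrary: x y) (simp_all add: B0 BS ch.ip_sc_left cinner_scaleC_right ch.ip_add_left cinner_add_right As)
  have Bn: "norm (B n x) <= b n * norm x" for n x
  proof (induction n arbitrary: x)
    case (Suc n)
    have "norm (B n (B n x)) <= b n * (b n * norm x)" using Suc[of "B n x"] mult_left_mono[OF Suc[of x] sb(1)[of n]] by linarith
    hence "norm (A x + B n (B n x)) <= norm x + (b n)\<^sup>2 * norm x"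
      using norm_triangle_ineq[of "A x" "B n (B n x)"] An[of x] by (simp add: power2_eq_square mult.assoc)
    hence "norm (A x + B n (B n x)) / 2 <= (norm x + (b n)\<^sup>2 * norm x) / 2" by simp
    thus ?case unfolding BS b norm_scaleC by (simp add: algebra_simps)
  qed (simp add: B0 b)
  have Bd: "norm (B (Suc n) x - B n x) <= (b (Suc n) - b n) * norm x" for n x
  proof (induction n arbitrary: x)
    case 0
    show ?case using An[of x] by (simp add: B0 BS b norm_scaleC)
  next
    case (Suc n)
    define y where "y = B (Suc n) x - B n x"
    have "B (Suc (Suc n)) x - B (Suc n) x = (1/2) *C (B (Suc n) (B (Suc n) x) - B n (B n x))"
      by (subst (1 2) BS) (simp add: ch.sc_diff[symmetric] del: One_nat_def)
    \<comment> \<open>The difference of squares factors because the iterates commute. The scalar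
      iterates factor in the same way, so the two estimates match.\<close>
    also have "B (Suc n) (B (Suc n) x) - B n (B n x) = B (Suc n) y + B n y" unfolding y_def bc_diff[OF bB] BB[of "Suc n" n] by simp
    finally have "norm (B (Suc (Suc n)) x - B (Suc n) x) = (1/2) * norm (B (Suc n) y + B n y)" by (simp add: norm_scaleC)
    also have "\<dots> <= (1/2) * (b (Suc n) * norm y + b n * norm y)"
      by (intro mult_left_mono order_trans[OF norm_triangle_ineq] add_mono Bn) simp
    also have "\<dots> = (1/2) * (b (Suc n) + b n) * norm y" by (simp add: algebra_simps)
    also have "\<dots> <= (1/2) * (b (Suc n) + b n) * ((b (Suc n) - b n) * norm x)"
      unfolding y_def using sb(1)[of n] sb(1)[of "Suc n"] by (intro mult_left_mono Suc) simp
    also have "\<dots> = (((b (Suc n))\<^sup>2 - (b n)\<^sup>2) / 2) * norm x" by (simp add: power2_eq_square algebra_simps)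
    also have "((b (Suc n))\<^sup>2 - (b n)\<^sup>2) / 2 = b (Suc (Suc n)) - b (Suc n)"
      unfolding arg_cong2[OF b(2)[of "Suc n"] b(2)[of n], of "(-)"] by (simp add: diff_divide_distrib[symmetric])
    finally show ?case .
  qed
  have Bd': "norm (B (n + k) x - B n x) <= (b (n + k) - b n) * norm x" for n k x
  proof (induction k)
    case (Suc k)
    have "B (n + Suc k) x - B n x = (B (Suc (n + k)) x - B (n + k) x) + (B (n + k) x - B n x)" by simp
    hence "norm (B (n + Suc k) x - B n x) <= norm (B (Suc (n + k)) x - B (n + k) x) + norm (B (n + k) x - B n x)"
      by (metis norm_triangle_ineq)
    also have "\<dots> <= (b (Suc (n + k)) - b (n + k)) * norm x + (b (n + k) - b n) * norm x" by (intro add_mono Bd Suc)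
    finally show ?case by (simp add: algebra_simps)
  qed simp
  have "convergent (%n. B n x)" for x
  proof -
    have cb: "Cauchy b" using sb(4) by (rule convergent_Cauchy)
    have "Cauchy (%n. B n x)"
    proof (rule metric_CauchyI)
      fix e :: real assume "0 < e"
      hence "e / (norm x + 1) > 0" by (simp add: add_nonneg_pos)
      then obtain N where N: "\<And>m n. m >= N ==> n >= N ==> dist (b m) (b n) < e / (norm x + 1)" using metric_CauchyD[OF cb] by blast
      have *: "dist (B m x) (B n x) < e" if "N <= m" "m <= n" for m n
      proof -
        have "norm (B n x - B m x) <= (b n - b m) * norm x" using Bd'[of m "n - m" x] that by simp
        also have "\<dots> <= dist (b m) (b n) * norm x" by (intro mult_right_mono) (simp_all add: dist_real_def)
        also have "\<dots> <= dist (b m) (b n) * (norm x + 1)" by (intro mult_left_mono) simp_all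
        also have "\<dots> < e" using N[of m n] that by (simp add: pos_less_divide_eq add_nonneg_pos)
        finally show ?thesis by (simp add: dist_norm norm_minus_commute)
      qed
      show "\<exists>M. \<forall>m\<ge>M. \<forall>n\<ge>M. dist (B m x) (B n x) < e"
      proof (intro exI[of _ N] allI impI)
        fix m n assume "N <= m" "N <= n"
        thus "dist (B m x) (B n x) < e" using *[of m n] *[of n m] by (cases "m <= n") (auto simp: dist_commute)
      qed
    qed
    thus ?thesis by (rule Cauchy_convergent)
  qed
  then obtain L where L: "\<And>x. (%n. B n x) \<longlonglongrightarrow> L x" unfolding convergent_def by metis
  have Bn1: "norm (B n x) <= norm x" for n x using Bn[of n x] mult_right_mono[OF sb(2)[of n] norm_ge_zero[of x]] by linarith
  have bL: "bc L"
  proof (rule bounded_clinearI[of _ 1])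
    show "L (x + y) = L x + L y" for x y by (rule LIMSEQ_unique[OF L]) (use tendsto_add[OF L L] in \<open>simp add: bc_add[OF bB]\<close>)
    show "L (c *C x) = c *C L x" for c x
      by (rule LIMSEQ_unique[OF L]) (use tendsto_scaleC[OF tendsto_const L] in \<open>simp add: bc_scale[OF bB]\<close>)
    show "norm (L x) <= 1 * norm x" for x by (rule LIMSEQ_le_const2[OF tendsto_norm[OF L]]) (use Bn1 in auto)
  qed
  have Ls: "cinner (L x) y = cinner x (L y)" for x y
    by (rule LIMSEQ_unique[OF tendsto_cinner'[OF L tendsto_const]]) (use tendsto_cinner'[OF tendsto_const L] in \<open>simp add: Bs\<close>)
  have LL: "2 *C L x = A x + L (L x)" for x
  proof -
    have "(%n. B n (B n x - L x)) \<longlonglongrightarrow> 0"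
    proof (rule Lim_null_comparison)
      show "\<forall>\<^sub>F n in sequentially. norm (B n (B n x - L x)) <= norm (B n x - L x)" using Bn1 by simp
      show "(%n. norm (B n x - L x)) \<longlonglongrightarrow> 0" using tendsto_norm[OF tendsto_diff[OF L[of x] tendsto_const[of "L x"]]] by simp
    qed
    from tendsto_add[OF this L[of "L x"]] have "(%n. B n (B n x)) \<longlonglongrightarrow> L (L x)" by (simp add: bc_diff[OF bB])
    hence "(%n. (1/2) *C (A x + B n (B n x))) \<longlonglongrightarrow> (1/2) *C (A x + L (L x))" by (intro tendsto_scaleC tendsto_add tendsto_const)
    moreover have "(%n. B (Suc n) x) \<longlonglongrightarrow> L x" using L by (rule LIMSEQ_Suc)
    ultimately have "L x = (1/2) *C (A x + L (L x))" unfolding BS by (rule LIMSEQ_unique[rotated])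
    hence "2 *C L x = 2 *C (1/2) *C (A x + L (L x))" by simp
    thus ?thesis by (simp add: scaleC_scaleC)
  qed
  define S where "S x = x - L x" for x
  show ?thesis
  proof (intro exI[of _ S] conjI allI impI)
    show "bc S" unfolding S_def by (intro bc_minus bc_ident bL)
    show "cinner (S x) y = cinner x (S y)" for x y by (simp add: S_def ch.ip_diff ch.ip_diff_left Ls)
    show "S (S x) = T x" for x
    proof -
      have "L x + L x = A x + L (L x)" using LL[of x] scaleC_add_left[of 1 1 "L x"] by simp
      hence "L (L x) = L x + L x - A x" by simp
      thus ?thesis by (simp add: S_def bc_diff[OF bL] A_def)
    qed
    fix R x assume R: "bc R" "\<forall>x. R (T x) = T (R x)"
    have "R (A x) = A (R x)" for x by (simp add: A_def bc_diff[OF R(1)] R(2))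
    hence "(%n. R (B n x)) = (%n. B n (R x))" using com[OF R(1)] by blast
    hence "R (L x) = L (R x)" using bc_tendsto[OF R(1) L[of x]] L[of "R x"] LIMSEQ_unique by metis
    thus "R (S x) = S (R x)" by (simp add: S_def bc_diff[OF R(1)])
  qed
qed

subsection \<open>Normal representations are compressions of ampliations\<close>

definition star_rep :: "('h::chilbert_space => 'h) set => (('h => 'h) => 'l::chilbert_space => 'l) => bool"
  where "star_rep A rho \<longleftrightarrow> (\<forall>a\<in>A. bc (rho a)) \<and> (\<forall>a\<in>A. \<forall>b\<in>A. rho (a o b) = rho a o rho b) \<and>
    (\<forall>a\<in>A. rho (cadj a) = cadj (rho a)) \<and> (\<forall>a\<in>A. \<forall>b\<in>A. \<forall>c. rho (lincomb a c b) = (%xi. rho a xi + c *C rho b xi))"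

lemma star_repD:
  assumes "star_rep A rho" shows "a \<in> A ==> bc (rho a)" "a \<in> A ==> b \<in> A ==> rho (a o b) = rho a o rho b"
    "a \<in> A ==> rho (cadj a) = cadj (rho a)"
    "a \<in> A ==> b \<in> A ==> rho (lincomb a c b) = (%xi. rho a xi + c *C rho b xi)" using assms unfolding star_rep_def by blast+

context vn_algebra
begin

lemma star_rep_amp: "star_rep A (%a. a \<odot> id)" unfolding star_rep_def
proof (intro conjI ballI allI)
  fix a b c assume a: "a \<in> A" and b: "b \<in> A"
  note ab = A_bc[OF a] A_bc[OF b]
  show "bc (a \<odot> id)" by (intro bc_op_tensor ab bc_id)
  show "(a o b) \<odot> id = (a \<odot> id) o (b \<odot> id)" by (simp add: op_tensor_comp ab)
  show "cadj a \<odot> id = cadj (a \<odot> id)" by (simp add: cadj_op_tensor ab)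
  show "(lincomb a c b) \<odot> id = (%xi. (a \<odot> id) xi + c *C (b \<odot> id) xi)" by (rule op_tensor_lincomb_left) (simp_all add: ab)
qed

lemma star_rep_cinner:
  assumes "star_rep A rho" "a \<in> A" "b \<in> A" shows "cinner (rho a x) (rho b y) = cinner x (rho (cadj a o b) y)"
  using star_repD[OF assms(1)] assms(2,3) A_cadj by (simp add: cadj_right)

text \<open>The hypothesis makes the assignment between the two orbits well defined and contractive,
  and it is extended by zero. The intertwining relation survives the extension because the
  orthogonal complement of the orbit is invariant as well, \<open>A\<close> being closed under
  adjoints.\<close>

lemma intertwiner_exists:
  fixes rho :: "('h => 'h) => 'x::chilbert_space => 'x" and \<sigma> :: "('h => 'h) => 'y::chilbert_space => 'y"
  assumes rho: "star_rep A rho" and \<sigma>: "star_rep A \<sigma>" and le: "\<forall>a\<in>A. norm (\<sigma> a y) <= norm (rho a x)"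
  shows "\<exists>C. bc C \<and> (\<forall>a\<in>A. C (rho a x) = \<sigma> a y) \<and> (\<forall>z. norm (C z) <= 1 * norm z) \<and> (\<forall>a\<in>A. C o rho a = \<sigma> a o C)"
proof -
  define R where "R = {(rho a x, \<sigma> a y) | a. a \<in> A}"
  have csR: "csubspace R" unfolding csubspace_def
  proof (intro conjI ballI allI)
    have "(rho (%_. 0) x, \<sigma> (%_. 0) y) = 0" using star_repD(4)[OF rho A_id A_id, of "-1"] star_repD(4)[OF \<sigma> A_id A_id, of "-1"]
      by (simp add: ch.sc_minus zero_prod_def)
    thus "0 \<in> R" unfolding R_def using A_zero by (metis (mono_tags, lifting) mem_Collect_eq)
    fix z w assume "z \<in> R" "w \<in> R"
    then obtain a b where ab: "z = (rho a x, \<sigma> a y)" "w = (rho b x, \<sigma> b y)" "a \<in> A" "b \<in> A" unfolding R_def by blast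
    have "z + w = (rho (%xi. a xi + 1 *C b xi) x, \<sigma> (%xi. a xi + 1 *C b xi) y)"
      by (simp only: star_repD(4)[OF rho ab(3,4)] star_repD(4)[OF \<sigma> ab(3,4)]) (simp add: ab)
    thus "z + w \<in> R" unfolding R_def using A_lincomb[OF ab(3,4), of 1] by blast
  next
    fix c z assume "z \<in> R"
    then obtain a where a: "z = (rho a x, \<sigma> a y)" "a \<in> A" unfolding R_def by blast
    have "c *C z = (rho (%xi. a xi + (c - 1) *C a xi) x, \<sigma> (%xi. a xi + (c - 1) *C a xi) y)"
      by (simp only: star_repD(4)[OF rho a(2,2)] star_repD(4)[OF \<sigma> a(2,2)]) (simp add: a scaleC_prod_def scaleC_diff_left)
    thus "c *C z \<in> R" unfolding R_def using A_lincomb[OF a(2,2), of "c - 1"] by blast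
  qed
  have bdR: "\<forall>v w. (v, w) \<in> R --> norm w <= 1 * norm v" unfolding R_def using le by auto
  obtain C where C: "bc C" "\<forall>v w. (v, w) \<in> R --> C v = w" "\<forall>z. norm (C z) <= 1 * norm z"
    "\<forall>z. (\<forall>v w. (v, w) \<in> R --> cinner v z = 0) --> C z = 0" using extension_of_relation[OF csR zero_le_one bdR] by (elim exE conjE)
  have C2: "C (rho a x) = \<sigma> a y" if "a \<in> A" for a using C(2) that unfolding R_def by blast
  have C4: "C z = 0" if "\<And>a. a \<in> A ==> cinner (rho a x) z = 0" for z by (rule C(4)[rule_format]) (use that in \<open>auto simp: R_def\<close>)
  define D where "D = (%a. rho a x) ` A"
  \<comment> \<open>The orbit and its orthogonal complement together are total, so the intertwining
    relation is checked on each separately.\<close>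
  define G where "G = D \<union> {z. \<forall>d\<in>D. cinner d z = 0}"
  have G: "closure (cspan G) = UNIV"
  proof (rule dense_if_total)
    fix z assume o: "\<And>s. s \<in> G ==> cinner s z = 0"
    hence "z \<in> G" unfolding G_def by blast
    hence "cinner z z = 0" by (rule o)
    thus "z = 0" by (simp add: cinner_eq_0_iff)
  qed
  have "C o rho a = \<sigma> a o C" if a: "a \<in> A" for a
  proof (rule bc_eq_on_total[OF _ _ G])
    note bra = star_repD(1)[OF rho a] and bsa = star_repD(1)[OF \<sigma> a]
    show "bc (C o rho a)" "bc (\<sigma> a o C)" by (intro bc_compose C bra bsa)+
    fix g assume "g \<in> G"
    then consider b where "g = rho b x" "b \<in> A" | "\<forall>d\<in>D. cinner d g = 0" unfolding G_def D_def by blast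
    thus "(C o rho a) g = (\<sigma> a o C) g"
    proof cases
      case 1
      have "C (rho a g) = C (rho (a o b) x)" using 1 star_repD(2)[OF rho a 1(2)] by simp
      also have "\<dots> = \<sigma> (a o b) y" by (rule C2[OF A_comp[OF a 1(2)]])
      also have "\<dots> = \<sigma> a (C g)" using 1 star_repD(2)[OF \<sigma> a 1(2)] C2 by simp
      finally show ?thesis by simp
    next
      case 2
      have g0: "cinner (rho b x) g = 0" if "b \<in> A" for b using 2 that unfolding D_def by blast
      have "cinner (rho b x) (rho a g) = 0" if b: "b \<in> A" for b
      proof -
        have "cinner (rho b x) (rho a g) = cinner (rho (cadj a o b) x) g"
          using star_repD(2)[OF rho A_cadj[OF a] b] star_repD(3)[OF rho a] by (simp add: cadj_left[OF bra])
        thus ?thesis using g0[OF A_comp[OF A_cadj[OF a] b]] by simp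
      qed
      hence "C (rho a g) = 0" by (rule C4)
      moreover have "C g = 0" by (rule C4[OF g0])
      ultimately show ?thesis by (simp add: bc_zero[OF bsa])
    qed
  qed
  thus ?thesis using C(1,3) C2 by blast
qed

text \<open>Normality writes the vector state of \<open>xi\<close> as a series with two vector
  sequences. By polarization it is dominated by the state of the single amplified vector
  \<open>\<Gamma>\<close>, and the square root of the resulting positive contraction in the
  commutant of the ampliation turns domination into equality.\<close>

lemma cyclic_vector_amplified:
  fixes \<pi> :: "('h => 'h) => 'l::chilbert_space => 'l" assumes \<pi>: "star_rep A \<pi>" and psi: "uw_fun psi" "\<And>a. a \<in> A ==> cinner xi (\<pi> a xi) = psi a"
  shows "\<exists>\<Theta> :: ('h, nat ell2) htens. \<forall>a\<in>A. \<forall>b\<in>A. cinner ((a \<odot> id) \<Theta>) ((b \<odot> id) \<Theta>) = cinner (\<pi> a xi) (\<pi> b xi)"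
proof -
  obtain alpha beta :: "nat => 'h" where alphabeta: "sqsum alpha" "sqsum beta"
    "\<And>x. x \<in> bounded_ops ==> (%n. cinner (alpha n) (x (beta n))) sums psi x" using uw_fun_repr[OF psi(1)] by metis
  \<comment> \<open>Averages serve because \<open>Re (cinner u v)\<close> is at most the squared
    norm of \<open>(1/2) *C (u + v)\<close>: the series with two sequences is dominated by one with
    a single sequence.\<close>
  define \<gamma> where "\<gamma> n = (1/2) *C (alpha n + beta n)" for n
  have s\<gamma>: "sqsum \<gamma>"
  proof (rule summable_comparison_test')
    show "summable (%n. (norm (alpha n))\<^sup>2 + (norm (beta n))\<^sup>2)" by (intro summable_add alphabeta)
    fix n
    have "(norm (alpha n + beta n))\<^sup>2 <= 2 * (norm (alpha n))\<^sup>2 + 2 * (norm (beta n))\<^sup>2"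
      using parallelogram[of "alpha n" "beta n"] zero_le_power2[of "norm (alpha n - beta n)"] by linarith
    moreover have "norm ((norm (\<gamma> n))\<^sup>2) = (norm (alpha n + beta n))\<^sup>2 / 4" by (simp add: \<gamma>_def norm_scaleC power_mult_distrib power_divide)
    ultimately show "norm ((norm (\<gamma> n))\<^sup>2) <= (norm (alpha n))\<^sup>2 + (norm (beta n))\<^sup>2"
      using zero_le_power2[of "norm (alpha n)"] zero_le_power2[of "norm (beta n)"] by linarith
  qed
  define g :: "nat => ('h, nat ell2) htens" where "g n = \<gamma> n \<otimes> basis n" for n
  have "summable g" by (rule orthogonal_summable) (use s\<gamma> in \<open>auto simp: g_def cinner_tens cinner_basis norm_tens\<close>)
  then obtain \<Gamma> where \<Gamma>: "g sums \<Gamma>" by (auto simp: summable_def)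
  have E\<Gamma>: "cadj (E_ket (basis n)) \<Gamma> = \<gamma> n" for n
  proof -
    have "(%m. cadj (E_ket (basis n)) (g m)) sums cadj (E_ket (basis n)) \<Gamma>"
      by (rule bounded_linear.sums[OF bounded_clinear_bounded_linear[OF bc_cadj[OF E_ket_bc]] \<Gamma>])
    moreover have "(%m. cadj (E_ket (basis n)) (g m)) = (%m. if m = n then \<gamma> m else 0)"
      by (rule ext) (auto simp: g_def cadj_E_ket cinner_basis)
    ultimately show ?thesis using sums_single[of n \<gamma>] sums_unique2 by metis
  qed
  have norm\<Gamma>: "(%n. (norm (b (\<gamma> n)))\<^sup>2) sums (norm ((b \<odot> id) \<Gamma>))\<^sup>2" if b: "bc b" for b
    using has_sum_imp_sums[OF parseval(2)[of "(b \<odot> id) \<Gamma>"]] by (simp add: cadj_E_ket_amp[OF b] E\<Gamma>)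
  have le: "\<forall>b\<in>A. norm (\<pi> b xi) <= norm ((b \<odot> id) \<Gamma>)"
  proof
    fix b assume b: "b \<in> A"
    note bb = A_bc[OF b]
    have bA: "cadj b o b \<in> A" by (intro A_comp A_cadj b)
    have "(%n. cinner (alpha n) ((cadj b o b) (beta n))) sums psi (cadj b o b)" by (rule alphabeta(3)) (use bA A_bounded in blast)
    hence "(%n. Re (cinner (b (alpha n)) (b (beta n)))) sums Re (psi (cadj b o b))" by (intro sums_Re) (simp add: cadj_right[OF bb])
    moreover have "psi (cadj b o b) = cinner (\<pi> b xi) (\<pi> b xi)" using psi(2)[OF bA] star_rep_cinner[OF \<pi> b b, of xi xi] by simp
    ultimately have s: "(%n. Re (cinner (b (alpha n)) (b (beta n)))) sums (norm (\<pi> b xi))\<^sup>2" by (simp add: norm_sq_cinner)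
    have "Re (cinner (b (alpha n)) (b (beta n))) <= (norm (b (\<gamma> n)))\<^sup>2" for n
    proof -
      define u v where "u = b (alpha n)" and "v = b (beta n)"
      have "(norm (u + v))\<^sup>2 = (norm u)\<^sup>2 + 2 * Re (cinner u v) + (norm v)\<^sup>2" using ch.sn_expand[of u 1 v] by simp
      moreover have "(norm (u - v))\<^sup>2 = (norm u)\<^sup>2 - 2 * Re (cinner u v) + (norm v)\<^sup>2" using ch.sn_expand[of u "-1" v] by (simp add: ch.sc_minus)
      ultimately have "4 * Re (cinner u v) <= (norm (u + v))\<^sup>2" using zero_le_power2[of "norm (u - v)"] by linarith
      moreover have "b (\<gamma> n) = (1/2) *C (u + v)" by (simp add: \<gamma>_def u_def v_def bc_scale[OF bb] bc_add[OF bb])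
      ultimately show ?thesis by (simp add: u_def v_def norm_scaleC power_mult_distrib power_divide)
    qed
    hence "(norm (\<pi> b xi))\<^sup>2 <= (norm ((b \<odot> id) \<Gamma>))\<^sup>2" by (rule sums_le[OF _ s norm\<Gamma>[OF bb]])
    thus "norm (\<pi> b xi) <= norm ((b \<odot> id) \<Gamma>)" by (rule power2_le_imp_le) simp
  qed
  obtain C where C: "bc C" "\<forall>a\<in>A. C ((a \<odot> id) \<Gamma>) = \<pi> a xi" "\<forall>z. norm (C z) <= 1 * norm z"
    "\<forall>a\<in>A. C o (a \<odot> id) = \<pi> a o C" using intertwiner_exists[OF star_rep_amp \<pi> le] by (elim exE conjE)
  \<comment> \<open>\<open>T\<close> is positive, at most 1 and commutes with the ampliation, so its
    square root commutes too; that root applied to \<open>\<Gamma>\<close> is the vector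
    sought.\<close>
  define T where "T = cadj C o C"
  have bT: "bc T" unfolding T_def by (intro bc_compose bc_cadj C)
  have Tq: "cinner x (T y) = cinner (C x) (C y)" for x y by (simp add: T_def cadj_right[OF C(1)])
  have bamp: "bc ((a \<odot> id) :: ('h, nat ell2) htens => _)" if "a \<in> A" for a by (rule star_repD(1)[OF star_rep_amp that])
  have Tcom: "(a \<odot> id) (T x) = T ((a \<odot> id) x)" if a: "a \<in> A" for a x
  proof (rule cinner_ext)
    fix y
    note aA = A_cadj[OF a]
    have "cinner y ((a \<odot> id) (T x)) = cinner ((cadj a \<odot> id) y) (T x)"
      using cadj_left[OF bamp[OF a], of y "T x"] by (simp add: cadj_op_tensor A_bc[OF a])
    also have "\<dots> = cinner (\<pi> (cadj a) (C y)) (C x)" unfolding Tq using fun_cong[OF bspec[OF C(4) aA], of y] by simp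
    also have "\<dots> = cinner (C y) (\<pi> a (C x))" using star_repD(3)[OF \<pi> a] cadj_left[OF star_repD(1)[OF \<pi> a]] by simp
    also have "\<dots> = cinner y (T ((a \<odot> id) x))" unfolding Tq using fun_cong[OF bspec[OF C(4) a], of x] by simp
    finally show "cinner y ((a \<odot> id) (T x)) = cinner y (T ((a \<odot> id) x))" .
  qed
  have "\<exists>S. bc S \<and> (\<forall>x y. cinner (S x) y = cinner x (S y)) \<and> (\<forall>x. S (S x) = T x) \<and>
    (\<forall>R. bc R --> (\<forall>x. R (T x) = T (R x)) --> (\<forall>x. R (S x) = S (R x)))"
  proof (rule sqrt_exists[OF bT])
    show "cinner (T x) y = cinner x (T y)" for x y by (subst cinner_commute) (simp add: Tq cinner_commute[symmetric])
    show "0 <= Re (cinner x (T x))" for x by (simp add: Tq ch.ip_pos)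
    show "Re (cinner x (T x)) <= (norm x)\<^sup>2" for x unfolding Tq norm_sq_cinner[symmetric] by (rule power_mono) (use C(3) in simp_all)
  qed
  then obtain S where S: "bc S" "\<forall>x y. cinner (S x) y = cinner x (S y)" "\<forall>x. S (S x) = T x"
    "\<forall>R. bc R --> (\<forall>x. R (T x) = T (R x)) --> (\<forall>x. R (S x) = S (R x))" by (elim exE conjE)
  have Scom: "(a \<odot> id) (S x) = S ((a \<odot> id) x)" if "a \<in> A" for a x using S(4)[rule_format, OF bamp[OF that] Tcom[OF that]] .
  have "cinner ((a \<odot> id) (S \<Gamma>)) ((b \<odot> id) (S \<Gamma>)) = cinner (\<pi> a xi) (\<pi> b xi)" if a: "a \<in> A" and b: "b \<in> A" for a b
  proof -
    have "cinner ((a \<odot> id) (S \<Gamma>)) ((b \<odot> id) (S \<Gamma>)) = cinner ((a \<odot> id) \<Gamma>) (T ((b \<odot> id) \<Gamma>))"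
      unfolding Scom[OF a] Scom[OF b] using S(2,3) by simp
    thus ?thesis unfolding Tq using C(2) a b by simp
  qed
  thus ?thesis by blast
qed

text \<open>Zorn's lemma yields a maximal family of vectors with mutually orthogonal cyclic
  subspaces. Each of these embeds into an ampliation by \<open>cyclic_vector_amplified\<close>, and
  the images are kept orthogonal by giving every cyclic vector \<open>xi\<close> its own block
  \<open>(xi, n)\<close> of basis vectors; this is the origin of the index type
  \<open>'l \<times> nat\<close>.\<close>

theorem normal_rep_dilation:
  fixes \<pi> :: "('h => 'h) => 'l::chilbert_space => 'l"
  assumes \<pi>: "star_rep A \<pi>" and one: "\<pi> id = id" and normal: "\<And>xi. \<exists>psi. uw_fun psi \<and> (\<forall>a\<in>A. cinner xi (\<pi> a xi) = psi a)"
  shows "\<exists>W :: 'l => ('h, ('l \<times> nat) ell2) htens. bc W \<and> (\<forall>x y. cinner (W x) (W y) = cinner x y) \<and>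
    (\<forall>a\<in>A. W o \<pi> a = (a \<odot> id) o W)"
proof -
  define good where "good S \<longleftrightarrow> (\<forall>xi\<in>S. \<forall>eta\<in>S. xi \<noteq> eta --> (\<forall>a\<in>A. cinner xi (\<pi> a eta) = 0))" for S
  have "\<exists>M\<in>{S. good S \<and> 0 \<notin> S}. \<forall>X\<in>{S. good S \<and> 0 \<notin> S}. M \<subseteq> X --> X = M"
  proof (rule subset_Zorn)
    fix C assume C: "subset.chain {S. good S \<and> 0 \<notin> S} C"
    have "good (\<Union>C)" unfolding good_def
    proof (intro ballI impI)
      fix xi eta a assume "xi \<in> \<Union>C" "eta \<in> \<Union>C" and n: "xi \<noteq> eta" "a \<in> A"
      then obtain X Y where XY: "X \<in> C" "Y \<in> C" "xi \<in> X" "eta \<in> Y" by blast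
      hence "X \<subseteq> Y \<or> Y \<subseteq> X" "good X" "good Y" using C unfolding subset.chain_def by blast+
      thus "cinner xi (\<pi> a eta) = 0" using XY n unfolding good_def by blast
    qed
    moreover have "0 \<notin> \<Union>C" using C unfolding subset.chain_def by blast
    ultimately show "\<exists>U\<in>{S. good S \<and> 0 \<notin> S}. \<forall>X\<in>C. X \<subseteq> U" by (intro bexI[of _ "\<Union>C"]) auto
  qed
  then obtain S where S: "good S" "0 \<notin> S" "\<And>X. good X ==> 0 \<notin> X ==> S \<subseteq> X ==> X = S" by auto
  \<comment> \<open>Maximality: a nonzero vector orthogonal to all the cyclic subspaces could be
    added to the family.\<close>
  have tot: "zeta = 0" if z: "\<And>xi a. xi \<in> S ==> a \<in> A ==> cinner (\<pi> a xi) zeta = 0" for zeta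
  proof (rule ccontr)
    assume nz: "zeta \<noteq> 0"
    have 1: "cinner zeta (\<pi> a xi) = 0" if "xi \<in> S" "a \<in> A" for xi a using z[OF that] cinner_0_commute by blast
    have 2: "cinner xi (\<pi> a zeta) = 0" if "xi \<in> S" "a \<in> A" for xi a
    proof -
      have "cinner (\<pi> (cadj a) xi) zeta = 0" by (rule z[OF that(1) A_cadj[OF that(2)]])
      thus ?thesis using star_repD(3)[OF \<pi> that(2)] cadj_left[OF star_repD(1)[OF \<pi> that(2)]] by simp
    qed
    have "good (insert zeta S)" using S(1) 1 2 unfolding good_def by (metis insert_iff)
    hence "insert zeta S = S" using S(2) nz by (intro S(3)) auto
    hence "cinner zeta zeta = 0" using 1[of zeta id] A_id one by auto
    thus False using nz by (simp add: cinner_eq_0_iff)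
  qed
  have ex: "\<forall>xi. \<exists>\<Theta> :: ('h, nat ell2) htens. \<forall>a\<in>A. \<forall>b\<in>A. cinner ((a \<odot> id) \<Theta>) ((b \<odot> id) \<Theta>) = cinner (\<pi> a xi) (\<pi> b xi)"
  proof
    fix xi
    obtain psi where "uw_fun psi" "\<forall>a\<in>A. cinner xi (\<pi> a xi) = psi a" using normal[of xi] by (elim exE conjE)
    thus "\<exists>\<Theta> :: ('h, nat ell2) htens. \<forall>a\<in>A. \<forall>b\<in>A. cinner ((a \<odot> id) \<Theta>) ((b \<odot> id) \<Theta>) = cinner (\<pi> a xi) (\<pi> b xi)"
      using cyclic_vector_amplified[OF \<pi>] by blast
  qed
  obtain \<Theta> :: "'l => ('h, nat ell2) htens" where \<Theta>: "\<forall>xi. \<forall>a\<in>A. \<forall>b\<in>A. cinner ((a \<odot> id) (\<Theta> xi)) ((b \<odot> id) (\<Theta> xi)) = cinner (\<pi> a xi) (\<pi> b xi)"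
    using choice[OF ex] by (elim exE)
  \<comment> \<open>\<open>J xi\<close> embeds the sequence space as the block that belongs to
    \<open>xi\<close>; distinct blocks are orthogonal.\<close>
  have "\<forall>xi::'l. \<exists>J :: nat ell2 => ('l \<times> nat) ell2. bc J \<and> (\<forall>n\<in>UNIV. J (basis n) = basis (xi, n)) \<and> (\<forall>x. norm (J x) <= 1 * norm x) \<and>
    (\<forall>x. (\<forall>n\<in>UNIV. cinner (basis n) x = 0) --> J x = 0)" by (intro allI isometry_from_generators) (simp add: cinner_basis)
  from choice[OF this] obtain J :: "'l => nat ell2 => ('l \<times> nat) ell2" where J: "\<forall>xi. bc (J xi) \<and> (\<forall>n\<in>UNIV. J xi (basis n) = basis (xi, n)) \<and>
    (\<forall>x. norm (J xi x) <= 1 * norm x) \<and> (\<forall>x. (\<forall>n\<in>UNIV. cinner (basis n) x = 0) --> J xi x = 0)" by (elim exE)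
  have bJ: "bc (J xi)" and Jb: "J xi (basis n) = basis (xi, n)" for xi n using J by blast+
  have JJ: "cadj (J xi) o J eta = (if xi = eta then id else (%_. 0))" for xi eta
  proof (rule bc_eq_on_total[OF _ _ basis_total])
    show "bc (cadj (J xi) o J eta)" by (intro bc_compose bc_cadj bJ)
    show "bc (if xi = eta then id else (%_. 0 :: nat ell2))" by simp
    fix g :: "nat ell2" assume "g \<in> range basis"
    then obtain n where g: "g = basis n" by blast
    show "(cadj (J xi) o J eta) g = (if xi = eta then id else (%_. 0)) g"
    proof (rule total_if_dense[OF basis_total])
      fix s :: "nat ell2" assume "s \<in> range basis"
      then obtain m where "s = basis m" by blast
      thus "cinner s ((cadj (J xi) o J eta) g) = cinner s ((if xi = eta then id else (%_. 0)) g)"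
        unfolding g by (simp add: cadj_right[OF bJ] Jb cinner_basis)
    qed
  qed
  define d :: "'l \<times> ('h => 'h) => ('h, ('l \<times> nat) ell2) htens" where "d = (%(xi, a). (id \<odot> J xi) ((a \<odot> id) (\<Theta> xi)))"
  define g where "g = (%(xi, a). \<pi> a xi)"
  have ip: "cinner (d i) (d j) = cinner (g i) (g j)" if ij: "i \<in> S \<times> A" "j \<in> S \<times> A" for i j
  proof -
    obtain xi a eta b where h: "i = (xi, a)" "j = (eta, b)" "xi \<in> S" "eta \<in> S" "a \<in> A" "b \<in> A" using ij by (cases i; cases j) auto
    have "cinner (d i) (d j) = cinner ((a \<odot> id) (\<Theta> xi)) ((id \<odot> (cadj (J xi) o J eta)) ((b \<odot> id) (\<Theta> eta)))"
      unfolding d_def h(1,2) split_conv cadj_right[OF bc_op_tensor[OF bc_id bJ], symmetric]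
      by (simp add: cadj_op_tensor bJ op_tensor_comp_apply bc_cadj)
    also have "\<dots> = cinner (\<pi> a xi) (\<pi> b eta)"
    proof (cases "xi = eta")
      case True
      thus ?thesis unfolding JJ using \<Theta> h(5,6) by simp
    next
      case False
      have "id \<odot> (%_. 0) = (%_ :: ('h, nat ell2) htens. 0 :: ('h, nat ell2) htens)" by (rule op_tensor_eqI) simp_all
      moreover have "cinner (\<pi> a xi) (\<pi> b eta) = 0"
        unfolding star_rep_cinner[OF \<pi> h(5,6)] using S(1) h(3,4) False A_comp[OF A_cadj[OF h(5)] h(6)] unfolding good_def by blast
      ultimately show ?thesis unfolding JJ using False by simp
    qed
    finally show ?thesis unfolding g_def h by simp
  qed
  have exW: "\<exists>W. bc W \<and> (\<forall>i\<in>S \<times> A. W (g i) = d i) \<and> (\<forall>x. norm (W x) <= 1 * norm x) \<and>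
    (\<forall>x. (\<forall>i\<in>S \<times> A. cinner (g i) x = 0) --> W x = 0)" by (rule isometry_from_generators) (rule ip)
  obtain W where W: "bc W" "\<forall>i\<in>S \<times> A. W (g i) = d i" using exW by (elim exE conjE)
  have G: "closure (cspan (g ` (S \<times> A))) = UNIV" by (rule dense_if_total, rule tot) (auto simp: g_def)
  have Wiso: "cadj W o W = id"
  proof (rule bc_eq_on_total[OF _ bc_id G])
    show "bc (cadj W o W)" by (intro bc_compose bc_cadj W)
    fix x assume "x \<in> g ` (S \<times> A)"
    then obtain j where j: "x = g j" "j \<in> S \<times> A" by blast
    show "(cadj W o W) x = id x"
    proof (rule total_if_dense[OF G])
      fix s assume "s \<in> g ` (S \<times> A)"
      then obtain i where i: "s = g i" "i \<in> S \<times> A" by blast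
      show "cinner s ((cadj W o W) x) = cinner s (id x)"
        unfolding i(1) j(1) using bspec[OF W(2) i(2)] bspec[OF W(2) j(2)] ip[OF i(2) j(2)] by (simp add: cadj_right[OF W(1)])
    qed
  qed
  have "W o \<pi> a = (a \<odot> id) o W" if a: "a \<in> A" for a
  proof (rule bc_eq_on_total[OF _ _ G])
    show "bc (W o \<pi> a)" by (intro bc_compose W star_repD(1)[OF \<pi> a])
    show "bc ((a \<odot> id) o W)" by (intro bc_compose W bc_op_tensor A_bc[OF a] bc_id)
    fix x assume "x \<in> g ` (S \<times> A)"
    then obtain xi b where x: "x = g (xi, b)" "xi \<in> S" "b \<in> A" by auto
    have "\<pi> a x = g (xi, a o b)" unfolding x g_def using star_repD(2)[OF \<pi> a x(3)] by simp
    hence "(W o \<pi> a) x = d (xi, a o b)" using W(2) x(2) A_comp[OF a x(3)] by simp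
    also have "\<dots> = (a \<odot> id) (d (xi, b))"
      unfolding d_def split_conv by (simp add: op_tensor_comp_apply A_bc[OF a] A_bc[OF x(3)] bJ bc_compose)
    also have "\<dots> = ((a \<odot> id) o W) x" unfolding x(1) using W(2) x(2,3) by simp
    finally show "(W o \<pi> a) x = ((a \<odot> id) o W) x" .
  qed
  moreover have "cinner (W x) (W y) = cinner x y" for x y using cadj_right[OF W(1), of x "W y"] fun_cong[OF Wiso, of y] by simp
  ultimately show ?thesis using W(1) by blast
qed

end

subsection \<open>Amplification of a compressed ampliation\<close>

lemma uw_fun_has_sum:
  assumes "uw_fun (phi :: ('a::chilbert_space => 'a) => complex)"
  shows "\<exists>xi eta :: nat => 'a. sqsum xi \<and> sqsum eta \<and>
    (\<forall>x\<in>bounded_ops. ((%n. cinner (xi n) (x (eta n))) has_sum phi x) UNIV)" by (rule uw_fun_repr[OF assms]) blast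

text \<open>Expanding each vector of the representing sequences along the basis of the second factor
  gives, by Parseval, doubly indexed square-summable families, so the pulled-back functional is of
  the same kind.\<close>

lemma uw_fun_ampliation:
  fixes phi :: "(('a::chilbert_space, 'i ell2) htens => ('a, 'i ell2) htens) => complex" assumes "uw_fun phi" shows "uw_fun (%x. phi (x \<odot> id))"
proof -
  obtain xi eta :: "nat => ('a, 'i ell2) htens" where r: "sqsum xi" "sqsum eta"
    "\<forall>x\<in>bounded_ops. ((%n. cinner (xi n) (x (eta n))) has_sum phi x) UNIV" using uw_fun_has_sum[OF assms] by (elim exE conjE)
  define c where "c f = (%(n, i). cadj (E_ket (basis i)) (f n))" for f :: "nat => ('a, 'i ell2) htens"
  have sm: "(%p. (norm (c f p))\<^sup>2) summable_on UNIV" if f: "sqsum f" for f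
  proof -
    have s: "((%i. norm ((norm (c f (n, i)))\<^sup>2)) has_sum (norm (f n))\<^sup>2) UNIV" for n using parseval(2)[of "f n"] by (simp add: c_def)
    have e: "(\<Sum>\<^sub>\<infinity>i. norm ((norm (c f (n, i)))\<^sup>2)) = (norm (f n))\<^sup>2" for n using s by (rule infsumI)
    have "(%p. norm ((norm (c f p))\<^sup>2)) summable_on (SIGMA n:UNIV. UNIV)" unfolding Infinite_Sum.abs_summable_on_Sigma_iff e
    proof (intro conjI ballI)
      show "(%i. norm ((norm (c f (n, i)))\<^sup>2)) summable_on UNIV" for n using s by (rule has_sum_imp_summable)
      show "(%n. norm ((norm (f n))\<^sup>2)) summable_on UNIV" using f by (simp add: summable_on_UNIV_nonneg_real_iff)
    qed
    thus ?thesis by simp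
  qed
  have "uw_fun (%x. \<Sum>\<^sub>\<infinity>p. cinner (c xi p) (x (c eta p)))" by (rule uw_fun_family; rule sm; fact r)
  moreover have "phi (x \<odot> id) = (\<Sum>\<^sub>\<infinity>p. cinner (c xi p) (x (c eta p)))" if x: "x \<in> bounded_ops" for x
  proof -
    note bx = bounded_opsD[OF x]
    have "(%p. cinner (c xi p) (x (c eta p))) summable_on UNIV" by (rule abs_summable_summable, rule family_abs_summable) (rule sm r bx)+
    hence s: "(%p. cinner (c xi p) (x (c eta p))) summable_on (SIGMA n:UNIV. UNIV)" by simp
    have "(\<Sum>\<^sub>\<infinity>p. cinner (c xi p) (x (c eta p))) = (\<Sum>\<^sub>\<infinity>n. \<Sum>\<^sub>\<infinity>i. cinner (c xi (n, i)) (x (c eta (n, i))))" using infsum_Sigma_banach[OF s] by simp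
    also have "(%n. \<Sum>\<^sub>\<infinity>i. cinner (c xi (n, i)) (x (c eta (n, i)))) = (%n. cinner (xi n) ((x \<odot> id) (eta n)))"
      by (rule ext, rule infsumI) (use parseval(1) in \<open>simp add: c_def cadj_E_ket_amp[OF bx, symmetric]\<close>)
    also have "infsum \<dots> UNIV = phi (x \<odot> id)" by (rule infsumI, rule bspec[OF r(3)]) (intro bounded_opsI bc_op_tensor bx bc_id)
    finally show ?thesis by simp
  qed
  ultimately show ?thesis by (rule uw_fun_cong)
qed

lemma rearrange_exists:
  "\<exists>U :: (('a::chilbert_space, 'e::chilbert_space) htens, 'k::chilbert_space) htens => (('a, 'k) htens, 'e) htens.
    bc U \<and> (\<forall>u e k. U ((u \<otimes> e) \<otimes> k) = (u \<otimes> k) \<otimes> e) \<and> (\<forall>x. norm (U x) <= norm x)"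
proof -
  have "\<exists>U :: (('a, 'e) htens, 'k) htens => (('a, 'k) htens, 'e) htens. bc U \<and>
    (\<forall>i\<in>UNIV. U ((%(u, e, k). (u \<otimes> e) \<otimes> k) i) = (%(u, e, k). (u \<otimes> k) \<otimes> e) i) \<and> (\<forall>x. norm (U x) <= 1 * norm x) \<and>
    (\<forall>x. (\<forall>i\<in>UNIV. cinner ((%(u, e, k). (u \<otimes> e) \<otimes> k) i) x = 0) --> U x = 0)" by (rule isometry_from_generators) (auto simp: cinner_tens)
  thus ?thesis by (elim exE conjE) (intro exI conjI, auto)
qed

definition rearrange :: "(('a::chilbert_space, 'e::chilbert_space) htens, 'k::chilbert_space) htens => (('a, 'k) htens, 'e) htens"
  where "rearrange = (SOME U. bc U \<and> (\<forall>u e k. U ((u \<otimes> e) \<otimes> k) = (u \<otimes> k) \<otimes> e) \<and> (\<forall>x. norm (U x) <= norm x))"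

lemma rearrange_props:
  "bc (rearrange :: (('a::chilbert_space, 'e::chilbert_space) htens, 'k::chilbert_space) htens => _)"
  "rearrange ((u \<otimes> e) \<otimes> k) = (u \<otimes> k) \<otimes> e" "norm (rearrange x) <= norm x"
  using someI_ex[OF rearrange_exists] unfolding rearrange_def[symmetric] by blast+

lemma rearrange_E_ket: "bc R ==> (rearrange o (R \<odot> id)) (eta \<otimes> w) = (E_ket w \<odot> id) (R eta)"
proof -
  have e: "(%z. rearrange (z \<otimes> w)) = E_ket w \<odot> id" by (rule op_tensor_eqI[symmetric])
      (use bc_compose[OF rearrange_props(1) bc_tens_right] in \<open>simp_all add: o_def rearrange_props E_ket_def\<close>)
  assume "bc R"
  thus ?thesis using fun_cong[OF e, of "R eta"] by (simp add: op_tensor_apply)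
qed

text \<open>If compressing the ampliation of \<open>A\<close> by \<open>R\<close> gives a
  representation, this is its extension by the identity on \<open>'k\<close>:
  \<open>rearrange\<close> moves the auxiliary factor \<open>'e\<close> out of the way so that
  \<open>x\<close> can act on \<open>'h\<close> and \<open>'k\<close>.\<close>

definition amplify :: "('l::chilbert_space => ('h::chilbert_space, 'e::chilbert_space) htens)
    => (('h, 'k::chilbert_space) htens => ('h, 'k) htens) => ('l, 'k) htens => ('l, 'k) htens"
  where "amplify R x = cadj (rearrange o (R \<odot> id)) o (x \<odot> id) o (rearrange o (R \<odot> id))"

lemma slices_ext:
  fixes S T :: "('a::chilbert_space, 'k::chilbert_space) htens => ('b::chilbert_space, 'm::chilbert_space) htens"
  assumes "bc S" "bc T" "\<And>v w. block v S w = block v T w" shows "S = T"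
proof (rule tens_op_ext[OF assms(1,2)], rule cinner_tens_ext)
  fix u w u' v
  have "cinner u' ((block v S w) u) = cinner u' ((block v T w) u)" unfolding assms(3) ..
  thus "cinner (u' \<otimes> v) (S (u \<otimes> w)) = cinner (u' \<otimes> v) (T (u \<otimes> w))" by (simp add: cadj_right[OF E_ket_bc]) (simp add: E_ket_def)
qed

context
  fixes R :: "'l::chilbert_space => ('h::chilbert_space, 'i ell2) htens" assumes R: "bc R"
begin

lemma bc_rR: "bc (rearrange o (R \<odot> (id :: 'k::chilbert_space => 'k)))" by (intro bc_compose rearrange_props bc_op_tensor R bc_id)

lemma bc_amplify: "bc x ==> bc (amplify R x)"
  unfolding amplify_def by (intro bc_compose[OF bc_compose[OF bc_cadj[OF bc_rR] bc_op_tensor] bc_rR] bc_id)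

text \<open>Slicing in the second factor commutes with the extension. This identifies its values on
  elementary tensors, and later reduces matrix elements of \<open>flow_endo\<close> to
  \<open>j\<close> applied to slices.\<close>

lemma amplify_slice:
  fixes x :: "('h, 'k::chilbert_space) htens => ('h, 'k) htens" assumes x: "bc x"
  shows "block v (amplify R x) w = cadj R o ((block v x w) \<odot> id) o R"
proof -
  define V :: "('l, 'k) htens => (('h, 'k) htens, 'i ell2) htens" where "V = rearrange o (R \<odot> id)"
  have bV: "bc V" unfolding V_def by (rule bc_rR)
  have VE: "V o E_ket w = (E_ket w \<odot> id) o R" for w
    by (rule ext) (simp only: o_apply E_ket_def[of w] V_def, simp only: rearrange_E_ket[OF R, unfolded o_apply] E_ket_def)
  have bE: "bc (E_ket w \<odot> (id :: 'i ell2 => _))" for w :: 'k by (intro bc_op_tensor E_ket_bc bc_id)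
  have "cadj (E_ket v) o cadj V = cadj (V o E_ket v)" by (simp add: cadj_comp bV E_ket_bc)
  also have "\<dots> = cadj R o (cadj (E_ket v) \<odot> id)" unfolding VE by (simp add: cadj_comp bE R cadj_op_tensor E_ket_bc)
  finally have EV: "cadj (E_ket v) o cadj V = cadj R o (cadj (E_ket v) \<odot> id)" .
  have "block v (amplify R x) w = (cadj (E_ket v) o cadj V) o (x \<odot> id) o (V o E_ket w)"
    unfolding amplify_def V_def by (simp only: comp_assoc)
  also have "\<dots> = cadj R o ((cadj (E_ket v) \<odot> id) o (x \<odot> id) o (E_ket w \<odot> id)) o R" unfolding EV VE by (simp only: comp_assoc)
  also have "(cadj (E_ket v) \<odot> id) o (x \<odot> id) o (E_ket w \<odot> id) = (block v x w) \<odot> id"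
    by (simp add: op_tensor_comp bc_cadj E_ket_bc x bc_compose)
  finally show ?thesis .
qed

lemma amplify_elem:
  assumes "bc a" "bc b" shows "amplify R (a \<odot> b) = (cadj R o (a \<odot> id) o R) \<odot> b"
proof (rule slices_ext)
  have ba: "bc (a \<odot> id)" by (intro bc_op_tensor assms bc_id)
  have bR: "bc (cadj R o (a \<odot> id) o R)" by (intro bc_compose bc_cadj R ba)
  show "bc (amplify R (a \<odot> b))" by (intro bc_amplify bc_op_tensor assms)
  show "bc ((cadj R o (a \<odot> id) o R) \<odot> b)" by (rule bc_op_tensor[OF bR assms(2)])
  fix v w
  have sl: "block v (c \<odot> b) w = (%u. cinner v (b w) *C c u)" if "bc c" for c :: "'m::chilbert_space => 'n::chilbert_space"
    by (rule ext) (simp add: E_ket_def[of w] op_tensor_apply[OF that assms(2)] cadj_E_ket)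
  have sc: "(%u. c *C a u) \<odot> id = (%zeta. c *C (a \<odot> id) zeta)" for c
    by (rule op_tensor_eqI) (simp_all add: bc_scaled ba op_tensor_apply assms tens_scale_left)
  show "block v (amplify R (a \<odot> b)) w = block v ((cadj R o (a \<odot> id) o R) \<odot> b) w"
    unfolding amplify_slice[OF bc_op_tensor[OF assms]] sl[OF assms(1)] sl[OF bR] sc by (rule ext) (simp add: bc_scale[OF bc_cadj[OF R]])
qed

lemma amplify_normal: "uw_fun phi ==> uw_fun (%x. phi (amplify R x))"
  using uw_fun_ampliation[OF uw_fun_conj[OF _ bc_cadj[OF bc_rR] bc_rR]] unfolding amplify_def by blast

lemma amplify_lincomb:
  "bc x ==> bc y ==> amplify R (lincomb x c y) = (%xi. amplify R x xi + c *C amplify R y xi)" unfolding amplify_def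
  by (rule ext) (simp add: op_tensor_lincomb_left bc_add[OF bc_cadj[OF bc_rR]] bc_scale[OF bc_cadj[OF bc_rR]])

lemma cadj_amplify: assumes "bc x" shows "cadj (amplify R x) = amplify R (cadj x)"
proof -
  have bx: "bc (x \<odot> id)" by (intro bc_op_tensor assms bc_id)
  have c: "cadj (cadj V o (x \<odot> id) o V) = cadj V o (cadj x \<odot> id) o V" if "bc V" for V
    by (simp add: cadj_comp bc_compose bc_cadj that bx cadj_cadj cadj_op_tensor assms comp_assoc)
  show ?thesis unfolding amplify_def by (rule c[OF bc_rR])
qed

lemma amplify_comp_right:
  fixes x :: "('h, 'k::chilbert_space) htens => ('h, 'k) htens" assumes x: "bc x" and b: "bc b"
  shows "amplify R ((id \<odot> b) o x) = (id \<odot> b) o amplify R x"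
proof (rule slices_ext)
  have bb: "bc (id \<odot> b)" by (intro bc_op_tensor b bc_id)
  show "bc (amplify R ((id \<odot> b) o x))" by (intro bc_amplify bc_compose bb x)
  show "bc ((id \<odot> b) o amplify R x)" by (intro bc_amplify bc_compose bc_op_tensor b bc_id x)
  fix v w
  have e: "cadj (E_ket v) o (id \<odot> b) = cadj (E_ket (cadj b v))" by (rule ext) (simp add: cadj_E_ket_op_tensor b)
  show "block v (amplify R ((id \<odot> b) o x)) w = block v ((id \<odot> b) o amplify R x) w"
    unfolding amplify_slice[OF bc_compose[OF bb x]] comp_assoc[symmetric] e
    by (simp only: amplify_slice[OF x, symmetric] comp_assoc[symmetric])
qed

end

lemma uw_fun_sum:
  assumes "uw_fun phi" "\<And>i. i < n ==> x i \<in> bounded_ops" shows "phi (%xi. \<Sum>i<n. x i xi) = (\<Sum>i<(n::nat). phi (x i :: 'a::chilbert_space => 'a))"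
  using assms(2)
proof (induction n)
  case 0
  show ?case using uw_fun_op0[OF assms(1)] by simp
next
  case (Suc n)
  have "(%xi. \<Sum>i<n. x i xi) \<in> bounded_ops"
  proof (intro bounded_opsI bc_sums)
    fix i assume "i \<in> {..<n}"
    hence "x i \<in> bounded_ops" by (intro Suc.prems) simp
    thus "bc (x i)" by (rule bounded_opsD)
  qed
  from uw_fun_linear[OF assms(1) this Suc.prems[of n], of 1] show ?case using Suc by simp
qed

lemma vn_tensor_induct_elem:
  assumes "x \<in> vn_tensor A B" "uw_fun phi" "uw_fun psi" "A \<subseteq> bounded_ops" "B \<subseteq> bounded_ops"
    and elem: "\<And>a b. a \<in> A ==> b \<in> B ==> phi (a \<odot> b) = psi (a \<odot> b)" shows "phi x = psi x"
proof (rule vn_tensor_induct[OF assms(1-5)])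
  fix n :: nat and a b assume h: "\<forall>i<n. a i \<in> A \<and> b i \<in> B"
  have b: "a i \<odot> b i \<in> bounded_ops" if "i < n" for i
  proof -
    have "bc (a i)" "bc (b i)" using h that assms(4,5) bounded_opsD by blast+
    thus ?thesis by (intro bounded_opsI bc_op_tensor)
  qed
  have "(\<Sum>i<n. phi (a i \<odot> b i)) = (\<Sum>i<n. psi (a i \<odot> b i))" by (intro sum.cong refl elem) (use h in auto)
  thus "phi (%zeta. \<Sum>i<n. (a i \<odot> b i) zeta) = psi (%zeta. \<Sum>i<n. (a i \<odot> b i) zeta)"
    using uw_fun_sum[OF assms(2), of n "%i. a i \<odot> b i"] uw_fun_sum[OF assms(3), of n "%i. a i \<odot> b i"] b by simp
qed

text \<open>The hypothesis \<open>inv\<close> says that, for elements of \<open>A\<close>, the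
  compression by \<open>R\<close> can be undone. Both sides are ultraweakly continuous in
  \<open>x\<close>, so elementary tensors suffice.\<close>

lemma amplify_intertwine:
  fixes R :: "'l::chilbert_space => ('h::chilbert_space, 'i ell2) htens" and x :: "('h, 'k::chilbert_space) htens => ('h, 'k) htens"
  assumes R: "bc R" and AB: "A \<subseteq> bounded_ops" "B \<subseteq> bounded_ops" and x: "x \<in> vn_tensor A B"
    and inv: "\<And>a. a \<in> A ==> R o (cadj R o (a \<odot> id) o R) = (a \<odot> id) o R"
  shows "(rearrange o (R \<odot> id)) o amplify R x = (x \<odot> id) o (rearrange o (R \<odot> id))"
proof (rule op_ext_cinner)
  define V :: "('l, 'k) htens => (('h, 'k) htens, 'i ell2) htens" where "V = rearrange o (R \<odot> id)"
  have bV: "bc V" unfolding V_def by (rule bc_rR[OF R])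
  fix xi eta
  have "cinner (cadj V xi) (amplify R x eta) = cinner xi ((x \<odot> id) (V eta))"
  proof (rule vn_tensor_induct_elem[OF x _ _ AB])
    show "uw_fun (%x. cinner (cadj V xi) (amplify R x eta))" by (rule amplify_normal[OF R uw_fun_vec])
    show "uw_fun (%x. cinner xi ((x \<odot> id) (V eta)))" by (rule uw_fun_ampliation[OF uw_fun_vec])
    fix a b assume ab: "a \<in> A" "b \<in> B"
    hence ba: "bc a" "bc b" using AB bounded_opsD by blast+
    define c where "c = cadj R o (a \<odot> id) o R"
    have bc: "bc c" unfolding c_def by (intro bc_compose bc_cadj R bc_op_tensor ba bc_id)
    have Rc: "R (c zeta) = (a \<odot> id) (R zeta)" for zeta using fun_cong[OF inv[OF ab(1), folded c_def], of zeta] by simp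
    have "V o (c \<odot> b) = ((a \<odot> b) \<odot> id) o V"
    proof (rule tens_op_ext)
      show "bc (V o (c \<odot> b))" by (rule bc_compose[OF bV bc_op_tensor[OF bc ba(2)]])
      show "bc (((a \<odot> b) \<odot> id) o V)" by (intro bc_compose[OF _ bV] bc_op_tensor ba bc_id)
      fix zeta w
      have Vt: "V (zeta \<otimes> w) = (E_ket w \<odot> id) (R zeta)" for zeta w unfolding V_def by (rule rearrange_E_ket[OF R])
      have "V ((c \<odot> b) (zeta \<otimes> w)) = (E_ket (b w) \<odot> id) ((a \<odot> id) (R zeta))" by (simp add: op_tensor_apply[OF bc ba(2)] Vt Rc)
      also have "\<dots> = ((E_ket (b w) o a) \<odot> id) (R zeta)" by (simp add: op_tensor_comp_apply E_ket_bc ba)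
      also have "E_ket (b w) o a = (a \<odot> b) o E_ket w" by (rule ext) (simp add: E_ket_def op_tensor_apply ba)
      also have "(((a \<odot> b) o E_ket w) \<odot> id) (R zeta) = ((a \<odot> b) \<odot> id) ((E_ket w \<odot> id) (R zeta))"
        by (simp add: op_tensor_comp_apply E_ket_bc ba bc_op_tensor)
      finally show "(V o (c \<odot> b)) (zeta \<otimes> w) = (((a \<odot> b) \<odot> id) o V) (zeta \<otimes> w)" by (simp add: Vt)
    qed
    from fun_cong[OF this, of eta]
    show "cinner (cadj V xi) (amplify R (a \<odot> b) eta) = cinner xi (((a \<odot> b) \<odot> id) (V eta))"
      by (simp add: amplify_elem[OF R ba, folded c_def] cadj_left[OF bV])
  qed
  thus "cinner xi (((rearrange o (R \<odot> id)) o amplify R x) eta) = cinner xi (((x \<odot> id) o (rearrange o (R \<odot> id))) eta)"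
    unfolding V_def[symmetric] cadj_left[OF bV] o_apply .
qed

text \<open>The right factor is moved through \<open>R\<close> by \<open>amplify_intertwine\<close>,
  after which both factors stand inside one compression; hence the asymmetric assumptions on
  \<open>x\<close> and \<open>y\<close>.\<close>

lemma amplify_mult:
  fixes x y :: "('h::chilbert_space, 'k::chilbert_space) htens => ('h, 'k) htens"
  assumes R: "bc (R :: 'l::chilbert_space => ('h, 'i ell2) htens)" and AB: "A \<subseteq> bounded_ops" "B \<subseteq> bounded_ops" and x: "bc x" and y: "y \<in> vn_tensor A B"
    and inv: "\<And>a. a \<in> A ==> R o (cadj R o (a \<odot> id) o R) = (a \<odot> id) o R" shows "amplify R (x o y) = amplify R x o amplify R y"
proof -
  define V :: "('l, 'k) htens => (('h, 'k) htens, 'i ell2) htens" where "V = rearrange o (R \<odot> id)"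
  have d: "amplify R z = cadj V o (z \<odot> id) o V" for z unfolding amplify_def V_def ..
  have iV: "V o amplify R y = (y \<odot> id) o V" unfolding V_def by (rule amplify_intertwine[OF R AB y inv])
  have "amplify R x o amplify R y = cadj V o (x \<odot> id) o (V o amplify R y)" unfolding d[of x] by (simp only: comp_assoc)
  also have "\<dots> = cadj V o ((x \<odot> id) o (y \<odot> id)) o V" unfolding iV by (simp only: comp_assoc)
  also have "(x \<odot> id) o (y \<odot> id) = (x o y) \<odot> id" by (simp add: op_tensor_comp x bounded_opsD[OF vn_tensor_bounded[OF y]])
  finally show ?thesis unfolding d[of "x o y"] by (rule sym)
qed

lemma amplify_norm:
  assumes R: "bc (R :: 'l::chilbert_space => ('h::chilbert_space, 'i ell2) htens)" "\<And>z. norm (R z) <= norm z"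
    and x: "bc x" "0 <= C" "\<And>z. norm (x z) <= C * norm z" shows "norm (amplify R x zeta) <= C * norm (zeta :: ('l, 'k::chilbert_space) htens)"
proof -
  define V :: "('l, 'k) htens => (('h, 'k) htens, 'i ell2) htens" where "V = rearrange o (R \<odot> id)"
  have bV: "bc V" unfolding V_def by (rule bc_rR[OF R(1)])
  have nV: "norm (V z) <= 1 * norm z" for z unfolding V_def o_apply
    using order_trans[OF rearrange_props(3) norm_op_tensor[of R 1 id 1 z]] R by simp
  have "norm (amplify R x zeta) <= 1 * norm ((x \<odot> id) (V zeta))"
    unfolding amplify_def V_def[symmetric] o_apply by (rule norm_cadj_le[OF bV _ nV]) simp
  also have "\<dots> <= C * norm (V zeta)" using norm_op_tensor[of x C id 1 "V zeta"] x by simp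
  also have "\<dots> <= C * norm zeta" using nV[of zeta] x(2) by (simp add: mult_left_mono)
  finally show ?thesis .
qed

lemma ampliation_strong_convergence:
  fixes x :: "'t => 'a::chilbert_space => 'b::chilbert_space"
  assumes C: "0 <= C" and ev: "eventually (%t. bc (x t) \<and> (\<forall>z. norm (x t z) <= C * norm z)) Fl" and y: "bc y"
    and lim: "\<And>z. ((%t. x t z) \<longlongrightarrow> y z) Fl" shows "((%t. (x t \<odot> id) zeta) \<longlongrightarrow> (y \<odot> id) (zeta :: ('a, 'k::chilbert_space) htens)) Fl"
proof (rule strong_convergence[where C = C, OF _ bc_op_tensor[OF y bc_id] tensors_total])
  show "\<forall>\<^sub>F t in Fl. bc (x t \<odot> id) \<and> (\<forall>z::('a, 'k) htens. norm ((x t \<odot> id) z) <= C * norm z)" using ev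
  proof eventually_elim
    case (elim t)
    thus ?case using norm_op_tensor[of "x t" C id 1] C by (auto intro: bc_op_tensor)
  qed
  fix g :: "('a, 'k) htens" assume "g \<in> tensors"
  then obtain u v where g: "g = u \<otimes> v" unfolding tensors_def by blast
  have "eventually (%t. x t u \<otimes> v = (x t \<odot> id) g) Fl" using ev unfolding g by eventually_elim (simp add: op_tensor_apply)
  moreover have "((%t. x t u \<otimes> v) \<longlongrightarrow> (y \<odot> id) g) Fl"
    unfolding g op_tensor_apply[OF y bc_id] id_apply by (intro tendsto_tens lim tendsto_const)
  ultimately show "((%t. (x t \<odot> id) g) \<longlongrightarrow> (y \<odot> id) g) Fl" by (rule Lim_transform_eventually[rotated])
qed

lemma amplify_strong_convergence:
  fixes x :: "'t => ('h::chilbert_space, 'k::chilbert_space) htens => ('h, 'k) htens"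
  assumes R: "bc (R :: 'l::chilbert_space => ('h, 'i ell2) htens)"
    and h: "0 <= C" "eventually (%t. bc (x t) \<and> (\<forall>z. norm (x t z) <= C * norm z)) Fl" "bc y"
      "\<And>z. ((%t. x t z) \<longlongrightarrow> y z) Fl" shows "((%t. amplify R (x t) zeta) \<longlongrightarrow> amplify R y zeta) Fl" unfolding amplify_def o_apply
  by (rule bc_tendsto[OF bc_cadj[OF bc_rR[OF R, unfolded o_def]], unfolded o_def])
    (rule ampliation_strong_convergence[OF h])

subsection \<open>Corners and the tensor product with a corner of the bounded operators\<close>

text \<open>Operators on a closed subspace, realised on the whole space through its projection
  \<open>p\<close>. The case \<open>p = fock_id J\<close> gives \<open>fock_ops J\<close>, and
  \<open>p = id\<close> gives all bounded operators, so one description covers the tensor products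
  of both \<open>hat_map\<close> and \<open>tilde_map\<close>.\<close>

definition corner :: "('k::chilbert_space => 'k) => ('k => 'k) set" where "corner p = {z \<in> bounded_ops. p o z = z \<and> z o p = z}"

definition projection :: "('k::chilbert_space => 'k) => bool" where "projection p \<longleftrightarrow> bc p \<and> p o p = p \<and> cadj p = p"

lemma corner_bounded: "corner p \<subseteq> bounded_ops" by (auto simp: corner_def)

lemma corner_id [simp]: "corner id = bounded_ops" by (auto simp: corner_def)

lemma projection_id [simp]: "projection id" by (simp add: projection_def)

lemma projectionD: "projection p ==> bc p" "projection p ==> p o p = p" "projection p ==> p (p x) = p x"
    "projection p ==> cadj p = p" unfolding projection_def by (auto simp: fun_eq_iff)

context vn_algebra
begin

text \<open>This replaces an ultraweak closure by algebraic conditions. They pass to the closure by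
  density; conversely, commutation with the commutant puts every slice into the bicommutant of
  \<open>A\<close>, which is \<open>A\<close>, and \<open>vn_tensor_if_slices\<close>
  applies.\<close>

theorem vn_tensor_corner:
  fixes x :: "('h, 'k::chilbert_space) htens => ('h, 'k) htens" assumes p: "projection p"
  shows "x \<in> vn_tensor A (corner p) \<longleftrightarrow> bc x \<and> (id \<odot> p) o x = x \<and> x o (id \<odot> p) = x \<and>
    (\<forall>b\<in>commutant A. (b \<odot> id) o x = x o (b \<odot> id))"
proof
  assume x: "x \<in> vn_tensor A (corner p)"
  note ident = vn_tensor_identity[OF x A_bounded corner_bounded]
  note bp = projectionD(1)[OF p]
  have b1: "bc ((id \<odot> p) :: ('h, 'k) htens => _)" by (intro bc_op_tensor bp bc_id)
  have cb: "bc z" "p o z = z" "z o p = z" if "z \<in> corner p" for z using that bounded_opsD unfolding corner_def by blast+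
  have "(id \<odot> p) o x o id = id o x o id" by (rule ident[OF b1 bc_id]) (use cb A_bc bp in \<open>simp add: op_tensor_comp\<close>)
  moreover have "id o x o (id \<odot> p) = id o x o id" by (rule ident[OF bc_id bc_id]) (use cb A_bc bp in \<open>simp add: op_tensor_comp\<close>)
  moreover have "(b \<odot> id) o x = x o (b \<odot> id)" if b: "b \<in> commutant A" for b
  proof -
    note bb = commutantD(1)[OF b]
    have b2: "bc ((b \<odot> id) :: ('h, 'k) htens => _)" by (intro bc_op_tensor bb bc_id)
    have "(b \<odot> id) o x o id = id o x o (b \<odot> id)"
      by (rule ident[OF b2 bc_id]) (use cb A_bc bb commutantD(2)[OF b] in \<open>simp add: op_tensor_comp\<close>)
    thus ?thesis by simp
  qed
  ultimately show "bc x \<and> (id \<odot> p) o x = x \<and> x o (id \<odot> p) = x \<and>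
    (\<forall>b\<in>commutant A. (b \<odot> id) o x = x o (b \<odot> id))" using bounded_opsD[OF vn_tensor_bounded[OF x]] by simp
next
  assume h: "bc x \<and> (id \<odot> p) o x = x \<and> x o (id \<odot> p) = x \<and>
    (\<forall>b\<in>commutant A. (b \<odot> id) o x = x o (b \<odot> id))"
  note bp = projectionD(1)[OF p]
  show "x \<in> vn_tensor A (corner p)"
  proof (rule vn_tensor_if_slices[OF A_bounded corner_bounded bp])
    show "p o z o p \<in> corner p" if "bc z" for z unfolding corner_def using that bp projectionD(2)[OF p]
      by (auto intro!: bounded_opsI bc_compose simp: fun_eq_iff)
    show "bc x" "(id \<odot> p) o x o (id \<odot> p) = x" using h by (simp_all add: comp_assoc)
    fix v w
    show "block v x w \<in> A"
    proof (rule A_I)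
      show "bc (block v x w)" using h by (intro bc_compose bc_cadj E_ket_bc) blast
      fix b assume b: "b \<in> commutant A"
      note bb = commutantD(1)[OF b]
      have "cadj (E_ket v) (x (E_ket w (b u))) = b (cadj (E_ket v) (x (E_ket w u)))" for u
      proof -
        have "E_ket w (b u) = (b \<odot> id) (E_ket w u)" by (simp add: E_ket_def op_tensor_apply bb)
        hence "x (E_ket w (b u)) = (b \<odot> id) (x (E_ket w u))" using h b by (metis comp_apply)
        thus ?thesis by (simp add: cadj_E_ket_amp bb)
      qed
      thus "(block v x w) o b = b o (block v x w)" by (auto simp: fun_eq_iff)
    qed
  qed
qed

lemma vn_tensor_slice:
  fixes x :: "('h, 'k::chilbert_space) htens => ('h, 'k) htens" assumes "bc x" "\<And>b. b \<in> commutant A ==> (b \<odot> id) o x = x o (b \<odot> id)"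
  shows "block v x w \<in> A"
proof (rule A_I)
  show "bc (block v x w)" by (intro bc_compose bc_cadj E_ket_bc assms(1))
  fix b assume b: "b \<in> commutant A"
  note bb = commutantD(1)[OF b]
  have "cadj (E_ket v) (x (E_ket w (b u))) = b (cadj (E_ket v) (x (E_ket w u)))" for u
  proof -
    have "E_ket w (b u) = (b \<odot> id) (E_ket w u)" by (simp add: E_ket_def op_tensor_apply bb)
    hence "x (E_ket w (b u)) = (b \<odot> id) (x (E_ket w u))" using fun_cong[OF assms(2)[OF b], of "E_ket w u"] by simp
    thus ?thesis by (simp add: cadj_E_ket_amp bb)
  qed
  thus "(block v x w) o b = b o (block v x w)" by (auto simp: fun_eq_iff)
qed

text \<open>A converse to \<open>vn_tensor_slice\<close> in which a total set of slicing vectors is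
  enough. Exponential vectors form such a set, which links processes in \<open>A\<close> with the
  ultraweak tensor product.\<close>

lemma commutes_if_slices:
  fixes x :: "('h, 'k::chilbert_space) htens => ('h, 'k) htens" assumes x: "bc x" and G: "closure (cspan {(u::'h) \<otimes> g | u g. g \<in> G}) = UNIV"
    and sl: "\<And>v w. v \<in> G ==> w \<in> G ==> block v x w \<in> A" and b: "b \<in> commutant A" shows "(b \<odot> id) o x = x o (b \<odot> id)"
proof -
  note bb = commutantD(1)[OF b]
  have b2: "bc ((b \<odot> id) :: ('h, 'k) htens => _)" by (intro bc_op_tensor bb bc_id)
  show ?thesis
  proof (rule bc_eq_on_total[OF _ _ G])
    show "bc ((b \<odot> id) o x)" "bc (x o (b \<odot> id))" by (intro bc_compose b2 x)+
    fix g assume "g \<in> {(u::'h) \<otimes> g | u g. g \<in> G}"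
    then obtain u w where g: "g = u \<otimes> w" "w \<in> G" by blast
    show "((b \<odot> id) o x) g = (x o (b \<odot> id)) g"
    proof (rule total_if_dense[OF G])
      fix s assume "s \<in> {(u::'h) \<otimes> g | u g. g \<in> G}"
      then obtain u' v where s: "s = u' \<otimes> v" "v \<in> G" by blast
      have "cinner s ((b \<odot> id) (x g)) = cinner u' (b (cadj (E_ket v) (x (E_ket w u))))"
        unfolding s g cadj_E_ket_amp[OF bb, symmetric] cadj_right[OF E_ket_bc] by (simp add: E_ket_def)
      also have "\<dots> = cinner u' (cadj (E_ket v) (x (E_ket w (b u))))" using fun_cong[OF A_commute[OF sl[OF s(2) g(2)] b], of u] by simp
      also have "\<dots> = cinner s (x ((b \<odot> id) g))" unfolding s g cadj_right[OF E_ket_bc] by (simp add: E_ket_def op_tensor_apply bb)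
      finally show "cinner s (((b \<odot> id) o x) g) = cinner s ((x o (b \<odot> id)) g)" by simp
    qed
  qed
qed

lemma vn_tensor_corner_lincomb:
  assumes p: "projection p" and x: "x \<in> vn_tensor A (corner p)" and y: "y \<in> vn_tensor A (corner p)"
  shows "(lincomb x c y) \<in> vn_tensor A (corner p)"
proof -
  note hx = x[unfolded vn_tensor_corner[OF p]] and hy = y[unfolded vn_tensor_corner[OF p]]
  note bp = projectionD(1)[OF p]
  have T: "T o (lincomb x c y) = (%xi. (T o x) xi + c *C (T o y) xi)" if "bc T" for T
    by (rule ext) (simp add: bc_add[OF that] bc_scale[OF that])
  have T': "(lincomb x c y) o T = (%xi. (x o T) xi + c *C (y o T) xi)" for T by (rule ext) simp
  have 1: "(id \<odot> p) o x = x" "(id \<odot> p) o y = y" "x o (id \<odot> p) = x" "y o (id \<odot> p) = y" using hx hy by blast+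
  show ?thesis unfolding vn_tensor_corner[OF p]
  proof (intro conjI ballI)
    show "bc (lincomb x c y)" using hx hy by (intro bc_plus bc_scaled) blast+
    show "(id \<odot> p) o (lincomb x c y) = (lincomb x c y)" by (simp only: T[OF bc_op_tensor[OF bc_id bp]] 1)
    show "(lincomb x c y) o (id \<odot> p) = (lincomb x c y)" by (simp only: T' 1)
    fix b assume b: "b \<in> commutant A"
    have "(b \<odot> id) o x = x o (b \<odot> id)" "(b \<odot> id) o y = y o (b \<odot> id)" using hx hy b by blast+
    thus "(b \<odot> id) o (lincomb x c y) = (lincomb x c y) o (b \<odot> id)"
      by (simp only: T[OF bc_op_tensor[OF commutantD(1)[OF b] bc_id]] T')
  qed
qed

end

subsection \<open>Evaluation of normal tensor maps\<close>

lemma linear_map_on_zero: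
  assumes "linear_map_on M kappa" "(%_. 0) \<in> M" shows "kappa (%_. 0) = (%_. 0 :: 'b::chilbert_space)"
proof -
  have "kappa (%xi. 0 + (-1) *C 0) = (%xi. kappa (%_. 0) xi + (-1) *C kappa (%_. 0) xi)"
    by (rule assms(1)[unfolded linear_map_on_def, rule_format, OF assms(2) assms(2)])
  thus ?thesis by (simp add: ch.sc_minus)
qed

lemma linear_map_on_alg:
  assumes lin: "linear_map_on M kappa" and sub: "alg_tensor A B \<subseteq> M" and ab: "\<forall>i<n. a i \<in> A \<and> b i \<in> B"
  shows "kappa (%zeta. \<Sum>i<(n::nat). (a i \<odot> b i) zeta) = (%xi. \<Sum>i<n. kappa (a i \<odot> b i) (xi :: 'c::chilbert_space))" using ab
proof (induction n)
  case 0
  have "(%_. 0) \<in> alg_tensor A B" using alg_tensorI[of "{}" undefined A undefined B] by simp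
  thus ?case using linear_map_on_zero[OF lin] sub by auto
next
  case (Suc n)
  have 1: "(%zeta. \<Sum>i<n. (a i \<odot> b i) zeta) \<in> M" by (rule subsetD[OF sub]) (rule alg_tensorI, use Suc.prems in auto)
  have 2: "a n \<odot> b n \<in> M" by (rule subsetD[OF sub]) (rule elem_in_alg, use Suc.prems in auto)
  have "kappa (%xi. (\<Sum>i<n. (a i \<odot> b i) xi) + 1 *C (a n \<odot> b n) xi) = (%xi. kappa (%zeta. \<Sum>i<n. (a i \<odot> b i) zeta) xi + 1 *C kappa (a n \<odot> b n) xi)"
    by (rule lin[unfolded linear_map_on_def, rule_format, OF 1 2])
  thus ?case using Suc by simp
qed

text \<open>Evaluates the definite description: a normal map is fixed on the closure by its values
  on the algebraic tensor product, and off the closure by extensionality, which is why the candidate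
  is the restriction \<open>K\<close>.\<close>

theorem normal_tensor_map_eq:
  fixes kappa :: "(('a::chilbert_space, 'b::chilbert_space) htens => ('a, 'b) htens) => ('c::chilbert_space => 'c)"
  assumes AB: "A \<subseteq> bounded_ops" "B \<subseteq> bounded_ops"
    and lc: "\<And>x y c. x \<in> vn_tensor A B ==> y \<in> vn_tensor A B ==> (lincomb x c y) \<in> vn_tensor A B"
    and bd: "\<And>x. x \<in> vn_tensor A B ==> bc (kappa x)"
    and lin: "\<And>x y c. x \<in> vn_tensor A B ==> y \<in> vn_tensor A B ==> kappa (lincomb x c y) = (%xi. kappa x xi + c *C kappa y xi)"
    and nrm: "\<And>phi. uw_fun phi ==> uw_fun (%x. phi (kappa x))" and elem: "\<And>a b. a \<in> A ==> b \<in> B ==> kappa (a \<odot> b) = \<Phi> a b" and x: "x \<in> vn_tensor A B"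
  shows "normal_tensor_map A B \<Phi> x = kappa x"
proof -
  define M where "M = vn_tensor A B"
  define K where "K = restrict kappa M"
  have alg: "alg_tensor A B \<subseteq> M" unfolding M_def by (rule alg_in_vn_tensor[OF AB])
  have MB: "M \<subseteq> bounded_ops" unfolding M_def using vn_tensor_bounded by blast
  have KM: "K z = kappa z" if "z \<in> M" for z using that by (simp add: K_def)
  have linK: "linear_map_on M K" unfolding linear_map_on_def using lc lin KM by (simp add: M_def)
  have contK: "continuous_map (subtopology ultraweak M) ultraweak K"
  proof (rule continuous_map_ultraweakI[OF MB])
    show "K z \<in> bounded_ops" if "z \<in> M" for z using bd that KM[OF that] unfolding M_def by (simp add: bounded_opsI)
    show "\<exists>psi. uw_fun psi \<and> (\<forall>z\<in>M. phi (K z) = psi z)" if "uw_fun phi" for phi by (intro exI[of _ "%x. phi (kappa x)"] conjI nrm that ballI) (simp add: KM)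
  qed
  have P: "K \<in> extensional M \<and> normal_map M K \<and> (\<forall>a\<in>A. \<forall>b\<in>B. K (a \<odot> b) = \<Phi> a b)"
  proof (intro conjI ballI)
    show "K \<in> extensional M" by (simp add: K_def)
    show "normal_map M K" unfolding normal_map_def using linK contK by blast
    fix a b assume ab: "a \<in> A" "b \<in> B"
    show "K (a \<odot> b) = \<Phi> a b" using KM[OF subsetD[OF alg elem_in_alg[OF ab]]] elem[OF ab] by simp
  qed
  have uniq: "K' = K" if K': "K' \<in> extensional M \<and> normal_map M K' \<and> (\<forall>a\<in>A. \<forall>b\<in>B. K' (a \<odot> b) = \<Phi> a b)" for K'
  proof
    fix z
    show "K' z = K z"
    proof (cases "z \<in> M")
      case False
      thus ?thesis using K' P extensional_arb by metis
    next
      case True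
      have linK': "linear_map_on M K'" and contK': "continuous_map (subtopology ultraweak M) ultraweak K'"
        using K' unfolding normal_map_def by blast+
      have cl: "z \<in> subtopology ultraweak M closure_of alg_tensor A B"
        using True alg unfolding closure_of_subtopology M_def vn_tensor_alg by (simp add: Int_absorb1)
      have ag: "K' s = K s" if s: "s \<in> alg_tensor A B" for s
      proof -
        obtain n :: nat and a b where h: "s = (%zeta. \<Sum>i<n. (a i \<odot> b i) zeta)" "\<forall>i<n. a i \<in> A \<and> b i \<in> B" by (rule alg_tensorE[OF s])
        have "K' (a i \<odot> b i) = K (a i \<odot> b i)" if "i < n" for i using h(2) that K' P by simp
        thus ?thesis unfolding h(1) linear_map_on_alg[OF linK' alg h(2)] linear_map_on_alg[OF linK alg h(2)] by simp
      qed
      have "cinner xi (K' z eta) = cinner xi (K z eta)" for xi eta by (rule forall_in_closure_of_eq[OF cl Hausdorff_space_euclidean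
              continuous_map_ultraweak_uw_fun[OF contK' uw_fun_vec] continuous_map_ultraweak_uw_fun[OF contK uw_fun_vec]])
          (simp only: ag)
      thus ?thesis by (rule op_ext_cinner)
    qed
  qed
  have "normal_tensor_map A B \<Phi> = K" unfolding normal_tensor_map_def M_def[symmetric] by (rule the_equality) (rule P, rule uniq)
  thus ?thesis using x KM by (simp add: M_def)
qed

context vn_algebra
begin

lemma normal_tensor_map_amplify:
  fixes R :: "'l::chilbert_space => ('h, 'i ell2) htens" and p :: "'k::chilbert_space => 'k" and V :: "('l, 'k) htens => 'm::chilbert_space"
  assumes R: "bc R" and p: "projection p" and V: "bc V"
    and \<Phi>: "\<And>a b. a \<in> A ==> b \<in> corner p ==> \<Phi> a b = V o ((cadj R o (a \<odot> id) o R) \<odot> b) o cadj V" and x: "x \<in> vn_tensor A (corner p)"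
  shows "normal_tensor_map A (corner p) \<Phi> x = V o amplify R x o cadj V"
proof (rule normal_tensor_map_eq[OF A_bounded corner_bounded vn_tensor_corner_lincomb[OF p] _ _ _ _ x])
  note b = bounded_opsD[OF vn_tensor_bounded]
  show "bc (V o amplify R y o cadj V)" if "y \<in> vn_tensor A (corner p)" for y by (intro bc_compose V bc_amplify[OF R] bc_cadj b[OF that])
  show "V o amplify R (lincomb y c z) o cadj V = (%xi. (V o amplify R y o cadj V) xi + c *C (V o amplify R z o cadj V) xi)"
    if "y \<in> vn_tensor A (corner p)" "z \<in> vn_tensor A (corner p)" for y z c
    unfolding amplify_lincomb[OF R b[OF that(1)] b[OF that(2)]] by (rule ext) (simp add: bc_add[OF V] bc_scale[OF V])
  show "uw_fun (%x. phi (V o amplify R x o cadj V))" if "uw_fun phi" for phi by (rule amplify_normal[OF R uw_fun_conj[OF that V bc_cadj[OF V]]])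
  fix a z assume az: "a \<in> A" "z \<in> corner p"
  have "bc z" using az(2) corner_bounded bounded_opsD by blast
  thus "V o amplify R (a \<odot> z) o cadj V = \<Phi> a z" unfolding \<Phi>[OF az] by (simp add: amplify_elem[OF R A_bc[OF az(1)]])
qed

text \<open>\<open>tilde_map\<close> has the algebra in the second factor while
  \<open>amplify\<close> acts on it in the first, hence the conjugation with
  \<open>tflip\<close>.\<close>

lemma normal_tensor_map_flip_amplify:
  fixes R :: "'l::chilbert_space => ('h, 'i ell2) htens" assumes R: "bc R"
    and \<Phi>: "\<And>a b. b \<in> bounded_ops ==> a \<in> A ==> \<Phi> b a = b \<odot> (cadj R o (a \<odot> id) o R)"
    and x: "x \<in> vn_tensor (bounded_ops :: ('k::chilbert_space => 'k) set) A"
  shows "normal_tensor_map bounded_ops A \<Phi> x = tflip o amplify R (tflip o x o tflip) o tflip"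
proof (rule normal_tensor_map_eq[OF order_refl A_bounded _ _ _ _ _ x])
  have fl: "tflip o y o tflip \<in> vn_tensor A (corner id)" if "y \<in> vn_tensor (bounded_ops :: ('k => 'k) set) A" for y
    using vn_tensor_flip[OF order_refl A_bounded that] by simp
  have ff: "tflip o (tflip o y o tflip) o tflip = y" for y :: "('k, 'h) htens => ('k, 'h) htens" by (rule ext) simp
  have fa: "tflip o (lincomb y c z) o tflip = (%xi. (tflip o y o tflip) xi + c *C (tflip o z o tflip) xi)"
    for y z :: "('a::chilbert_space, 'b::chilbert_space) htens => ('a, 'b) htens" and c by (rule ext) (simp add: bc_add bc_scale)
  note b = bounded_opsD[OF vn_tensor_bounded]
  fix y z c assume y: "y \<in> vn_tensor (bounded_ops :: ('k => 'k) set) A" and z: "z \<in> vn_tensor (bounded_ops :: ('k => 'k) set) A"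
  have "tflip o (%xi. (tflip o y o tflip) xi + c *C (tflip o z o tflip) xi) o tflip \<in> vn_tensor bounded_ops A"
    using vn_tensor_flip[OF A_bounded corner_bounded vn_tensor_corner_lincomb[OF projection_id fl[OF y] fl[OF z]]] by simp
  thus "(lincomb y c z) \<in> vn_tensor bounded_ops A" unfolding fa[of "tflip o y o tflip"] ff .
  show "bc (tflip o amplify R (tflip o y o tflip) o tflip)" by (intro bc_compose bc_tflip bc_amplify[OF R] b[OF fl[OF y]] b[OF y])
  show "tflip o amplify R (tflip o (lincomb y c z) o tflip) o tflip =
    (%xi. (tflip o amplify R (tflip o y o tflip) o tflip) xi + c *C (tflip o amplify R (tflip o z o tflip) o tflip) xi)"
    unfolding fa amplify_lincomb[OF R b[OF fl[OF y]] b[OF fl[OF z]]] ..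
next
  show "uw_fun (%x. phi (tflip o amplify R (tflip o x o tflip) o tflip))" if "uw_fun phi" for phi
    by (rule uw_fun_conj[OF amplify_normal[OF R uw_fun_conj[OF that bc_tflip bc_tflip]] bc_tflip bc_tflip])
  fix c :: "'k => 'k" and a assume ca: "c \<in> bounded_ops" "a \<in> A"
  note bc = bounded_opsD[OF ca(1)] A_bc[OF ca(2)]
  have "bc (cadj R o (a \<odot> id) o R)" by (intro bc_compose bc_cadj R bc_op_tensor bc bc_id)
  thus "tflip o amplify R (tflip o (c \<odot> a) o tflip) o tflip = \<Phi> c a"
    unfolding \<Phi>[OF ca] tflip_op_tensor[OF bc] amplify_elem[OF R bc(2,1)] by (rule tflip_op_tensor[OF _ bc(1)])
qed

end

section \<open>Step functions, exponential vectors and Fock space\<close>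

subsection \<open>Right-continuous functions\<close>

text \<open>Samples \<open>p\<close> at the right end of the cell of mesh \<open>1 / (i + 1)\<close>
  that contains \<open>x\<close>. The sample point lies strictly to the right of \<open>x\<close>,
  so right continuity is enough for convergence, and the cut-off leaves finitely many cells and
  hence finitely many values.\<close>

definition dyadic :: "(real => 'b::zero) => nat => real => 'b"
  where "dyadic p i x = (if 0 <= x \<and> x < real i then p ((real_of_int \<lfloor>real (Suc i) * x\<rfloor> + 1) / real (Suc i)) else 0)"

lemma dyadic_finite: "finite (range (dyadic p i))"
proof (rule finite_subset)
  show "range (dyadic p i) \<subseteq> insert 0 ((%k. p ((real_of_int k + 1) / real (Suc i))) ` {0..int (Suc i * i)})"
  proof
    fix y assume "y \<in> range (dyadic p i)"
    then obtain x where x: "y = dyadic p i x" by blast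
    show "y \<in> insert 0 ((%k. p ((real_of_int k + 1) / real (Suc i))) ` {0..int (Suc i * i)})"
    proof (cases "0 <= x \<and> x < real i")
      case True
      have "real (Suc i) * x <= real (Suc i) * real i" using True by (intro mult_left_mono) auto
      hence "\<lfloor>real (Suc i) * x\<rfloor> <= \<lfloor>real (Suc i * i)\<rfloor>" by (intro floor_mono) (simp only: of_nat_mult)
      hence "\<lfloor>real (Suc i) * x\<rfloor> \<in> {0..int (Suc i * i)}" using True by (simp del: of_nat_Suc of_nat_mult)
      moreover have "y = p ((real_of_int \<lfloor>real (Suc i) * x\<rfloor> + 1) / real (Suc i))" using True unfolding x dyadic_def by simp
      ultimately show ?thesis by (intro insertI2 image_eqI)
    qed (auto simp: x dyadic_def)
  qed
qed simp

lemma dyadic_preimage: "dyadic p i -` {y} \<in> sets borel"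
proof -
  have m: "(%x. \<lfloor>real (Suc i) * x\<rfloor>) \<in> measurable borel (count_space UNIV)" by measurable
  have "(%x. p ((real_of_int \<lfloor>real (Suc i) * x\<rfloor> + 1) / real (Suc i))) \<in> measurable borel (count_space UNIV)"
    using measurable_compose[OF m, of "%k. p ((real_of_int k + 1) / real (Suc i))" "count_space UNIV"] by simp
  hence "(%x. p ((real_of_int \<lfloor>real (Suc i) * x\<rfloor> + 1) / real (Suc i))) -` {y} \<in> sets borel"
    by (drule_tac measurable_sets[where S = "{y}"]) (simp_all del: of_nat_Suc)
  hence "((%x. p ((real_of_int \<lfloor>real (Suc i) * x\<rfloor> + 1) / real (Suc i))) -` {y} \<inter> {0..<real i}) \<union> (if y = 0 then - {0..<real i} else {}) \<in> sets borel"
    by (intro sets.Un sets.Int) auto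
  also have "((%x. p ((real_of_int \<lfloor>real (Suc i) * x\<rfloor> + 1) / real (Suc i))) -` {y} \<inter> {0..<real i}) \<union> (if y = 0 then - {0..<real i} else {}) = dyadic p i -` {y}"
    by (auto simp: dyadic_def split: if_splits)
  finally show ?thesis .
qed

lemma dyadic_tendsto:
  assumes "0 <= x" "(p \<longlongrightarrow> p x) (at_right x)" shows "(%i. dyadic p i x) \<longlonglongrightarrow> p (x::real)"
proof -
  define y where "y i = (real_of_int \<lfloor>real (Suc i) * x\<rfloor> + 1) / real (Suc i)" for i
  have y1: "x < y i" for i
    using real_of_int_floor_add_one_gt[of "real (Suc i) * x"] unfolding y_def by (simp add: pos_less_divide_eq mult.commute del: of_nat_Suc)
  have y2: "y i <= x + inverse (real (Suc i))" for i
    using of_int_floor_le[of "real (Suc i) * x"] unfolding y_def by (simp add: field_simps del: of_nat_Suc)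
  have "(%i. x + inverse (real (Suc i))) \<longlonglongrightarrow> x + 0" by (intro tendsto_intros LIMSEQ_inverse_real_of_nat)
  hence "y \<longlonglongrightarrow> x" by (intro tendsto_sandwich[OF _ _ tendsto_const, of x y]) (use y1 y2 less_imp_le in \<open>auto intro!: always_eventually\<close>)
  hence "filterlim y (at_right x) sequentially"
    unfolding filterlim_at using y1 by (auto intro!: always_eventually simp: less_imp_neq[THEN not_sym])
  hence "(%i. p (y i)) \<longlonglongrightarrow> p x" by (rule filterlim_compose[OF assms(2)])
  moreover have "eventually (%i. p (y i) = dyadic p i x) sequentially" using eventually_gt_at_top[of "nat \<lceil>x\<rceil>"]
  proof eventually_elim
    case (elim i)
    hence "x < real i" by linarith
    thus ?case using assms(1) by (simp add: dyadic_def y_def)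
  qed
  ultimately show ?thesis by (rule Lim_transform_eventually)
qed

lemma dyadic_pointwise:
  assumes "\<And>x. 0 <= x ==> (p \<longlongrightarrow> p x) (at_right x)" "\<And>x. x < 0 ==> p x = 0" shows "(%i. dyadic p i x) \<longlonglongrightarrow> p (x::real)"
proof (cases "0 <= x")
  case False
  hence "(%i. dyadic p i x) = (%_. p x)" using assms(2)[of x] by (auto simp: dyadic_def)
  thus ?thesis by simp
qed (intro dyadic_tendsto assms)

text \<open>The explicit simple functions \<open>dyadic p i\<close> take the place of a separability
  argument; this makes vector-valued integrands tractable for an arbitrary noise space.\<close>

lemma strongly_measurable_right_continuous:
  fixes p :: "real => 'b::real_normed_vector"
  assumes S: "S \<in> sets lebesgue" and rc: "\<And>x. 0 <= x ==> x \<in> S ==> (p \<longlongrightarrow> p x) (at_right x)" and neg: "\<And>x. x \<in> S ==> x < 0 ==> p x = 0"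
  shows "strongly_measurable (lebesgue_on S) p" unfolding strongly_measurable_def
proof (intro exI[of _ "dyadic p"] conjI allI)
  fix i
  show "simple_function (lebesgue_on S) (dyadic p i)" unfolding simple_function_def
  proof (intro conjI ballI)
    show "finite (dyadic p i ` space (lebesgue_on S))" by (rule finite_subset[OF _ dyadic_finite[of p i]]) auto
    fix y
    have "dyadic p i -` {y} \<in> sets lebesgue" using dyadic_preimage[of p i y] by (simp add: sets_completionI_sets)
    thus "dyadic p i -` {y} \<inter> space (lebesgue_on S) \<in> sets (lebesgue_on S)" using S by (auto simp: sets_restrict_space space_restrict_space)
  qed
next
  have "(%i. dyadic p i x) \<longlonglongrightarrow> p x" if x: "x \<in> S" for x
  proof (cases "0 <= x")
    case True
    thus ?thesis using rc x by (intro dyadic_tendsto)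
  next
    case False
    hence "(%i. dyadic p i x) = (%_. p x)" using neg[OF x] by (auto simp: dyadic_def)
    thus ?thesis by simp
  qed
  thus "AE x in lebesgue_on S. (%i. dyadic p i x) \<longlonglongrightarrow> p x" by (intro AE_I2) (simp add: space_restrict_space)
qed

lemma borel_measurable_right_continuous:
  fixes q :: "real => complex" assumes "\<And>x. 0 <= x ==> (q \<longlongrightarrow> q x) (at_right x)" "\<And>x. x < 0 ==> q x = 0" shows "q \<in> borel_measurable borel"
proof (rule borel_measurable_LIMSEQ_metric)
  show "(%i. dyadic q i x) \<longlonglongrightarrow> q x" for x by (rule dyadic_pointwise[OF assms])
  show "dyadic q i \<in> borel_measurable borel" for i
    by (rule borel_measurable_simple_function) (auto simp: simple_function_def dyadic_preimage intro: finite_subset[OF _ dyadic_finite[of q i]])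
qed

lemma strongly_measurable_norm:
  fixes f :: "real => 'b::real_normed_vector" assumes "strongly_measurable lebesgue f" shows "(%x. norm (f x)) \<in> borel_measurable lebesgue"
proof -
  obtain F where F: "\<And>i. simple_function lebesgue (F i)" "AE x in lebesgue. (%i::nat. F i x) \<longlonglongrightarrow> f x"
    using assms unfolding strongly_measurable_def by blast
  have m: "(%x. norm (F i x)) \<in> borel_measurable lebesgue" for i
    by (rule borel_measurable_simple_function, rule simple_function_compose1[OF F(1)])
  have "(%x. lim (%i. norm (F i x))) \<in> borel_measurable lebesgue" by (rule borel_measurable_lim_metric) (rule m)
  moreover have "AE x in lebesgue. lim (%i. norm (F i x)) = norm (f x)" using F(2) by eventually_elim (auto intro!: limI tendsto_norm)
  ultimately show ?thesis by (rule borel_measurable_AE)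
qed

subsection \<open>Step functions\<close>

abbreviation "constant_off P f \<equiv> \<forall>s t. 0 <= s --> s <= t --> (\<forall>p\<in>P. \<not> (s < p \<and> p <= t)) --> f s = f t"

text \<open>Break points form an unordered finite set instead of an increasing sequence, so that
  sums, cut-offs and shifts only unite or move break points. Break points are looked for in
  \<open>(s, t]\<close>, which encodes constancy on intervals closed on the left.\<close>

definition piecewise :: "(real => 'b::zero) => bool" where "piecewise f \<longleftrightarrow> (\<forall>s<0. f s = 0) \<and> (\<exists>N. \<forall>s\<ge>N. f s = 0) \<and>
    (\<exists>P. finite P \<and> constant_off P f)"

lemma partition_locate:
  fixes t :: "nat => real" assumes "t 0 <= s" "s < t n" shows "\<exists>i<n. t i <= s \<and> s < t (Suc i)" using assms
proof (induction n)
  case (Suc n)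
  show ?case
  proof (cases "s < t n")
    case True
    thus ?thesis using Suc by (meson less_SucI)
  next
    case False
    thus ?thesis using Suc.prems by (intro exI[of _ n]) auto
  qed
qed simp

lemma step_fun_piecewise: assumes "f \<in> step_fun" shows "piecewise f"
proof -
  obtain n :: nat and t where h: "t 0 = 0" "\<forall>i<n. t i < t (Suc i) \<and> (\<forall>s\<in>{t i..<t (Suc i)}. f s = f (t i))"
    "\<forall>s\<ge>t n. f s = 0" "\<forall>s<0. f s = 0" using assms unfolding step_fun_def by blast
  have "f s = f r" if r: "0 <= s" "s <= r" "\<forall>p\<in>t ` {..n}. \<not> (s < p \<and> p <= r)" for s r
  proof (cases "s < t n")
    case False
    thus ?thesis using h(3) r by auto
  next
    case True
    then obtain i where i: "i < n" "t i <= s" "s < t (Suc i)" using partition_locate[of t s n] h(1) r(1) by auto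
    have "t (Suc i) \<in> t ` {..n}" using i(1) by (intro imageI) simp
    hence "\<not> (s < t (Suc i) \<and> t (Suc i) <= r)" using r(3) by blast
    hence "s \<in> {t i..<t (Suc i)}" "r \<in> {t i..<t (Suc i)}" using i r by auto
    hence "f r = f (t i)" "f s = f (t i)" using h(2) i(1) by blast+
    thus ?thesis by simp
  qed
  hence "\<forall>s r. 0 <= s --> s <= r --> (\<forall>p\<in>t ` {..n}. \<not> (s < p \<and> p <= r)) --> f s = f r" by blast
  thus ?thesis unfolding piecewise_def using h(3,4) finite_imageI[OF finite_atMost, of t n] by blast
qed

lemma piecewise_step_fun: assumes "piecewise f" shows "f \<in> step_fun"
proof -
  obtain N P where h: "\<forall>s<0. f s = 0" "\<forall>s\<ge>N. f s = 0" "finite P"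
    "constant_off P f" using assms unfolding piecewise_def by blast
  \<comment> \<open>The partition must start at 0 and end beyond the support:
    \<open>\<bar>N\<bar> + 1\<close> is a positive number above \<open>N\<close>, and break points
    that are not positive are dropped.\<close>
  define Q where "Q = {0, \<bar>N\<bar> + 1} \<union> {p \<in> P. 0 < p}"
  have Q: "finite Q" "Q \<noteq> {}" "\<And>q. q \<in> Q ==> 0 <= q" using h(3) by (auto simp: Q_def)
  define L where "L = sorted_list_of_set Q"
  have L: "set L = Q" "sorted L" "distinct L" using Q(1) by (simp_all add: L_def)
  define n where "n = length L - 1"
  have len: "length L = Suc n" using L(1) Q(2) by (cases L) (simp_all add: n_def)
  define t where "t i = L ! i" for i
  have tQ: "t i \<in> Q" if "i <= n" for i using that len L(1) nth_mem[of i L] by (simp add: t_def)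
  have mono: "t i <= t j" if "i <= j" "j <= n" for i j unfolding t_def by (rule sorted_nth_mono[OF L(2)]) (use that len in auto)
  have smono: "t i < t (Suc i)" if "i < n" for i
    using mono[of i "Suc i"] that nth_eq_iff_index_eq[OF L(3), of i "Suc i"] len by (simp add: t_def order.strict_iff_order)
  have idx: "\<exists>k\<le>n. q = t k" if "q \<in> Q" for q using that L(1) len in_set_conv_nth[of q L] by (auto simp: t_def less_Suc_eq_le)
  have t0: "t 0 = 0"
  proof -
    obtain k where "k <= n" "0 = t k" using idx[of 0] by (auto simp: Q_def)
    hence "t 0 <= 0" using mono[of 0 k] by simp
    thus ?thesis using Q(3)[OF tQ[of 0]] by simp
  qed
  show ?thesis unfolding step_fun_def
  proof (intro CollectI exI[of _ n] exI[of _ t] conjI allI impI ballI)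
    show "t 0 = 0" by (rule t0)
    show "t i < t (Suc i)" if "i < n" for i by (rule smono[OF that])
    show "f s = f (t i)" if i: "i < n" and s: "s \<in> {t i..<t (Suc i)}" for i s
    proof -
      have "\<not> (t i < p \<and> p <= s)" if p: "p \<in> P" for p
      proof
        assume a: "t i < p \<and> p <= s"
        have "0 <= t i" using Q(3) tQ i by simp
        hence "p \<in> Q" using p a by (auto simp: Q_def)
        then obtain k where k: "k <= n" "p = t k" using idx by blast
        show False
        proof (cases "k <= i")
          case True
          thus ?thesis using mono[of k i] a k i by simp
        next
          case False
          thus ?thesis using mono[of "Suc i" k] a k s by simp
        qed
      qed
      moreover have "0 <= t i" using Q(3) tQ i by simp
      ultimately have "f (t i) = f s" using h(4) s by simp
      thus ?thesis by simp
    qed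
    show "f s = 0" if "t n <= s" for s
    proof -
      obtain k where "k <= n" "\<bar>N\<bar> + 1 = t k" using idx[of "\<bar>N\<bar> + 1"] by (auto simp: Q_def)
      hence "N <= s" using mono[of k n] that by simp
      thus ?thesis using h(2) by simp
    qed
    show "f s = 0" if "s < 0" for s using h(1) that by simp
  qed
qed

lemma step_fun_iff: "f \<in> step_fun \<longleftrightarrow> piecewise f" using step_fun_piecewise piecewise_step_fun by blast

lemma step_neg: "f \<in> step_fun ==> s < 0 ==> f s = 0" unfolding step_fun_iff piecewise_def by blast

lemma step_combine:
  fixes f :: "real => 'a::chilbert_space" and g :: "real => 'b::chilbert_space" and h :: "'a => 'b => 'c::chilbert_space"
  assumes f: "f \<in> step_fun" and g: "g \<in> step_fun" and h: "h 0 0 = 0" shows "(%s. h (f s) (g s)) \<in> step_fun"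
proof -
  obtain N P where F0: "\<forall>s<0. f s = 0" "\<forall>s\<ge>N. f s = 0" "finite P"
    "constant_off P f" using f unfolding step_fun_iff piecewise_def by (elim conjE exE)
  note F = F0[rule_format]
  obtain M Q where G0: "\<forall>s<0. g s = 0" "\<forall>s\<ge>M. g s = 0" "finite Q"
    "\<forall>s t. 0 <= s --> s <= t --> (\<forall>p\<in>Q. \<not> (s < p \<and> p <= t)) --> g s = g t" using g unfolding step_fun_iff piecewise_def by (elim conjE exE)
  note G = G0[rule_format]
  show ?thesis unfolding step_fun_iff piecewise_def
  proof (intro conjI allI impI exI[of _ "max N M"] exI[of _ "P \<union> Q"])
    show "finite (P \<union> Q)" using F(3) G(3) by simp
    fix s t assume st: "0 <= s" "s <= t" "\<forall>p\<in>P \<union> Q. \<not> (s < p \<and> p <= t)"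
    have "f s = f t" by (rule F(4)) (use st in auto)
    moreover have "g s = g t" by (rule G(4)) (use st in auto)
    ultimately show "h (f s) (g s) = h (f t) (g t)" by simp
  qed (use F G h in auto)
qed

lemma step_add: "f \<in> step_fun ==> g \<in> step_fun ==> (%s. f s + g s) \<in> step_fun" using step_combine[of f g "(+)"] by simp

lemma step_scale: "f \<in> step_fun ==> (%s. c *C f s) \<in> step_fun" using step_combine[of f f "%x _. c *C x"] by simp

lemma step_interval:
  assumes "0 <= a" shows "(%s. if s \<in> {a..<b} then c else 0) \<in> step_fun" unfolding step_fun_iff piecewise_def
proof (intro conjI allI impI exI[of _ "b"] exI[of _ "{a, b}"])
  fix s t :: real assume "0 <= s" "s <= t" "\<forall>p\<in>{a, b}. \<not> (s < p \<and> p <= t)"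
  hence "s \<in> {a..<b} \<longleftrightarrow> t \<in> {a..<b}" by auto
  thus "(if s \<in> {a..<b} then c else 0) = (if t \<in> {a..<b} then c else 0)" by simp
qed (use assms in auto)

lemma step_zero: "(%_. 0) \<in> step_fun" using step_interval[of 0 0 0] by simp

lemma step_restr_interval:
  assumes f: "f \<in> step_fun" and I: "\<And>s t. s <= t ==> \<not> (s < r \<and> r <= t) ==> s \<in> I \<longleftrightarrow> t \<in> I" shows "restr_to I f \<in> step_fun"
proof -
  obtain N P where F0: "\<forall>s<0. f s = 0" "\<forall>s\<ge>N. f s = 0" "finite P"
    "constant_off P f" using f unfolding step_fun_iff piecewise_def by (elim conjE exE)
  note F = F0[rule_format]
  show ?thesis unfolding step_fun_iff piecewise_def restr_to_def
  proof (intro conjI allI impI exI[of _ N] exI[of _ "insert r P"])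
    fix s t assume st: "0 <= s" "s <= t" "\<forall>p\<in>insert r P. \<not> (s < p \<and> p <= t)"
    have "f s = f t" by (rule F(4)) (use st in auto)
    moreover have "s \<in> I \<longleftrightarrow> t \<in> I" by (rule I) (use st in auto)
    ultimately show "(if s \<in> I then f s else 0) = (if t \<in> I then f t else 0)" by simp
  qed (use F in auto)
qed

lemma step_restr_from: "f \<in> step_fun ==> after r f \<in> step_fun" by (rule step_restr_interval[of f r]) auto

lemma step_restr_upto: assumes f: "f \<in> step_fun" shows "before r f \<in> step_fun"
proof -
  have "before r f = restr_to {..<r} f" using step_neg[OF f] by (auto simp: restr_to_def fun_eq_iff)
  moreover have "restr_to {..<r} f \<in> step_fun" by (rule step_restr_interval[OF f]) auto
  ultimately show ?thesis by simp
qed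

lemma step_shift_right: assumes f: "f \<in> step_fun" and r: "0 <= r" shows "(%s. f (s - r)) \<in> step_fun"
proof -
  obtain N P where F0: "\<forall>s<0. f s = 0" "\<forall>s\<ge>N. f s = 0" "finite P"
    "constant_off P f" using f unfolding step_fun_iff piecewise_def by (elim conjE exE)
  note F = F0[rule_format]
  show ?thesis unfolding step_fun_iff piecewise_def
  proof (intro conjI allI impI exI[of _ "N + r"] exI[of _ "insert r ((%p. p + r) ` P)"])
    fix s t assume st: "0 <= s" "s <= t" "\<forall>p\<in>insert r ((%p. p + r) ` P). \<not> (s < p \<and> p <= t)"
    show "f (s - r) = f (t - r)"
    proof (cases "s < r")
      case True
      thus ?thesis using st F(1) by auto
    next
      case False
      show ?thesis
      proof (rule F(4))
        fix p assume "p \<in> P"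
        hence "\<not> (s < p + r \<and> p + r <= t)" using st(3) by blast
        thus "\<not> (s - r < p \<and> p <= t - r)" by linarith
      qed (use st False in auto)
    qed
  qed (use F r in auto)
qed

lemma step_shift_left: assumes f: "f \<in> step_fun" and r: "0 <= r" shows "(%s. if 0 <= s then f (s + r) else 0) \<in> step_fun"
proof -
  obtain N P where F0: "\<forall>s<0. f s = 0" "\<forall>s\<ge>N. f s = 0" "finite P"
    "constant_off P f" using f unfolding step_fun_iff piecewise_def by (elim conjE exE)
  note F = F0[rule_format]
  show ?thesis unfolding step_fun_iff piecewise_def
  proof (intro conjI allI impI exI[of _ "N - r"] exI[of _ "(%p. p - r) ` P"])
    fix s t assume st: "0 <= s" "s <= t" "\<forall>p\<in>(%p. p - r) ` P. \<not> (s < p \<and> p <= t)"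
    have "f (s + r) = f (t + r)"
    proof (rule F(4))
      fix p assume "p \<in> P"
      hence "\<not> (s < p - r \<and> p - r <= t)" using st(3) by blast
      thus "\<not> (s + r < p \<and> p <= t + r)" by linarith
    qed (use st r in auto)
    thus "(if 0 <= s then f (s + r) else 0) = (if 0 <= t then f (t + r) else 0)" using st by simp
  qed (use F in auto)
qed

lemma step_locally_constant:
  assumes f: "f \<in> step_fun" and s: "0 <= s" shows "\<exists>e>0. \<forall>t\<in>{s..<s + e}. f t = f s"
proof -
  obtain N P where F0: "\<forall>s<0. f s = 0" "\<forall>s\<ge>N. f s = 0" "finite P"
    "constant_off P f" using f unfolding step_fun_iff piecewise_def by (elim conjE exE)
  note F = F0[rule_format]
  define Q where "Q = insert (s + 1) {p \<in> P. s < p}"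
  have Q: "finite Q" "Q \<noteq> {}" "\<And>q. q \<in> Q ==> s < q" using F(3) by (auto simp: Q_def)
  define e where "e = Min Q - s"
  have "e > 0" using Q Min_in[OF Q(1,2)] by (auto simp: e_def)
  moreover have "f t = f s" if t: "t \<in> {s..<s + e}" for t
  proof -
    have "f s = f t"
    proof (rule F(4)[OF s])
      fix p assume p: "p \<in> P"
      show "\<not> (s < p \<and> p <= t)"
      proof
        assume "s < p \<and> p <= t"
        hence "Min Q <= t" using Min_le[OF Q(1), of p] p by (auto simp: Q_def)
        thus False using t by (simp add: e_def)
      qed
    qed (use t in simp)
    thus ?thesis by simp
  qed
  ultimately show ?thesis by blast
qed

lemma step_right_continuous:
  assumes "f \<in> step_fun" "0 <= s" shows "(f \<longlongrightarrow> f s) (at_right s)"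
proof -
  obtain e where e: "e > 0" "\<forall>t\<in>{s..<s + e}. f t = f s" using step_locally_constant[OF assms] by blast
  have "eventually (%t. t \<in> {s<..<s + e}) (at_right s)" using e(1) by (intro eventually_at_right_real) simp
  hence "eventually (%t. f s = f t) (at_right s)" 
  proof eventually_elim
    case (elim t)
    hence "t \<in> {s..<s + e}" by simp
    thus ?case using e(2) by metis
  qed
  thus ?thesis by (rule Lim_transform_eventually[OF tendsto_const])
qed

lemma step_bounded: assumes f: "f \<in> step_fun" shows "\<exists>B. \<forall>s. norm (f s :: 'a::chilbert_space) <= B"
proof -
  obtain N P where F0: "\<forall>s<0. f s = 0" "\<forall>s\<ge>N. f s = 0" "finite P"
    "constant_off P f" using f unfolding step_fun_iff piecewise_def by (elim conjE exE)
  note F = F0[rule_format]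
  define Q where "Q = insert 0 P"
  have Q: "finite (norm ` f ` Q)" using F(3) by (simp add: Q_def)
  have "norm (f s) <= Max (insert 0 (norm ` f ` Q))" for s
  proof (cases "s < 0")
    case True
    thus ?thesis using F(1) Q by simp
  next
    case False
    \<comment> \<open>The value at \<open>s\<close> is the value at the last point of
      \<open>Q\<close> not after \<open>s\<close>, so only finitely many values occur.\<close>
    define R where "R = {p \<in> Q. 0 <= p \<and> p <= s}"
    have R: "finite R" "0 \<in> R" using F(3) False by (auto simp: R_def Q_def)
    define q where "q = Max R"
    have q: "q \<in> R" unfolding q_def by (rule Max_in) (use R in auto)
    have "f q = f s"
    proof (rule F(4))
      fix p assume p: "p \<in> P"
      show "\<not> (q < p \<and> p <= s)"
      proof
        assume a: "q < p \<and> p <= s"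
        hence "p \<in> R" using p q by (auto simp: R_def Q_def)
        hence "p <= q" unfolding q_def using R by simp
        thus False using a by simp
      qed
    qed (use q in \<open>auto simp: R_def\<close>)
    moreover have "norm (f q) <= Max (insert 0 (norm ` f ` Q))" using q Q by (intro Max_ge) (auto simp: R_def)
    ultimately show ?thesis by simp
  qed
  thus ?thesis by blast
qed

subsection \<open>Square-integrable functions\<close>

definition L2fun :: "(real => 'k::chilbert_space) set"
  where "L2fun = {f. (\<forall>s<0. f s = 0) \<and> strongly_measurable lebesgue f \<and> integrable lebesgue (%s. (norm (f s))\<^sup>2)}"

lemma Rep_Abs_l2: "f \<in> L2fun ==> Rep_l2 (Abs_l2 f) = f" unfolding L2fun_def by (rule Abs_l2_inverse)

lemma Rep_l2_L2fun: "Rep_l2 f \<in> L2fun" using Rep_l2 unfolding L2fun_def .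

lemma L2fun_bound:
  assumes "strongly_measurable lebesgue f" "\<forall>s<0. f s = 0" "integrable lebesgue (%s. h s)" "\<And>s. (norm (f s))\<^sup>2 <= (h s :: real)"
  shows "f \<in> L2fun" unfolding L2fun_def
proof (intro CollectI conjI)
  have "(%s. (norm (f s))\<^sup>2) \<in> borel_measurable lebesgue" by (intro borel_measurable_power strongly_measurable_norm assms(1))
  moreover have "AE s in lebesgue. norm ((norm (f s))\<^sup>2) <= norm (h s)"
    by (rule AE_I2) (use assms(4) order_trans[OF zero_le_power2 assms(4)] in simp)
  ultimately show "integrable lebesgue (%s. (norm (f s))\<^sup>2)" by (rule Bochner_Integration.integrable_bound[OF assms(3)])
qed (use assms in auto)

lemma strongly_measurable_step: assumes "f \<in> step_fun" shows "strongly_measurable lebesgue f"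
proof -
  have "strongly_measurable (lebesgue_on UNIV) f"
    by (rule strongly_measurable_right_continuous) (use step_right_continuous[OF assms] step_neg[OF assms] in auto)
  thus ?thesis by (simp add: lebesgue_on_UNIV_eq)
qed

lemma step_L2fun: assumes f: "f \<in> step_fun" shows "f \<in> L2fun"
proof -
  obtain B where B: "\<And>s. norm (f s) <= B" using step_bounded[OF f] by blast
  obtain N where N0: "\<forall>s\<ge>N. f s = 0" using f unfolding step_fun_iff piecewise_def by (elim conjE exE)
  note N = N0[rule_format]
  show ?thesis
  proof (rule L2fun_bound[OF strongly_measurable_step[OF f]])
    show "\<forall>s<0. f s = 0" using step_neg[OF f] by blast
    show "integrable lebesgue (%s. B\<^sup>2 * indicator {0..N} s)"
      by (intro Bochner_Integration.integrable_mult_right integrable_real_indicator) (auto simp: emeasure_lborel_Icc_eq)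
    show "(norm (f s))\<^sup>2 <= B\<^sup>2 * indicator {0..N} s" for s
      using power_mono[OF B[of s] norm_ge_zero, of 2] step_neg[OF f, of s] N[of s] by (auto simp: indicator_def)
  qed
qed

text \<open>The class of \<open>f\<close> in the one-particle space, where functions equal almost
  everywhere are finally identified.\<close>

definition vec :: "(real => 'k::chilbert_space) => 'k l2 hcompl" where "vec f = hgen (Abs_l2 f)"

lemma L2_integrable: "f \<in> L2fun ==> g \<in> L2fun ==> integrable lebesgue (%s. cinner (f s) (g s))"
  using l2_integrable[of "Abs_l2 f" "Abs_l2 g"] by (simp add: Rep_Abs_l2)

lemma cinner_vec: "f \<in> L2fun ==> g \<in> L2fun ==> cinner (vec f) (vec g) = (LINT s|lebesgue. cinner (f s) (g s))"
  by (simp add: vec_def cinner_hgen kern_l2_def Rep_Abs_l2)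

lemma norm_vec: assumes "f \<in> L2fun" shows "(norm (vec f))\<^sup>2 = (LINT s|lebesgue. (norm (f s))\<^sup>2)"
proof -
  have "complex_of_real ((norm (vec f))\<^sup>2) = (LINT s|lebesgue. complex_of_real ((norm (f s))\<^sup>2))"
    using cinner_vec[OF assms assms] by (simp only: cinner_self)
  thus ?thesis by (simp only: integral_complex_of_real of_real_eq_iff)
qed

lemma L2fun_lincomb: assumes f: "f \<in> L2fun" and g: "g \<in> L2fun" shows "(%s. f s + c *C g s) \<in> L2fun"
proof (rule L2fun_bound)
  obtain F where F: "\<And>i. simple_function lebesgue (F i)" "AE x in lebesgue. (%i::nat. F i x) \<longlonglongrightarrow> f x"
    using f unfolding L2fun_def strongly_measurable_def by blast
  obtain G where G: "\<And>i. simple_function lebesgue (G i)" "AE x in lebesgue. (%i::nat. G i x) \<longlonglongrightarrow> g x"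
    using g unfolding L2fun_def strongly_measurable_def by blast
  show "strongly_measurable lebesgue (%s. f s + c *C g s)" unfolding strongly_measurable_def
  proof (intro exI[of _ "%i s. F i s + c *C G i s"] conjI allI)
    show "simple_function lebesgue (%s. F i s + c *C G i s)" for i
      by (rule simple_function_compose2[of _ "F i" "G i" "%x y. x + c *C y"]) (rule F G)+
    show "AE x in lebesgue. (%i. F i x + c *C G i x) \<longlonglongrightarrow> f x + c *C g x"
      using F(2) G(2) by eventually_elim (intro tendsto_add tendsto_scaleC tendsto_const)
  qed
  show "integrable lebesgue (%s. 2 * (norm (f s))\<^sup>2 + 2 * ((cmod c)\<^sup>2 * (norm (g s))\<^sup>2))" using f g unfolding L2fun_def by auto
  show "(norm (f s + c *C g s))\<^sup>2 <= 2 * (norm (f s))\<^sup>2 + 2 * ((cmod c)\<^sup>2 * (norm (g s))\<^sup>2)" for s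
    using parallelogram[of "f s" "c *C g s"] zero_le_power2[of "norm (f s - c *C g s)"] unfolding norm_scaleC power_mult_distrib by linarith
qed (use f g in \<open>auto simp: L2fun_def\<close>)

lemma vec_lincomb:
  assumes f: "f \<in> L2fun" and g: "g \<in> L2fun" shows "vec (%s. f s + c *C g s) = vec f + c *C vec g"
proof (rule total_if_dense[OF hgen_total])
  fix x assume "x \<in> range (hgen :: 'a l2 => _)"
  then obtain h :: "'a l2" where "x = hgen h" by blast
  hence x: "x = vec (Rep_l2 h)" by (simp add: vec_def Rep_l2_inverse)
  show "cinner x (vec (%s. f s + c *C g s)) = cinner x (vec f + c *C vec g)"
    unfolding x using L2_integrable[OF Rep_l2_L2fun f, of h] L2_integrable[OF Rep_l2_L2fun g, of h]
    by (simp add: cinner_add_right cinner_scaleC_right cinner_vec Rep_l2_L2fun L2fun_lincomb f g)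
qed

lemma vec_dominated:
  fixes f :: "nat => real => 'k::chilbert_space" assumes f: "\<And>i. f i \<in> L2fun" and h: "h \<in> L2fun" and g: "integrable lebesgue g"
    and bd: "\<And>i s. (norm (f i s))\<^sup>2 <= g s" and lim: "AE s in lebesgue. (%i. f i s) \<longlonglongrightarrow> h s" shows "(%i. vec (f i)) \<longlonglongrightarrow> vec h"
proof -
  define d where "d i s = f i s + (-1) *C h s" for i s
  have d: "d i \<in> L2fun" for i unfolding d_def by (rule L2fun_lincomb[OF f h])
  have v: "vec (d i) = vec (f i) - vec h" for i unfolding d_def using vec_lincomb[OF f h, of i "-1"] by (simp add: scaleC_minus_left)
  have mb: "(%s. (norm (d i s))\<^sup>2) \<in> borel_measurable lebesgue" for i using d[of i] unfolding L2fun_def by auto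
  \<comment> \<open>By the parallelogram law the squared distance is at most twice the sum of the
    two squared norms, and the limit inherits the bound \<open>g\<close>; this is the origin of the
    factor 4.\<close>
  have "(%i. LINT s|lebesgue. (norm (d i s))\<^sup>2) \<longlonglongrightarrow> (LINT s|(lebesgue :: real measure). (0::real))"
  proof (rule Bochner_Integration.integral_dominated_convergence[where w = "%s. 4 * g s"])
    show "AE s in lebesgue. (%i. (norm (d i s))\<^sup>2) \<longlonglongrightarrow> 0" using lim
    proof eventually_elim
      case (elim s)
      have "(%i. (norm (f i s - h s))\<^sup>2) \<longlonglongrightarrow> (norm (h s - h s))\<^sup>2" by (intro tendsto_intros elim)
      thus ?case by (simp add: d_def scaleC_minus_left)
    qed
    show "AE s in lebesgue. norm ((norm (d i s))\<^sup>2) <= 4 * g s" for i using lim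
    proof eventually_elim
      case (elim s)
      have "(%i. (norm (f i s))\<^sup>2) \<longlonglongrightarrow> (norm (h s))\<^sup>2" by (intro tendsto_intros elim)
      hence "(norm (h s))\<^sup>2 <= g s" by (rule LIMSEQ_le_const2) (use bd in auto)
      moreover have dd: "d i s = f i s - h s" by (simp add: d_def scaleC_minus_left)
      ultimately show ?case using parallelogram[of "f i s" "h s"] bd[of i s] zero_le_power2[of "norm (f i s + h s)"]
        unfolding real_norm_def abs_of_nonneg[OF zero_le_power2] dd by linarith
    qed
    show "integrable lebesgue (%s. 4 * g s)" by (intro Bochner_Integration.integrable_mult_right g)
  qed (rule borel_measurable_const mb)+
  hence "(%i. (norm (vec (f i) - vec h))\<^sup>2) \<longlonglongrightarrow> 0" by (simp only: norm_vec[OF d, symmetric] v Bochner_Integration.integral_zero)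
  from tendsto_real_sqrt[OF this] have "(%i. norm (vec (f i) - vec h)) \<longlonglongrightarrow> 0" by (simp only: real_sqrt_abs abs_norm_cancel real_sqrt_zero)
  thus ?thesis by (rule LIM_zero_cancel[OF tendsto_norm_zero_cancel])
qed

lemma vec_AE_eq:
  assumes "f \<in> L2fun" "h \<in> L2fun" "AE s in lebesgue. f s = h s" shows "vec f = vec h"
proof -
  have "(%i::nat. vec f) \<longlonglongrightarrow> vec h" by (rule vec_dominated[where g = "%s. (norm (f s))\<^sup>2"]) (use assms in \<open>auto simp: L2fun_def\<close>)
  thus ?thesis by (simp add: LIMSEQ_const_iff)
qed

lemma L2fun_indicator:
  assumes "S \<in> sets lebesgue" "S \<subseteq> {0..N}" shows "(%s. if s \<in> S then c else 0) \<in> L2fun"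
proof (rule L2fun_bound)
  have "simple_function lebesgue (%s. if s \<in> S then c else 0)" by (rule simple_function_If_set) (use assms in auto)
  thus "strongly_measurable lebesgue (%s. if s \<in> S then c else 0)"
    unfolding strongly_measurable_def by (intro exI[of _ "%_ s. if s \<in> S then c else 0"]) simp
  show "integrable lebesgue (%s. (norm c)\<^sup>2 * indicator {0..N} s)"
    by (intro Bochner_Integration.integrable_mult_right integrable_real_indicator) (auto simp: emeasure_lborel_Icc_eq)
qed (use assms(2) in \<open>auto simp: indicator_def\<close>)

definition step_on :: "real set => (real => 'k::chilbert_space) set" where "step_on J = {f \<in> step_fun. \<forall>s. s \<notin> J --> f s = 0}"

text \<open>Common ground of \<open>{0..<r}\<close> and \<open>{r..}\<close>: each bounded cut is a
  half-open interval, so its indicator is a step function.\<close>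

definition subinterval :: "real set => bool" where "subinterval J \<longleftrightarrow> (\<forall>b. \<exists>alpha\<ge>0. \<exists>beta. J \<inter> {0..<b} = {alpha..<beta})"

lemma subinterval_upto: "subinterval {0..<r}"
proof -
  have "{0..<r} \<inter> {0..<b} = {0..<min b r}" for b by auto
  thus ?thesis unfolding subinterval_def by blast
qed

lemma subinterval_from: "0 <= r ==> subinterval {r..}"
proof -
  assume r: "0 <= r"
  have "{r..} \<inter> {0..<b} = {r..<b}" for b using r by auto
  thus ?thesis unfolding subinterval_def using r by blast
qed

text \<open>A Dynkin-system argument over the half-lines \<open>{..<x}\<close>: orthogonality passes
  to complements by linearity and to countable disjoint unions by dominated convergence. Lebesgue
  sets differ from Borel sets by null sets, which \<open>vec\<close> does not see.\<close>

lemma indicator_orth: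
  assumes J: "subinterval J" and y: "\<And>f. f \<in> step_on J ==> cinner (vec f) y = 0" and S: "S \<in> sets lebesgue"
  shows "cinner (vec (%s. if s \<in> J \<inter> {0..<b} \<inter> S then c else 0)) y = 0"
proof -
  obtain alpha beta where ab: "0 <= alpha" "J \<inter> {0..<b} = {alpha..<beta}" using J unfolding subinterval_def by blast
  define K where "K = {alpha..<beta}"
  define ind where "ind E c s = (if s \<in> K \<inter> E then c else 0)" for E and c :: 'a and s
  have K: "K \<subseteq> {0..beta}" "K \<in> sets borel" using ab(1) by (auto simp: K_def)
  have L2: "ind E c \<in> L2fun" if "E \<in> sets lebesgue" for E c
    unfolding ind_def[abs_def] by (rule L2fun_indicator[of _ beta]) (use that K in auto)
  have sl: "A \<in> sets lebesgue" if "A \<in> sigma_sets UNIV (range lessThan)" for A :: "real set"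
  proof -
    have "A \<in> sets borel" using that unfolding borel_Iio by simp
    thus ?thesis by (simp add: sets_completionI_sets)
  qed
  have UN: "\<And>c. cinner (vec (ind UNIV c)) y = 0"
  proof (rule y)
    fix c
    have "ind UNIV c = (%s. if s \<in> {alpha..<beta} then c else 0)" by (simp add: ind_def[abs_def] K_def)
    moreover have "K \<subseteq> J" using ab by (auto simp: K_def)
    ultimately show "ind UNIV c \<in> step_on J" using step_interval[OF ab(1)] unfolding step_on_def by (auto simp: K_def)
  qed
  have Int: "Int_stable (range (lessThan :: real => _))"
  proof -
    have "{..<x} \<inter> {..<y} = {..<min x y}" for x y :: real by auto
    thus ?thesis unfolding Int_stable_def by auto
  qed
  have borel: "\<forall>c. cinner (vec (ind E c)) y = 0" if "E \<in> sigma_sets UNIV (range lessThan)" for E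
    using Int subset_UNIV[of "range lessThan", folded Pow_UNIV] that
  proof (induction rule: sigma_sets_induct_disjoint)
    case (basic A)
    then obtain x where x: "A = {..<x}" by blast
    show ?case
    proof (intro allI y)
      fix c
      have "ind A c = (%s. if s \<in> {alpha..<min beta x} then c else 0)" by (auto simp: ind_def[abs_def] K_def x)
      moreover have "K \<subseteq> J" using ab by (auto simp: K_def)
      moreover have "(%s. if s \<in> {alpha..<min beta x} then c else 0) \<in> step_fun" by (rule step_interval[OF ab(1)])
      ultimately show "ind A c \<in> step_on J" unfolding step_on_def by (auto simp: K_def)
    qed
  next
    case empty
    have "ind {} c = (%s. 0)" for c by (simp add: ind_def[abs_def])
    moreover have "cinner (vec (%_. 0)) y = 0" by (rule y) (simp add: step_on_def step_zero)
    ultimately show ?case by simp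
  next
    case (compl A)
    have A: "A \<in> sets lebesgue" using compl(1) by (rule sl)
    have "ind (UNIV - A) c = (%s. ind UNIV c s + (-1) *C ind A c s)" for c by (auto simp: ind_def[abs_def] scaleC_minus_left)
    hence "vec (ind (UNIV - A) c) = vec (ind UNIV c) + (-1) *C vec (ind A c)" for c using vec_lincomb[OF L2[of UNIV] L2[OF A]] by simp
    thus ?case using compl UN by (simp add: ch.ip_add_left ch.ip_sc_left)
  next
    case (union A)
    have A: "A i \<in> sets lebesgue" for i using union(2) by (intro sl) auto
    show ?case
    proof
      fix c
      have fin: "cinner (vec (ind (\<Union>i<n. A i) c)) y = 0" for n :: nat
      proof (induction n)
        case 0
        have "cinner (vec (%_. 0)) y = 0" by (rule y) (simp add: step_on_def step_zero)
        thus ?case by (simp add: ind_def[abs_def])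
      next
        case (Suc n)
        have "A i \<inter> A n = {}" if "i < n" for i by (rule disjoint_family_onD[OF union(1)]) (use that in auto)
        hence "s \<notin> A i" if "s \<in> A n" "i < n" for s i using that by blast
        hence e: "ind (\<Union>i<Suc n. A i) c = (%s. ind (\<Union>i<n. A i) c s + 1 *C ind (A n) c s)" by (intro ext) (auto simp: ind_def lessThan_Suc)
        have "(\<Union>i<n. A i) \<in> sets lebesgue" using A by blast
        hence "vec (ind (\<Union>i<Suc n. A i) c) = vec (ind (\<Union>i<n. A i) c) + 1 *C vec (ind (A n) c)" unfolding e by (intro vec_lincomb L2 A)
        thus ?case using Suc union(3) by (simp add: ch.ip_add_left ch.ip_sc_left)
      qed
      have "(%n. vec (ind (\<Union>i<n. A i) c)) \<longlonglongrightarrow> vec (ind (\<Union>i. A i) c)"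
      proof (rule vec_dominated[where g = "%s. (norm (ind UNIV c s))\<^sup>2"])
        show "integrable lebesgue (%s. (norm (ind UNIV c s))\<^sup>2)" using L2[of UNIV c] unfolding L2fun_def by auto
        have "(%n. ind (\<Union>i<n. A i) c s) \<longlonglongrightarrow> ind (\<Union>i. A i) c s" for s
        proof (cases "s \<in> (\<Union>i. A i)")
          case True
          then obtain i where "s \<in> A i" by blast
          hence "ind (\<Union>i. A i) c s = ind (\<Union>i<n. A i) c s" if "i < n" for n using that by (simp add: ind_def) blast
          hence "eventually (%n. ind (\<Union>i. A i) c s = ind (\<Union>i<n. A i) c s) sequentially"
            using eventually_gt_at_top[of i] by (rule eventually_mono[rotated])
          thus ?thesis by (rule Lim_transform_eventually[OF tendsto_const])
        next
          case False
          thus ?thesis by (simp add: ind_def)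
        qed
        thus "AE s in lebesgue. (%n. ind (\<Union>i<n. A i) c s) \<longlonglongrightarrow> ind (\<Union>i. A i) c s" by simp
        show "(norm (ind (\<Union>i<n. A i) c s))\<^sup>2 <= (norm (ind UNIV c s))\<^sup>2" for n s by (simp add: ind_def)
        show "ind (\<Union>i<n. A i) c \<in> L2fun" for n by (intro L2 sets.finite_UN A) simp
        show "ind (\<Union>i. A i) c \<in> L2fun" by (intro L2 sets.countable_UN) (use A in blast)
      qed
      hence "(%n. cinner (vec (ind (\<Union>i<n. A i) c)) y) \<longlonglongrightarrow> cinner (vec (ind (\<Union>i. A i) c)) y" by (intro tendsto_cinner' tendsto_const)
      thus "cinner (vec (ind (\<Union>i. A i) c)) y = 0" unfolding fin by (simp add: LIMSEQ_const_iff)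
    qed
  qed
  obtain E N N' where E: "S = E \<union> N" "N \<subseteq> N'" "N' \<in> null_sets lborel" "E \<in> sets lborel" using S by (rule sets_completionE)
  have El: "E \<in> sets lebesgue" using E(4) by (rule sets_completionI_sets)
  have "N \<in> null_sets lebesgue" using null_sets_completion_subset[OF E(2)] E(3) null_sets_completionI by blast
  hence "AE s in lebesgue. s \<notin> N" by (rule AE_not_in)
  hence "AE s in lebesgue. ind S c s = ind E c s" by eventually_elim (auto simp: ind_def E(1))
  hence "vec (ind S c) = vec (ind E c)" by (rule vec_AE_eq[OF L2[OF S] L2[OF El]])
  moreover have "cinner (vec (ind E c)) y = 0" using borel[of E] E(4) by (simp add: borel_Iio)
  moreover have "ind S c = (%s. if s \<in> J \<inter> {0..<b} \<inter> S then c else 0)" unfolding ind_def[abs_def] K_def ab(2)[symmetric] ..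
  ultimately show ?thesis by simp
qed

text \<open>Density of step functions among the square-integrable functions on \<open>J\<close>, in
  dual form: simple functions are finite sums of the indicators treated in
  \<open>indicator_orth\<close>.\<close>

lemma vec_orth:
  fixes h :: "real => 'k::chilbert_space"
  assumes J: "subinterval J" and y: "\<And>f. f \<in> step_on J ==> cinner (vec f) y = 0" and h: "h \<in> L2fun" "\<And>s. s \<notin> J ==> h s = 0"
  shows "cinner (vec h) y = 0"
proof -
  obtain F where F: "\<And>i. simple_function lebesgue (F i)" "AE x in lebesgue. (%i::nat. F i x) \<longlonglongrightarrow> h x"
    using h(1) unfolding L2fun_def strongly_measurable_def by blast
  \<comment> \<open>Keeping \<open>F i s\<close> only where its norm is at most
    \<open>2 * norm (h s)\<close> makes the truncations dominated by a multiple of \<open>h\<close>.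
    Where \<open>h\<close> is nonzero this restriction is eventually void, and where
    \<open>h\<close> vanishes the truncations vanish too.\<close>
  define K where "K i = J \<inter> {0..<real i} \<inter> {s. norm (F i s) <= 2 * norm (h s)}" for i
  define G where "G i s = (if s \<in> K i then F i s else 0)" for i s
  have "(%s. norm (h s)) \<in> borel_measurable lebesgue" using h(1) unfolding L2fun_def by (auto intro: strongly_measurable_norm)
  moreover have "(%s. norm (F i s)) \<in> borel_measurable lebesgue" for i
    by (rule borel_measurable_simple_function, rule simple_function_compose1[OF F(1)])
  ultimately have "{s \<in> space lebesgue. norm (F i s) <= 2 * norm (h s)} \<in> sets lebesgue" for i by (intro borel_measurable_le) auto
  hence m: "{s. norm (F i s) <= 2 * norm (h s)} \<in> sets lebesgue" for i by simp
  have Jm: "J \<inter> {0..<real i} \<in> sets lebesgue" for i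
  proof -
    obtain alpha beta where "J \<inter> {0..<real i} = {alpha..<beta}" using J unfolding subinterval_def by blast
    thus ?thesis by simp
  qed
  have Gs: "simple_function lebesgue (G i)" for i
    unfolding G_def[abs_def] by (rule simple_function_If_set) (use F(1) m Jm in \<open>auto simp: K_def\<close>)
  have pre: "G i -` {c} \<in> sets lebesgue" for i c using simple_functionD(2)[OF Gs, of i "{c}"] by simp
  define I where "I i c s = (if s \<in> J \<inter> {0..<real i} \<inter> (G i -` {c}) then c else 0)" for i and c :: 'k and s
  have I2: "I i c \<in> L2fun" for i c unfolding I_def[abs_def] by (rule L2fun_indicator[of _ "real i"]) (use Jm pre in auto)
  have sum: "(%s. \<Sum>c\<in>R. I i c s) \<in> L2fun \<and> cinner (vec (%s. \<Sum>c\<in>R. I i c s)) y = 0" if "finite R" for R i using that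
  proof (induction R rule: finite_induct)
    case empty
    show ?case using y[of "%_. 0"] step_L2fun[OF step_zero] by (simp add: step_on_def step_zero)
  next
    case (insert c R)
    have e: "(%s. \<Sum>c\<in>insert c R. I i c s) = (%s. (\<Sum>c\<in>R. I i c s) + 1 *C I i c s)" using insert by (simp add: add.commute)
    have "cinner (vec (I i c)) y = 0" unfolding I_def[abs_def] by (rule indicator_orth[OF J y pre])
    moreover have IH: "(%s. \<Sum>c\<in>R. I i c s) \<in> L2fun" "cinner (vec (%s. \<Sum>c\<in>R. I i c s)) y = 0" using insert.IH by auto
    ultimately show ?case unfolding e vec_lincomb[OF IH(1) I2] using L2fun_lincomb[OF IH(1) I2, of 1 i c]
      by (simp add: ch.ip_add_left ch.ip_sc_left del: sum.insert)
  qed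
  have fin: "finite (range (G i))" for i using simple_functionD(1)[OF Gs, of i] by simp
  have GI: "G i = (%s. \<Sum>c\<in>range (G i). I i c s)" for i
  proof
    fix s
    have "(\<Sum>c\<in>range (G i). I i c s) = (\<Sum>c\<in>range (G i). if c = G i s then I i c s else 0)" by (rule sum.cong) (auto simp: I_def)
    also have "\<dots> = I i (G i s) s" using fin by simp
    also have "\<dots> = G i s" by (auto simp: I_def G_def K_def)
    finally show "G i s = (\<Sum>c\<in>range (G i). I i c s)" by simp
  qed
  have GL: "G i \<in> L2fun" and Gy: "cinner (vec (G i)) y = 0" for i using sum[OF fin, of i i] GI[of i] by auto
  have "(%i. vec (G i)) \<longlonglongrightarrow> vec h"
  proof (rule vec_dominated[OF GL h(1), where g = "%s. 4 * (norm (h s))\<^sup>2"])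
    show "integrable lebesgue (%s. 4 * (norm (h s))\<^sup>2)" using h(1) unfolding L2fun_def by auto
    show "(norm (G i s))\<^sup>2 <= 4 * (norm (h s))\<^sup>2" for i s
    proof -
      have "norm (G i s) <= 2 * norm (h s)" by (auto simp: G_def K_def)
      from power_mono[OF this norm_ge_zero, of 2] show ?thesis by (simp add: power_mult_distrib)
    qed
    show "AE s in lebesgue. (%i. G i s) \<longlonglongrightarrow> h s" using F(2)
    proof eventually_elim
      case (elim s)
      show ?case
      proof (cases "h s = 0")
        case True
        hence "G i s = 0" for i by (auto simp: G_def K_def)
        thus ?thesis using True by simp
      next
        case False
        hence s: "s \<in> J" "0 <= s" using h unfolding L2fun_def by (auto simp: not_less[symmetric])
        have "(%i. norm (F i s)) \<longlonglongrightarrow> norm (h s)" by (intro tendsto_norm elim)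
        hence "eventually (%i. norm (F i s) < 2 * norm (h s)) sequentially" using False by (intro order_tendstoD(2)) auto
        hence "eventually (%i. F i s = G i s) sequentially" using eventually_gt_at_top[of "nat \<lceil>s\<rceil>"]
        proof eventually_elim
          case (elim i)
          hence "s < real i" by linarith
          thus ?case using elim s by (simp add: G_def K_def)
        qed
        thus ?thesis by (rule Lim_transform_eventually[OF elim])
      qed
    qed
  qed
  hence "(%i. cinner (vec (G i)) y) \<longlonglongrightarrow> cinner (vec h) y" by (intro tendsto_cinner' tendsto_const)
  thus ?thesis unfolding Gy by (simp add: LIMSEQ_const_iff)
qed

subsection \<open>Exponential vectors\<close>

definition pw :: "nat => (real => 'k::chilbert_space) => 'k fock" where "pw n f = hgen (SymPow n (Abs_l2 f))"

text \<open>The unnormalized exponential vector. Its inner products are exponentials of those of the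
  arguments, without the Gaussian factor of \<open>expv\<close>, and so depend analytically on
  scalars multiplying the arguments.\<close>

definition expu :: "(real => 'k::chilbert_space) => 'k fock" where "expu f = (\<Sum>n. complex_of_real (1 / sqrt (fact n)) *C pw n f)"

lemma cinner_pw: "cinner (pw m f) (pw n g) = (if m = n then cinner (vec f) (vec g) ^ n else 0)" by (simp add: pw_def vec_def cinner_hgen)

lemma norm_pw: "norm (pw n f) = norm (vec f) ^ n"
proof (rule power2_eq_imp_eq)
  have "complex_of_real ((norm (pw n f))\<^sup>2) = complex_of_real ((norm (vec f) ^ n)\<^sup>2)"
    unfolding cinner_self[symmetric] cinner_pw by (simp add: cinner_self power_mult[symmetric] mult.commute)
  thus "(norm (pw n f))\<^sup>2 = (norm (vec f) ^ n)\<^sup>2" by (simp only: of_real_eq_iff)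
qed auto

lemma expu_sums: "(%n. complex_of_real (1 / sqrt (fact n)) *C pw n f) sums expu f" unfolding expu_def
proof (rule summable_sums, rule orthogonal_summable)
  show "cinner (complex_of_real (1 / sqrt (fact m)) *C pw m f) (complex_of_real (1 / sqrt (fact n)) *C pw n f) = 0" if "m \<noteq> n" for m n
    using that by (simp add: cinner_scaleC_right ch.ip_sc_left cinner_pw)
  have "(norm (complex_of_real (1 / sqrt (fact n)) *C pw n f))\<^sup>2 = inverse (fact n) * ((norm (vec f))\<^sup>2) ^ n" for n
    by (simp add: norm_scaleC norm_divide norm_pw power_mult_distrib power_divide power_mult[symmetric] mult.commute inverse_eq_divide)
  thus "summable (%n. (norm (complex_of_real (1 / sqrt (fact n)) *C pw n f))\<^sup>2)" by (simp only: summable_exp)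
qed

lemma cinner_expu_sums: "(%n. complex_of_real (1 / sqrt (fact n)) * cinner y (pw n f)) sums cinner y (expu f)"
  using bounded_linear.sums[OF bounded_clinear_bounded_linear[OF bounded_clinear_cinner[of y]] expu_sums[of f]]
  by (simp add: cinner_scaleC_right)

lemma cinner_pw_expu: "cinner (pw n f) (expu g) = complex_of_real (1 / sqrt (fact n)) * cinner (vec f) (vec g) ^ n"
proof -
  have "(%k. complex_of_real (1 / sqrt (fact k)) * cinner (pw n f) (pw k g)) sums
      (complex_of_real (1 / sqrt (fact n)) * cinner (pw n f) (pw n g))"
    using sums_finite[of "{n}" "%k. complex_of_real (1 / sqrt (fact k)) * cinner (pw n f) (pw k g)"] by (simp add: cinner_pw)
  from sums_unique2[OF cinner_expu_sums this] show ?thesis by (simp add: cinner_pw)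
qed

lemma cinner_expu: "cinner (expu f) (expu g) = exp (cinner (vec f) (vec g))"
proof -
  define z where "z = cinner (vec g) (vec f)"
  have "complex_of_real (1 / sqrt (fact n)) * cinner (expu g) (pw n f) = z ^ n /\<^sub>R fact n" for n
  proof -
    have "cinner (expu g) (pw n f) = complex_of_real (1 / sqrt (fact n)) * z ^ n"
      by (subst cinner_commute) (simp add: cinner_pw_expu z_def cinner_commute[symmetric])
    moreover have "complex_of_real (1 / sqrt (fact n)) * complex_of_real (1 / sqrt (fact n)) = complex_of_real (1 / fact n)"
      unfolding of_real_mult[symmetric] by simp
    ultimately show ?thesis by (simp add: mult.assoc[symmetric] scaleR_conv_of_real divide_inverse of_real_inverse)
  qed
  hence "(%n. z ^ n /\<^sub>R fact n) sums cinner (expu g) (expu f)" using cinner_expu_sums[of "expu g" f] by simp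
  from sums_unique2[OF this exp_converges] have "cinner (expu g) (expu f) = exp z" .
  hence "cnj (cinner (expu g) (expu f)) = exp (cnj z)" by (simp add: exp_cnj)
  thus ?thesis by (simp add: cinner_commute[symmetric] z_def)
qed

lemma expv_expu: "f \<in> L2fun ==> expv f = complex_of_real (exp (- (norm (vec f))\<^sup>2 / 2)) *C expu f"
  unfolding expv_def expu_def pw_def by (simp only: norm_vec scaleR_scaleC)

lemma cinner_expv:
  "f \<in> L2fun ==> g \<in> L2fun ==> cinner (expv f) (expv g) = complex_of_real (exp (- (norm (vec f))\<^sup>2 / 2)) *
    complex_of_real (exp (- (norm (vec g))\<^sup>2 / 2)) * exp (cinner (vec f) (vec g))"
  by (simp add: expv_expu ch.ip_sc_left cinner_scaleC_right cinner_expu mult_ac)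

lemma norm_expv: assumes "f \<in> L2fun" shows "norm (expv f) = 1"
proof -
  have "complex_of_real ((norm (expv f))\<^sup>2) = complex_of_real (exp (- (norm (vec f))\<^sup>2 / 2) * exp (- (norm (vec f))\<^sup>2 / 2) * exp ((norm (vec f))\<^sup>2))"
    unfolding cinner_self[symmetric] cinner_expv[OF assms assms] by (simp add: cinner_self exp_of_real del: of_real_power)
  also have "\<dots> = complex_of_real 1" unfolding exp_add[symmetric] by simp
  finally have "(norm (expv f))\<^sup>2 = 1" by (simp only: of_real_eq_iff)
  thus ?thesis using norm_ge_zero[of "expv f"] by (simp add: power2_eq_1_iff)
qed

text \<open>Leaving out \<open>z = 0\<close> lets the hypothesis survive division by
  \<open>z\<close>, which shifts the coefficients in the induction.\<close>

lemma power_series_zero: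
  fixes a :: "nat => complex" assumes "\<And>z. z \<noteq> 0 ==> (%n. a n * z ^ n) sums 0" shows "a n = 0" using assms
proof (induction n arbitrary: a)
  case 0
  have "((%_. 0) \<longlongrightarrow> a 0) (at (0::complex))" by (rule powser_limit_0_strong[of 1]) (use 0 in auto)
  thus ?case by (simp add: tendsto_const_iff)
next
  case (Suc n)
  have z: "a 0 = 0"
  proof -
    have "((%_. 0) \<longlongrightarrow> a 0) (at (0::complex))" by (rule powser_limit_0_strong[of 1]) (use Suc.prems in auto)
    thus ?thesis by (simp add: tendsto_const_iff)
  qed
  have "(%n. a (Suc n) * z ^ n) sums 0" if "z \<noteq> 0" for z
  proof -
    have "(%n. a (Suc n) * z ^ Suc n) sums 0" using Suc.prems[OF that] sums_Suc_iff[of "%n. a n * z ^ n" 0] z by simp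
    from sums_mult[OF this, of "inverse z"] show ?thesis using that by (simp add: field_simps)
  qed
  from Suc.IH[of "%n. a (Suc n)", OF this] show ?case by simp
qed

lemma L2fun_scale: "f \<in> L2fun ==> (%s. c *C f s) \<in> L2fun" and vec_scale: "f \<in> L2fun ==> vec (%s. c *C f s) = c *C vec f"
proof -
  assume f: "f \<in> L2fun"
  have e: "(%s. c *C f s) = (%s. f s + (c - 1) *C f s)" by (simp add: scaleC_diff_left)
  show "(%s. c *C f s) \<in> L2fun" unfolding e by (rule L2fun_lincomb[OF f f])
  show "vec (%s. c *C f s) = c *C vec f" unfolding e vec_lincomb[OF f f] by (simp add: scaleC_diff_left)
qed

lemma vec_zero: "vec (%_. 0 :: 'k::chilbert_space) = 0" using vec_scale[OF step_L2fun[OF step_zero], of 0] by simp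

lemma pw_eqI: assumes "vec f = c *C vec g" shows "pw n f = c ^ n *C pw n g"
proof (rule total_if_dense[OF hgen_total])
  fix x assume "x \<in> range (hgen :: 'a l2 sympow => _)"
  then obtain y :: "'a l2 sympow" where "x = hgen y" by blast
  then obtain m h where "x = hgen (SymPow m h)" by (cases y) auto
  hence x: "x = pw m (Rep_l2 h)" by (simp add: pw_def Rep_l2_inverse)
  show "cinner x (pw n f) = cinner x (c ^ n *C pw n g)" by (simp add: x cinner_pw assms cinner_scaleC_right power_mult_distrib)
qed

lemma in_closure_cspanI:
  assumes "\<And>y. (\<And>s. s \<in> S ==> cinner s y = 0) ==> cinner h y = 0" shows "h \<in> closure (cspan (S :: 'a::chilbert_space set))"
proof -
  obtain p where p: "p \<in> closure (cspan S)" "\<And>y. y \<in> closure (cspan S) ==> cinner y (h - p) = 0"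
    using projection_exists[OF csubspace_closure[OF csubspace_cspan] closed_closure, of S h] by blast
  have "cinner s (h - p) = 0" if "s \<in> S" for s using cspan_base[OF that] closure_subset by (intro p(2)) blast
  hence "cinner h (h - p) = 0" by (rule assms)
  moreover have "cinner p (h - p) = 0" by (rule p(2)[OF p(1)])
  ultimately have "cinner (h - p) (h - p) = 0" by (simp add: ch.ip_diff_left)
  thus ?thesis using p(1) by (simp add: cinner_eq_0_iff)
qed

lemma step_on_step: "f \<in> step_on J ==> f \<in> step_fun" and step_on_L2fun: "f \<in> step_on J ==> f \<in> L2fun"
  by (auto simp: step_on_def intro: step_L2fun)

lemma step_on_lincomb: "f \<in> step_on J ==> g \<in> step_on J ==> (%s. f s + c *C g s) \<in> step_on J"
  by (auto simp: step_on_def intro: step_add step_scale)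

lemma step_on_zero: "(%_. 0) \<in> step_on J" by (simp add: step_on_def step_zero)

lemma vec_approx:
  fixes h :: "real => 'k::chilbert_space" assumes J: "subinterval J" and h: "h \<in> L2fun" "\<And>s. s \<notin> J ==> h s = 0"
  shows "\<exists>f. (\<forall>i. f i \<in> step_on J) \<and> (%i::nat. vec (f i)) \<longlonglongrightarrow> vec h"
proof -
  have "csubspace (vec ` (step_on J :: (real => 'k) set))" unfolding csubspace_def
  proof (intro conjI ballI allI)
    show "0 \<in> vec ` (step_on J :: (real => 'k) set)" using imageI[OF step_on_zero, of vec J] by (simp only: vec_zero)
  next
    fix x y :: "'k l2 hcompl" assume "x \<in> vec ` step_on J" "y \<in> vec ` step_on J"
    then obtain f g where "x = vec f" "y = vec g" "f \<in> step_on J" "g \<in> step_on J" by blast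
    thus "x + y \<in> vec ` step_on J" using vec_lincomb[OF step_on_L2fun step_on_L2fun, of f J g J 1] step_on_lincomb[of f J g 1]
      by (intro image_eqI[of _ _ "%s. f s + g s"]) simp_all
  next
    fix c and x :: "'k l2 hcompl" assume "x \<in> vec ` step_on J"
    then obtain f where "x = vec f" "f \<in> step_on J" by blast
    thus "c *C x \<in> vec ` step_on J" using step_scale[of f c]
      by (auto intro!: image_eqI[of _ _ "%s. c *C f s"] simp: vec_scale step_on_L2fun step_on_def)
  qed
  hence "cspan (vec ` (step_on J :: (real => 'k) set)) \<subseteq> vec ` step_on J" by (rule cspan_minimal[OF subset_refl])
  moreover have "vec h \<in> closure (cspan (vec ` step_on J))" by (rule in_closure_cspanI, rule vec_orth[OF J _ h]) auto
  ultimately have "vec h \<in> closure (vec ` step_on J)" using closure_mono by blast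
  then obtain v where v: "\<forall>i. v i \<in> vec ` step_on J" "v \<longlonglongrightarrow> vec h" unfolding closure_sequential by blast
  from v(1) have "\<forall>i. \<exists>f. f \<in> step_on J \<and> v i = vec f" by blast
  from choice[OF this] obtain f where f: "\<forall>i. f i \<in> step_on J \<and> v i = vec (f i)" by (elim exE)
  hence "v = (%i. vec (f i))" by auto
  thus ?thesis using f v(2) by (intro exI[of _ f]) simp
qed

text \<open>Replacing \<open>f\<close> by its multiple with \<open>z\<close> turns orthogonality to
  exponential vectors into the vanishing of a power series in \<open>z\<close>, hence of each
  coefficient, and these are the \<open>n\<close>-particle components. Step functions then
  approximate a general \<open>h\<close>.\<close>

lemma pw_orth:
  assumes J: "subinterval J" and y: "\<And>f. f \<in> step_on J ==> cinner (expv f) y = 0" and h: "h \<in> L2fun" "\<And>s. s \<notin> J ==> h s = 0"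
  shows "cinner (pw n h) y = 0"
proof -
  have step: "cinner y (pw n f) = 0" if f: "f \<in> step_on J" for f
  proof -
    have "(%n. (complex_of_real (1 / sqrt (fact n)) * cinner y (pw n f)) * z ^ n) sums 0" for z
    proof -
      define g where "g = (%s. z *C f s)"
      have g: "g \<in> step_on J" "g \<in> L2fun" using step_scale[of f z] f by (auto simp: g_def step_on_def intro!: step_L2fun)
      have vg: "vec g = z *C vec f" unfolding g_def by (rule vec_scale[OF step_on_L2fun[OF f]])
      have "cinner (expu g) y = 0" using y[OF g(1)] by (simp add: expv_expu[OF g(2)] ch.ip_sc_left)
      hence "cinner y (expu g) = 0" by (simp add: cinner_0_commute)
      moreover have "cinner y (pw n g) = z ^ n * cinner y (pw n f)" for n by (simp add: pw_eqI[OF vg] cinner_scaleC_right)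
      ultimately show ?thesis using cinner_expu_sums[of y g] by (simp add: mult_ac)
    qed
    hence "complex_of_real (1 / sqrt (fact n)) * cinner y (pw n f) = 0" by (rule power_series_zero)
    thus ?thesis by simp
  qed
  have "\<exists>f. (\<forall>i. f i \<in> step_on J) \<and> (%i::nat. vec (f i)) \<longlonglongrightarrow> vec h" by (rule vec_approx[OF J h(1)]) (rule h(2))
  then obtain f where f: "\<forall>i. f i \<in> step_on J" "(%i::nat. vec (f i)) \<longlonglongrightarrow> vec h" by (elim exE conjE)
  define a where "a = cinner (vec h) (vec h) ^ n"
  have e: "complex_of_real ((norm (pw n (f i) - pw n h))\<^sup>2) =
      (cinner (vec (f i)) (vec (f i)) ^ n - cinner (vec h) (vec (f i)) ^ n) - (cinner (vec (f i)) (vec h) ^ n - a)" for i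
    unfolding cinner_self[symmetric] by (simp only: ch.ip_diff ch.ip_diff_left cinner_pw a_def refl if_True)
  have "(%i. (cinner (vec (f i)) (vec (f i)) ^ n - cinner (vec h) (vec (f i)) ^ n) - (cinner (vec (f i)) (vec h) ^ n - a)) \<longlonglongrightarrow> (a - a) - (a - a)"
    using tendsto_diff[OF tendsto_diff[OF tendsto_power[OF tendsto_cinner'[OF f(2) f(2)]] tendsto_power[OF tendsto_cinner'[OF tendsto_const f(2)]]]
      tendsto_diff[OF tendsto_power[OF tendsto_cinner'[OF f(2) tendsto_const]] tendsto_const]] unfolding a_def .
  hence "(%i. complex_of_real ((norm (pw n (f i) - pw n h))\<^sup>2)) \<longlonglongrightarrow> 0" unfolding e by (simp only: diff_self)
  hence "(%i. (norm (pw n (f i) - pw n h))\<^sup>2) \<longlonglongrightarrow> 0" by (simp only: tendsto_of_real_iff[where c = 0, unfolded of_real_0])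
  from tendsto_real_sqrt[OF this] have "(%i. norm (pw n (f i) - pw n h)) \<longlonglongrightarrow> 0" by (simp only: real_sqrt_abs abs_norm_cancel real_sqrt_zero)
  hence "(%i. pw n (f i)) \<longlonglongrightarrow> pw n h" by (rule LIM_zero_cancel[OF tendsto_norm_zero_cancel])
  hence "(%i. cinner y (pw n (f i))) \<longlonglongrightarrow> cinner y (pw n h)" by (rule tendsto_cinner'[OF tendsto_const])
  moreover have "cinner y (pw n (f i)) = 0" for i using step f(1) by blast
  ultimately have "cinner y (pw n h) = 0" by (simp add: LIMSEQ_const_iff)
  thus ?thesis by (simp add: cinner_0_commute)
qed

lemma closure_cspan_subset:
  assumes "\<And>y s. (\<And>t. t \<in> T ==> cinner t y = 0) ==> s \<in> S ==> cinner s y = 0"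
  shows "closure (cspan S) \<subseteq> closure (cspan (T :: 'a::chilbert_space set))"
proof (rule closure_minimal[OF _ closed_closure], rule cspan_minimal[OF _ csubspace_closure[OF csubspace_cspan]])
  show "S \<subseteq> closure (cspan T)" using assms by (intro subsetI in_closure_cspanI) blast
qed

text \<open>Reconciles the definition by powers of arbitrary square-integrable functions with the
  exponential vectors of step functions, on which operators are specified.\<close>

lemma fock_on_expv:
  assumes J: "subinterval J" shows "fock_on J = closure (cspan (expv ` step_on J) :: 'k::chilbert_space fock set)" unfolding fock_on_def
proof (rule equalityI; rule closure_cspan_subset)
  fix y s :: "'k fock" assume y: "\<And>t. t \<in> expv ` step_on J ==> cinner t y = 0" and "s \<in> {hgen (SymPow n f) |n f. \<forall>s. s \<notin> J --> Rep_l2 (f :: 'k l2) s = 0}"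
  then obtain n f where s: "s = hgen (SymPow n f)" "\<forall>s. s \<notin> J --> Rep_l2 f s = 0" by blast
  have "cinner (pw n (Rep_l2 f)) y = 0" by (rule pw_orth[OF J _ Rep_l2_L2fun]) (use y s in auto)
  thus "cinner s y = 0" by (simp add: s pw_def Rep_l2_inverse)
next
  fix y s :: "'k fock" assume y: "\<And>t. t \<in> {hgen (SymPow n f) |n f. \<forall>s. s \<notin> J --> Rep_l2 (f :: 'k l2) s = 0} ==> cinner t y = 0" and "s \<in> expv ` step_on J"
  then obtain f where f: "s = expv f" "f \<in> step_on J" by blast
  have "cinner (pw n f) y = 0" for n unfolding pw_def
  proof (rule y, intro CollectI exI conjI)
    show "\<forall>s. s \<notin> J --> Rep_l2 (Abs_l2 f) s = 0" using f by (simp add: Rep_Abs_l2[OF step_on_L2fun[OF f(2)]] step_on_def)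
  qed (rule refl)
  hence "cinner y (pw n f) = 0" for n by (simp add: cinner_0_commute)
  hence "(%n. 0) sums cinner y (expu f)" using cinner_expu_sums[of y f] by simp
  hence "cinner y (expu f) = 0" using sums_zero sums_unique2 by blast
  thus "cinner s y = 0" unfolding f(1) expv_expu[OF step_on_L2fun[OF f(2)]] by (simp add: ch.ip_sc_left cinner_0_commute)
qed

lemma expv_total: "closure (cspan (expv ` step_fun)) = (UNIV :: 'k::chilbert_space fock set)"
proof -
  have "subinterval {0..}" by (rule subinterval_from) simp
  hence "closure (cspan (expv ` step_on {0..})) = (fock_on {0..} :: 'k fock set)" by (rule fock_on_expv[symmetric])
  also have "\<dots> = UNIV"
  proof -
    have "{hgen (SymPow n f) | n f. \<forall>s. s \<notin> {0..} --> Rep_l2 (f :: 'k l2) s = 0} = range hgen"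
    proof (intro equalityI subsetI)
      fix x assume "x \<in> range (hgen :: 'k l2 sympow => _)"
      then obtain y :: "'k l2 sympow" where "x = hgen y" by blast
      then obtain m h where "x = hgen (SymPow m h)" by (cases y) auto
      moreover have "Rep_l2 h s = 0" if "s \<notin> {0..}" for s using Rep_l2_L2fun[of h] that unfolding L2fun_def by auto
      ultimately show "x \<in> {hgen (SymPow n f) | n f. \<forall>s. s \<notin> {0..} --> Rep_l2 (f :: 'k l2) s = 0}" by blast
    qed auto
    thus ?thesis unfolding fock_on_def by (simp add: hgen_total)
  qed
  also have "step_on {0..} = (step_fun :: (real => 'k) set)" by (auto simp: step_on_def step_neg)
  finally show ?thesis .
qed

subsection \<open>Projections onto the Fock spaces of subintervals\<close>

text \<open>The inclusion of \<open>M\<close> is an isometric assignment on generators, and its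
  extension by zero is the projection.\<close>

lemma orth_projection_exists:
  fixes S :: "'a::chilbert_space set" assumes M: "M = closure (cspan S)"
  shows "\<exists>p. projection p \<and> range p \<subseteq> M \<and> (\<forall>x\<in>M. p x = x) \<and> (\<forall>x. (\<forall>y\<in>M. cinner y x = 0) --> p x = 0)"
proof -
  have "\<exists>p. bc p \<and> (\<forall>m\<in>M. p m = m) \<and> (\<forall>x. norm (p x) <= 1 * norm x) \<and> (\<forall>x. (\<forall>m\<in>M. cinner m x = 0) --> p x = 0)"
    by (rule isometry_from_generators) (rule refl)
  then obtain p where p: "bc p" "\<forall>m\<in>M. p m = m" "\<forall>x. (\<forall>m\<in>M. cinner m x = 0) --> p x = 0" by (elim exE conjE)
  have dec: "p x \<in> M \<and> (\<forall>y\<in>M. cinner y (x - p x) = 0)" for x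
  proof -
    obtain m where m: "m \<in> M" "\<forall>y\<in>M. cinner y (x - m) = 0"
      using projection_exists[of M x] csubspace_closure[OF csubspace_cspan[of S]] by (auto simp: M)
    have "p (x - m) = 0" using p(3) m(2) by blast
    hence "p x = m" using m(1) p(2) by (simp add: bc_diff[OF p(1)])
    thus ?thesis using m by simp
  qed
  have "cinner (p y) x = cinner y (p x)" for x y
  proof -
    have "cinner (p y) (x - p x) = 0" "cinner (p x) (y - p y) = 0" using dec by blast+
    hence "cinner (p y) x = cinner (p y) (p x)" "cinner (y - p y) (p x) = 0" by (simp_all add: ch.ip_diff cinner_0_commute)
    thus ?thesis by (simp add: ch.ip_diff_left)
  qed
  hence "cadj p = p" by (intro cadj_eqI p(1)) auto
  moreover have "p o p = p" using dec p(2) by (auto simp: fun_eq_iff)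
  ultimately show ?thesis using p dec unfolding projection_def by (intro exI[of _ p]) blast
qed

text \<open>Range in a subspace and vanishing on its complement amount to being fixed by the
  projection from both sides, so the algebras \<open>fock_ops J\<close> fall under the results on
  \<open>corner\<close>.\<close>

lemma fock_id_props:
  fixes J :: "real set"
  defines "M \<equiv> (fock_on J :: 'k::chilbert_space fock set)" and "p \<equiv> (fock_id J :: 'k fock => 'k fock)"
  shows "projection p" "range p \<subseteq> M" "\<And>x. x \<in> M ==> p x = x" "\<And>x. (\<And>y. y \<in> M ==> cinner y x = 0) ==> p x = 0"
    and fock_ops_corner: "fock_ops J = corner p"
proof -
  obtain q :: "'k fock => 'k fock" where q: "projection q" "range q \<subseteq> M" "\<forall>x\<in>M. q x = x" "\<forall>x. (\<forall>y\<in>M. cinner y x = 0) --> q x = 0"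
    using orth_projection_exists[of M] unfolding M_def fock_on_def by blast
  note qb = projectionD(1)[OF q(1)]
  have perp: "cinner y (x - q x) = 0" if y: "y \<in> M" for x y
  proof -
    have "cinner y (x - q x) = cinner (cadj q y) (x - q x)" using q(1,3) y by (simp add: projectionD(4))
    also have "\<dots> = 0" by (simp add: cadj_left[OF qb] bc_diff[OF qb] projectionD(3)[OF q(1)])
    finally show ?thesis .
  qed
  have ops: "fock_ops J = corner q"
  proof (intro equalityI subsetI)
    fix z assume z: "z \<in> (fock_ops J :: ('k fock => _) set)"
    hence zb: "bc z" and z1: "range z \<subseteq> M" and z2: "\<And>x. (\<forall>y\<in>M. cinner y x = 0) ==> z x = 0"
      by (auto simp: fock_ops_def bounded_ops_def M_def)
    have "z (x - q x) = 0" for x using perp by (intro z2) blast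
    hence "z o q = z" by (auto simp: fun_eq_iff bc_diff[OF zb])
    moreover have "q o z = z" using z1 q(3) by (auto simp: fun_eq_iff)
    ultimately show "z \<in> corner q" using zb by (simp add: corner_def bounded_ops_def)
  next
    fix z assume z: "z \<in> corner q"
    hence zb: "bc z" and z1: "\<And>x. q (z x) = z x" "\<And>x. z (q x) = z x" by (auto simp: corner_def bounded_ops_def fun_eq_iff)
    have "z x \<in> M" for x
    proof -
      have "q (z x) \<in> M" using q(2) by blast
      thus ?thesis by (simp add: z1(1))
    qed
    hence "range z \<subseteq> M" by blast
    moreover have "z x = 0" if "\<forall>y\<in>M. cinner y x = 0" for x
    proof -
      have "q x = 0" using q(4) that by blast
      thus ?thesis using z1(2)[of x] bc_zero[OF zb] by simp
    qed
    ultimately show "z \<in> fock_ops J" using zb by (simp add: fock_ops_def bounded_ops_def M_def)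
  qed
  have "p = q" unfolding p_def fock_id_def
  proof (rule the_equality)
    have "q \<in> corner q" using q(1) by (simp add: corner_def bounded_ops_def projection_def)
    thus "q \<in> fock_ops J \<and> (\<forall>x\<in>fock_on J. q x = x)" using q(3) by (simp add: ops M_def)
  next
    fix p' :: "'k fock => 'k fock" assume h: "p' \<in> fock_ops J \<and> (\<forall>x\<in>fock_on J. p' x = x)"
    have "p' x = q x" for x
    proof -
      have "p' (q x) = q x" using h q(2) by (auto simp: M_def)
      moreover have "p' (q x) = p' x" using h by (auto simp: ops corner_def fun_eq_iff)
      ultimately show ?thesis by simp
    qed
    thus "p' = q" by (rule ext)
  qed
  thus "projection p" "range p \<subseteq> M" "\<And>x. x \<in> M ==> p x = x" "\<And>x. (\<And>y. y \<in> M ==> cinner y x = 0) ==> p x = 0"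
    "fock_ops J = corner p" using q ops by auto
qed

lemma bc_fock_id [simp]: "bc (fock_id J)" by (rule projectionD(1)[OF fock_id_props(1)])

lemma fock_id_expv: "subinterval J ==> f \<in> step_on J ==> fock_id J (expv f) = expv f"
  by (rule fock_id_props(3), unfold fock_on_expv) (auto intro!: closure_subset[THEN subsetD] cspan_base)

text \<open>The form of uniqueness needed for partial isometries, which are specified on generators
  of a proper subspace and on its orthogonal complement.\<close>

lemma bc_eq_on_gens:
  assumes T: "bc T" and S: "bc S" and G: "\<And>g. g \<in> G ==> T g = S g"
    and O: "\<And>x. (\<And>g. g \<in> G ==> cinner g x = 0) ==> T x = S x" shows "T = S"
proof
  fix x
  obtain p where p: "p \<in> closure (cspan G)" "\<And>y. y \<in> closure (cspan G) ==> cinner y (x - p) = 0"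
    using projection_exists[OF csubspace_closure[OF csubspace_cspan] closed_closure, of G x] by blast
  have "closure (cspan G) \<subseteq> {x. T x = S x}"
  proof (rule closure_minimal, rule cspan_minimal)
    show "G \<subseteq> {x. T x = S x}" using G by blast
    show "csubspace {x. T x = S x}" by (simp add: csubspace_def bc_zero bc_add bc_scale T S)
    show "closed {x. T x = S x}" by (rule closed_Collect_eq) (rule bc_continuous_on[OF T], rule bc_continuous_on[OF S])
  qed
  hence "T p = S p" using p(1) by blast
  moreover have "T (x - p) = S (x - p)" by (rule O) (use p(2) cspan_base closure_subset in blast)
  ultimately show "T x = S x" by (simp add: bc_diff T S)
qed

subsection \<open>Splitting and shifting\<close>

lemma restr_step_on: "f \<in> step_fun ==> before r f \<in> step_on {0..<r}" "f \<in> step_fun ==> after r f \<in> step_on {r..}"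
  using step_restr_upto[of f r] step_restr_from[of f r] by (auto simp: step_on_def restr_to_def)

lemma restr_of_step_on: "f \<in> step_on J ==> restr_to J f = f" by (auto simp: step_on_def restr_to_def)

lemma restr_split: "0 <= r ==> f \<in> step_fun ==> (%s. before r f s + after r f s) = f" by (auto simp: restr_to_def fun_eq_iff step_neg)

lemma step_on_sum: "f \<in> step_on J ==> g \<in> step_on K ==> (%s. f s + g s) \<in> step_fun" by (auto simp: step_on_def intro: step_add)

lemma vec_step_sum: "f \<in> step_on J ==> g \<in> step_on K ==> vec (%s. f s + g s) = vec f + vec g"
  using vec_lincomb[OF step_on_L2fun step_on_L2fun, of f J g K 1] by simp

lemma vec_step_orth: assumes "f \<in> step_on {0..<r}" "g \<in> step_on {r..}" shows "cinner (vec f) (vec g) = 0"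
proof -
  have "cinner (f s) (g s) = 0" for s using assms by (cases "s < r") (auto simp: step_on_def)
  thus ?thesis using assms by (simp add: cinner_vec step_on_L2fun)
qed

text \<open>Functions supported before and after \<open>r\<close> are orthogonal, so squared norms
  and inner products of the sums add up in the exponent. This factorization makes
  \<open>fock_split\<close> isometric on exponential vectors.\<close>

lemma cinner_expv_split:
  assumes f: "f \<in> step_on {0..<r}" "f' \<in> step_on {0..<r}" and g: "g \<in> step_on {r..}" "g' \<in> step_on {r..}"
  shows "cinner (expv (%s. f s + g s)) (expv (%s. f' s + g' s)) = cinner (expv f) (expv f') * cinner (expv g) (expv g')"
proof -
  have n: "(norm (vec f + vec g))\<^sup>2 = (norm (vec f))\<^sup>2 + (norm (vec g))\<^sup>2" if "f \<in> step_on {0..<r}" "g \<in> step_on {r..}" for f g :: "real => 'a"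
    by (rule pythagoras[OF vec_step_orth[OF that]])
  have e: "exp (- (a + b) / 2) = exp (- a / 2) * exp (- b / 2)" for a b :: real unfolding exp_add[symmetric] by (simp add: field_simps)
  have "cinner (vec g) (vec f') = 0" using vec_step_orth[OF f(2) g(1)] by (simp add: cinner_0_commute)
  hence "cinner (vec f + vec g) (vec f' + vec g') = cinner (vec f) (vec f') + cinner (vec g) (vec g')"
    by (simp add: cinner_add_right ch.ip_add_left vec_step_orth[OF f(1) g(2)])
  thus ?thesis unfolding cinner_expv[OF step_L2fun step_L2fun, OF step_on_sum[OF f(1) g(1)] step_on_sum[OF f(2) g(2)]]
      cinner_expv[OF step_on_L2fun step_on_L2fun, OF f] cinner_expv[OF step_on_L2fun step_on_L2fun, OF g]
      vec_step_sum[OF f(1) g(1)] vec_step_sum[OF f(2) g(2)] n[OF f(1) g(1)] n[OF f(2) g(2)] e of_real_mult by (simp add: exp_add)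
qed

definition split_gens :: "real => (('h::chilbert_space, 'k::chilbert_space) sp, 'k fock) htens set"
  where "split_gens r = {ev (ev u f) g | u f g. f \<in> step_on {0..<r} \<and> g \<in> step_on {r..}}"

lemma fock_split_props:
  assumes r: "0 <= r"
  defines "V \<equiv> (fock_split r :: (('h::chilbert_space, 'k::chilbert_space) sp, 'k fock) htens => ('h, 'k) sp)" shows bc_fock_split: "bc V"
    and fock_split_expv: "\<And>u f g. f \<in> step_on {0..<r} ==> g \<in> step_on {r..} ==>
      V (ev (ev u f) g) = ev u (%s. f s + g s)" and fock_split_orth: "\<And>x. (\<And>y. y \<in> split_gens r ==> cinner y x = 0) ==> V x = 0"
    and norm_fock_split: "\<And>x. norm (V x) <= norm x"
proof -
  define I where "I = (UNIV :: 'h set) \<times> (step_on {0..<r} :: (real => 'k) set) \<times> (step_on {r..} :: (real => 'k) set)"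
  define G where "G = (%(u::'h, f::real => 'k, g::real => 'k). ev (ev u f) g)"
  define D where "D = (%(u::'h, f::real => 'k, g). ev u (%s. f s + g s))"
  have ip: "cinner (D i) (D j) = cinner (G i) (G j)" if "i \<in> I" "j \<in> I" for i j
    using that by (auto simp: I_def D_def G_def cinner_tens cinner_expv_split)
  have "\<exists>T. bc T \<and> (\<forall>i\<in>I. T (G i) = D i) \<and> (\<forall>x. norm (T x) <= 1 * norm x) \<and> (\<forall>x. (\<forall>i\<in>I. cinner (G i) x = 0) --> T x = 0)"
    by (rule isometry_from_generators) (rule ip)
  then obtain T where T: "bc T" "\<forall>i\<in>I. T (G i) = D i" "\<forall>x. norm (T x) <= 1 * norm x" "\<forall>x. (\<forall>i\<in>I. cinner (G i) x = 0) --> T x = 0"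
    by (elim exE conjE)
  have gens: "split_gens r = G ` I" unfolding split_gens_def G_def I_def by force
  have restr: "ev (ev u (before r f)) (after r g) \<in> split_gens r" if "f \<in> step_fun" "g \<in> step_fun" for u :: 'h and f g :: "real => 'k"
    using restr_step_on[of _ r] that unfolding split_gens_def by blast
  \<comment> \<open>Restrictions of step functions are exactly the step functions supported in the
    interval, so the condition in the definition is one on \<open>split_gens r\<close>.\<close>
  have conv: "(\<forall>u. \<forall>f\<in>step_fun. \<forall>g\<in>step_fun. cinner (ev (ev u (before r f)) (after r g)) x = 0)
      \<longleftrightarrow> (\<forall>y\<in>split_gens r. cinner y x = 0)" for x :: "(('h, 'k) sp, 'k fock) htens"
    using restr unfolding split_gens_def by (auto simp: restr_of_step_on dest: step_on_step) (metis restr_of_step_on step_on_step)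
  have "V = T" unfolding V_def fock_split_def Let_def conv
  proof (rule the_equality)
    have "T (ev (ev u (before r f)) (after r g)) = ev u (%s. before r f s + after r g s)"
      if "f \<in> step_fun" "g \<in> step_fun" for u :: 'h and f g :: "real => 'k"
      using T(2)[rule_format, of "(u, before r f, after r g)"] restr_step_on(1)[OF that(1), of r] restr_step_on(2)[OF that(2), of r]
      by (simp add: I_def G_def D_def)
    thus "bc T \<and> (\<forall>u. \<forall>f\<in>step_fun. \<forall>g\<in>step_fun. T (ev (ev u (before r f)) (after r g)) =
        ev u (%s. before r f s + after r g s)) \<and> (\<forall>x. (\<forall>y\<in>split_gens r. cinner y x = 0) --> T x = 0)" using T by (simp add: gens)
  next
    fix S :: "(('h, 'k) sp, 'k fock) htens => ('h, 'k) sp"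
    assume S: "bc S \<and> (\<forall>u. \<forall>f\<in>step_fun. \<forall>g\<in>step_fun. S (ev (ev u (before r f)) (after r g)) =
        ev u (%s. before r f s + after r g s)) \<and> (\<forall>x. (\<forall>y\<in>split_gens r. cinner y x = 0) --> S x = 0)"
    show "S = T"
    proof (rule bc_eq_on_gens[where G = "split_gens r"])
      fix y :: "(('h, 'k) sp, 'k fock) htens" assume "y \<in> split_gens r"
      then obtain u :: 'h and f g :: "real => 'k" where y: "y = ev (ev u f) g" "f \<in> step_on {0..<r}" "g \<in> step_on {r..}"
        unfolding split_gens_def by blast
      have "S y = ev u (%s. f s + g s)"
        using S[THEN conjunct2, THEN conjunct1, rule_format, OF step_on_step[OF y(2)] step_on_step[OF y(3)], of u] y by (simp add: restr_of_step_on)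
      moreover have "T y = ev u (%s. f s + g s)" using T(2)[rule_format, of "(u, f, g)"] y by (simp add: I_def G_def D_def)
      ultimately show "S y = T y" by simp
    qed (use S T gens in auto)
  qed
  note VT = this
  show "bc V" using T(1) VT by simp
  show "norm (V x) <= norm x" for x using T(3) VT by simp
  show "V x = 0" if "\<And>y. y \<in> split_gens r ==> cinner y x = 0" for x
  proof -
    have "\<forall>i\<in>I. cinner (G i) x = 0" by (rule ballI, rule that) (simp add: gens)
    thus ?thesis using T(4) VT by simp
  qed
  show "V (ev (ev u f) g) = ev u (%s. f s + g s)" if "f \<in> step_on {0..<r}" "g \<in> step_on {r..}" for u f g
    using T(2)[rule_format, of "(u, f, g)"] that VT by (simp add: I_def G_def D_def)
qed

lemma exp_gens_total: "closure (cspan {ev u f | u f. f \<in> step_fun}) = (UNIV :: ('h::chilbert_space, 'k::chilbert_space) sp set)"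
proof (rule dense_if_total)
  fix x :: "('h, 'k) sp" assume x: "\<And>s. s \<in> {ev u f | u f. f \<in> step_fun} ==> cinner s x = 0"
  show "x = 0"
  proof (rule cinner_tens_ext)
    fix u :: 'h and w :: "'k fock"
    have "cinner w (cadj (%w. u \<otimes> w) x) = 0"
      by (rule orth_closure_cspan[of "expv ` step_fun"]) (auto simp: cadj_right[OF bc_tens_left] expv_total intro!: x)
    thus "cinner (u \<otimes> w) x = cinner (u \<otimes> w) 0" by (simp add: cadj_right[OF bc_tens_left])
  qed
qed

lemma exp_dom_dense: "closure exp_dom = UNIV" unfolding exp_dom_def by (rule exp_gens_total)

text \<open>Orthogonality is spread from exponential vectors to arbitrary vectors of the two Fock
  spaces one tensor leg at a time, through adjoints of the maps that insert a vector into a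
  leg.\<close>

lemma split_gens_closure:
  fixes x :: "(('h::chilbert_space, 'k::chilbert_space) sp, 'k fock) htens"
  assumes r: "0 <= r" and x: "\<And>y. y \<in> split_gens r ==> cinner y x = 0" shows "((id \<odot> fock_id {0..<r}) \<odot> fock_id {r..}) x = 0"
proof -
  define S where "S = ((id :: 'h => 'h) \<odot> fock_id {0..<r} :: ('h, 'k) sp => _) \<odot> (fock_id {r..} :: 'k fock => _)"
  have pp: "projection (fock_id J :: 'k fock => _)" for J by (rule fock_id_props(1))
  have Sb: "bc S" unfolding S_def by (intro bc_op_tensor bc_id bc_fock_id)
  have Sc: "cadj S = S" unfolding S_def by (simp add: cadj_op_tensor bc_op_tensor projectionD(4)[OF pp])
  have z: "cinner ((u \<otimes> a) \<otimes> b) x = 0" if a: "a \<in> fock_on {0..<r}" and b: "b \<in> fock_on {r..}" for u a b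
  proof -
    have xg: "cinner (ev (ev u f) g) x = 0" if "f \<in> step_on {0..<r}" "g \<in> step_on {r..}" for f g
      by (rule x) (use that in \<open>unfold split_gens_def, blast\<close>)
    have b': "cinner ((ev u f) \<otimes> b) x = 0" if f: "f \<in> step_on {0..<r}" for f
    proof -
      have "cinner b (cadj (%b. (ev u f) \<otimes> b) x) = 0" by (rule orth_closure_cspan[of "expv ` step_on {r..}"])
          (use b f fock_on_expv[OF subinterval_from[OF r]] in \<open>auto simp: cadj_right[OF bc_tens_left] xg\<close>)
      thus ?thesis by (simp add: cadj_right[OF bc_tens_left])
    qed
    have bc: "bc (%a. (u \<otimes> a) \<otimes> b)" using bc_compose[OF bc_tens_right bc_tens_left, of b u] by (simp add: o_def)
    have "cinner a (cadj (%a. (u \<otimes> a) \<otimes> b) x) = 0"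
      by (rule orth_closure_cspan[of "expv ` step_on {0..<r}"]) (use a fock_on_expv[OF subinterval_upto] in \<open>auto simp: cadj_right[OF bc] intro: b'\<close>)
    thus ?thesis by (simp add: cadj_right[OF bc])
  qed
  have "S x = 0"
  proof (rule cinner_tens_ext)
    fix y :: "('h, 'k) sp" and w :: "'k fock"
    have bc: "bc (%y. S (y \<otimes> w))" using bc_compose[OF Sb bc_tens_right, of w] by (simp add: o_def)
    have "cadj (%y. S (y \<otimes> w)) x = 0"
    proof (rule cinner_tens_ext)
      fix u :: 'h and v :: "'k fock"
      have "S ((u \<otimes> v) \<otimes> w) = (u \<otimes> fock_id {0..<r} v) \<otimes> fock_id {r..} w" unfolding S_def by (simp add: op_tensor_apply bc_op_tensor)
      moreover have "fock_id {0..<r} v \<in> fock_on {0..<r}" "fock_id {r..} w \<in> fock_on {r..}" using fock_id_props(2) by blast+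
      ultimately show "cinner (u \<otimes> v) (cadj (%y. S (y \<otimes> w)) x) = cinner (u \<otimes> v) 0" unfolding cadj_right[OF bc] by (simp add: z)
    qed
    hence "cinner (S (y \<otimes> w)) x = 0" using cadj_right[OF bc, of y x] by simp
    thus "cinner (y \<otimes> w) (S x) = cinner (y \<otimes> w) 0" using cadj_left[OF Sb, of "y \<otimes> w" x] unfolding Sc by simp
  qed
  thus ?thesis unfolding S_def .
qed

lemma fock_split_isometry:
  assumes r: "0 <= r"
  defines "V \<equiv> (fock_split r :: (('h::chilbert_space, 'k::chilbert_space) sp, 'k fock) htens => ('h, 'k) sp)"
  shows "cadj V o V = (id \<odot> fock_id {0..<r}) \<odot> fock_id {r..}" and "V o cadj V = id"
proof -
  have Vb: "bc V" unfolding V_def by (rule bc_fock_split[OF r])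
  have Ve: "V (ev (ev u f) g) = ev u (%s. f s + g s)" if "f \<in> step_on {0..<r}" "g \<in> step_on {r..}" for u f g
    unfolding V_def by (rule fock_split_expv[OF r that])
  have gens: "cadj V (V y) = y" if y: "y \<in> split_gens r" for y
  proof -
    have g: "cinner y' (cadj V (V y) - y) = 0" if y': "y' \<in> split_gens r" for y'
    proof -
      from y y' obtain u f g u' f' g' where e: "y = ev (ev u f) g" "f \<in> step_on {0..<r}" "g \<in> step_on {r..}"
        "y' = ev (ev u' f') g'" "f' \<in> step_on {0..<r}" "g' \<in> step_on {r..}" unfolding split_gens_def by blast
      show ?thesis by (simp add: ch.ip_diff cadj_right[OF Vb] e Ve cinner_tens cinner_expv_split[OF e(5) e(2) e(6) e(3)])
    qed
    \<comment> \<open>\<open>d\<close> is orthogonal to all generators, so \<open>V\<close>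
      annihilates it; this makes it orthogonal to both terms of its own definition.\<close>
    define d where "d = cadj V (V y) - y"
    have "V d = 0" unfolding d_def V_def by (rule fock_split_orth[OF r]) (rule g[unfolded V_def])
    hence "cinner d (cadj V (V y)) = 0" by (simp add: cadj_right[OF Vb])
    moreover have "cinner d y = 0" using g[OF y] unfolding d_def[symmetric] by (simp add: cinner_0_commute)
    ultimately have "cinner d d = 0" by (subst (2) d_def) (simp add: ch.ip_diff)
    hence "d = 0" by (simp add: cinner_eq_0_iff)
    thus ?thesis by (simp add: d_def)
  qed
  show "cadj V o V = (id \<odot> fock_id {0..<r}) \<odot> fock_id {r..}"
  proof (rule bc_eq_on_gens[where G = "split_gens r"])
    show "bc (cadj V o V)" by (intro bc_compose bc_cadj Vb)
    show "bc ((id \<odot> fock_id {0..<r}) \<odot> fock_id {r..} :: (('h, 'k) sp, 'k fock) htens => _)" by (intro bc_op_tensor bc_id bc_fock_id)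
  next
    fix y :: "(('h, 'k) sp, 'k fock) htens" assume y: "y \<in> split_gens r"
    then obtain u f g where e: "y = ev (ev u f) g" "f \<in> step_on {0..<r}" "g \<in> step_on {r..}" unfolding split_gens_def by blast
    show "(cadj V o V) y = ((id \<odot> fock_id {0..<r}) \<odot> fock_id {r..}) y"
      using gens[OF y] by (simp add: e op_tensor_apply bc_op_tensor fock_id_expv subinterval_upto subinterval_from[OF r])
  next
    fix x :: "(('h, 'k) sp, 'k fock) htens" assume x: "\<And>y. y \<in> split_gens r ==> cinner y x = 0"
    have "V x = 0" unfolding V_def by (rule fock_split_orth[OF r]) (rule x)
    thus "(cadj V o V) x = ((id \<odot> fock_id {0..<r}) \<odot> fock_id {r..}) x"
      using split_gens_closure[OF r x] by (simp add: bc_zero[OF bc_cadj[OF Vb]])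
  qed
  show "V o cadj V = id"
  proof (rule bc_eq_on_total[OF _ bc_id exp_gens_total])
    show "bc (V o cadj V)" by (intro bc_compose bc_cadj Vb)
    fix y :: "('h, 'k) sp" assume "y \<in> {ev u f | u f. f \<in> step_fun}"
    then obtain u f where y: "y = ev u f" "f \<in> step_fun" by blast
    define z where "z = ev (ev u (before r f)) (after r f)"
    have "V z = y" using Ve[OF restr_step_on(1)[OF y(2)] restr_step_on(2)[OF y(2)], of u] by (simp add: z_def y restr_split[OF r y(2)])
    moreover have "z \<in> split_gens r" unfolding split_gens_def z_def using restr_step_on[OF y(2), of r] by blast
    ultimately show "(V o cadj V) y = id y" using gens[of z] by auto
  qed
qed

text \<open>Translation invariance is applied to the Borel measure \<open>lborel\<close>. The inner
  product of two step functions is right continuous, hence Borel, so its integrals against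
  \<open>lborel\<close> and \<open>lebesgue\<close> agree.\<close>

lemma vec_shift:
  assumes f: "f \<in> step_fun" and g: "g \<in> step_fun" and r: "0 <= r"
  shows "cinner (vec (%s. f (s - r))) (vec (%s. g (s - r))) = cinner (vec f) (vec g)"
proof -
  define q where "q s = cinner (f s) (g s)" for s
  have q: "q \<in> borel_measurable borel"
  proof (rule borel_measurable_right_continuous)
    show "(q \<longlongrightarrow> q x) (at_right x)" if "0 <= x" for x
      unfolding q_def by (rule tendsto_cinner'[OF step_right_continuous[OF f that] step_right_continuous[OF g that]])
  qed (simp add: q_def step_neg[OF f])
  hence q': "(%s. q (s - r)) \<in> borel_measurable borel" by measurable
  have "cinner (vec (%s. f (s - r))) (vec (%s. g (s - r))) = (LINT s|lebesgue. q (s - r))"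
    by (simp add: cinner_vec step_L2fun step_shift_right f g r q_def)
  also have "\<dots> = (LINT s|lborel. q (s - r))" by (rule integral_completion) (use q' in simp)
  also have "\<dots> = (LINT s|lborel. q s)" using lborel_integral_real_affine[of 1 q "- r"] by simp
  also have "\<dots> = (LINT s|lebesgue. q s)" by (rule integral_completion[symmetric]) (use q in simp)
  also have "\<dots> = cinner (vec f) (vec g)" by (simp add: cinner_vec step_L2fun f g q_def)
  finally show ?thesis .
qed

lemma shift_step_on: "f \<in> step_fun ==> 0 <= r ==> (%s. f (s - r)) \<in> step_on {r..}" by (auto simp: step_on_def step_shift_right step_neg)

definition unshift :: "real => (real => 'k::zero) => real => 'k" where "unshift r f s = (if 0 <= s then f (s + r) else 0)"

lemma unshift_step: "f \<in> step_fun ==> 0 <= r ==> unshift r f \<in> step_fun" unfolding unshift_def[abs_def] by (rule step_shift_left)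

lemma unshift_inverse: "f \<in> step_on {r..} ==> 0 <= r ==> (%s. unshift r f (s - r)) = f" by (auto simp: unshift_def step_on_def fun_eq_iff)

lemma fock_shift_props:
  assumes r: "0 <= r"
  defines "T \<equiv> (fock_shift r :: 'k::chilbert_space fock => 'k fock)" shows bc_fock_shift: "bc T"
    and fock_shift_expv: "\<And>f. f \<in> step_fun ==> T (expv f) = expv (%s. f (s - r))" and fock_shift_isometry: "cadj T o T = id"
    and norm_fock_shift: "\<And>x. norm (T x) <= norm x" and fock_id_shift: "fock_id {r..} o T = T"
proof -
  let ?d = "%f s. f (s - r) :: 'k"
  have ip: "cinner (expv (?d f)) (expv (?d g)) = cinner (expv f) (expv g)" if "f \<in> step_fun" "g \<in> step_fun" for f g :: "real => 'k"
    using that r by (simp add: cinner_expv step_L2fun step_shift_right vec_shift norm_sq_cinner)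
  have "\<exists>S. bc S \<and> (\<forall>f\<in>step_fun. S (expv f) = expv (?d f)) \<and> (\<forall>x. norm (S x) <= 1 * norm x) \<and>
      (\<forall>x. (\<forall>f\<in>step_fun. cinner (expv f) x = 0) --> S x = 0)" by (rule isometry_from_generators) (rule ip)
  then obtain S :: "'k fock => 'k fock" where S: "bc S" "\<forall>f\<in>step_fun. S (expv f) = expv (?d f)" "\<forall>x. norm (S x) <= 1 * norm x"
    by (elim exE conjE)
  have TS: "T = S" unfolding T_def fock_shift_def
  proof (rule the_equality)
    fix S' :: "'k fock => 'k fock" assume h: "bc S' \<and> (\<forall>f\<in>step_fun. S' (expv f) = expv (?d f))"
    show "S' = S" by (rule bc_eq_on_total[OF _ S(1) expv_total]) (use h S(2) in auto)
  qed (use S in simp)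
  show b: "bc T" using S(1) TS by simp
  show e: "T (expv f) = expv (?d f)" if "f \<in> step_fun" for f using S(2) TS that by simp
  show "norm (T x) <= norm x" for x using S(3) TS by simp
  show "cadj T o T = id"
  proof (rule bc_eq_on_total[OF _ bc_id expv_total])
    fix x assume "x \<in> expv ` (step_fun :: (real => 'k) set)"
    then obtain f where f: "x = expv f" "f \<in> step_fun" by blast
    show "(cadj T o T) x = id x"
    proof (rule total_if_dense[OF expv_total])
      fix y assume "y \<in> expv ` (step_fun :: (real => 'k) set)"
      then obtain g where g: "y = expv g" "g \<in> step_fun" by blast
      show "cinner y ((cadj T o T) x) = cinner y (id x)" by (simp add: cadj_right[OF b] f g e ip)
    qed
  qed (intro bc_compose bc_cadj b)
  show "fock_id {r..} o T = T"
  proof (rule bc_eq_on_total[OF _ b expv_total])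
    fix x assume "x \<in> expv ` (step_fun :: (real => 'k) set)"
    then obtain f where f: "x = expv f" "f \<in> step_fun" by blast
    show "(fock_id {r..} o T) x = T x" by (simp add: f e fock_id_expv subinterval_from[OF r] shift_step_on[OF f(2) r])
  qed (intro bc_compose bc_fock_id b)
qed

lemma cadj_shift_expv:
  assumes r: "0 <= r" and f: "f \<in> step_on {r..}" shows "cadj (fock_shift r) (expv f) = expv (unshift r f)"
proof -
  have "expv f = fock_shift r (expv (unshift r f))"
    by (simp add: fock_shift_expv[OF r] unshift_step[OF step_on_step[OF f] r] unshift_inverse[OF f r])
  thus ?thesis using fun_cong[OF fock_shift_isometry[OF r], of "expv (unshift r f)"] by simp
qed

section \<open>Densely defined operators and adaptedness\<close>

subsection \<open>Densely defined operators\<close>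

abbreviation op_on :: "('a::chilbert_space => 'b::chilbert_space) => 'a set => 'a \<rightharpoonup> 'b" where "op_on T V \<equiv> (%zeta. Some (T zeta)) |` V"

lemma dom_op_on [simp]: "dom (op_on T V) = V" by (auto simp: restrict_map_def split: if_splits)

lemma op_on_apply [simp]: "zeta \<in> V ==> op_on T V zeta = Some (T zeta)" by simp

lemma lin_op_on: "csubspace V ==> bc T ==> lin_op (op_on T V)"
  unfolding lin_op_def by (simp add: csubspace_add csubspace_scale bc_add bc_scale)

lemma lin_opD:
  assumes "lin_op X" shows "csubspace (dom X)" "x \<in> dom X ==> y \<in> dom X ==> the (X (x + y)) = the (X x) + the (X y)"
    "the (X 0) = 0" "x \<in> dom X ==> the (X (c *C x)) = c *C the (X x)"
proof -
  have l: "the (X (x + c *C y)) = the (X x) + c *C the (X y)" if "x \<in> dom X" "y \<in> dom X" for x y c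
    using assms that unfolding lin_op_def by blast
  show V: "csubspace (dom X)" using assms unfolding lin_op_def by blast
  show a: "the (X (x + y)) = the (X x) + the (X y)" if "x \<in> dom X" "y \<in> dom X" for x y using l[OF that, of 1] by simp
  show z: "the (X 0) = 0" using a[OF csubspace_0[OF V] csubspace_0[OF V]] by simp
  show "the (X (c *C x)) = c *C the (X x)" if "x \<in> dom X" using l[OF csubspace_0[OF V] that, of c] z by simp
qed

lemma lin_op_sum:
  assumes "lin_op X" "finite F" "\<And>i. i \<in> F ==> x i \<in> dom X" shows "the (X (\<Sum>i\<in>F. c i *C x i)) = (\<Sum>i\<in>F. c i *C the (X (x i)))"
  using assms(2,3)
proof (induction F rule: finite_induct)
  case (insert i F)
  note V = lin_opD(1)[OF assms(1)]
  have "(\<Sum>i\<in>F. c i *C x i) \<in> dom X" using insert.prems by (intro csubspace_sum[OF V] csubspace_scale[OF V]) auto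
  moreover have "c i *C x i \<in> dom X" using insert.prems by (intro csubspace_scale[OF V]) auto
  ultimately show ?case using insert by (simp add: lin_opD(2)[OF assms(1)] lin_opD(4)[OF assms(1)])
qed (simp add: lin_opD(3)[OF assms(1)])

lemma lin_op_eqI:
  assumes X: "lin_op X" "dom X = cspan G" and Y: "lin_op Y" "dom Y = cspan G" and G: "\<And>g. g \<in> G ==> the (X g) = the (Y g)" shows "X = Y"
proof
  fix x
  have "cspan G \<subseteq> {x \<in> cspan G. the (X x) = the (Y x)}"
  proof (rule cspan_minimal)
    show "G \<subseteq> {x \<in> cspan G. the (X x) = the (Y x)}" using G cspan_base by blast
    show "csubspace {x \<in> cspan G. the (X x) = the (Y x)}" unfolding csubspace_def
      using lin_opD[OF X(1), unfolded X(2)] lin_opD[OF Y(1), unfolded Y(2)] by (simp add: csubspace_0 csubspace_add csubspace_scale)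
  qed
  hence "the (X x) = the (Y x)" if "x \<in> cspan G" using that by blast
  thus "X x = Y x" using X(2) Y(2) by (cases "x \<in> cspan G") (force simp: domIff)+
qed

lemma op_ext_op_on:
  assumes "closure V = UNIV" "bc T" shows "op_ext (op_on T V) = T" unfolding op_ext_def
proof (rule the_equality)
  fix S assume S: "bc S \<and> (\<forall>zeta\<in>dom (op_on T V). the (op_on T V zeta) = S zeta)"
  have "closure (cspan V) = UNIV" using closure_mono[OF cspan_superset[of V]] assms(1) by auto
  thus "S = T" by (rule bc_eq_on_total[rotated 2]) (use S assms in auto)
qed (use assms in simp)

text \<open>From here on bounded processes are handled as families of everywhere defined operators,
  restricted to \<open>exp_dom\<close> only where partial operators are asked for.\<close>

lemma bounded_op_op_on:
  assumes X: "lin_op X" "bounded_op X" and d: "closure (dom X) = UNIV" shows "bc (op_ext X)" "X = op_on (op_ext X) (dom X)"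
proof -
  obtain C0 where C0: "\<And>zeta. zeta \<in> dom X ==> norm (the (X zeta)) <= C0 * norm zeta" using X(2) unfolding bounded_op_def by blast
  define C where "C = \<bar>C0\<bar>"
  have C: "norm (the (X zeta)) <= C * norm zeta" if "zeta \<in> dom X" for zeta
    using C0[OF that] mult_right_mono[OF abs_ge_self[of C0] norm_ge_zero[of zeta]] unfolding C_def by linarith
  define R where "R = {(zeta, the (X zeta)) | zeta. zeta \<in> dom X}"
  note V = lin_opD(1)[OF X(1)]
  have "csubspace R" unfolding csubspace_def
  proof (intro conjI ballI allI)
    show "0 \<in> R" using csubspace_0[OF V] lin_opD(3)[OF X(1)] by (auto simp: R_def zero_prod_def)
    fix a b assume "a \<in> R" "b \<in> R"
    then obtain x y where ab: "a = (x, the (X x))" "b = (y, the (X y))" "x \<in> dom X" "y \<in> dom X" unfolding R_def by blast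
    have "a + b = (x + y, the (X (x + y)))" by (simp add: ab lin_opD(2)[OF X(1) ab(3,4)])
    thus "a + b \<in> R" using csubspace_add[OF V ab(3,4)] unfolding R_def by blast
  next
    fix c a assume "a \<in> R"
    then obtain x where a: "a = (x, the (X x))" "x \<in> dom X" unfolding R_def by blast
    have "c *C a = (c *C x, the (X (c *C x)))" by (simp add: a(1) lin_opD(4)[OF X(1) a(2)] prod_eq_iff)
    thus "c *C a \<in> R" using csubspace_scale[OF V a(2)] unfolding R_def by blast
  qed
  moreover have "\<forall>v w. (v, w) \<in> R --> norm w <= C * norm v" using C by (auto simp: R_def)
  ultimately obtain T where T: "bc T" "\<forall>v w. (v, w) \<in> R --> T v = w" using extension_of_relation[of R C] by (auto simp: C_def)
  have "X = op_on T (dom X)"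
  proof
    fix zeta show "X zeta = op_on T (dom X) zeta" using T(2) by (cases "zeta \<in> dom X") (auto simp: R_def restrict_map_def domIff)
  qed
  moreover from this have "op_ext X = T" using op_ext_op_on[OF d T(1)] by simp
  ultimately show "bc (op_ext X)" "X = op_on (op_ext X) (dom X)" using T(1) by auto
qed

lemma ampliation_op_on:
  fixes V :: "'a::chilbert_space set" assumes "bc T"
  shows "(ampliation (op_on T V) :: ('c::chilbert_space, 'a) htens \<rightharpoonup> _) = op_on (id \<odot> T) (cspan {c \<otimes> zeta | c zeta. zeta \<in> V})"
  unfolding ampliation_def dom_op_on
proof (rule the_equality)
  let ?G = "{c \<otimes> zeta | (c::'c) zeta. zeta \<in> V}"
  have l: "lin_op (op_on (id \<odot> T) (cspan ?G))" by (rule lin_op_on[OF csubspace_cspan]) (intro bc_op_tensor bc_id assms)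
  have g: "c \<otimes> zeta \<in> cspan ?G" if "zeta \<in> V" for c zeta by (rule cspan_base) (use that in blast)
  show "lin_op (op_on (id \<odot> T) (cspan ?G)) \<and> dom (op_on (id \<odot> T) (cspan ?G)) = cspan ?G \<and>
    (\<forall>c. \<forall>zeta\<in>V. the (op_on (id \<odot> T) (cspan ?G) (c \<otimes> zeta)) = c \<otimes> the (op_on T V zeta))" using l g by (simp add: op_tensor_apply assms)
  fix Z assume Z: "lin_op Z \<and> dom Z = cspan ?G \<and> (\<forall>c. \<forall>zeta\<in>V. the (Z (c \<otimes> zeta)) = c \<otimes> the (op_on T V zeta))"
  show "Z = op_on (id \<odot> T) (cspan ?G)"
  proof (rule lin_op_eqI[of _ ?G])
    fix y assume "y \<in> ?G"
    then obtain c zeta where y: "y = c \<otimes> zeta" "zeta \<in> V" by blast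
    show "the (Z y) = the (op_on (id \<odot> T) (cspan ?G) y)" using Z g[OF y(2)] y by (simp add: op_tensor_apply assms)
  qed (use Z l in auto)
qed

text \<open>Builds an operator that need not be bounded from a linear space of prescribed pairs;
  consistency is reduced to the value at 0 by taking differences.\<close>

lemma relation_operator:
  fixes R :: "('a::chilbert_space \<times> 'b::chilbert_space) set" assumes R: "csubspace R" and sv: "\<And>w. (0, w) \<in> R ==> w = 0"
  shows "\<exists>D. lin_op D \<and> dom D = fst ` R \<and> (\<forall>v w. (v, w) \<in> R --> D v = Some w)"
proof -
  have uniq: "w = w'" if "(v, w) \<in> R" "(v, w') \<in> R" for v w w' using sv[of "w - w'"] csubspace_diff[OF R that] by simp
  define D where "D v = (if v \<in> fst ` R then Some (SOME w. (v, w) \<in> R) else None)" for v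
  have D: "D v = Some w" if "(v, w) \<in> R" for v w
  proof -
    have "(v, SOME w. (v, w) \<in> R) \<in> R" using that by (rule someI)
    from uniq[OF that this] have "(SOME w. (v, w) \<in> R) = w" by simp
    moreover have "v \<in> fst ` R" using that by force
    ultimately show ?thesis by (simp add: D_def)
  qed
  have dom: "dom D = fst ` R" by (auto simp: D_def dom_def split: if_splits)
  have "lin_op D" unfolding lin_op_def dom
  proof (intro conjI ballI allI)
    show "csubspace (fst ` R)" unfolding csubspace_def
    proof (intro conjI ballI allI)
      show "0 \<in> fst ` R" using imageI[OF csubspace_0[OF R], of fst] by simp
    next
      fix x y assume "x \<in> fst ` R" "y \<in> fst ` R"
      then obtain a b where "a \<in> R" "b \<in> R" "x = fst a" "y = fst b" by blast
      thus "x + y \<in> fst ` R" using imageI[OF csubspace_add[OF R, of a b], of fst] by simp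
    next
      fix c x assume "x \<in> fst ` R"
      then obtain a where "a \<in> R" "x = fst a" by blast
      thus "c *C x \<in> fst ` R" using imageI[OF csubspace_scale[OF R, of a c], of fst] by simp
    qed
  next
    fix x y c assume "x \<in> fst ` R" "y \<in> fst ` R"
    then obtain w w' where w: "(x, w) \<in> R" "(y, w') \<in> R" by force
    have "(x, w) + c *C (y, w') \<in> R" by (intro csubspace_add csubspace_scale R w)
    moreover have "(x, w) + c *C (y, w') = (x + c *C y, w + c *C w')" by (simp add: prod_eq_iff)
    ultimately show "the (D (x + c *C y)) = the (D x) + c *C the (D y)" using D w by simp
  qed
  thus ?thesis using dom D by (intro exI[of _ D]) simp
qed

abbreviation exp_gens :: "('h::chilbert_space, 'k::chilbert_space) sp set" where "exp_gens \<equiv> {ev u f | u f. f \<in> step_fun}"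

lemma exp_domI: "f \<in> step_fun ==> ev u f \<in> exp_dom" unfolding exp_dom_def by (rule cspan_base) blast

lemma csubspace_exp_dom: "csubspace exp_dom" unfolding exp_dom_def by (rule csubspace_cspan)

lemma exp_domE:
  assumes "zeta \<in> (exp_dom :: ('h::chilbert_space, 'k::chilbert_space) sp set)"
  shows "\<exists>(F :: ('h \<times> (real => 'k)) set) c. finite F \<and> (\<forall>i\<in>F. snd i \<in> step_fun) \<and> zeta = (\<Sum>i\<in>F. c i *C (fst i \<otimes> expv (snd i)))"
proof -
  have e: "exp_gens = (%i. fst i \<otimes> expv (snd i)) ` ((UNIV :: 'h set) \<times> (step_fun :: (real => 'k) set))" by force
  obtain F c where F: "finite F" "F \<subseteq> (UNIV :: 'h set) \<times> (step_fun :: (real => 'k) set)" "zeta = (\<Sum>i\<in>F. c i *C (fst i \<otimes> expv (snd i)))"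
    using cspan_finite[OF assms[unfolded exp_dom_def e]] by (elim exE conjE)
  show ?thesis by (intro exI[of _ F] exI[of _ c]) (use F in auto)
qed

text \<open>The relation between \<open>ev u f\<close> and \<open>khat f s \<otimes> (ev u f)\<close> is single-valued because
  the scalar products of the latter are derivatives at \<open>0\<close> of scalar products of the former with
  \<open>expu (g + z h)\<close>, where \<open>h\<close> is supported in a small interval starting in \<open>s\<close>.\<close>

lemma nabla_single_valued:
  fixes f :: "'i => real => 'k::chilbert_space" and u :: "'i => 'h::chilbert_space"
  assumes s: "0 <= s" and F: "finite F" "\<And>i. i \<in> F ==> f i \<in> step_fun" and z: "(\<Sum>i\<in>F. c i *C (u i \<otimes> expv (f i))) = 0"
  shows "(\<Sum>i\<in>F. c i *C (khat (f i) s \<otimes> (u i \<otimes> expv (f i)))) = 0"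
proof (rule total_if_dense)
  define w where "w = (\<Sum>i\<in>F. c i *C (khat (f i) s \<otimes> (u i \<otimes> expv (f i))))"
  show "closure (cspan {d \<otimes> y | (d :: complex \<times> 'k) y. y \<in> (exp_gens :: ('h, 'k) sp set)}) = UNIV"
  proof (rule dense_if_total)
    fix x :: "('h, 'k) hsp" assume x: "\<And>t. t \<in> {d \<otimes> y | d y. y \<in> exp_gens} ==> cinner t x = 0"
    show "x = 0"
    proof (rule cinner_tens_ext)
      fix d :: "complex \<times> 'k" and y :: "('h, 'k) sp"
      have yy: "y \<in> closure (cspan exp_gens)" using exp_gens_total[where 'h = 'h and 'k = 'k] by blast
      have "cinner (d \<otimes> y) x = 0" if "y \<in> exp_gens" for y by (rule x, rule CollectI, intro exI conjI, rule refl, rule that)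
      hence z: "cinner y (cadj (%y. d \<otimes> y) x) = 0" if "y \<in> exp_gens" for y using that by (simp only: cadj_right[OF bc_tens_left])
      have "cinner y (cadj (%y. d \<otimes> y) x) = 0" using yy by (rule orth_closure_cspan[rotated]) (rule z)
      thus "cinner (d \<otimes> y) x = cinner (d \<otimes> y) 0" by (simp add: cadj_right[OF bc_tens_left])
    qed
  qed
  fix t :: "('h, 'k) hsp" assume "t \<in> {d \<otimes> y | d y. y \<in> exp_gens}"
  then obtain d v g where t: "t = d \<otimes> (ev v g)" and g: "g \<in> step_fun" unfolding mem_Collect_eq by (elim exE conjE) simp
  have "\<exists>e>0. \<forall>i\<in>F. \<forall>tau\<in>{s..<s + e}. f i tau = f i s" using F
  proof (induction F rule: finite_induct)
    case empty
    show ?case by (intro exI[of _ 1]) simp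
  next
    case (insert i F)
    have "\<exists>e>0. \<forall>i\<in>F. \<forall>tau\<in>{s..<s + e}. f i tau = f i s" by (rule insert.IH) (rule insert.prems, rule insertI2)
    then obtain e where e: "e > 0" "\<forall>i\<in>F. \<forall>tau\<in>{s..<s + e}. f i tau = f i s" by (elim exE conjE)
    obtain e' where e': "e' > 0" "\<forall>tau\<in>{s..<s + e'}. f i tau = f i s"
      using step_locally_constant[OF insert.prems[OF insertI1] s] by (elim exE conjE)
    have fl: "f l tau = f l s" if "l \<in> insert i F" "tau \<in> {s..<s + min e e'}" for l tau
    proof -
      have "s + min e e' <= s + e" "s + min e e' <= s + e'" by simp_all
      hence tau: "tau \<in> {s..<s + e}" "tau \<in> {s..<s + e'}" using that(2) unfolding atLeastLessThan_iff by linarith+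
      show ?thesis
      proof (cases "l = i")
        case True
        thus ?thesis using e'(2) tau(2) by blast
      next
        case False
        thus ?thesis using e(2) tau(1) that(1) by blast
      qed
    qed
    have "0 < min e e'" using e(1) e'(1) by simp
    thus ?case by (intro exI[of _ "min e e'"] conjI ballI fl)
  qed
  then obtain e where e: "e > 0" "\<forall>i\<in>F. \<forall>tau\<in>{s..<s + e}. f i tau = f i s" by (elim exE conjE)
  define h where "h = (%tau. if tau \<in> {s..<s + e} then snd d else 0)"
  have h: "h \<in> step_fun" unfolding h_def by (rule step_interval[OF s])
  have hf: "cinner (vec h) (vec (f i)) = complex_of_real e * cinner (snd d) (f i s)" if i: "i \<in> F" for i
  proof -
    have "(%tau. cinner (h tau) (f i tau)) = (%tau. indicator {s..<s + e} tau *\<^sub>R cinner (snd d) (f i s))"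
    proof
      fix tau
      show "cinner (h tau) (f i tau) = indicator {s..<s + e} tau *\<^sub>R cinner (snd d) (f i s)"
      proof (cases "tau \<in> {s..<s + e}")
        case True
        hence "f i tau = f i s" using e(2) i by blast
        thus ?thesis using True by (simp add: h_def)
      qed (auto simp: h_def)
    qed
    hence "cinner (vec h) (vec (f i)) = (LINT tau|lebesgue. indicator {s..<s + e} tau *\<^sub>R cinner (snd d) (f i s))"
      by (simp add: cinner_vec step_L2fun h F(2)[OF i])
    also have "\<dots> = measure lebesgue {s..<s + e} *\<^sub>R cinner (snd d) (f i s)"
      by (subst integral_scaleR_left) (use e(1) in \<open>auto intro!: integrable_real_indicator\<close>)
    finally show ?thesis using e(1) by (simp add: scaleR_conv_of_real)
  qed
  define a where "a i = c i * cinner v (u i) * cinner (expu g) (expv (f i))" for i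
  define b where "b i = complex_of_real e * cinner (snd d) (f i s)" for i
  have fe: "expv (f i) = complex_of_real (exp (- (norm (vec (f i)))\<^sup>2 / 2)) *C expu (f i)" if "i \<in> F" for i
    by (rule expv_expu[OF step_L2fun[OF F(2)[OF that]]])
  have zero: "(\<Sum>i\<in>F. a i * exp (complex_of_real tau * b i)) = 0" for tau :: real
  proof -
    define k where "k = (%x. g x + complex_of_real tau *C h x)"
    have vk: "vec k = vec g + complex_of_real tau *C vec h" unfolding k_def by (rule vec_lincomb[OF step_L2fun[OF g] step_L2fun[OF h]])
    have "0 = cinner (v \<otimes> expu k) (\<Sum>i\<in>F. c i *C (u i \<otimes> expv (f i)))" by (simp add: z)
    also have "\<dots> = (\<Sum>i\<in>F. a i * exp (complex_of_real tau * b i))" unfolding cinner_sum_right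
      by (rule sum.cong[OF refl]) (simp add: cinner_scaleC_right cinner_tens fe cinner_expu vk ch.ip_add_left ch.ip_sc_left hf a_def b_def exp_add mult_ac)
    finally show ?thesis by simp
  qed
  have "((%tau. \<Sum>i\<in>F. a i * exp (complex_of_real tau * b i)) has_vector_derivative (\<Sum>i\<in>F. a i * b i)) (at 0)"
  proof (intro has_vector_derivative_sum has_vector_derivative_mult_right)
    fix i
    show "((%tau. exp (complex_of_real tau * b i)) has_vector_derivative b i) (at 0)"
      using exp_scaleR_has_vector_derivative_right[of "b i" 0 UNIV] by (simp add: scaleR_conv_of_real)
  qed
  hence "((%tau::real. 0) has_vector_derivative (\<Sum>i\<in>F. a i * b i)) (at 0)" unfolding zero .
  hence ab: "(\<Sum>i\<in>F. a i * b i) = 0" using vector_derivative_unique_at[OF _ has_vector_derivative_const[of 0 "at 0"]] by blast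
  define N where "N = complex_of_real (exp (- (norm (vec g))\<^sup>2 / 2))"
  have ge: "expv g = N *C expu g" unfolding N_def by (rule expv_expu[OF step_L2fun[OF g]])
  have cd: "cinner d (khat (f i) s) = cnj (fst d) + cinner (snd d) (f i s)" for i by (simp add: khat_def cinner_prod_def cinner_complex_def)
  have "cinner t w = cnj (fst d) * cinner (ev v g) (\<Sum>i\<in>F. c i *C (u i \<otimes> expv (f i))) +
      (\<Sum>i\<in>F. cinner (snd d) (f i s) * (c i * cinner (ev v g) (u i \<otimes> expv (f i))))"
    unfolding w_def cinner_sum_right t sum_distrib_left sum.distrib[symmetric]
    by (rule sum.cong[OF refl]) (simp add: cinner_scaleC_right cinner_tens cd algebra_simps)
  also have "\<dots> = (\<Sum>i\<in>F. cinner (snd d) (f i s) * (c i * cinner (ev v g) (u i \<otimes> expv (f i))))" by (simp add: z)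
  also have "\<dots> = (\<Sum>i\<in>F. (cnj N / complex_of_real e) * (a i * b i))"
    by (rule sum.cong[OF refl]) (use e(1) in \<open>simp add: cinner_tens ge ch.ip_sc_left a_def b_def mult_ac\<close>)
  also have "\<dots> = 0" by (simp only: sum_distrib_left[symmetric] ab mult_zero_right)
  finally show "cinner t w = cinner t 0" by simp
qed

lemma nabla_props:
  assumes s: "0 <= s"
  defines "D \<equiv> (nabla s :: ('h::chilbert_space, 'k::chilbert_space) sp \<rightharpoonup> ('h, 'k) hsp)"
  shows lin_op_nabla: "lin_op D" and dom_nabla: "dom D = exp_dom"
    and nabla_expv: "\<And>u f. f \<in> step_fun ==> the (D (ev u f)) = khat f s \<otimes> (ev u f)"
proof -
  define P where "P = (%i :: 'h \<times> (real => 'k). (fst i \<otimes> expv (snd i), khat (snd i) s \<otimes> (fst i \<otimes> expv (snd i))))"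
  define I where "I = (UNIV :: 'h set) \<times> (step_fun :: (real => 'k) set)"
  define R where "R = cspan (P ` I)"
  have Rs: "csubspace R" unfolding R_def by (rule csubspace_cspan)
  have fs: "fst (\<Sum>i\<in>F. c i *C P i) = (\<Sum>i\<in>F. c i *C (fst i \<otimes> expv (snd i)))"
    "snd (\<Sum>i\<in>F. c i *C P i) = (\<Sum>i\<in>F. c i *C (khat (snd i) s \<otimes> (fst i \<otimes> expv (snd i))))" for F c by (simp_all add: fst_sum snd_sum P_def)
  have sv: "w = 0" if w: "(0, w) \<in> R" for w
  proof -
    obtain F c where F: "finite F" "F \<subseteq> I" "(0, w) = (\<Sum>i\<in>F. c i *C P i)" using cspan_finite[OF w[unfolded R_def]] by (elim exE conjE)
    have "(\<Sum>i\<in>F. c i *C (fst i \<otimes> expv (snd i))) = 0" "w = (\<Sum>i\<in>F. c i *C (khat (snd i) s \<otimes> (fst i \<otimes> expv (snd i))))"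
      using arg_cong[OF F(3), of fst] arg_cong[OF F(3), of snd] unfolding fs by simp_all
    moreover have "snd i \<in> step_fun" if "i \<in> F" for i using that F(2) by (auto simp: I_def)
    ultimately show ?thesis using nabla_single_valued[OF s F(1), of snd c fst] by simp
  qed
  have "\<exists>D. lin_op D \<and> dom D = fst ` R \<and> (\<forall>v w. (v, w) \<in> R --> D v = Some w)" by (rule relation_operator[OF Rs]) (rule sv)
  then obtain E where E: "lin_op E" "dom E = fst ` R" "\<forall>v w. (v, w) \<in> R --> E v = Some w" by (elim exE conjE)
  have dE: "dom E = exp_dom"
  proof
    have "fst ` P ` I = exp_gens" unfolding P_def I_def by force
    moreover have "R \<subseteq> {x. fst x \<in> cspan (fst ` P ` I)}" unfolding R_def
    proof (rule cspan_minimal)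
      show "csubspace {x. fst x \<in> cspan (fst ` P ` I)}" using csubspace_cspan[of "fst ` P ` I"] by (simp add: csubspace_def)
    qed (auto intro: cspan_base)
    ultimately show "dom E \<subseteq> exp_dom" unfolding E(2) exp_dom_def by auto
    have "exp_gens \<subseteq> dom E" unfolding E(2) R_def \<open>fst ` P ` I = exp_gens\<close>[symmetric] by (intro image_mono cspan_superset)
    thus "exp_dom \<subseteq> dom E" unfolding exp_dom_def by (rule cspan_minimal) (rule lin_opD(1)[OF E(1)])
  qed
  have gen: "the (E (ev u f)) = khat f s \<otimes> (ev u f)" if "f \<in> step_fun" for u f
  proof -
    have "P (u, f) \<in> R" unfolding R_def by (rule cspan_base) (use that in \<open>auto simp: I_def\<close>)
    thus ?thesis using E(3) by (simp add: P_def)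
  qed
  have "D = E" unfolding D_def nabla_def
  proof (rule the_equality)
    show "lin_op E \<and> dom E = exp_dom \<and> (\<forall>u. \<forall>f\<in>step_fun. the (E (ev u f)) = khat f s \<otimes> (ev u f))" using E(1) dE gen by blast
    fix E' :: "('h, 'k) sp \<rightharpoonup> ('h, 'k) hsp"
    assume E': "lin_op E' \<and> dom E' = exp_dom \<and> (\<forall>u. \<forall>f\<in>step_fun. the (E' (ev u f)) = khat f s \<otimes> (ev u f))"
    show "E' = E" by (rule lin_op_eqI[of _ exp_gens]) (use E' E(1) dE gen in \<open>auto simp: exp_dom_def\<close>)
  qed
  thus "lin_op D" "dom D = exp_dom" "\<And>u f. f \<in> step_fun ==> the (D (ev u f)) = khat f s \<otimes> (ev u f)" using E(1) dE gen by simp_all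
qed

subsection \<open>Adapted operators\<close>

abbreviation vac :: "'k::chilbert_space fock" where "vac \<equiv> expv (%_. 0)"

lemma cinner_vac: "cinner vac vac = 1" by (simp add: cinner_self norm_expv step_L2fun step_zero)

abbreviation (input) past_id :: "real => ('h::chilbert_space, 'k::chilbert_space) sp => ('h, 'k) sp"
  where "past_id r \<equiv> id \<odot> fock_id {0..<r}"

lemma bc_past_id: "bc (past_id r)" by (intro bc_op_tensor bc_id bc_fock_id)

lemma past_id_idem: "past_id r (past_id r x) = past_id r x" by (simp add: op_tensor_comp_apply projectionD(2)[OF fock_id_props(1)])

lemma cadj_past_id: "cadj (past_id r) = past_id r" by (simp add: cadj_op_tensor projectionD(4)[OF fock_id_props(1)])

lemma past_id_expv: "f \<in> step_on {0..<r} ==> past_id r (ev u f) = ev u f" by (simp add: op_tensor_apply fock_id_expv subinterval_upto)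

lemma exp_op_ext:
  fixes X Y :: "('h::chilbert_space, 'k::chilbert_space) sp => ('h, 'k) sp" assumes X: "bc X" and Y: "bc Y"
    and e: "\<And>u v f g. f \<in> step_fun ==> g \<in> step_fun ==> cinner (ev u f) (X (ev v g)) = cinner (ev u f) (Y (ev v g))" shows "X = Y"
proof (rule bc_eq_on_total[OF X Y exp_gens_total])
  fix y :: "('h, 'k) sp" assume "y \<in> exp_gens"
  then obtain v g where y: "y = ev v g" "g \<in> step_fun" by blast
  show "X y = Y y"
  proof (rule total_if_dense[OF exp_gens_total])
    fix z :: "('h, 'k) sp" assume "z \<in> exp_gens"
    then obtain u f where z: "z = ev u f" "f \<in> step_fun" by blast
    show "cinner z (X y) = cinner z (Y y)" unfolding y(1) z(1) by (rule e[OF z(2) y(2)])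
  qed
qed

definition adapted :: "real => (('h::chilbert_space, 'k::chilbert_space) sp => ('h, 'k) sp) => bool"
  where "adapted r X \<longleftrightarrow> (\<forall>u v. \<forall>f\<in>step_fun. \<forall>g\<in>step_fun. cinner (ev u f) (X (ev v g)) =
    cinner (expv (after r f)) (expv (after r g)) *
    cinner (ev u (before r f)) (X (ev v (before r g))))"

lemma adaptedD:
  "adapted r X ==> f \<in> step_fun ==> g \<in> step_fun ==> cinner (ev u f) (X (ev v g)) =
    cinner (expv (after r f)) (expv (after r g)) *
    cinner (ev u (before r f)) (X (ev v (before r g)))" unfolding adapted_def by blast

locale split_at =
  fixes r :: real and V :: "(('h::chilbert_space, 'k::chilbert_space) sp, 'k fock) htens => ('h, 'k) sp" assumes r: "0 <= r"
  defines "V \<equiv> fock_split r"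
begin

abbreviation "p \<equiv> (past_id r :: ('h, 'k) sp => ('h, 'k) sp)"
abbreviation "q \<equiv> (fock_id {r..} :: 'k fock => 'k fock)"

lemma Vb: "bc V" unfolding V_def by (rule bc_fock_split[OF r])

lemma Vb': "bc (cadj V)" by (rule bc_cadj[OF Vb])

lemma VsV: "cadj V (V x) = (p \<odot> q) x" using fun_cong[OF fock_split_isometry(1)[OF r, where 'h = 'h and 'k = 'k], of x] by (simp add: V_def)

lemma V_expv: "f \<in> step_fun ==> V (ev (ev u (before r f)) (after r f)) = ev u f"
  using fock_split_expv[OF r restr_step_on(1) restr_step_on(2), of f f u] by (simp add: V_def restr_split[OF r])

lemma fock_id_restr: "f \<in> step_fun ==> fock_id {0..<r} (expv (before r f)) = expv (before r f :: real => 'k)"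
  by (rule fock_id_expv[OF subinterval_upto restr_step_on(1)])

lemma q_expv: "f \<in> step_fun ==> q (expv (after r f)) = expv (after r f)" by (rule fock_id_expv[OF subinterval_from[OF r] restr_step_on(2)])

lemma q_vac: "q vac = vac" by (rule fock_id_expv[OF subinterval_from[OF r] step_on_zero])

lemma Vs_expv: assumes f: "f \<in> step_fun" shows "cadj V (ev u f) = ev (ev u (before r f)) (after r f)" unfolding V_expv[OF f, symmetric] VsV
  by (simp add: op_tensor_apply bc_past_id fock_id_restr[OF f] q_expv[OF f])

lemma V_matrix:
  assumes "f \<in> step_fun" "g \<in> step_fun" shows "cinner (ev u f) (V (Z (cadj V (ev v g)))) =
    cinner (ev (ev u (before r f)) (after r f)) (Z (ev (ev v (before r g)) (after r g)))"
  using cadj_left[OF Vb, of "ev u f"] by (simp add: Vs_expv assms)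

text \<open>A vector of the past subspace is one with vacuum future. Applying an operator to
  \<open>x \<otimes> vac\<close> and recombining is how past parts are extracted from then
  on.\<close>

lemma V_vac: "V (x \<otimes> vac) = p x"
proof -
  have "(%x. V (x \<otimes> vac)) = p"
  proof (rule tens_op_ext[OF _ bc_past_id])
    have "V o E_ket vac = (%x. V (x \<otimes> vac))" by (simp add: fun_eq_iff E_ket_def)
    thus "bc (%x. V (x \<otimes> vac))" using bc_compose[OF Vb E_ket_bc, of vac] by simp
    fix u :: 'h and w :: "'k fock"
    have bc: "bc (%w. V ((u \<otimes> w) \<otimes> vac))" using bc_compose[OF \<open>bc (%x. V (x \<otimes> vac))\<close> bc_tens_left, of u] by (simp add: o_def)
    have bc': "bc (%w. u \<otimes> fock_id {0..<r} w)" using bc_compose[OF bc_tens_left bc_fock_id, of u "{0..<r}"] by (simp add: o_def)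
    have "(%w. V ((u \<otimes> w) \<otimes> vac)) = (%w. u \<otimes> fock_id {0..<r} w)"
    proof (rule bc_eq_on_gens[where G = "expv ` step_on {0..<r}", OF bc bc'])
      fix w :: "'k fock" assume "w \<in> expv ` step_on {0..<r}"
      then obtain f where f: "w = expv f" "f \<in> step_on {0..<r}" by blast
      show "V ((u \<otimes> w) \<otimes> vac) = u \<otimes> fock_id {0..<r} w"
        using fock_split_expv[OF r f(2) step_on_zero, of u] by (simp add: V_def f(1) fock_id_expv[OF subinterval_upto f(2)])
    next
      fix w :: "'k fock" assume w: "\<And>g. g \<in> expv ` step_on {0..<r} ==> cinner g w = 0"
      have "V ((u \<otimes> w) \<otimes> vac) = 0" unfolding V_def
      proof (rule fock_split_orth[OF r])
        fix y :: "(('h, 'k) sp, 'k fock) htens" assume "y \<in> split_gens r"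
        then obtain u' f g where y: "y = ev (ev u' f) g" "f \<in> step_on {0..<r}" unfolding split_gens_def by blast
        have "cinner (expv f) w = 0" by (rule w) (use y in blast)
        thus "cinner y ((u \<otimes> w) \<otimes> vac) = 0" by (simp add: y(1) cinner_tens)
      qed
      moreover have "fock_id {0..<r} w = 0"
      proof (rule fock_id_props(4))
        fix y :: "'k fock" assume "y \<in> fock_on {0..<r}"
        hence "y \<in> closure (cspan (expv ` step_on {0..<r}))" by (simp add: fock_on_expv subinterval_upto)
        thus "cinner y w = 0" by (rule orth_closure_cspan[rotated]) (rule w)
      qed
      ultimately show "V ((u \<otimes> w) \<otimes> vac) = u \<otimes> fock_id {0..<r} w" by simp
    qed
    thus "V ((u \<otimes> w) \<otimes> vac) = p (u \<otimes> w)" by (simp add: fun_eq_iff op_tensor_apply)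
  qed
  thus ?thesis by (simp add: fun_eq_iff)
qed

text \<open>The condition on matrix elements becomes a factorization: under the splitting, an
  adapted operator is its past part tensored with the identity of the future, which in this
  realization is the projection \<open>q\<close>.\<close>

lemma adapted_split: assumes X: "bc X" "adapted r X" shows "X = V o ((p o X o p) \<odot> q) o cadj V"
proof (rule exp_op_ext[OF X(1)])
  have b: "bc (p o X o p)" by (intro bc_compose bc_past_id X)
  show "bc (V o ((p o X o p) \<odot> q) o cadj V)" by (intro bc_compose Vb Vb' bc_op_tensor b bc_fock_id)
  fix u v :: 'h and f g :: "real => 'k" assume fg: "f \<in> step_fun" "g \<in> step_fun"
  have "cinner (ev u (before r f)) (p y) = cinner (ev u (before r f)) y" for y using cadj_left[OF bc_past_id, of r "ev u (before r f)" y]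
    by (simp add: cadj_past_id past_id_expv restr_step_on(1)[OF fg(1)])
  thus "cinner (ev u f) (X (ev v g)) = cinner (ev u f) ((V o ((p o X o p) \<odot> q) o cadj V) (ev v g))"
    by (simp add: V_matrix fg op_tensor_apply b cinner_tens fock_id_restr q_expv adaptedD[OF X(2) fg])
qed

lemma adapted_splitI: assumes x: "bc x" shows "adapted r (V o (x \<odot> q) o cadj V)" unfolding adapted_def
proof (intro allI ballI)
  fix u v :: 'h and f g :: "real => 'k" assume fg: "f \<in> step_fun" "g \<in> step_fun"
  have rr: "before r (before r h) = before r h" "after r (before r h) = (%_. 0)" for h :: "real => 'k" by (auto simp: restr_to_def)
  show "cinner (ev u f) ((V o (x \<odot> q) o cadj V) (ev v g)) =
    cinner (expv (after r f)) (expv (after r g)) *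
    cinner (ev u (before r f)) ((V o (x \<odot> q) o cadj V) (ev v (before r g)))"
    by (simp add: V_matrix fg step_restr_upto rr op_tensor_apply x cinner_tens q_expv q_vac cinner_vac)
qed

text \<open>The identity factor of \<open>adapted_split\<close> leaves a vacuum future unchanged, so
  the past subspace is invariant.\<close>

lemma adapted_past: assumes X: "bc X" "adapted r X" shows "X (p y) = p (X (p y))"
proof -
  have b: "bc (p o X o p)" by (intro bc_compose bc_past_id X)
  have "X (p y) = V (((p o X o p) \<odot> q) (cadj V (V (y \<otimes> vac))))" by (subst adapted_split[OF X]) (simp add: V_vac)
  also have "\<dots> = V (p (X (p y)) \<otimes> vac)" by (simp add: VsV op_tensor_apply bc_past_id b q_vac past_id_idem)
  finally show ?thesis by (simp add: V_vac past_id_idem)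
qed

lemma adapted_comp:
  fixes X Y :: "('h, 'k) sp => ('h, 'k) sp" assumes X: "bc X" "adapted r X" and Y: "bc Y" "adapted r Y" shows "adapted r (X o Y)"
proof -
  define x where "x = p o X o p"
  define y where "y = p o Y o p"
  have b: "bc x" "bc y" unfolding x_def y_def by (intro bc_compose bc_past_id X Y)+
  have "(X o Y) z = (V o ((x o p o y) \<odot> q) o cadj V) z" for z
  proof -
    have "(X o Y) z = V ((x \<odot> q) (cadj V (V ((y \<odot> q) (cadj V z)))))"
      by (subst adapted_split[OF X], subst adapted_split[OF Y]) (simp add: x_def y_def)
    thus ?thesis by (simp add: VsV op_tensor_comp_apply b bc_past_id bc_compose projectionD(2)[OF fock_id_props(1)] comp_assoc[symmetric])
  qed
  hence "X o Y = V o ((x o p o y) \<odot> q) o cadj V" by (rule ext)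
  thus ?thesis by (simp only: adapted_splitI[OF bc_compose[OF bc_compose[OF b(1) bc_past_id] b(2)]])
qed

text \<open>Needed for \<open>J_matrix\<close>, where an adapted operator acts first: its value on
  an exponential vector still splits at \<open>r\<close>, with the future part untouched.\<close>

lemma Vs_adapted:
  assumes X: "bc X" "adapted r X" and g: "g \<in> step_fun" shows "cadj V (X (ev v g)) = X (ev v (before r g)) \<otimes> expv (after r g)"
proof -
  have b: "bc (p o X o p)" by (intro bc_compose bc_past_id X)
  define y where "y = ev v (before r g)"
  have py: "p y = y" unfolding y_def by (rule past_id_expv[OF restr_step_on(1)[OF g]])
  have pX: "p (X y) = X y" using adapted_past[OF X, of y] by (simp add: py)
  have "X (ev v g) = V (X y \<otimes> expv (after r g))"
    by (subst adapted_split[OF X]) (simp add: Vs_expv[OF g] op_tensor_apply b q_expv[OF g] y_def[symmetric] py pX)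
  thus ?thesis unfolding y_def[symmetric] by (simp add: VsV op_tensor_apply bc_past_id pX q_expv[OF g])
qed

end

lemma adapted_id: "0 <= r ==> adapted r (id :: ('h::chilbert_space, 'k::chilbert_space) sp => _)"
proof -
  assume r: "0 <= r"
  interpret split_at r "fock_split r :: (('h, 'k) sp, 'k fock) htens => ('h, 'k) sp" by unfold_locales (use r in auto)
  have "fock_split r o (id \<odot> fock_id {r..}) o cadj (fock_split r) = (id :: ('h, 'k) sp => _)"
  proof (rule exp_op_ext)
    show "bc (fock_split r o (id \<odot> fock_id {r..}) o cadj (fock_split r :: (('h, 'k) sp, 'k fock) htens => ('h, 'k) sp))"
      by (intro bc_compose Vb Vb' bc_op_tensor bc_id bc_fock_id)
    show "cinner (ev u f) ((fock_split r o (id \<odot> fock_id {r..}) o cadj (fock_split r)) (ev v g)) = cinner (ev u f) (id (ev v g))"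
      if "f \<in> step_fun" "g \<in> step_fun" for u v :: 'h and f g :: "real => 'k"
      using V_expv[OF that(2), of v] by (simp add: Vs_expv that op_tensor_apply q_expv)
  qed simp
  thus ?thesis using adapted_splitI[OF bc_id] by simp
qed

lemma cinner_slice:
  assumes "g \<in> step_fun" shows "cinner v (slice f (op_on X exp_dom) g u) = cinner (ev v f) (X (ev u g))"
  using cadj_right[OF E_ket_bc, of v "expv f" "X (ev u g)"] by (simp add: slice_def E_ket_def exp_domI[OF assms])

lemma slice_op_on: "g \<in> step_fun ==> slice f (op_on X exp_dom) g = block (expv f) X (expv g)"
  by (simp add: slice_def fun_eq_iff E_ket_def exp_domI)

lemma slice_adapted:
  fixes X :: "('h::chilbert_space, 'k::chilbert_space) sp => ('h, 'k) sp" shows   "(\<forall>f\<in>step_fun. \<forall>g\<in>step_fun. slice f (op_on X exp_dom) g =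
    (%u. cinner (expv (after t f)) (expv (after t g)) *C
      slice (before t f) (op_on X exp_dom) (before t g) u)) \<longleftrightarrow> adapted t X"
proof
  assume L: "\<forall>f\<in>step_fun. \<forall>g\<in>step_fun. slice f (op_on X exp_dom) g =
    (%u. cinner (expv (after t f)) (expv (after t g)) *C
      slice (before t f) (op_on X exp_dom) (before t g) u)"
  show "adapted t X" unfolding adapted_def
  proof (intro allI ballI)
    fix u v :: 'h and f g :: "real => 'k" assume fg: "f \<in> step_fun" "g \<in> step_fun"
    show "cinner (ev u f) (X (ev v g)) = cinner (expv (after t f)) (expv (after t g)) *
        cinner (ev u (before t f)) (X (ev v (before t g)))" using arg_cong[OF fun_cong[OF L[rule_format, OF fg], of v], of "cinner u"]
      by (simp only: cinner_scaleC_right cinner_slice fg step_restr_upto)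
  qed
next
  assume R: "adapted t X"
  show "\<forall>f\<in>step_fun. \<forall>g\<in>step_fun. slice f (op_on X exp_dom) g =
    (%u. cinner (expv (after t f)) (expv (after t g)) *C
      slice (before t f) (op_on X exp_dom) (before t g) u)"
    by (intro ballI ext, rule cinner_ext) (simp only: cinner_scaleC_right cinner_slice step_restr_upto adaptedD[OF R])
qed

lemma op_process_op_on:
  assumes "\<And>t. 0 <= t ==> bc (X t)" shows "op_process (%t. op_on (X t) exp_dom) \<longleftrightarrow>
    (\<forall>zeta'. \<forall>zeta\<in>exp_dom. (%t. cinner zeta' (X t zeta)) \<in> borel_measurable (lebesgue_on {0..})) \<and> (\<forall>t\<ge>0. adapted t (X t))"
  unfolding op_process_def slice_adapted using lin_op_on[OF csubspace_exp_dom assms] by (simp add: dom_op_on)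

section \<open>Flows and their endomorphisms\<close>

subsection \<open>The endomorphisms of a flow\<close>

locale flow = vn_algebra A
  for A :: "('h::chilbert_space => 'h) set" +
  fixes j :: "real => ('h => 'h) => ('h, 'k::chilbert_space) sp => ('h, 'k) sp" assumes flow: "qs_flow A j"
begin

lemma j_bc: "0 <= t ==> a \<in> A ==> bc (j t a)"
  using flow unfolding qs_flow_def qs_cocycle_def mapping_process_def by (intro bounded_opsD) blast

lemma j_process: "a \<in> A ==> process_in A (%t. op_on (j t a) exp_dom)"
  using flow unfolding qs_flow_def qs_cocycle_def mapping_process_def by blast

lemma j_adapted: assumes t: "0 <= t" and a: "a \<in> A" shows "adapted t (j t a)"
proof -
  have "op_process (%t. op_on (j t a) exp_dom) \<longleftrightarrow>
    (\<forall>zeta'. \<forall>zeta\<in>exp_dom. (%t. cinner zeta' (j t a zeta)) \<in> borel_measurable (lebesgue_on {0..})) \<and> (\<forall>t\<ge>0. adapted t (j t a))"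
    by (rule op_process_op_on) (rule j_bc[OF _ a])
  thus ?thesis using t j_process[OF a] unfolding process_in_def by blast
qed

lemma j_slice: "0 <= t ==> a \<in> A ==> f \<in> step_fun ==> g \<in> step_fun ==> block (expv f) (j t a) (expv g) \<in> A"
proof -
  assume h: "0 <= t" "a \<in> A" "f \<in> step_fun" "g \<in> step_fun"
  have "slice f (op_on (j t a) exp_dom) g \<in> A" using j_process[OF h(2)] h unfolding process_in_def by blast
  thus ?thesis by (simp only: slice_op_on[OF h(4)])
qed

lemma j_id: "0 <= t ==> j t id = id" using flow unfolding qs_flow_def by blast

lemma j_linear: "0 <= t ==> linear_map_on A (j t)" using flow unfolding qs_flow_def qs_cocycle_def mapping_process_def by blast

lemma j_rep: assumes t: "0 <= t" shows "star_rep A (j t)" unfolding star_rep_def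
proof (intro conjI ballI allI)
  fix a b c assume ab: "a \<in> A" "b \<in> A"
  show "j t (a o b) = j t a o j t b" using flow ab t unfolding qs_flow_def by blast
  show "j t (lincomb a c b) = (%xi. j t a xi + c *C j t b xi)" using j_linear[OF t] ab unfolding linear_map_on_def by blast
qed (use flow t j_bc in \<open>auto simp: qs_flow_def\<close>)

lemma j_cont: assumes a: "a \<in> A" and phi: "uw_fun phi" shows "continuous_on {0..} (%t. phi (j t a))"
proof -
  have "continuous_map (top_of_set {0..}) ultraweak (%t. j t a)" using flow a unfolding qs_flow_def by blast
  from continuous_map_ultraweak_uw_fun[OF this phi] show ?thesis by (simp only: continuous_map_iff_continuous)
qed

lemma j_normal: assumes t: "0 <= t" and phi: "uw_fun phi" shows "\<exists>psi. uw_fun psi \<and> (\<forall>a\<in>A. phi (j t a) = psi a)"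
proof (rule continuous_functional_uw_fun[OF A_bounded A_zero A_lincomb])
  have "normal_map A (j t)" using flow t unfolding qs_flow_def qs_cocycle_def by blast
  hence "continuous_map (subtopology ultraweak A) ultraweak (j t)" unfolding normal_map_def by blast
  thus "continuous_map (subtopology ultraweak A) euclidean (%a. phi (j t a))" by (rule continuous_map_ultraweak_uw_fun[OF _ phi])
  fix a b c assume ab: "a \<in> A" "b \<in> A"
  show "phi (j t (lincomb a c b)) = phi (j t a) + c * phi (j t b)"
    unfolding star_repD(4)[OF j_rep[OF t] ab] by (rule uw_fun_linear[OF phi bounded_opsI[OF j_bc[OF t ab(1)]] bounded_opsI[OF j_bc[OF t ab(2)]]])
qed

lemma exp_gens_alt: "exp_gens = {(u::'h) \<otimes> g | u g. g \<in> expv ` (step_fun :: (real => 'k) set)}" by blast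

text \<open>The algebra on which \<open>flow_endo\<close> is meaningful: \<open>A\<close> tensored
  with all bounded operators on Fock space.\<close>

definition obs :: "(('h, 'k) sp => ('h, 'k) sp) set" where "obs = vn_tensor A bounded_ops"

lemma obs_iff: "x \<in> obs \<longleftrightarrow> bc x \<and> (\<forall>b\<in>commutant A. (b \<odot> id) o x = x o (b \<odot> id))"
  using vn_tensor_corner[OF projection_id, of x] by (simp add: obs_def)

lemma obs_bc: "x \<in> obs ==> bc x" by (simp add: obs_iff)

lemma obsI_slices:
  assumes "bc x" "\<And>f g. f \<in> step_fun ==> g \<in> step_fun ==> block (expv f) x (expv g) \<in> A" shows "x \<in> obs" unfolding obs_iff
proof (intro conjI ballI assms(1))
  fix b assume b: "b \<in> commutant A"
  show "(b \<odot> id) o x = x o (b \<odot> id)"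
  proof (rule commutes_if_slices[OF assms(1) _ _ b])
    show "closure (cspan {(u::'h) \<otimes> g | u g. g \<in> expv ` (step_fun :: (real => 'k) set)}) = UNIV"
      unfolding exp_gens_alt[symmetric] by (rule exp_gens_total)
    fix v w :: "'k fock" assume "v \<in> expv ` step_fun" "w \<in> expv ` step_fun"
    thus "block v x w \<in> A" by (elim imageE) (simp only: assms(2))
  qed
qed

lemma j_obs: "0 <= t ==> a \<in> A ==> j t a \<in> obs" by (rule obsI_slices) (rule j_bc j_slice; assumption)+

lemma obs_comp: "x \<in> obs ==> y \<in> obs ==> x o y \<in> obs"
proof -
  assume h: "x \<in> obs" "y \<in> obs"
  have "(b \<odot> id) o (x o y) = (x o y) o (b \<odot> id)" if b: "b \<in> commutant A" for b
  proof -
    have "(b \<odot> id) (x z) = x ((b \<odot> id) z)" "(b \<odot> id) (y z) = y ((b \<odot> id) z)" for z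
      using h b unfolding obs_iff fun_eq_iff comp_apply by blast+
    thus ?thesis by (intro ext) (simp only: comp_apply)
  qed
  thus ?thesis using h unfolding obs_iff by (intro conjI ballI bc_compose) blast+
qed

lemma obs_slice: "x \<in> obs ==> block v x w \<in> A" unfolding obs_iff by (rule vn_tensor_slice) blast+

lemma id_obs: "id \<in> obs" by (simp add: obs_iff)

lemma dil_exists:
  assumes t: "0 <= t" shows "\<exists>W :: ('h, 'k) sp => ('h, (('h, 'k) sp \<times> nat) ell2) htens. bc W \<and> (\<forall>x y. cinner (W x) (W y) = cinner x y) \<and>
    (\<forall>a\<in>A. W o j t a = (a \<odot> id) o W)" by (rule normal_rep_dilation[OF j_rep[OF t] j_id[OF t]]) (rule j_normal[OF t uw_fun_vec])

definition dil :: "real => ('h, 'k) sp => ('h, (('h, 'k) sp \<times> nat) ell2) htens"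
  where "dil t = (SOME W. bc W \<and> (\<forall>x y. cinner (W x) (W y) = cinner x y) \<and> (\<forall>a\<in>A. W o j t a = (a \<odot> id) o W))"

lemma dil_props:
  assumes t: "0 <= t" shows "bc (dil t)" "cinner (dil t x) (dil t y) = cinner x y" "a \<in> A ==> dil t o j t a = (a \<odot> id) o dil t"
proof -
  have h: "bc (dil t) \<and> (\<forall>x y. cinner (dil t x) (dil t y) = cinner x y) \<and> (\<forall>a\<in>A. dil t o j t a = (a \<odot> id) o dil t)"
    unfolding dil_def by (rule someI_ex[OF dil_exists[OF t]])
  show "bc (dil t)" using h by (rule conjunct1)
  show "cinner (dil t x) (dil t y) = cinner x y" using h[THEN conjunct2, THEN conjunct1] by blast
  show "dil t o j t a = (a \<odot> id) o dil t" if "a \<in> A" using h[THEN conjunct2, THEN conjunct2] that by blast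
qed

lemma norm_dil: assumes t: "0 <= t" shows "norm (dil t x) = norm x" by (rule power2_eq_imp_eq) (simp_all add: norm_sq_cinner dil_props[OF t])

lemma dil_isometry: assumes t: "0 <= t" shows "cadj (dil t) (dil t x) = x" by (rule cinner_ext) (simp add: cadj_right dil_props[OF t])

lemma dil_rep: assumes t: "0 <= t" and a: "a \<in> A" shows "cadj (dil t) o (a \<odot> id) o dil t = j t a"
  unfolding comp_assoc dil_props(3)[OF t a, symmetric] by (simp add: fun_eq_iff dil_isometry[OF t])

text \<open>\<open>hat_map\<close> tensors the past part of \<open>j s a\<close> with the future.
  That past part represents \<open>A\<close> on the past subspace and is zero on the complement;
  composing the dilation with the past projection covers it in the form that \<open>amplify\<close>
  requires.\<close>

definition pdil :: "real => ('h, 'k) sp => ('h, (('h, 'k) sp \<times> nat) ell2) htens" where "pdil s = dil s o past_id s"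

lemma norm_past_id: "norm (past_id r x) <= norm x"
proof -
  have "cinner (past_id r x) (x - past_id r x) = 0"
    using cadj_left[OF bc_past_id, of r x "x - past_id r x"] by (simp add: cadj_past_id bc_diff[OF bc_past_id] past_id_idem)
  thus ?thesis by (rule orth_decomp_bound)
qed

lemma pdil_props:
  assumes s: "0 <= s" shows "bc (pdil s)" "norm (pdil s x) <= norm x" "pdil s o past_id s = pdil s"
    and "a \<in> A ==> cadj (pdil s) o (a \<odot> id) o pdil s = past_id s o j s a o past_id s"
    and "a \<in> A ==> pdil s o (cadj (pdil s) o (a \<odot> id) o pdil s) = (a \<odot> id) o pdil s"
proof -
  interpret split_at s "fock_split s :: (('h, 'k) sp, 'k fock) htens => ('h, 'k) sp" by unfold_locales (use s in auto)
  show "bc (pdil s)" unfolding pdil_def by (intro bc_compose dil_props(1) bc_past_id s)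
  show "norm (pdil s x) <= norm x" unfolding pdil_def by (simp add: norm_dil[OF s] norm_past_id)
  show "pdil s o past_id s = pdil s" unfolding pdil_def by (simp add: fun_eq_iff past_id_idem)
  assume a: "a \<in> A"
  have c: "cadj (pdil s) = past_id s o cadj (dil s)" unfolding pdil_def by (simp add: cadj_comp dil_props(1)[OF s] bc_past_id cadj_past_id)
  have W: "(a \<odot> id) (dil s x) = dil s (j s a x)" for x using fun_cong[OF dil_props(3)[OF s a], of x] by simp
  show e: "cadj (pdil s) o (a \<odot> id) o pdil s = past_id s o j s a o past_id s"
    unfolding c unfolding pdil_def by (simp add: fun_eq_iff W dil_isometry[OF s])
  show "pdil s o (cadj (pdil s) o (a \<odot> id) o pdil s) = (a \<odot> id) o pdil s" unfolding e unfolding pdil_def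
    using adapted_past[OF j_bc[OF s a] j_adapted[OF s a]] by (simp add: fun_eq_iff W past_id_idem)
qed

lemma past_commute:
  assumes b: "bc b" shows "(b \<odot> id) o past_id s = (past_id s :: ('h, 'k) sp => _) o (b \<odot> id)" by (simp add: op_tensor_comp b)

text \<open>Existence is \<open>adapted_split\<close>. Uniqueness comes from testing on vectors with
  vacuum future, where the past operator can be read off.\<close>

lemma past_part_eq:
  assumes s: "0 <= s" and a: "a \<in> A" shows "past_part A j s a = past_id s o j s a o past_id s"
proof -
  interpret split_at s "fock_split s :: (('h, 'k) sp, 'k fock) htens => ('h, 'k) sp" by unfold_locales (use s in auto)
  let ?V = "fock_split s :: (('h, 'k) sp, 'k fock) htens => ('h, 'k) sp"
  define x where "x = p o j s a o p"
  have xb: "bc x" unfolding x_def by (intro bc_compose bc_past_id j_bc s a)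
  have pr: "projection (fock_id {0..<s} :: 'k fock => _)" by (rule fock_id_props(1))
  have "x \<in> vn_tensor A (corner (fock_id {0..<s}))" unfolding vn_tensor_corner[OF pr]
  proof (intro conjI ballI xb)
    show "p o x = x" "x o p = x" by (simp_all add: x_def fun_eq_iff past_id_idem)
    fix b assume b: "b \<in> commutant A"
    have "(b \<odot> id) (j s a y) = j s a ((b \<odot> id) y)" for y using j_obs[OF s a] b unfolding obs_iff by (simp add: fun_eq_iff)
    moreover have "(b \<odot> id) (p y) = p ((b \<odot> id) y)" for y using past_commute[OF commutantD(1)[OF b], of s] by (simp add: fun_eq_iff)
    ultimately show "(b \<odot> id) o x = x o (b \<odot> id)" by (simp add: x_def fun_eq_iff)
  qed
  moreover have "j s a = split_tensor s x (fock_id {s..})"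
    unfolding split_tensor_def x_def by (rule adapted_split[OF j_bc[OF s a] j_adapted[OF s a]])
  moreover have "y = x" if y: "y \<in> vn_tensor A (corner (fock_id {0..<s}))" "j s a = split_tensor s y (fock_id {s..})" for y
  proof -
    have yb: "bc y" and yp: "p o y = y" "y o p = y" using y(1) unfolding vn_tensor_corner[OF pr] by blast+
    have "p (j s a (p z)) = y z" for z
    proof -
      have "j s a (p z) = ?V ((y \<odot> q) (cadj ?V (?V (z \<otimes> vac))))" unfolding y(2) split_tensor_def by (simp add: V_vac)
      also have "\<dots> = ?V (y (p z) \<otimes> vac)" by (simp add: VsV op_tensor_apply bc_past_id yb q_vac)
      also have "\<dots> = p (y (p z))" by (rule V_vac)
      finally show ?thesis using yp by (simp add: past_id_idem fun_eq_iff)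
    qed
    thus ?thesis by (simp add: x_def fun_eq_iff)
  qed
  ultimately show ?thesis unfolding past_part_def fock_ops_corner x_def[symmetric] by (intro the_equality) blast+
qed

lemma hat_map_eq:
  assumes s: "0 <= s" and x: "x \<in> vn_tensor A (corner (fock_id {s..}))"
  shows "hat_map A j s x = fock_split s o amplify (pdil s) x o cadj (fock_split s)" unfolding hat_map_def fock_ops_corner
proof (rule normal_tensor_map_amplify[OF pdil_props(1)[OF s] fock_id_props(1) bc_fock_split[OF s] _ x])
  show "split_tensor s (past_part A j s a) z = fock_split s o ((cadj (pdil s) o (a \<odot> id) o pdil s) \<odot> z) o cadj (fock_split s)"
    if "a \<in> A" for a z unfolding split_tensor_def past_part_eq[OF s that] pdil_props(4)[OF s that] ..
qed

lemma sigma_eq: "0 <= s ==> sigma_shift s x = (id \<odot> fock_shift s) o x o (id \<odot> cadj (fock_shift s))"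
  unfolding sigma_shift_def by (simp add: cadj_op_tensor bc_fock_shift)

lemma sigma_corner:
  assumes s: "0 <= s" and x: "x \<in> obs" shows "sigma_shift s x \<in> vn_tensor A (corner (fock_id {s..}))"
proof -
  let ?T = "fock_shift s :: 'k fock => 'k fock"
  have T: "bc ?T" "bc (cadj ?T)" by (intro bc_cadj bc_fock_shift s)+
  have qT: "fock_id {s..} o ?T = ?T" by (rule fock_id_shift[OF s])
  have Tq: "cadj ?T o fock_id {s..} = cadj ?T" using arg_cong[OF qT, of cadj] by (simp add: cadj_comp T projectionD(4)[OF fock_id_props(1)])
  note xb = obs_bc[OF x]
  show ?thesis unfolding vn_tensor_corner[OF fock_id_props(1)] sigma_eq[OF s]
  proof (intro conjI ballI)
    show "bc ((id \<odot> ?T) o x o (id \<odot> cadj ?T))" by (intro bc_compose bc_op_tensor bc_id T xb)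
    show "(id \<odot> fock_id {s..}) o ((id \<odot> ?T) o x o (id \<odot> cadj ?T)) = (id \<odot> ?T) o x o (id \<odot> cadj ?T)"
      by (simp add: fun_eq_iff op_tensor_comp_apply T qT)
    show "((id \<odot> ?T) o x o (id \<odot> cadj ?T)) o (id \<odot> fock_id {s..}) = (id \<odot> ?T) o x o (id \<odot> cadj ?T)"
      by (simp add: fun_eq_iff op_tensor_comp_apply T Tq)
    fix b assume b: "b \<in> commutant A"
    note bb = commutantD(1)[OF b]
    have "(b \<odot> id) (x y) = x ((b \<odot> id) y)" for y using x b unfolding obs_iff by (simp add: fun_eq_iff)
    moreover have "(b \<odot> id) ((id \<odot> S) y) = (id \<odot> S) ((b \<odot> id) y)" if "bc S" for S :: "'k fock => 'k fock" and y
      by (simp add: op_tensor_comp_apply bb that)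
    ultimately show "(b \<odot> id) o ((id \<odot> ?T) o x o (id \<odot> cadj ?T)) = ((id \<odot> ?T) o x o (id \<odot> cadj ?T)) o (b \<odot> id)" by (simp add: fun_eq_iff T)
  qed
qed

lemma sigma_bc: "0 <= s ==> bc x ==> bc (sigma_shift s x)"
  by (simp only: sigma_eq) (intro bc_compose bc_op_tensor bc_id bc_cadj bc_fock_shift)

lemma sigma_slice:
  fixes x :: "('h, 'k) sp => ('h, 'k) sp" assumes s: "0 <= s" and x: "bc x" and f: "f \<in> step_on {s..}" and g: "g \<in> step_on {s..}"
  shows "block (expv f) (sigma_shift s x) (expv g) = block (expv (unshift s f)) x (expv (unshift s g))"
proof (rule op_ext_cinner)
  fix u v :: 'h
  let ?T = "id \<odot> (fock_shift s :: 'k fock => 'k fock) :: ('h, 'k) sp => _"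
  have Tb: "bc ?T" by (intro bc_op_tensor bc_id bc_fock_shift s)
  have e: "cadj ?T (ev u f) = ev u (unshift s f)" if "f \<in> step_on {s..}" for u f
    by (simp add: cadj_op_tensor bc_fock_shift[OF s] op_tensor_apply bc_cadj cadj_shift_expv[OF s that])
  show "cinner u ((block (expv f) (sigma_shift s x) (expv g)) v) =
      cinner u ((block (expv (unshift s f)) x (expv (unshift s g))) v)" using cadj_left[OF Tb, of "ev u f"]
    unfolding comp_apply cadj_right[OF E_ket_bc] sigma_shift_def by (simp add: E_ket_def e f g)
qed

abbreviation "J \<equiv> flow_endo A j"

lemma J_eq: "0 <= s ==> x \<in> obs ==> J s x = fock_split s o amplify (pdil s) (sigma_shift s x) o cadj (fock_split s)"
  by (simp add: flow_endo_def hat_map_eq sigma_corner)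

lemma J_bc: "0 <= s ==> x \<in> obs ==> bc (J s x)"
  by (simp only: J_eq) (intro bc_compose bc_cadj bc_fock_split bc_amplify pdil_props(1) sigma_bc obs_bc)

lemma J_cocycle: "0 <= s ==> 0 <= t ==> a \<in> A ==> J s (j t a) = j (s + t) a"
  using flow unfolding qs_flow_def qs_cocycle_def flow_endo_def by simp

lemma J_id: "0 <= s ==> J s id = id" using J_cocycle[of s 0 id] by (simp add: j_id A_id)

lemma J_norm:
  assumes s: "0 <= s" and x: "x \<in> obs" and C: "0 <= C" "\<And>z. norm (x z) <= C * norm z" shows "norm (J s x zeta) <= C * norm zeta"
proof -
  let ?T = "id \<odot> (fock_shift s :: 'k fock => 'k fock) :: ('h, 'k) sp => _" and ?V = "fock_split s :: (('h, 'k) sp, 'k fock) htens => _"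
  have Tb: "bc ?T" by (intro bc_op_tensor bc_id bc_fock_shift s)
  have Tn: "norm (?T z) <= 1 * norm z" for z
    using norm_op_tensor[of "id :: 'h => 'h" 1 "fock_shift s :: 'k fock => 'k fock" 1 z] by (simp add: norm_fock_shift[OF s] bc_fock_shift[OF s])
  have "norm (sigma_shift s x z) <= C * norm z" for z
  proof -
    have "norm (sigma_shift s x z) <= norm (x (cadj ?T z))" using Tn[of "x (cadj ?T z)"] by (simp add: sigma_shift_def)
    also have "\<dots> <= C * norm (cadj ?T z)" by (rule C(2))
    also have "\<dots> <= C * (1 * norm z)" by (intro mult_left_mono norm_cadj_le[OF Tb] Tn C(1)) simp
    finally show ?thesis by simp
  qed
  hence a: "norm (amplify (pdil s) (sigma_shift s x) z) <= C * norm z" for z by (intro amplify_norm pdil_props s sigma_bc obs_bc x C(1))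
  have "norm (J s x zeta) <= norm (amplify (pdil s) (sigma_shift s x) (cadj ?V zeta))" by (simp add: J_eq s x norm_fock_split[OF s])
  also have "\<dots> <= C * norm (cadj ?V zeta)" by (rule a)
  also have "\<dots> <= C * (1 * norm zeta)" by (intro mult_left_mono norm_cadj_le[OF bc_fock_split[OF s]] C(1)) (simp_all add: norm_fock_split[OF s])
  finally show ?thesis by simp
qed

text \<open>Composing two values of \<open>J s\<close> leaves the projection
  \<open>p \<odot> q\<close> of the splitting in the middle. The right-hand factor absorbs it: the
  future leg because the shifted operator lies in the corner of \<open>q\<close>, the past leg
  because \<open>pdil s\<close> absorbs the past projection.\<close>

lemma J_mult:
  assumes s: "0 <= s" and x: "x \<in> obs" and y: "y \<in> obs" shows "J s (x o y) = J s x o J s y"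
proof -
  interpret split_at s "fock_split s :: (('h, 'k) sp, 'k fock) htens => ('h, 'k) sp" by unfold_locales (use s in auto)
  define S where "S = sigma_shift s y"
  have S: "S \<in> vn_tensor A (corner (fock_id {s..}))" unfolding S_def by (rule sigma_corner[OF s y])
  have Sb: "bc S" and Sq: "(id \<odot> fock_id {s..}) o S = S" using S unfolding vn_tensor_corner[OF fock_id_props(1)] by blast+
  have "sigma_shift s (x o y) = sigma_shift s x o S" unfolding S_def sigma_eq[OF s]
    by (simp add: fun_eq_iff op_tensor_comp_apply bc_fock_shift[OF s] bc_cadj fock_shift_isometry[OF s])
  hence m: "amplify (pdil s) (sigma_shift s (x o y)) = amplify (pdil s) (sigma_shift s x) o amplify (pdil s) S"
    using amplify_mult[OF pdil_props(1)[OF s] A_bounded corner_bounded sigma_bc[OF s obs_bc[OF x]] S pdil_props(5)[OF s]] by simp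
  have "amplify (pdil s) S z = (p \<odot> q) (amplify (pdil s) S z)" for z
  proof -
    have "amplify (pdil s) S = (id \<odot> q) o amplify (pdil s) S" using amplify_comp_right[OF pdil_props(1)[OF s] Sb bc_fock_id, of "{s..}"] by (simp add: Sq)
    moreover have "amplify (pdil s) S = (p \<odot> id) o amplify (pdil s) S"
    proof (rule slices_ext)
      have b: "bc (amplify (pdil s) S :: (('h, 'k) sp, 'k fock) htens => _)" by (rule bc_amplify[OF pdil_props(1)[OF s] Sb])
      show "bc (amplify (pdil s) S :: (('h, 'k) sp, 'k fock) htens => _)" by (rule b)
      show "bc ((p \<odot> id) o amplify (pdil s) S :: (('h, 'k) sp, 'k fock) htens => _)" by (intro bc_compose bc_op_tensor bc_past_id bc_id b)
      have c: "p o cadj (pdil s) = cadj (pdil s)"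
        using arg_cong[OF pdil_props(3)[OF s], of cadj] by (simp add: cadj_comp pdil_props(1)[OF s] bc_past_id cadj_past_id)
      fix v w :: "'k fock"
      have "block v ((p \<odot> id) o amplify (pdil s) S) w = p o (block v (amplify (pdil s) S) w)"
        by (simp add: fun_eq_iff cadj_E_ket_amp bc_past_id)
      also have "\<dots> = block v (amplify (pdil s) S) w" unfolding amplify_slice[OF pdil_props(1)[OF s] Sb] comp_assoc[symmetric] c ..
      finally show "block v (amplify (pdil s) S) w = block v ((p \<odot> id) o amplify (pdil s) S) w" by simp
    qed
    ultimately have "amplify (pdil s) S z = (p \<odot> id) ((id \<odot> q) (amplify (pdil s) S z))" by (metis comp_apply)
    thus ?thesis by (simp add: op_tensor_comp_apply bc_past_id)
  qed
  hence "J s (x o y) z = (J s x o J s y) z" for z by (simp add: J_eq s x y obs_comp m VsV[symmetric] S_def[symmetric])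
  thus ?thesis by (rule ext)
qed

text \<open>The splitting separates past from future, and slicing out the future turns
  \<open>J s x\<close> into \<open>j s\<close> of a slice of \<open>x\<close> along the futures
  moved back by \<open>s\<close>. The adapted factor \<open>Y\<close> is included because in the
  cocycle identity such a factor stands to the right of \<open>J s\<close>.\<close>

lemma J_matrix:
  assumes s: "0 <= s" and x: "x \<in> obs" and Y: "bc Y" "adapted s Y" and f: "f \<in> step_fun" and g: "g \<in> step_fun"
  shows "cinner (ev u f) (J s x (Y (ev v g))) =
    cinner (ev u (before s f)) (j s (block (expv (unshift s f)) x (expv (unshift s g))) (Y (ev v (before s g))))"
proof -
  interpret split_at s "fock_split s :: (('h, 'k) sp, 'k fock) htens => ('h, 'k) sp" by unfold_locales (use s in auto)
  let ?V = "fock_split s :: (('h, 'k) sp, 'k fock) htens => ('h, 'k) sp"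
  define a where "a = block (expv (unshift s f)) x (expv (unshift s g))"
  have a: "a \<in> A" unfolding a_def by (rule obs_slice[OF x])
  define y where "y = Y (ev v (before s g))"
  define w where "w = ev u (before s f)"
  have py: "p y = y" using adapted_past[OF Y, of "ev v (before s g)"] by (simp add: y_def past_id_expv[OF restr_step_on(1)[OF g]])
  have pw: "p w = w" unfolding w_def by (rule past_id_expv[OF restr_step_on(1)[OF f]])
  have us: "unshift s (after s h) = unshift s h" for h :: "real => 'k" by (auto simp: unshift_def restr_to_def)
  let ?M = "amplify (pdil s) (sigma_shift s x) :: (('h, 'k) sp, 'k fock) htens => (('h, 'k) sp, 'k fock) htens"
  have "cinner (ev u f) (J s x (Y (ev v g))) = cinner (cadj ?V (ev u f)) (?M (cadj ?V (Y (ev v g))))"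
    by (simp add: J_eq[OF s x] cadj_left[OF Vb])
  also have "\<dots> = cinner (ev w (after s f)) (?M (ev y (after s g)))" unfolding Vs_expv[OF f] Vs_adapted[OF Y g] y_def w_def ..
  also have "\<dots> = cinner w ((block (expv (after s f)) ?M (expv (after s g))) y)"
    unfolding comp_apply cadj_right[OF E_ket_bc] by (simp only: E_ket_def)
  also have "\<dots> = cinner w ((cadj (pdil s) o (a \<odot> id) o pdil s) y)"
    unfolding amplify_slice[OF pdil_props(1)[OF s] sigma_bc[OF s obs_bc[OF x]]] sigma_slice[OF s obs_bc[OF x] restr_step_on(2)[OF f] restr_step_on(2)[OF g]] us a_def ..
  also have "\<dots> = cinner w (p (j s a y))" by (simp only: pdil_props(4)[OF s a] comp_apply py)
  also have "\<dots> = cinner w (j s a y)" using cadj_left[OF bc_past_id, of s w "j s a y"] by (simp add: cadj_past_id pw)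
  finally show ?thesis unfolding a_def y_def w_def .
qed

end

section \<open>Strong continuity and the perturbation equation\<close>

subsection \<open>Strongly continuous families\<close>

text \<open>Local boundedness is built in because continuity of products, and of
  \<open>T s (v s)\<close> with a moving vector, is derived from it.\<close>

definition strong_family :: "(real => 'a::chilbert_space => 'b::chilbert_space) => bool" where "strong_family T \<longleftrightarrow> (\<forall>t\<ge>0. bc (T t)) \<and>
    (\<forall>N. \<exists>C\<ge>0. \<forall>t\<in>{0..N}. \<forall>x. norm (T t x) <= C * norm x) \<and> (\<forall>x. continuous_on {0..} (%t. T t x))"

lemma sf_bc: "strong_family T ==> 0 <= t ==> bc (T t)" unfolding strong_family_def by blast

lemma sf_cont: "strong_family T ==> continuous_on {0..} (%t. T t x)" unfolding strong_family_def by blast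

lemma sf_bound: "strong_family T ==> \<exists>C\<ge>0. \<forall>t\<in>{0..N}. \<forall>x. norm (T t x) <= C * norm x" unfolding strong_family_def by blast

lemma eventually_below: "eventually (%s. s \<in> {0..t + 1}) (at (t::real) within {0..})"
proof -
  have "eventually (%s. s < t + 1) (at t within {0..})" by (rule order_tendstoD(2)[OF tendsto_ident_at]) simp
  moreover have "eventually (%s. s \<in> {0..}) (at t within {0..})" by (simp add: eventually_at_filter)
  ultimately show ?thesis by eventually_elim simp
qed

lemma sf_eventually:
  assumes "strong_family T" shows "\<exists>C\<ge>0. eventually (%s. bc (T s) \<and> (\<forall>x. norm (T s x) <= C * norm x)) (at t within {0..})"
proof -
  obtain C where C: "C >= 0" "\<forall>s\<in>{0..t+1}. \<forall>x. norm (T s x) <= C * norm x" using sf_bound[OF assms] by blast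
  have "eventually (%s. bc (T s) \<and> (\<forall>x. norm (T s x) <= C * norm x)) (at t within {0..})"
    using eventually_below[of t] by eventually_elim (use C(2) sf_bc[OF assms] in auto)
  thus ?thesis using C(1) by blast
qed

lemma sf_lim: "strong_family T ==> 0 <= t ==> ((%s. T s x) \<longlongrightarrow> T t x) (at t within {0..})" using sf_cont[of T x] by (simp add: continuous_on)

lemma sf_tendsto:
  assumes T: "strong_family T" and t: "0 <= t" and S: "S \<subseteq> {0..}" and v: "(v \<longlongrightarrow> w) (at t within S)"
  shows "((%s. T s (v s)) \<longlongrightarrow> T t w) (at t within S)"
proof -
  obtain C where C: "C >= 0" "eventually (%s. bc (T s) \<and> (\<forall>x. norm (T s x) <= C * norm x)) (at t within {0..})"
    using sf_eventually[OF T] by blast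
  have le: "at t within S <= at t within {0..}" by (rule at_le[OF S])
  have "((%s. C * norm (v s - w)) \<longlongrightarrow> C * norm (w - w)) (at t within S)" by (intro tendsto_intros v)
  hence "((%s. C * norm (v s - w)) \<longlongrightarrow> 0) (at t within S)" by simp
  moreover have "eventually (%s. norm (T s (v s) - T s w) <= C * norm (v s - w)) (at t within S)"
    using filter_leD[OF le C(2)] by eventually_elim (simp add: bc_diff[symmetric])
  ultimately have "((%s. T s (v s) - T s w) \<longlongrightarrow> 0) (at t within S)" by (rule Lim_null_comparison[rotated])
  from tendsto_add[OF this tendsto_mono[OF le sf_lim[OF T t, of w]]] show ?thesis by simp
qed

lemma sf_continuous_on: "strong_family T ==> continuous_on {0..} v ==> continuous_on {0..} (%s. T s (v s))"
  unfolding continuous_on by (auto intro: sf_tendsto)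

lemma strong_familyI:
  assumes bc: "\<And>t. 0 <= t ==> bc (T t)" and bd: "\<And>N. 0 <= N ==> \<exists>C. \<forall>t\<in>{0..N}. \<forall>x. norm (T t x) <= C * norm x"
    and G: "closure (cspan G) = UNIV" and cont: "\<And>g. g \<in> G ==> continuous_on {0..} (%t. T t g)" shows "strong_family T"
  unfolding strong_family_def
proof (intro conjI allI impI bc)
  show bd': "\<exists>C\<ge>0. \<forall>t\<in>{0..N}. \<forall>x. norm (T t x) <= C * norm x" for N
  proof (cases "0 <= N")
    case True
    then obtain C where "\<forall>t\<in>{0..N}. \<forall>x. norm (T t x) <= C * norm x" using bd by blast
    thus ?thesis by (intro exI[of _ "\<bar>C\<bar>"] conjI ballI allI) (simp, meson abs_ge_self mult_right_mono norm_ge_zero order_trans)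
  qed auto
  fix x
  show "continuous_on {0..} (%t. T t x)" unfolding continuous_on
  proof
    fix t :: real assume t: "t \<in> {0..}"
    obtain C where C: "\<forall>s\<in>{0..t+1}. \<forall>x. norm (T s x) <= C * norm x" using bd' by blast
    show "((%s. T s x) \<longlongrightarrow> T t x) (at t within {0..})"
    proof (rule strong_convergence[where C = C, OF _ bc G])
      show "eventually (%s. bc (T s) \<and> (\<forall>x. norm (T s x) <= C * norm x)) (at t within {0..})"
        using eventually_below[of t] by eventually_elim (use C bc in auto)
      show "((%s. T s g) \<longlongrightarrow> T t g) (at t within {0..})" if "g \<in> G" for g using cont[OF that] t by (simp add: continuous_on)
    qed (use t in simp)
  qed
qed simp

lemma sf_comp: assumes S: "strong_family S" and T: "strong_family T" shows "strong_family (%t. S t o T t)" unfolding strong_family_def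
proof (intro conjI allI impI bc_compose sf_bc S T)
  fix N :: real
  obtain C where C: "C >= 0" "\<forall>t\<in>{0..N}. \<forall>x. norm (S t x) <= C * norm x" using sf_bound[OF S] by blast
  obtain D where D: "D >= 0" "\<forall>t\<in>{0..N}. \<forall>x. norm (T t x) <= D * norm x" using sf_bound[OF T] by blast
  have "norm ((S t o T t) x) <= (C * D) * norm x" if "t \<in> {0..N}" for t x
  proof -
    have "norm ((S t o T t) x) <= C * norm (T t x)" using C that by simp
    also have "\<dots> <= C * (D * norm x)" using D that C(1) by (intro mult_left_mono) auto
    finally show ?thesis by (simp add: mult.assoc)
  qed
  thus "\<exists>C\<ge>0. \<forall>t\<in>{0..N}. \<forall>x. norm ((S t o T t) x) <= C * norm x" using C(1) D(1) by (intro exI[of _ "C * D"]) simp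
  show "continuous_on {0..} (%t. (S t o T t) x)" for x by (simp add: sf_continuous_on[OF S sf_cont[OF T]])
qed

lemma sf_const: assumes "bc T" shows "strong_family (%_. T)"
proof -
  obtain C where "0 <= C" "\<And>x. norm (T x) <= C * norm x" using bc_bound[OF assms] by blast
  thus ?thesis unfolding strong_family_def using assms by auto
qed

lemma sf_lincomb:
  assumes S: "strong_family S" and T: "strong_family T" shows "strong_family (%t x. S t x + c *C T t x)" unfolding strong_family_def
proof (intro conjI allI impI bc_plus bc_scaled sf_bc S T)
  fix N :: real
  obtain C where C: "C >= 0" "\<forall>t\<in>{0..N}. \<forall>x. norm (S t x) <= C * norm x" using sf_bound[OF S] by blast
  obtain D where D: "D >= 0" "\<forall>t\<in>{0..N}. \<forall>x. norm (T t x) <= D * norm x" using sf_bound[OF T] by blast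
  have "norm (S t x + c *C T t x) <= (C + cmod c * D) * norm x" if "t \<in> {0..N}" for t x
  proof -
    have "norm (S t x + c *C T t x) <= norm (S t x) + cmod c * norm (T t x)" using norm_triangle_ineq[of "S t x" "c *C T t x"] by (simp add: norm_scaleC)
    also have "\<dots> <= C * norm x + cmod c * (D * norm x)" using C D that by (intro add_mono mult_left_mono) auto
    finally show ?thesis by (simp add: algebra_simps)
  qed
  thus "\<exists>C\<ge>0. \<forall>t\<in>{0..N}. \<forall>x. norm (S t x + c *C T t x) <= C * norm x" using C(1) D(1) by (intro exI[of _ "C + cmod c * D"]) simp
  show "continuous_on {0..} (%t. S t x + c *C T t x)" for x
    by (intro continuous_on_add continuous_on_scaleC continuous_on_const sf_cont S T)
qed

lemma sf_tensor:
  fixes T :: "real => 'a::chilbert_space => 'b::chilbert_space"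
  assumes T: "strong_family T" shows "strong_family (%t. id \<odot> T t :: ('c::chilbert_space, 'a) htens => _)"
proof (rule strong_familyI[OF _ _ tensors_total])
  show "bc (id \<odot> T t :: ('c, 'a) htens => _)" if "0 <= t" for t by (intro bc_op_tensor bc_id sf_bc[OF T that])
  fix N :: real
  obtain C where C: "C >= 0" "\<forall>t\<in>{0..N}. \<forall>x. norm (T t x) <= C * norm x" using sf_bound[OF T] by blast
  show "\<exists>C. \<forall>t\<in>{0..N}. \<forall>x. norm ((id \<odot> T t :: ('c, 'a) htens => _) x) <= C * norm x"
  proof (intro exI[of _ C] ballI allI)
    fix t x assume t: "t \<in> {0..N}"
    show "norm ((id \<odot> T t :: ('c, 'a) htens => _) x) <= C * norm x"
      using norm_op_tensor[OF bc_id _ _ sf_bc[OF T, of t], of 1 C x] C t by simp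
  qed
next
  fix g :: "('c, 'a) htens" assume "g \<in> tensors"
  then obtain u v where g: "g = u \<otimes> v" unfolding tensors_def by blast
  have "continuous_on {0..} (%t. u \<otimes> T t v)"
    using sf_cont[OF T, of v] unfolding continuous_on by (intro ballI tendsto_tens tendsto_const) auto
  thus "continuous_on {0..} (%t. (id \<odot> T t :: ('c, 'a) htens => _) g)" by (rule continuous_on_eq) (simp add: g op_tensor_apply sf_bc[OF T])
qed


subsection \<open>The ampliation of a flow to the initial space\<close>

locale perturbed_flow = flow A j
  for A :: "('h::chilbert_space => 'h) set" and j :: "real => ('h => 'h) => ('h, 'k::chilbert_space) sp => ('h, 'k) sp" +
  fixes F :: "(complex \<times> 'k, 'h) htens => (complex \<times> 'k, 'h) htens" assumes F: "F \<in> vn_tensor bounded_ops A"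
begin

abbreviation "jF t \<equiv> tilde_map A j t F"

text \<open>Puts \<open>A\<close> into the first factor, where slicing and \<open>amplify\<close>
  operate.\<close>

definition "Fl = tflip o F o tflip"

definition "entry c d = block c Fl d"

text \<open>A slice of the square of the coefficient: its image under \<open>j t\<close> gives the
  norms of the values of \<open>jF t\<close> on elementary tensors.\<close>

definition "sq d = block d (cadj Fl o Fl) d"

lemma Fl_vn: "Fl \<in> vn_tensor A (corner id)" using vn_tensor_flip[OF order_refl A_bounded F] by (simp add: Fl_def)

lemma Fl_bc: "bc Fl" and Fl_commute: "b \<in> commutant A ==> (b \<odot> id) o Fl = Fl o (b \<odot> id)"
  using Fl_vn unfolding vn_tensor_corner[OF projection_id] by blast+

lemma entry_A: "entry c d \<in> A" unfolding entry_def by (rule vn_tensor_slice[OF Fl_bc Fl_commute])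

lemma sq_A: "sq d \<in> A" unfolding sq_def
proof (rule vn_tensor_slice)
  show "bc (cadj Fl o Fl)" by (intro bc_compose bc_cadj Fl_bc)
  fix b assume b: "b \<in> commutant A"
  note bb = commutantD(1)[OF b]
  have b': "cadj b \<in> commutant A" by (rule commutant_cadj[OF b A_bounded A_cadj])
  have "cadj ((cadj b \<odot> id) o Fl) = cadj (Fl o (cadj b \<odot> id))" by (simp only: Fl_commute[OF b'])
  hence c: "cadj Fl o (b \<odot> id) = (b \<odot> id) o cadj Fl"
    by (simp only: cadj_comp Fl_bc bc_op_tensor bc_cadj bc_id bb cadj_op_tensor cadj_cadj cadj_id)
  have "(b \<odot> id) o (cadj Fl o Fl) = (cadj Fl o (b \<odot> id)) o Fl" unfolding c by (rule comp_assoc[symmetric])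
  also have "\<dots> = cadj Fl o (Fl o (b \<odot> id))" unfolding comp_assoc Fl_commute[OF b] ..
  finally show "(b \<odot> id) o (cadj Fl o Fl) = (cadj Fl o Fl) o (b \<odot> id)" by (simp only: comp_assoc)
qed

lemma jF_eq: "0 <= t ==> jF t = tflip o amplify (dil t) Fl o tflip" unfolding tilde_map_def Fl_def
  by (rule normal_tensor_map_flip_amplify[OF dil_props(1) _ F]) (simp_all only: dil_rep)

lemma jF_bc: "0 <= t ==> bc (jF t)" by (simp only: jF_eq) (intro bc_compose bc_tflip bc_amplify dil_props(1) Fl_bc)

lemma amplify_dil_matrix:
  assumes t: "0 <= t" and x: "bc x" and a: "block c x d \<in> A"
  shows "cinner (zeta \<otimes> c) (amplify (dil t) x (eta \<otimes> d)) = cinner zeta (j t (block c x d) eta)"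
proof -
  have "cinner (zeta \<otimes> c) (amplify (dil t) x (eta \<otimes> d)) = cinner zeta ((block c (amplify (dil t) x) d) eta)"
    unfolding comp_apply cadj_right[OF E_ket_bc] by (simp only: E_ket_def)
  thus ?thesis unfolding amplify_slice[OF dil_props(1)[OF t] x] dil_rep[OF t a] .
qed

lemma jF_matrix: assumes t: "0 <= t" shows "cinner (c \<otimes> zeta) (jF t (d \<otimes> eta)) = cinner zeta (j t (entry c d) eta)"
proof -
  have "cinner (c \<otimes> zeta) (jF t (d \<otimes> eta)) = cinner (tflip (c \<otimes> zeta)) (amplify (dil t) Fl (eta \<otimes> d))"
    using cadj_left[OF bc_tflip, of "c \<otimes> zeta"] by (simp add: jF_eq[OF t])
  thus ?thesis using amplify_dil_matrix[OF t Fl_bc entry_A[unfolded entry_def]] by (simp add: entry_def)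
qed

lemma norm_jF: assumes t: "0 <= t" shows "norm (jF t (d \<otimes> eta))^2 = Re (cinner eta (j t (sq d) eta))"
proof -
  let ?M = "amplify (dil t) :: ((_, complex \<times> 'k) htens => _) => _"
  have inv: "dil t o (cadj (dil t) o (a \<odot> id) o dil t) = (a \<odot> id) o dil t" if "a \<in> A" for a
    by (simp only: dil_rep[OF t that] dil_props(3)[OF t that])
  have m: "?M (cadj Fl o Fl) = cadj (?M Fl) o ?M Fl" unfolding cadj_amplify[OF dil_props(1)[OF t] Fl_bc]
    by (rule amplify_mult[OF dil_props(1)[OF t] A_bounded corner_bounded bc_cadj[OF Fl_bc] Fl_vn inv])
  have b: "bc (?M Fl)" by (intro bc_amplify dil_props(1) t Fl_bc)
  have "cinner (jF t (d \<otimes> eta)) (jF t (d \<otimes> eta)) = cinner (?M Fl (eta \<otimes> d)) (?M Fl (eta \<otimes> d))"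
    using cadj_left[OF bc_tflip, of "tflip (?M Fl (eta \<otimes> d))"] by (simp add: jF_eq[OF t])
  also have "\<dots> = cinner (eta \<otimes> d) (?M (cadj Fl o Fl) (eta \<otimes> d))" by (simp add: m cadj_right[OF b])
  also have "\<dots> = cinner eta (j t (sq d) eta)"
    unfolding sq_def by (rule amplify_dil_matrix[OF t _ sq_A[unfolded sq_def]]) (intro bc_compose bc_cadj Fl_bc)
  finally show ?thesis by (simp add: norm_sq_cinner)
qed

text \<open>The flow itself is only assumed ultraweakly continuous. Weak continuity on elementary
  tensors comes from matrix elements; the norms are continuous too, because by multiplicativity they
  are matrix elements of \<open>j t (sq d)\<close>. Weak convergence together with convergence of
  norms is strong convergence.\<close>

lemma sf_jF: "strong_family jF"
proof (rule strong_familyI[OF jF_bc _ tensors_total])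
  fix N :: real
  obtain C where C: "0 <= C" "\<And>x. norm (Fl x) <= C * norm x" using bc_bound[OF Fl_bc] by blast
  have fl: "norm (tflip x) = norm x" for x :: "('a::chilbert_space, 'b::chilbert_space) htens"
    using cadj_left[OF bc_tflip, of "tflip x" x] by (rule_tac power2_eq_imp_eq) (simp_all add: norm_sq_cinner)
  have FB: "norm (jF t x) <= C * norm x" if "0 <= t" for t x
    using amplify_norm[OF dil_props(1)[OF that] _ Fl_bc C, of "tflip x"] by (simp add: jF_eq[OF that] fl norm_dil[OF that])
  show "\<exists>C. \<forall>t\<in>{0..N}. \<forall>x. norm (jF t x) <= C * norm x" using FB by (intro exI[of _ C]) simp
  fix g :: "('h, 'k) hsp" assume "g \<in> tensors"
  then obtain d eta where g: "g = d \<otimes> eta" unfolding tensors_def by blast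
  have bound: "norm (cinner (jF t g) z) <= (C * norm g) * norm z" if "0 <= t" for t z
    using ch.cauchy_schwarz[of "jF t g" z] mult_right_mono[OF FB[OF that, of g] norm_ge_zero[of z]] by linarith
  \<comment> \<open>Weak continuity against all vectors is strong continuity of this scalar-valued
    family, so it may be checked on elementary tensors.\<close>
  have "strong_family (%t. cinner (jF t g))"
  proof (rule strong_familyI[OF bounded_clinear_cinner _ tensors_total])
    show "\<exists>C. \<forall>t\<in>{0..N}. \<forall>x. norm (cinner (jF t g) x) <= C * norm x" for N by (intro exI[of _ "C * norm g"]) (use bound in simp)
    fix z :: "('h, 'k) hsp" assume "z \<in> tensors"
    then obtain c zeta where z: "z = c \<otimes> zeta" unfolding tensors_def by blast
    have "continuous_on {0..} (%t. cnj (cinner zeta (j t (entry c d) eta)))" by (intro continuous_on_cnj j_cont[OF entry_A] uw_fun_vec)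
    thus "continuous_on {0..} (%t. cinner (jF t g) z)"
      by (rule continuous_on_eq) (simp add: g z jF_matrix[symmetric] cinner_commute[symmetric])
  qed
  note weak = sf_lim[OF this]
  show "continuous_on {0..} (%t. jF t g)" unfolding continuous_on
  proof
    fix t :: real assume "t \<in> {0..}"
    hence t: "0 <= t" by simp
    have "((%s. Re (cinner eta (j s (sq d) eta))) \<longlongrightarrow> Re (cinner eta (j t (sq d) eta))) (at t within {0..})"
      using j_cont[OF sq_A[of d] uw_fun_vec[of eta eta]] t unfolding continuous_on by (intro tendsto_Re) auto
    moreover have "eventually (%s. Re (cinner eta (j s (sq d) eta)) = norm (jF s g)^2) (at t within {0..})"
      unfolding eventually_at_filter g by (intro always_eventually allI impI) (simp only: norm_jF atLeast_iff)
    ultimately have n: "((%s. norm (jF s g)^2) \<longlongrightarrow> norm (jF t g)^2) (at t within {0..})"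
      unfolding g norm_jF[OF t] by (rule Lim_transform_eventually)
    have "((%s. norm (jF s g)^2 - 2 * Re (cinner (jF s g) (jF t g)) + norm (jF t g)^2) \<longlongrightarrow>
       norm (jF t g)^2 - 2 * Re (cinner (jF t g) (jF t g)) + norm (jF t g)^2) (at t within {0..})" by (intro tendsto_intros n weak t)
    moreover have "norm (jF s g - jF t g)^2 = norm (jF s g)^2 - 2 * Re (cinner (jF s g) (jF t g)) + norm (jF t g)^2" for s
      using ch.sn_expand[of "jF s g" "-1" "jF t g"] by (simp add: ch.sc_minus)
    ultimately have "((%s. norm (jF s g - jF t g)^2) \<longlongrightarrow> 0) (at t within {0..})" by (simp add: norm_sq_cinner)
    from tendsto_real_sqrt[OF this] show "((%s. jF s g) \<longlongrightarrow> jF t g) (at t within {0..})" by (simp add: LIM_zero_iff tendsto_norm_zero_iff)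
  qed
qed

end

subsection \<open>Right-continuous integrands\<close>

lemma rc_integrable:
  fixes q :: "real => complex" assumes rc: "\<And>x. 0 <= x ==> (q \<longlongrightarrow> q x) (at_right x)" and bd: "\<And>x. x \<in> {0..N} ==> norm (q x) <= B"
  shows "integrable (lebesgue_on {0..N}) q"
proof -
  define p where "p x = (if x < 0 then 0 else q x)" for x
  have "(p \<longlongrightarrow> p x) (at_right x)" if x: "0 <= x" for x
  proof (rule Lim_transform_eventually)
    show "eventually (%y. q y = p y) (at_right x)" using eventually_at_right_less[of x] by eventually_elim (use x in \<open>simp add: p_def\<close>)
    show "(q \<longlongrightarrow> p x) (at_right x)" using rc[OF x] x by (simp add: p_def)
  qed
  hence "p \<in> borel_measurable borel" by (rule borel_measurable_right_continuous) (simp_all add: p_def)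
  hence "p \<in> borel_measurable lebesgue" by (rule measurable_completion[where N = borel, of _ lborel, simplified])
  hence m: "q \<in> borel_measurable (lebesgue_on {0..N})"
    by (rule measurable_cong[THEN iffD1, OF _ measurable_restrict_space1, rotated]) (simp add: p_def space_restrict_space)
  interpret finite_measure "lebesgue_on {0..N}" 
    by (rule finite_measureI) (simp add: emeasure_restrict_space space_restrict_space emeasure_lborel_Icc_eq)
  show ?thesis by (rule integrable_const_bound[OF _ m, where B = B]) (auto intro!: AE_I2 bd simp: space_restrict_space)
qed

text \<open>Integrands jump where the step functions do, so right continuity is the regularity at
  hand; with local bounds it gives both kinds of integrability.\<close>

lemma rc_locally_integrable:
  fixes f :: "real => 'a::chilbert_space" assumes rc: "\<And>x. 0 <= x ==> (f \<longlongrightarrow> f x) (at_right x)" and bd: "\<And>N. \<exists>B. \<forall>x\<in>{0..N}. norm (f x) <= B"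
  shows "locally_integrable f" "locally_square_integrable f"
proof -
  have m: "strongly_measurable (lebesgue_on {0..N}) f" for N by (rule strongly_measurable_right_continuous) (auto intro: rc)
  have i: "integrable (lebesgue_on {0..N}) (%s. norm (f s) ^ k)" for N k
  proof -
    obtain B where B: "\<forall>x\<in>{0..N}. norm (f x) <= B" using bd by blast
    have "integrable (lebesgue_on {0..N}) (%s. complex_of_real (norm (f s) ^ k))"
    proof (rule rc_integrable)
      show "((%s. complex_of_real (norm (f s) ^ k)) \<longlongrightarrow> complex_of_real (norm (f x) ^ k)) (at_right x)" if "0 <= x" for x
        by (intro tendsto_intros rc that)
      show "norm (complex_of_real (norm (f x) ^ k)) <= B ^ k" if "x \<in> {0..N}" for x using B that by (simp add: power_mono norm_power)
    qed
    from integrable_Re[OF this] show ?thesis by simp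
  qed
  show "locally_integrable f" unfolding locally_integrable_def using m i[of _ 1] by simp
  show "locally_square_integrable f" unfolding locally_square_integrable_def using m i[of _ 2] by simp
qed

lemma khat_rc:
  assumes f: "f \<in> step_fun" and s: "0 <= s" shows "(khat f \<longlongrightarrow> khat f s) (at_right s)"
  unfolding khat_def by (intro tendsto_intros step_right_continuous f s)

lemma khat_bounded: assumes f: "f \<in> step_fun" shows "\<exists>B. \<forall>s. norm (khat f s) <= B"
proof -
  obtain B where "\<forall>s. norm (f s) <= B" using step_bounded[OF f] by (elim exE)
  thus ?thesis by (intro exI[of _ "1 + B"]) (auto simp: khat_def intro: order_trans[OF norm_Pair_le])
qed

abbreviation hdom :: "('h::chilbert_space, 'k::chilbert_space) hsp set" where "hdom \<equiv> cspan {c \<otimes> zeta | c zeta. zeta \<in> exp_dom}"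

lemma hdomI: "zeta \<in> exp_dom ==> c \<otimes> zeta \<in> hdom" by (rule cspan_base) blast

lemma nabla_sum:
  assumes "0 <= s" "finite I" "\<And>i. i \<in> I ==> snd i \<in> step_fun"
  shows "the (nabla s (\<Sum>i\<in>I. c i *C (fst i \<otimes> expv (snd i)))) = (\<Sum>i\<in>I. c i *C (khat (snd i) s \<otimes> (fst i \<otimes> expv (snd i))))"
proof -
  have "the (nabla s (\<Sum>i\<in>I. c i *C (fst i \<otimes> expv (snd i)))) = (\<Sum>i\<in>I. c i *C the (nabla s (fst i \<otimes> expv (snd i))))"
    by (rule lin_op_sum[OF lin_op_nabla[OF assms(1)] assms(2)]) (simp add: dom_nabla[OF assms(1)] exp_domI assms(3))
  also have "\<dots> = (\<Sum>i\<in>I. c i *C (khat (snd i) s \<otimes> (fst i \<otimes> expv (snd i))))"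
    by (intro sum.cong refl) (simp add: nabla_expv[OF assms(1) assms(3)])
  finally show ?thesis .
qed

lemma nabla_dom:
  fixes zeta :: "('h::chilbert_space, 'k::chilbert_space) sp" assumes zeta: "zeta \<in> exp_dom" shows nabla_hdom: "0 <= s ==> the (nabla s zeta) \<in> hdom"
    and nabla_rc: "0 <= s ==> ((%s. the (nabla s zeta)) \<longlongrightarrow> the (nabla s zeta)) (at_right s)" and nabla_bound: "\<exists>B. \<forall>s\<ge>0. norm (the (nabla s zeta)) <= B"
proof -
  obtain I :: "('h \<times> (real => 'k)) set" and c where I: "finite I" "\<forall>i\<in>I. snd i \<in> step_fun" "zeta = (\<Sum>i\<in>I. c i *C (fst i \<otimes> expv (snd i)))"
    using exp_domE[OF zeta] by (elim exE conjE)
  define N where "N s = (\<Sum>i\<in>I. c i *C (khat (snd i) s \<otimes> (fst i \<otimes> expv (snd i))))" for s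
  have N: "the (nabla s zeta) = N s" if "0 <= s" for s unfolding I(3) N_def by (rule nabla_sum[OF that I(1)]) (use I(2) in blast)
  show "the (nabla s zeta) \<in> hdom" if "0 <= s" unfolding N[OF that] N_def
    by (intro csubspace_sum csubspace_scale csubspace_cspan hdomI exp_domI) (use I(2) in blast)
  show "((%s. the (nabla s zeta)) \<longlongrightarrow> the (nabla s zeta)) (at_right s)" if s: "0 <= s"
  proof (rule Lim_transform_eventually)
    show "(N \<longlongrightarrow> the (nabla s zeta)) (at_right s)" unfolding N[OF s] unfolding N_def
      by (intro tendsto_sum tendsto_scaleC tendsto_tens tendsto_const khat_rc s) (use I(2) in blast)
    show "eventually (%s. N s = the (nabla s zeta)) (at_right s)"
      using eventually_at_right_less[of s] by eventually_elim (use s in \<open>simp add: N\<close>)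
  qed
  obtain B where B: "\<And>f s. f \<in> step_fun ==> norm (khat (f :: real => 'k) s) <= B f" using khat_bounded by metis
  show "\<exists>B. \<forall>s\<ge>0. norm (the (nabla s zeta)) <= B"
  proof (intro exI allI impI)
    fix s :: real assume s: "0 <= s"
    show "norm (the (nabla s zeta)) <= (\<Sum>i\<in>I. cmod (c i) * (B (snd i) * norm (fst i \<otimes> expv (snd i))))" unfolding N[OF s] N_def
      by (intro order_trans[OF norm_sum] sum_mono)
        (use B I(2) in \<open>simp add: norm_scaleC norm_tens[of "khat _ _"] mult_left_mono mult_right_mono\<close>)
  qed
qed


subsection \<open>Strong solutions\<close>

lemma adapted_lincomb:
  assumes "adapted r X" "adapted r Y" shows "adapted r (%x. X x + c *C Y x)" unfolding adapted_def
  by (intro allI ballI, simp only: cinner_add_right cinner_scaleC_right, subst adaptedD[OF assms(1)], assumption+,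
      subst adaptedD[OF assms(2)], assumption+) (simp add: algebra_simps)

lemma E_hat_ket_bc: "bc (E_hat_ket c x)" unfolding E_hat_ket_def using bc_compose[OF bc_tens_left bc_tens_right] by (simp add: o_def)

lemma sf_measurable: "strong_family z ==> (%t. cinner zeta' (z t zeta)) \<in> borel_measurable (lebesgue_on {0..})"
  by (intro continuous_imp_measurable_on_sets_lebesgue continuous_on_cinner continuous_on_const sf_cont) auto

context perturbed_flow
begin

lemma pert_integrand_op_on:
  assumes "Y t = op_on (z t) exp_dom" "bc (z t)" shows "pert_integrand A j F Y t = op_on (jF t o (id \<odot> z t)) hdom"
  unfolding pert_integrand_def assms(1) ampliation_op_on[OF assms(2)] by (auto simp: restrict_map_def)

abbreviation "integrand z zeta s \<equiv> jF s ((id \<odot> z s) (the (nabla s zeta)))"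

text \<open>The matrix element of the integrand after the noise factor
  \<open>complex \<times> 'k\<close> has been sliced away: only \<open>j s\<close> on
  \<open>A\<close> remains, and \<open>tilde_map\<close> has disappeared.\<close>

definition matrix_integrand :: "(real => ('h, 'k) sp => ('h, 'k) sp) => 'h => (real => 'k) => 'h => (real => 'k) => real => complex"
  where "matrix_integrand z u f v g s = cinner (ev u f) (j s (entry (khat f s) (khat g s)) (z s (ev v g)))"

lemma matrix_integrand:
  assumes s: "0 <= s" and z: "bc (z s)" and fg: "f \<in> step_fun" "g \<in> step_fun"
  shows "cinner (the (nabla s (ev u f))) (integrand z (ev v g) s) = matrix_integrand z u f v g s"
  by (simp add: nabla_expv s fg op_tensor_apply z jF_matrix matrix_integrand_def)

lemma integrand_rc:
  assumes z: "strong_family z" and zeta: "zeta \<in> exp_dom"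
  shows "0 <= s ==> ((%s. integrand z zeta s) \<longlongrightarrow> integrand z zeta s) (at_right s)"
    and "\<exists>B. \<forall>s\<in>{0..N}. norm (integrand z zeta s) <= B"
proof -
  have sf: "strong_family (%s. jF s o (id \<odot> z s))" by (intro sf_comp sf_jF sf_tensor z)
  show "((%s. integrand z zeta s) \<longlongrightarrow> integrand z zeta s) (at_right s)" if s: "0 <= s"
    using sf_tendsto[OF sf s _ nabla_rc[OF zeta s]] s by (simp add: subset_eq)
  obtain C where C: "C >= 0" "\<forall>s\<in>{0..N}. \<forall>x. norm ((jF s o (id \<odot> z s)) x) <= C * norm x" using sf_bound[OF sf] by blast
  obtain B where B: "\<forall>s\<ge>0. norm (the (nabla s zeta)) <= B" using nabla_bound[OF zeta] by blast
  show "\<exists>B. \<forall>s\<in>{0..N}. norm (integrand z zeta s) <= B"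
  proof (intro exI ballI)
    fix s assume s: "s \<in> {0..N}"
    have "norm (integrand z zeta s) <= C * norm (the (nabla s zeta))" using C(2) s by simp
    also have "\<dots> <= C * B" using B s C(1) by (intro mult_left_mono) auto
    finally show "norm (integrand z zeta s) <= C * B" .
  qed
qed

lemma matrix_integrable:
  assumes z: "strong_family z" and zeta: "zeta \<in> exp_dom" "zeta' \<in> exp_dom"
  shows "integrable (lebesgue_on {0..N}) (%s. cinner (the (nabla s zeta')) (integrand z zeta s))"
proof -
  obtain B where B: "\<forall>s\<in>{0..N}. norm (integrand z zeta s) <= B" using integrand_rc(2)[OF z zeta(1), of N] by (elim exE)
  obtain C where C: "\<forall>s\<ge>0. norm (the (nabla s zeta')) <= C" using nabla_bound[OF zeta(2)] by (elim exE)
  show ?thesis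
  proof (rule rc_integrable)
    fix s assume s: "s \<in> {0..N}"
    have "norm (cinner (the (nabla s zeta')) (integrand z zeta s)) <= norm (the (nabla s zeta')) * norm (integrand z zeta s)"
      by (rule ch.cauchy_schwarz)
    also have "\<dots> <= C * B" using B C s by (intro mult_mono) (auto intro: order_trans[OF norm_ge_zero])
    finally show "norm (cinner (the (nabla s zeta')) (integrand z zeta s)) <= C * B" .
  qed (intro tendsto_cinner' nabla_rc integrand_rc z zeta)
qed

text \<open>For a strongly continuous adapted family, integrability and adaptedness of the integrand
  are consequences, and the equation extends from exponential vectors to \<open>exp_dom\<close> by
  sesquilinearity. Solutions can thus be recognized by matrix elements alone.\<close>

lemma strong_solutionI:
  assumes z: "strong_family z" and ad: "\<And>t. 0 <= t ==> adapted t (z t)" and eq: "\<And>t u v f g. 0 <= t ==> f \<in> step_fun ==> g \<in> step_fun ==>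
      cinner (ev u f) (z t (ev v g)) = cinner (ev u f) (ev v g) + (LINT s|lebesgue_on {0..t}. matrix_integrand z u f v g s)"
  shows "strong_solution A j F (%t. op_on (z t) exp_dom)"
proof -
  note zb = sf_bc[OF z]
  define P where "P = pert_integrand A j F (%t. op_on (z t) exp_dom)"
  have P: "P s = op_on (jF s o (id \<odot> z s)) hdom" if "0 <= s" for s unfolding P_def using that by (intro pert_integrand_op_on zb) simp
  have Pb: "bc (jF s o (id \<odot> z s))" if "0 <= s" for s by (intro bc_compose jF_bc bc_op_tensor bc_id zb that)
  have Pn: "the (P s (the (nabla s zeta))) = integrand z zeta s" if "0 <= s" "zeta \<in> exp_dom" for s zeta
    using nabla_hdom[OF that(2,1)] by (simp add: P[OF that(1)])
  have op: "op_process (%t. op_on (x t) exp_dom)" if "strong_family x" "\<And>t. 0 <= t ==> adapted t (x t)" for x :: "real => ('h, 'k) sp => _"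
    using op_process_op_on[of x] sf_bc[OF that(1)] sf_measurable[OF that(1)] that(2) by blast
  \<comment> \<open>The integral process has to be exhibited separately: it is the candidate minus
    its initial value, the identity.\<close>
  define x where "x t zeta = z t zeta + (-1) *C id zeta" for t and zeta :: "('h, 'k) sp"
  have x: "strong_family x" unfolding x_def by (intro sf_lincomb z sf_const bc_id)
  have xa: "adapted t (x t)" if "0 <= t" for t unfolding x_def by (intro adapted_lincomb ad adapted_id that)
  have "qs_integrable P" unfolding qs_integrable_def
  proof (intro conjI allI impI ballI)
    show "lin_op (P t)" if "0 <= t" for t unfolding P[OF that] by (intro lin_op_on csubspace_cspan Pb that)
    fix zeta :: "('h, 'k) sp" assume zeta: "zeta \<in> exp_dom"
    show "the (nabla t zeta) \<in> dom (P t)" if "0 <= t" for t using nabla_hdom[OF zeta that] by (simp only: P[OF that] dom_op_on)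
    have D: "((%s. (D \<odot> id) (the (P s (the (nabla s zeta))))) \<longlongrightarrow> (D \<odot> id) (the (P s (the (nabla s zeta))))) (at_right s)"
      "\<exists>B. \<forall>s\<in>{0..N}. norm ((D \<odot> id) (the (P s (the (nabla s zeta)))) :: ('h, 'k) hsp) <= B"
      if s: "0 <= s" and D: "bc D" for D :: "complex \<times> 'k => complex \<times> 'k" and s N
    proof -
      have DD: "bc (D \<odot> id :: ('h, 'k) hsp => _)" by (intro bc_op_tensor D bc_id)
      show "((%s. (D \<odot> id) (the (P s (the (nabla s zeta))))) \<longlongrightarrow> (D \<odot> id) (the (P s (the (nabla s zeta))))) (at_right s)"
      proof (rule bc_tendsto[OF DD], rule Lim_transform_eventually)
        show "((%s. integrand z zeta s) \<longlongrightarrow> the (P s (the (nabla s zeta)))) (at_right s)"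
          unfolding Pn[OF s zeta] by (rule integrand_rc(1)[OF z zeta s])
        show "eventually (%s. integrand z zeta s = the (P s (the (nabla s zeta)))) (at_right s)"
          using eventually_at_right_less[of s] by eventually_elim (use s in \<open>simp add: Pn zeta\<close>)
      qed
      obtain B where B: "\<forall>s\<in>{0..N}. norm (integrand z zeta s) <= B" using integrand_rc(2)[OF z zeta, of N] by (elim exE)
      obtain C where C: "C >= 0" "\<And>y. norm ((D \<odot> id :: ('h, 'k) hsp => _) y) <= C * norm y" using bc_bound[OF DD] by blast
      show "\<exists>B. \<forall>s\<in>{0..N}. norm ((D \<odot> id) (the (P s (the (nabla s zeta)))) :: ('h, 'k) hsp) <= B"
        using B by (intro exI[of _ "C * B"] ballI order_trans[OF C(2)] mult_left_mono C(1)) (simp add: Pn zeta)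
    qed
    have D1: "bc (Defs.Delta :: complex \<times> 'k => _)"
      by (rule bounded_clinearI[where C = 1]) (auto simp: Defs.Delta_def norm_snd_le prod_eq_iff)
    have D2: "bc (Delta_perp :: complex \<times> 'k => _)" unfolding Delta_perp_def by (intro bc_minus bc_ident D1)
    show "locally_integrable (%s. (Delta_perp \<odot> id) (the (P s (the (nabla s zeta)))))"
      by (rule rc_locally_integrable(1)) (rule D(1)[OF _ D2] D(2)[OF order_refl D2]; assumption?)+
    show "locally_square_integrable (%s. (Defs.Delta \<odot> id) (the (P s (the (nabla s zeta)))))"
      by (rule rc_locally_integrable(2)) (rule D(1)[OF _ D1] D(2)[OF order_refl D1]; assumption?)+
  next
    fix t :: real and f g :: "real => 'k" and u :: 'h
    assume t: "0 <= t" and fg: "f \<in> step_fun" "g \<in> step_fun"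
    note fg' = step_restr_upto[OF fg(1), of t] step_restr_upto[OF fg(2), of t]
    show "E_hat_ket (khat g t) (expv (before t g)) u \<in> dom (P t)"
      by (simp only: P[OF t] dom_op_on E_hat_ket_def) (intro hdomI exp_domI fg')
    have e: "cinner v (cadj (E_hat_ket (khat f t) (expv f')) (the (P t (E_hat_ket (khat g t) (expv g') u)))) =
        cinner (ev v f') ((j t (entry (khat f t) (khat g t)) o z t) (ev u g'))" if "g' \<in> step_fun" for v f' g'
    proof -
      have "khat g t \<otimes> (ev u g') \<in> hdom" by (intro hdomI exp_domI that)
      thus ?thesis unfolding cadj_right[OF E_hat_ket_bc] unfolding E_hat_ket_def by (simp add: P[OF t] op_tensor_apply zb[OF t] jF_matrix[OF t])
    qed
    \<comment> \<open>Once the noise factor is sliced by the values of \<open>khat\<close> at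
      \<open>t\<close>, adaptedness of the integrand is adaptedness of a product of two adapted
      operators.\<close>
    have ad': "adapted t (j t (entry (khat f t) (khat g t)) o z t)"
    proof -
      interpret split_at t "fock_split t :: (('h, 'k) sp, 'k fock) htens => ('h, 'k) sp" by unfold_locales (use t in auto)
      show ?thesis by (intro adapted_comp j_bc j_adapted zb ad t entry_A)
    qed
    have n: "the (nabla t (E_ket (expv g) u)) = E_hat_ket (khat g t) (expv g) u"
      by (simp add: E_ket_def E_hat_ket_def nabla_expv[OF t fg(2)])
    show "cadj (E_hat_ket (khat f t) (expv f)) (the (P t (the (nabla t (E_ket (expv g) u))))) =
        cinner (expv (after t f)) (expv (after t g)) *C
        cadj (E_hat_ket (khat f t) (expv (before t f))) (the (P t (E_hat_ket (khat g t) (expv (before t g)) u)))"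
      by (rule cinner_ext) (simp only: n cinner_scaleC_right e[OF fg(2)] e[OF fg'(2)] adaptedD[OF ad' fg])
  qed
  moreover have "is_qs_integral P (%t. op_on (x t) exp_dom)" unfolding is_qs_integral_def
  proof (intro conjI allI impI ballI op x xa)
    fix zeta :: "('h, 'k) sp" assume zeta: "zeta \<in> exp_dom"
    show "continuous_on {0..} (%t. the (op_on (x t) exp_dom zeta))" using sf_cont[OF x, of zeta] zeta by simp
    fix t :: real and zeta' :: "('h, 'k) sp" assume t: "0 <= t" and zeta': "zeta' \<in> exp_dom"
    obtain I :: "('h \<times> (real => 'k)) set" and c where I: "finite I" "\<forall>i\<in>I. snd i \<in> step_fun" "zeta = (\<Sum>i\<in>I. c i *C (fst i \<otimes> expv (snd i)))"
      using exp_domE[OF zeta] by (elim exE conjE)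
    obtain K :: "('h \<times> (real => 'k)) set" and d where K: "finite K" "\<forall>i\<in>K. snd i \<in> step_fun" "zeta' = (\<Sum>i\<in>K. d i *C (fst i \<otimes> expv (snd i)))"
      using exp_domE[OF zeta'] by (elim exE conjE)
    let ?m = "%k i. matrix_integrand z (fst k) (snd k) (fst i) (snd i)"
    have int: "integrable (lebesgue_on {0..t}) (?m k i)" if "k \<in> K" "i \<in> I" for k i
    proof (rule Bochner_Integration.integrable_cong[THEN iffD1, OF refl _ matrix_integrable[OF z exp_domI exp_domI]])
      show "snd i \<in> step_fun" "snd k \<in> step_fun" using that I(2) K(2) by blast+
      fix s assume "s \<in> space (lebesgue_on {0..t})"
      hence s: "0 <= s" by (simp add: space_restrict_space)
      show "cinner (the (nabla s (fst k \<otimes> expv (snd k)))) (integrand z (fst i \<otimes> expv (snd i)) s) = ?m k i s"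
        by (rule matrix_integrand[where z = z, OF s zb[OF s]]) (use that I(2) K(2) in blast)+
    qed
    have "(LINT s|lebesgue_on {0..t}. cinner (the (nabla s zeta')) (the (P s (the (nabla s zeta))))) =
        (LINT s|lebesgue_on {0..t}. (\<Sum>k\<in>K. \<Sum>i\<in>I. (cnj (d k) * c i) * ?m k i s))"
    proof (rule Bochner_Integration.integral_cong[OF refl])
      fix s assume "s \<in> space (lebesgue_on {0..t})"
      hence s: "0 <= s" by (simp add: space_restrict_space)
      have m: "cinner (the (nabla s (fst k \<otimes> expv (snd k)))) (integrand z (fst i \<otimes> expv (snd i)) s) = ?m k i s" if "k \<in> K" "i \<in> I" for k i
        by (rule matrix_integrand[where z = z, OF s zb[OF s]]) (use that I(2) K(2) in blast)+
      have N: "the (nabla s (\<Sum>i\<in>I. c i *C (fst i \<otimes> expv (snd i)))) = (\<Sum>i\<in>I. c i *C the (nabla s (fst i \<otimes> expv (snd i))))"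
        if "finite I" "\<forall>i\<in>I. snd i \<in> step_fun" for I :: "('h \<times> (real => 'k)) set" and c
        by (rule lin_op_sum[OF lin_op_nabla[OF s] that(1)]) (use that(2) in \<open>simp add: dom_nabla[OF s] exp_domI\<close>)
      show "cinner (the (nabla s zeta')) (the (P s (the (nabla s zeta)))) = (\<Sum>k\<in>K. \<Sum>i\<in>I. (cnj (d k) * c i) * ?m k i s)"
        unfolding Pn[OF s zeta] unfolding I(3) K(3) N[OF I(1,2)] N[OF K(1,2)] bc_sum[OF Pb[OF s], unfolded comp_apply] bc_scale[OF Pb[OF s], unfolded comp_apply]
        unfolding cinner_sum_left ch.ip_sc_left unfolding cinner_sum_right cinner_scaleC_right sum_distrib_left
        by (intro sum.cong refl) (simp add: m)
    qed
    also have "\<dots> = (\<Sum>k\<in>K. \<Sum>i\<in>I. (cnj (d k) * c i) * (LINT s|lebesgue_on {0..t}. ?m k i s))"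
      by (simp add: Bochner_Integration.integral_sum int)
    also have "\<dots> = (\<Sum>k\<in>K. \<Sum>i\<in>I. (cnj (d k) * c i) * cinner (fst k \<otimes> expv (snd k)) (x t (fst i \<otimes> expv (snd i))))"
    proof (intro sum.cong refl arg_cong2[where f = "(*)"])
      fix k i assume "k \<in> K" "i \<in> I"
      hence "snd k \<in> step_fun" "snd i \<in> step_fun" using I(2) K(2) by blast+
      from eq[OF t this, of "fst k" "fst i"] show "(LINT s|lebesgue_on {0..t}. ?m k i s) = cinner (fst k \<otimes> expv (snd k)) (x t (fst i \<otimes> expv (snd i)))"
        by (simp add: x_def cinner_add_right cinner_scaleC_right)
    qed
    also have "\<dots> = cinner zeta' (x t zeta)" unfolding I(3) K(3) bc_sum[OF sf_bc[OF x t]] bc_scale[OF sf_bc[OF x t]]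
      unfolding cinner_sum_left ch.ip_sc_left unfolding cinner_sum_right cinner_scaleC_right sum_distrib_left by (simp only: mult.assoc)
    finally show "cinner zeta' (the (op_on (x t) exp_dom zeta)) = (LINT s|lebesgue_on {0..t}. cinner (the (nabla s zeta')) (the (P s (the (nabla s zeta)))))"
      using zeta by simp
  qed
  ultimately show ?thesis
    unfolding strong_solution_def P_def using op[OF z ad] by (intro conjI exI[of _ "%t. op_on (x t) exp_dom"]) (auto simp: x_def ch.sc_minus)
qed

text \<open>Continuity is obtained on \<open>exp_dom\<close> only, from the integral process;
  reaching all vectors is left to the uniform bounds.\<close>

lemma strong_solutionD:
  assumes Y: "strong_solution A j F Y" and z: "\<And>t. 0 <= t ==> bc (z t)" "\<And>t. 0 <= t ==> Y t = op_on (z t) exp_dom"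
  shows "zeta \<in> exp_dom ==> continuous_on {0..} (%t. z t zeta)" and "0 <= t ==> f \<in> step_fun ==> g \<in> step_fun ==>
      cinner (ev u f) (z t (ev v g)) = cinner (ev u f) (ev v g) + (LINT s|lebesgue_on {0..t}. matrix_integrand z u f v g s)"
proof -
  define P where "P = pert_integrand A j F Y"
  obtain X where X: "is_qs_integral P X" "\<forall>t\<ge>0. \<forall>zeta\<in>exp_dom. the (Y t zeta) = zeta + the (X t zeta)"
    using Y unfolding strong_solution_def P_def by (elim exE conjE)
  have zX: "z t zeta = zeta + the (X t zeta)" if "0 <= t" "zeta \<in> exp_dom" for t zeta using X(2)[rule_format, OF that] that by (simp add: z(2))
  show "continuous_on {0..} (%t. z t zeta)" if zeta: "zeta \<in> exp_dom"
  proof (rule continuous_on_eq)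
    show "continuous_on {0..} (%t. zeta + the (X t zeta))"
      using X(1) zeta unfolding is_qs_integral_def by (intro continuous_on_add continuous_on_const) blast
  qed (simp add: zX zeta)
  assume t: "0 <= t" and fg: "f \<in> step_fun" "g \<in> step_fun"
  have "cinner (ev u f) (the (X t (ev v g))) =
      (LINT s|lebesgue_on {0..t}. cinner (the (nabla s (ev u f))) (the (P s (the (nabla s (ev v g))))))"
    using X(1) t exp_domI[OF fg(1), of u] exp_domI[OF fg(2), of v] unfolding is_qs_integral_def by blast
  also have "\<dots> = (LINT s|lebesgue_on {0..t}. matrix_integrand z u f v g s)"
  proof (rule Bochner_Integration.integral_cong[OF refl])
    fix s assume "s \<in> space (lebesgue_on {0..t})"
    hence s: "0 <= s" by (simp add: space_restrict_space)
    show "cinner (the (nabla s (ev u f))) (the (P s (the (nabla s (ev v g))))) = matrix_integrand z u f v g s"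
      unfolding P_def pert_integrand_op_on[where Y = Y and z = z, OF z(2)[OF s] z(1)[OF s]]
      using nabla_hdom[OF exp_domI[OF fg(2), of v] s] by (simp only: op_on_apply option.sel comp_apply matrix_integrand[where z = z, OF s z(1)[OF s] fg, symmetric])
  qed
  finally show "cinner (ev u f) (z t (ev v g)) = cinner (ev u f) (ev v g) + (LINT s|lebesgue_on {0..t}. matrix_integrand z u f v g s)"
    by (simp add: zX t exp_domI fg cinner_add_right)
qed

end

section \<open>Further solutions and the cocycle identity\<close>

subsection \<open>Multiplier cocycles from unique solutions\<close>

lemma adapted_initial:
  fixes X :: "('h::chilbert_space, 'k::chilbert_space) sp => ('h, 'k) sp" assumes b: "bc b" and X: "adapted r X"
  shows "adapted r ((b \<odot> id) o X)" "adapted r (X o (b \<odot> id))"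
proof -
  have l: "cinner (u \<otimes> w) ((b \<odot> id) x) = cinner (cadj b u \<otimes> w) x" for u :: 'h and w :: "'k fock" and x
    using cadj_left[OF bc_op_tensor[OF b bc_id], of "u \<otimes> w" x] by (simp add: cadj_op_tensor b op_tensor_apply bc_cadj)
  show "adapted r ((b \<odot> id) o X)" unfolding adapted_def comp_apply l using adaptedD[OF X] by blast
  show "adapted r (X o (b \<odot> id))" unfolding adapted_def comp_apply op_tensor_apply[OF b bc_id] id_apply using adaptedD[OF X] by blast
qed

context flow
begin

text \<open>\<open>J r\<close> tensors with the identity and multiplies by fixed operators; both
  operations preserve strong convergence of bounded families.\<close>

lemma sf_J:
  assumes r: "0 <= r" and x: "strong_family x" and obs: "\<And>t. 0 <= t ==> x t \<in> obs" shows "strong_family (%t. J r (x t))"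
  unfolding strong_family_def
proof (intro conjI allI impI J_bc r obs)
  fix N :: real
  obtain C where C: "C >= 0" "\<forall>t\<in>{0..N}. \<forall>z. norm (x t z) <= C * norm z" using sf_bound[OF x, of N] by (elim exE conjE)
  show "\<exists>C\<ge>0. \<forall>t\<in>{0..N}. \<forall>z. norm (J r (x t) z) <= C * norm z" using C by (intro exI[of _ C] conjI ballI allI J_norm r obs) auto
  fix zeta
  let ?V = "fock_split r :: (('h, 'k) sp, 'k fock) htens => ('h, 'k) sp"
  define S where "S t = (id \<odot> fock_shift r) o x t o (id \<odot> cadj (fock_shift r))" for t
  have S: "strong_family S" unfolding S_def by (intro sf_comp sf_const x bc_op_tensor bc_id bc_cadj bc_fock_shift r)
  have "continuous_on {0..} (%t. ?V (amplify (pdil r) (S t) (cadj ?V zeta)))" unfolding continuous_on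
  proof (rule ballI, rule bc_tendsto[OF bc_fock_split[OF r]])
    fix t :: real assume "t \<in> {0..}"
    hence t: "0 <= t" by simp
    obtain C where C: "C >= 0" "eventually (%s. bc (S s) \<and> (\<forall>x. norm (S s x) <= C * norm x)) (at t within {0..})"
      using sf_eventually[OF S, of t] by (elim exE conjE)
    show "((%t. amplify (pdil r) (S t) (cadj ?V zeta)) \<longlongrightarrow> amplify (pdil r) (S t) (cadj ?V zeta)) (at t within {0..})"
      by (rule amplify_strong_convergence[OF pdil_props(1)[OF r] C sf_bc[OF S t] sf_lim[OF S t]])
  qed
  thus "continuous_on {0..} (%t. J r (x t) zeta)" by (rule continuous_on_eq) (simp add: J_eq[OF r] obs sigma_eq[OF r] S_def)
qed

text \<open>Since \<open>x\<close> is adapted at \<open>t\<close>, the parts of the slicing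
  functions beyond \<open>t\<close> leave the slice as a scalar \<open>kappa\<close>. The shift is
  isometric, so \<open>kappa\<close> is the inner product of the futures beyond
  \<open>r + t\<close>.\<close>

lemma J_adapted:
  assumes r: "0 <= r" and t: "0 <= t" and x: "x \<in> obs" "adapted t x" and Y: "bc Y" "adapted r Y" shows "adapted (r + t) (J r x o Y)"
  unfolding adapted_def comp_apply
proof (intro allI ballI)
  fix u v :: 'h and f g :: "real => 'k" assume fg: "f \<in> step_fun" "g \<in> step_fun"
  have e: "before r (before (r + t) h) = before r h"
    "unshift r (before (r + t) h) = before t (unshift r h)"
    "(%s. after t (unshift r h) (s - r)) = after (r + t) h" for h :: "real => 'k"
    using r t by (auto simp: restr_to_def unshift_def fun_eq_iff)
  define kappa where "kappa = cinner (expv (after (r + t) f)) (expv (after (r + t) g))"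
  have kappa: "kappa = cinner (expv (after t (unshift r f))) (expv (after t (unshift r g)))"
  proof -
    have T: "fock_shift r (expv (after t (unshift r h))) = expv (after (r + t) h)" if "h \<in> step_fun" for h :: "real => 'k"
      using fock_shift_expv[OF r step_restr_from[OF unshift_step[OF that r]], of t] by (simp only: e)
    have "cinner (fock_shift r a) (fock_shift r b) = cinner a b" for a b :: "'k fock"
      using cadj_left[OF bc_fock_shift[OF r], of "fock_shift r a" b] fun_cong[OF fock_shift_isometry[OF r], of a] by simp
    thus ?thesis unfolding kappa_def T[OF fg(1), symmetric] T[OF fg(2), symmetric] by simp
  qed
  define a where "a = block (expv (before t (unshift r f))) x (expv (before t (unshift r g)))"
  have a: "a \<in> A" unfolding a_def by (rule obs_slice[OF x(1)])
  \<comment> \<open>Written as a combination with the zero operator because linearity of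
    \<open>j r\<close> is stated for combinations of this shape.\<close>
  have "block (expv (unshift r f)) x (expv (unshift r g)) = (%xi. (%_. 0) xi + kappa *C a xi)"
  proof (rule op_ext_cinner)
    fix u v :: 'h
    show "cinner u ((block (expv (unshift r f)) x (expv (unshift r g))) v) = cinner u ((%_. 0) v + kappa *C a v)"
      unfolding kappa a_def comp_apply add_0 cinner_scaleC_right cadj_right[OF E_ket_bc] unfolding E_ket_def
      by (rule adaptedD[OF x(2)]) (intro unshift_step fg r)+
  qed
  hence s: "j r (block (expv (unshift r f)) x (expv (unshift r g))) = (%xi. kappa *C j r a xi)"
    using star_repD(4)[OF j_rep[OF r] A_zero a, of kappa] linear_map_on_zero[OF j_linear[OF r] A_zero] by simp
  show "cinner (ev u f) (J r x (Y (ev v g))) = cinner (expv (after (r + t) f)) (expv (after (r + t) g)) *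
      cinner (ev u (before (r + t) f)) (J r x (Y (ev v (before (r + t) g))))"
    unfolding J_matrix[OF r x(1) Y fg] J_matrix[OF r x(1) Y step_restr_upto[OF fg(1)] step_restr_upto[OF fg(2)]] e s
      a_def[symmetric] kappa_def[symmetric] cinner_scaleC_right ..
qed

end

context perturbed_flow
begin

text \<open>The class of strong solutions delivered by \<open>strong_solutionI\<close>; uniqueness
  is only ever applied within it.\<close>

definition exp_solution :: "(real => ('h, 'k) sp => ('h, 'k) sp) => bool"
  where "exp_solution z \<longleftrightarrow> strong_family z \<and> (\<forall>t\<ge>0. adapted t (z t)) \<and>
    (\<forall>t\<ge>0. \<forall>f\<in>step_fun. \<forall>g\<in>step_fun. \<forall>u v. cinner (ev u f) (z t (ev v g)) =
      cinner (ev u f) (ev v g) + (LINT s|lebesgue_on {0..t}. matrix_integrand z u f v g s))"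

lemma matrix_integrand_integrable:
  assumes z: "strong_family z" and fg: "f \<in> step_fun" "g \<in> step_fun" shows "integrable (lebesgue_on {0..N}) (matrix_integrand z u f v g)"
proof (rule Bochner_Integration.integrable_cong[THEN iffD1, OF refl _ matrix_integrable[OF z exp_domI exp_domI]])
  show "g \<in> step_fun" "f \<in> step_fun" by (fact fg)+
  fix s assume "s \<in> space (lebesgue_on {0..N})"
  hence s: "0 <= s" by (simp add: space_restrict_space)
  show "cinner (the (nabla s (ev u f))) (integrand z (ev v g) s) = matrix_integrand z u f v g s"
    by (rule matrix_integrand[where z = z, OF s sf_bc[OF z s] fg])
qed

text \<open>The constant is uniform in \<open>u\<close> and \<open>v\<close>; this dominates the
  series of vector functionals in \<open>slice_equation\<close>.\<close>

lemma matrix_integrand_bound: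
  assumes z: "strong_family z" and fg: "f \<in> step_fun" "g \<in> step_fun"
  shows "\<exists>K\<ge>0. \<forall>s\<in>{0..N}. \<forall>u v. norm (matrix_integrand z u f v g s) <= K * (norm u * norm v)"
proof -
  have kb: "\<exists>B. \<forall>s. norm (khat f s) <= B" if "f \<in> step_fun" for f :: "real => 'k" by (rule khat_bounded[OF that])
  obtain B1 where B1: "\<forall>s. norm (khat f s) <= B1" using kb[OF fg(1)] by (elim exE)
  obtain B2 where B2: "\<forall>s. norm (khat g s) <= B2" using kb[OF fg(2)] by (elim exE)
  have B0: "0 <= B1" "0 <= B2" using B1 B2 order_trans[OF norm_ge_zero] by blast+
  have sf: "strong_family (%s. jF s o (id \<odot> z s))" by (intro sf_comp sf_jF sf_tensor z)
  obtain C where C: "C >= 0" "\<forall>s\<in>{0..N}. \<forall>x. norm ((jF s o (id \<odot> z s)) x) <= C * norm x" using sf_bound[OF sf, of N] by (elim exE conjE)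
  have "norm (matrix_integrand z u f v g s) <= (B1 * C * B2) * (norm u * norm v)" if s: "s \<in> {0..N}" for s u v
  proof -
    have s0: "0 <= s" using s by simp
    have "matrix_integrand z u f v g s = cinner (khat f s \<otimes> (ev u f)) ((jF s o (id \<odot> z s)) (khat g s \<otimes> (ev v g)))"
      using matrix_integrand[where z = z, OF s0 sf_bc[OF z s0] fg, of u v] by (simp add: nabla_expv s0 fg)
    also have "norm \<dots> <= norm (khat f s \<otimes> (ev u f)) * norm ((jF s o (id \<odot> z s)) (khat g s \<otimes> (ev v g)))" by (rule ch.cauchy_schwarz)
    also have "\<dots> <= (B1 * norm u) * (C * (B2 * norm v))"
    proof (intro mult_mono)
      show "norm (khat f s \<otimes> (ev u f)) <= B1 * norm u" using B1 by (simp add: norm_tens norm_expv step_L2fun fg mult_right_mono)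
      have "norm ((jF s o (id \<odot> z s)) (khat g s \<otimes> (ev v g))) <= C * norm (khat g s \<otimes> (ev v g))" using C(2) s by blast
      also have "\<dots> <= C * (B2 * norm v)"
        using B2 C(1) by (intro mult_left_mono) (simp_all add: norm_tens norm_expv step_L2fun fg mult_right_mono)
      finally show "norm ((jF s o (id \<odot> z s)) (khat g s \<otimes> (ev v g))) <= C * (B2 * norm v)" .
    qed (use B0 in auto)
    finally show ?thesis by (simp add: mult_ac)
  qed
  thus ?thesis using B0 C(1) by (intro exI[of _ "B1 * C * B2"]) simp
qed

end

locale unique_solution = perturbed_flow A j F
  for A :: "('h::chilbert_space => 'h) set" and j :: "real => ('h => 'h) => ('h, 'k::chilbert_space) sp => ('h, 'k) sp" and F +
  fixes y :: "real => ('h, 'k) sp => ('h, 'k) sp" assumes solution: "exp_solution y" and unique: "exp_solution z ==> 0 <= t ==> z t = y t"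
begin

lemma y_sf: "strong_family y" and y_adapted: "0 <= t ==> adapted t (y t)"
  and y_eq: "0 <= t ==> f \<in> step_fun ==> g \<in> step_fun ==> cinner (ev u f) (y t (ev v g)) =
      cinner (ev u f) (ev v g) + (LINT s|lebesgue_on {0..t}. matrix_integrand y u f v g s)"
  using solution unfolding exp_solution_def by blast+

lemmas y_bc = sf_bc[OF y_sf]

text \<open>The operator \<open>b \<odot> id\<close> passes the coefficients, which commute with it,
  and acts on the first tensor factor of the exponential vectors. The inhomogeneous terms of the two
  added processes cancel, so \<open>z\<close> keeps the initial value of \<open>y\<close>.\<close>

lemma y_obs:
  assumes t: "0 <= t" shows "y t \<in> obs" unfolding obs_iff
proof (intro conjI ballI y_bc t)
  fix b assume b: "b \<in> commutant A"
  note bb = commutantD(1)[OF b]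
  let ?B = "b \<odot> id :: ('h, 'k) sp => _"
  have Bb: "bc ?B" by (intro bc_op_tensor bb bc_id)
  define z where "z t x = (y t x + 1 *C (?B o y t) x) + (-1) *C (y t o ?B) x" for t x
  have l: "cinner (u \<otimes> w) (?B x) = cinner (cadj b u \<otimes> w) x" for u w x
    using cadj_left[OF Bb, of "u \<otimes> w" x] by (simp add: cadj_op_tensor bb op_tensor_apply bc_cadj)
  have zm: "cinner (ev u f) (a (z t (ev v g))) = cinner (ev u f) (a (y t (ev v g))) +
      cinner (cadj b u \<otimes> expv f) (a (y t (ev v g))) - cinner (ev u f) (a (y t (b v \<otimes> expv g)))"
    if a: "bc a" "\<And>x. a (?B x) = ?B (a x)" for a :: "('h, 'k) sp => ('h, 'k) sp" and t u v f g
    by (simp add: z_def bc_add[OF a(1)] bc_scale[OF a(1)] cinner_add_right cinner_scaleC_right op_tensor_apply[OF bb bc_id] a(2) l)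
  have "exp_solution z" unfolding exp_solution_def
  proof (intro conjI allI impI ballI)
    show "strong_family z" unfolding z_def by (intro sf_lincomb sf_comp sf_const y_sf Bb)
    show "adapted t (z t)" if "0 <= t" for t unfolding z_def by (intro adapted_lincomb adapted_initial bb y_adapted that)
    fix t :: real and f g :: "real => 'k" and u v assume t: "0 <= t" and fg: "f \<in> step_fun" "g \<in> step_fun"
    have m: "matrix_integrand z u f v g s = matrix_integrand y u f v g s + matrix_integrand y (cadj b u) f v g s - matrix_integrand y u f (b v) g s"
      if s: "0 <= s" for s
    proof -
      have e: "entry (khat f s) (khat g s) \<in> A" by (rule entry_A)
      have "j s (entry (khat f s) (khat g s)) (?B x) = ?B (j s (entry (khat f s) (khat g s)) x)" for x
        using j_obs[OF s e] b unfolding obs_iff by (simp add: fun_eq_iff)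
      thus ?thesis unfolding matrix_integrand_def by (rule zm[OF j_bc[OF s e]])
    qed
    have "(LINT s|lebesgue_on {0..t}. matrix_integrand z u f v g s) =
        (LINT s|lebesgue_on {0..t}. matrix_integrand y u f v g s + matrix_integrand y (cadj b u) f v g s - matrix_integrand y u f (b v) g s)"
      by (rule Bochner_Integration.integral_cong[OF refl m]) (simp add: space_restrict_space)
    also have "\<dots> = (LINT s|lebesgue_on {0..t}. matrix_integrand y u f v g s) + (LINT s|lebesgue_on {0..t}. matrix_integrand y (cadj b u) f v g s)
        - (LINT s|lebesgue_on {0..t}. matrix_integrand y u f (b v) g s)" by (simp add: matrix_integrand_integrable y_sf fg)
    finally show "cinner (ev u f) (z t (ev v g)) = cinner (ev u f) (ev v g) + (LINT s|lebesgue_on {0..t}. matrix_integrand z u f v g s)"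
      using zm[of id u f t v g] by (simp add: y_eq[OF t fg] cinner_tens cadj_left[OF bb])
  qed
  from unique[OF this t] have "z t x = y t x" for x by simp
  thus "?B o y t = y t o ?B" by (simp add: z_def fun_eq_iff ch.sc_minus)
qed

lemma y_zero: "y 0 = id"
proof (rule exp_op_ext[OF y_bc bc_id])
  fix u v :: 'h and f g :: "real => 'k" assume fg: "f \<in> step_fun" "g \<in> step_fun"
  have "(LINT s|lebesgue_on {0..0}. matrix_integrand y u f v g s) = integral {0..0} (matrix_integrand y u f v g)"
    by (rule lebesgue_integral_eq_integral) (simp_all add: matrix_integrand_integrable[OF y_sf fg, of 0, simplified])
  thus "cinner (ev u f) (y 0 (ev v g)) = cinner (ev u f) (id (ev v g))" using y_eq[OF order_refl fg, of u v] by simp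
qed simp

text \<open>A normal functional is a series of vector functionals that can be integrated termwise. Composed
  with \<open>j r\<close>, such functionals carry the equation of a solution over to its image under \<open>J r\<close>.\<close>

lemma slice_equation:
  assumes phi: "uw_fun phi" and t: "0 <= t" and fg: "f \<in> step_fun" "g \<in> step_fun"
  shows "integrable (lebesgue_on {0..t}) (%s. phi (block (expv f) (j s (entry (khat f s) (khat g s)) o y s) (expv g)))"
    and "phi (block (expv f) (y t) (expv g)) = phi (block (expv f) id (expv g)) +
    (LINT s|lebesgue_on {0..t}. phi (block (expv f) (j s (entry (khat f s) (khat g s)) o y s) (expv g)))"
proof -
  define a where "a = block (expv f) (y t) (expv g)"
  define d where "d = block (expv f) (id :: ('h, 'k) sp => _) (expv g)"
  define b where "b s = block (expv f) (j s (entry (khat f s) (khat g s)) o y s) (expv g)" for s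
  note defs = a_def[symmetric] d_def[symmetric] b_def[symmetric]
  have ab: "a \<in> bounded_ops" "d \<in> bounded_ops" unfolding a_def d_def by (intro bounded_opsI bc_compose bc_cadj E_ket_bc y_bc bc_id t)+
  have bb: "b s \<in> bounded_ops" if "0 <= s" for s unfolding b_def by (intro bounded_opsI bc_compose bc_cadj E_ket_bc y_bc j_bc entry_A that)
  have b: "cinner u (b s v) = matrix_integrand y u f v g s" for u v s
    unfolding b_def matrix_integrand_def comp_apply cadj_right[OF E_ket_bc] unfolding E_ket_def ..
  have adb: "cinner u (a v) = cinner u (d v) + (LINT s|lebesgue_on {0..t}. cinner u (b s v))" for u v
    using y_eq[OF t fg, of u v] unfolding b a_def d_def comp_apply cadj_right[OF E_ket_bc] unfolding E_ket_def by simp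
  obtain xi eta :: "nat => 'h" where r: "sqsum xi" "sqsum eta"
    "\<And>x. x \<in> bounded_ops ==> (%n. cinner (xi n) (x (eta n))) sums phi x" by (rule uw_fun_repr[OF phi]) blast
  obtain K where K: "K >= 0" "\<forall>s\<in>{0..t}. \<forall>u v. norm (matrix_integrand y u f v g s) <= K * (norm u * norm v)"
    using matrix_integrand_bound[OF y_sf fg, of t] by (elim exE conjE)
  define c where "c n = K * ((norm (xi n))\<^sup>2 + (norm (eta n))\<^sup>2)" for n
  have c: "summable c" unfolding c_def by (intro summable_mult summable_add r)
  have bd: "norm (cinner (xi n) (b s (eta n))) <= c n" if "s \<in> {0..t}" for n s
  proof -
    have "norm (xi n) * norm (eta n) <= (norm (xi n))\<^sup>2 + (norm (eta n))\<^sup>2"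
      using sum_squares_bound[of "norm (xi n)" "norm (eta n)"] mult_nonneg_nonneg[OF norm_ge_zero norm_ge_zero, of "xi n" "eta n"] by linarith
    from mult_left_mono[OF this K(1)] show ?thesis using K(2)[rule_format, OF that, of "xi n" "eta n"] unfolding b c_def by linarith
  qed
  have int: "integrable (lebesgue_on {0..t}) (%s. cinner (xi n) (b s (eta n)))" for n
    unfolding b by (rule matrix_integrand_integrable[OF y_sf fg])
  have ae: "AE s in lebesgue_on {0..t}. summable (%n. norm (cinner (xi n) (b s (eta n))))"
  proof (rule AE_I2)
    fix s assume "s \<in> space (lebesgue_on {0..t})"
    hence s: "s \<in> {0..t}" by (simp add: space_restrict_space)
    show "summable (%n. norm (cinner (xi n) (b s (eta n))))" by (rule summable_comparison_test'[OF c, of 0]) (use bd[OF s] in simp)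
  qed
  have sm: "summable (%n. LINT s|lebesgue_on {0..t}. norm (cinner (xi n) (b s (eta n))))"
  proof (rule summable_comparison_test'[OF summable_mult[OF c, of t], of 0])
    fix n
    have "integrable (lebesgue_on {0..t}) (%_. c n)" 
      by (rule finite_measure.integrable_const) (simp add: finite_measureI emeasure_restrict_space space_restrict_space emeasure_lborel_Icc_eq)
    hence "(LINT s|lebesgue_on {0..t}. norm (cinner (xi n) (b s (eta n)))) <= (LINT s|lebesgue_on {0..t}. c n)"
      by (intro integral_mono int integrable_norm) (use bd in \<open>simp_all add: space_restrict_space\<close>)
    also have "\<dots> = t * c n" using t by (simp add: measure_restrict_space space_restrict_space)
    finally show "norm (LINT s|lebesgue_on {0..t}. norm (cinner (xi n) (b s (eta n)))) <= t * c n" by simp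
  qed
  note sums = sums_integral[OF int ae sm]
  have phib: "phi (b s) = (\<Sum>n. cinner (xi n) (b s (eta n)))" if "s \<in> space (lebesgue_on {0..t})" for s
    using sums_unique[OF r(3)[OF bb]] that by (simp add: space_restrict_space)
  show "integrable (lebesgue_on {0..t}) (%s. phi (block (expv f) (j s (entry (khat f s) (khat g s)) o y s) (expv g)))" unfolding defs
    by (rule Bochner_Integration.integrable_cong[THEN iffD1, OF refl _ integrable_suminf[OF int ae sm]]) (simp only: phib)
  have "(LINT s|lebesgue_on {0..t}. (\<Sum>n. cinner (xi n) (b s (eta n)))) = (LINT s|lebesgue_on {0..t}. phi (b s))"
    by (rule Bochner_Integration.integral_cong[OF refl]) (simp only: phib)
  with sums_add[OF r(3)[OF ab(2)] sums] have "(%n. cinner (xi n) (a (eta n))) sums (phi d + (LINT s|lebesgue_on {0..t}. phi (b s)))"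
    unfolding adb by simp
  from sums_unique2[OF r(3)[OF ab(1)] this]
  show "phi (block (expv f) (y t) (expv g)) = phi (block (expv f) id (expv g)) +
    (LINT s|lebesgue_on {0..t}. phi (block (expv f) (j s (entry (khat f s) (khat g s)) o y s) (expv g)))" unfolding defs .
qed

lemma cocycle:
  assumes r: "0 <= r" and t: "0 <= t" shows "y (r + t) = J r (y t) o y r"
proof -
  define z where "z s = (if s <= r then y s else J r (y (s - r)) o y r)" for s
  have Jid: "J r (y 0) = id" by (simp add: y_zero J_id[OF r])
  \<comment> \<open>The branches agree at time \<open>r\<close> because \<open>J r\<close> maps the
    initial value \<open>id\<close> to \<open>id\<close>.\<close>
  have z2: "z (r + s) = J r (y s) o y r" if "0 <= s" for s using that Jid by (cases "s = 0") (auto simp: z_def)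
  have sfJ: "strong_family (%s. J r (y s) o y r)" by (intro sf_comp sf_J sf_const y_bc y_sf y_obs r)
  have z: "strong_family z" unfolding strong_family_def
  proof (intro conjI allI impI)
    show "bc (z s)" if "0 <= s" for s using y_bc[OF that] sf_bc[OF sfJ, of "s - r"] by (simp add: z_def)
    fix N :: real
    obtain C where C: "C >= 0" "\<forall>s\<in>{0..N}. \<forall>x. norm (y s x) <= C * norm x" using sf_bound[OF y_sf, of N] by (elim exE conjE)
    obtain D where D: "D >= 0" "\<forall>s\<in>{0..N}. \<forall>x. norm ((J r (y s) o y r) x) <= D * norm x" using sf_bound[OF sfJ, of N] by (elim exE conjE)
    have "norm (z s x) <= (C + D) * norm x" if "s \<in> {0..N}" for s x
    proof (cases "s <= r")
      case True
      have "norm (y s x) <= C * norm x" using C(2) that by blast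
      also have "\<dots> <= (C + D) * norm x" using D(1) by (simp add: mult_right_mono)
      finally show ?thesis using True by (simp add: z_def)
    next
      case False
      have "s - r \<in> {0..N}" using that r False by auto
      hence "norm ((J r (y (s - r)) o y r) x) <= D * norm x" using D(2) by blast
      also have "\<dots> <= (C + D) * norm x" using C(1) by (simp add: mult_right_mono)
      finally show ?thesis using False by (simp add: z_def)
    qed
    thus "\<exists>C\<ge>0. \<forall>s\<in>{0..N}. \<forall>x. norm (z s x) <= C * norm x" using C(1) D(1) by (intro exI[of _ "C + D"]) simp
    fix x
    have "continuous_on {0..} (%s. if s <= r then y s x else (J r (y (s - r)) o y r) x)"
    proof (rule continuous_on_cases_le)
      show "continuous_on {s \<in> {0..}. s <= r} (%s. y s x)" by (rule continuous_on_subset[OF sf_cont[OF y_sf]]) auto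
      show "continuous_on {s \<in> {0..}. r <= s} (%s. (J r (y (s - r)) o y r) x)"
        by (rule continuous_on_compose2[OF sf_cont[OF sfJ]]) (auto intro: continuous_intros)
    qed (auto simp: Jid intro: continuous_intros)
    thus "continuous_on {0..} (%s. z s x)" by (rule continuous_on_eq) (simp add: z_def)
  qed
  have "exp_solution z" unfolding exp_solution_def
  proof (intro conjI allI impI ballI z)
    show "adapted s (z s)" if "0 <= s" for s
      using y_adapted[OF that] J_adapted[OF r _ y_obs y_adapted y_bc[OF r] y_adapted[OF r], of "s - r"] by (simp add: z_def)
    fix s :: real and f g :: "real => 'k" and u v assume s: "0 <= s" and fg: "f \<in> step_fun" "g \<in> step_fun"
    let ?m = "matrix_integrand z u f v g"
    note mi = matrix_integrand_integrable[OF z fg]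
    \<comment> \<open>The gauge integral is brought in for its rules on splitting an interval at
      \<open>r\<close> and on translating it.\<close>
    have HK: "(LINT q|lebesgue_on {0..N}. ?m q) = integral {0..N} ?m" "?m integrable_on {0..N}" for N
      by (rule lebesgue_integral_eq_integral[OF mi]) (simp_all add: integrable_on_lebesgue_on[OF mi])
    have early: "(LINT q|lebesgue_on {0..N}. matrix_integrand y u f v g q) = integral {0..N} ?m" if "N <= r" for N unfolding HK(1)[symmetric]
      by (rule Bochner_Integration.integral_cong[OF refl]) (use that in \<open>simp add: space_restrict_space matrix_integrand_def z_def\<close>)
    show "cinner (ev u f) (z s (ev v g)) = cinner (ev u f) (ev v g) + (LINT q|lebesgue_on {0..s}. ?m q)"
    proof (cases "s <= r")
      case True
      thus ?thesis unfolding HK(1) using y_eq[OF s fg, of u v] by (simp add: z_def early)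
    next
      case False
      define tau where "tau = s - r"
      have tau: "0 <= tau" "s = r + tau" using False by (auto simp: tau_def)
      define f' where "f' = unshift r f"
      define g' where "g' = unshift r g"
      have fg': "f' \<in> step_fun" "g' \<in> step_fun" unfolding f'_def g'_def by (intro unshift_step fg r)+
      have kh: "khat f' q = khat f (r + q)" "khat g' q = khat g (r + q)" if "0 <= q" for q
        using that by (simp_all add: khat_def f'_def g'_def unshift_def add.commute)
      \<comment> \<open>The matrix element of \<open>j r\<close> at the past parts of the two
        vectors, with \<open>y r\<close> absorbed on the right, as a normal functional on
        \<open>A\<close>. On slices of \<open>x\<close> it yields matrix elements of
        \<open>J r x o y r\<close>.\<close>
      obtain phi where phi: "uw_fun phi" "\<forall>a\<in>A. cinner (ev u (before r f)) (j r a (y r (ev v (before r g)))) = phi a"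
        using j_normal[OF r uw_fun_vec[of "ev u (before r f)" "y r (ev v (before r g))"]] by (elim exE conjE)
      have J: "phi (block (expv f') x (expv g')) = cinner (ev u f) (J r x (y r (ev v g)))" if x: "x \<in> obs" for x
        unfolding J_matrix[OF r x y_bc[OF r] y_adapted[OF r] fg] using phi(2) obs_slice[OF x] by (simp add: f'_def g'_def)
      \<comment> \<open>\<open>J r\<close> is multiplicative and sends \<open>j q a\<close> to
        \<open>j (r + q) a\<close>, so the integrand of the slice equation at \<open>q\<close>
        becomes that of \<open>z\<close> at \<open>r + q\<close>.\<close>
      have late: "phi (block (expv f') (j q (entry (khat f' q) (khat g' q)) o y q) (expv g')) = ?m (r + q)" if q: "0 <= q" for q
        using J[OF obs_comp[OF j_obs[OF q entry_A] y_obs[OF q]], of "khat f' q" "khat g' q"]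
        by (simp add: J_mult[OF r j_obs[OF q entry_A] y_obs[OF q]] J_cocycle[OF r q entry_A] matrix_integrand_def z2[OF q] kh[OF q])
      have "cinner (ev u f) (z s (ev v g)) = phi (block (expv f') (y tau) (expv g'))" by (simp add: tau(2) z2[OF tau(1)] J[OF y_obs[OF tau(1)]])
      also have "\<dots> = phi (block (expv f') id (expv g')) + (LINT q|lebesgue_on {0..tau}. ?m (r + q))"
        unfolding slice_equation(2)[OF phi(1) tau(1) fg']
        by (intro arg_cong2[where f = "(+)"] refl Bochner_Integration.integral_cong) (simp add: space_restrict_space late)
      \<comment> \<open>The initial term of the slice equation turns into the solution at time
        \<open>r\<close>, where the later part of \<open>z\<close> starts.\<close>
      also have "phi (block (expv f') id (expv g')) = cinner (ev u f) (y r (ev v g))" unfolding J[OF id_obs] J_id[OF r] by simp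
      also have "\<dots> = cinner (ev u f) (ev v g) + integral {0..r} ?m" unfolding y_eq[OF r fg] early[OF order_refl] ..
      also have "(LINT q|lebesgue_on {0..tau}. ?m (r + q)) = integral {0..tau} (?m o (+) r)"
      proof (subst lebesgue_integral_eq_integral[symmetric])
        show "integrable (lebesgue_on {0..tau}) (?m o (+) r)"
          by (rule Bochner_Integration.integrable_cong[THEN iffD1, OF refl _ slice_equation(1)[OF phi(1) tau(1) fg']])
            (simp add: space_restrict_space late)
      qed (simp_all add: o_def)
      also have "\<dots> = integral {r..s} ?m" using integral_shift_Icc_real[of 0 tau ?m r] by (simp add: tau(2) add.commute)
      finally show ?thesis unfolding HK(1) using Henstock_Kurzweil_Integration.integral_combine[OF r _ HK(2)[of s]] tau by simp
    qed
  qed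
  from unique[OF this, of "r + t"] show ?thesis using r t by (simp add: z2)
qed

end

theorem theorem5p2:
  fixes A :: "('h::chilbert_space \<Rightarrow> 'h) set"
    and j :: "real \<Rightarrow> ('h \<Rightarrow> 'h) \<Rightarrow> ('h, 'k::chilbert_space) sp \<Rightarrow> ('h, 'k) sp"
    and F :: "(complex \<times> 'k, 'h) htens \<Rightarrow> (complex \<times> 'k, 'h) htens"
    and Y :: "real \<Rightarrow> ('h, 'k) sp \<rightharpoonup> ('h, 'k) sp"
  assumes "von_neumann_algebra A"
    and "qs_flow A j"
    and "F \<in> vn_tensor bounded_ops A"
    and "perturbation_process A j F Y"
    and "bounded_process Y"
    and "locally_uniform_bounds Y"
  shows "multiplier_cocycle A j Y"
proof -
  interpret perturbed_flow A j F by unfold_locales (fact assms(1-3))+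
  define y where "y t = op_ext (Y t)" for t
  have Y: "strong_solution A j F Y" "\<And>Z t. strong_solution A j F Z \<Longrightarrow> 0 <= t \<Longrightarrow> Z t = Y t"
    using assms(4) unfolding perturbation_process_def by blast+
  have op: "op_process Y" using Y(1) unfolding strong_solution_def by blast
  have Yt: "lin_op (Y t)" "bounded_op (Y t)" "dom (Y t) = exp_dom" if "0 <= t" for t
    using assms(5) that unfolding bounded_process_def op_process_def by blast+
  have yb: "bc (y t)" and Yy: "Y t = op_on (y t) exp_dom" if "0 <= t" for t
    using bounded_op_op_on[OF Yt(1,2)[OF that]] Yt(3)[OF that] exp_dom_dense unfolding y_def by simp_all
  have ad: "adapted t (y t)" if t: "0 <= t" for t using op t unfolding op_process_def slice_adapted[symmetric] by (simp add: Yy)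
  note sol = strong_solutionD[OF Y(1), of y, OF yb Yy]
  \<comment> \<open>The locally uniform bounds turn continuity on exponential vectors into strong
    continuity on the whole space.\<close>
  have sf: "strong_family y"
  proof (rule strong_familyI[OF yb _ exp_gens_total])
    fix N :: real assume "0 <= N"
    then obtain C where C: "\<And>t. t \<in> {0..N} \<Longrightarrow> onorm (y t) <= C"
      using assms(6) unfolding locally_uniform_bounds_def bdd_above_def y_def by blast
    have "norm (y t x) <= C * norm x" if t: "t \<in> {0..N}" for t x
      using order_trans[OF bc_onorm[OF yb] mult_right_mono[OF C[OF t] norm_ge_zero]] t by simp
    thus "\<exists>C. \<forall>t\<in>{0..N}. \<forall>x. norm (y t x) <= C * norm x" by blast
  qed (auto intro!: sol(1) exp_domI)
  \<comment> \<open>Restrictions to a common dense domain determine bounded operators, so uniqueness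
    of the partial operators \<open>Y t\<close> is uniqueness of the family
    \<open>y\<close>.\<close>
  interpret unique_solution A j F y
  proof
    show "exp_solution y" unfolding exp_solution_def using sf ad sol(2) by blast
    fix z :: "real \<Rightarrow> ('h, 'k) sp \<Rightarrow> ('h, 'k) sp" and t :: real assume z: "exp_solution z" and t: "0 <= t"
    have "strong_solution A j F (%t. op_on (z t) exp_dom)" using z unfolding exp_solution_def by (intro strong_solutionI) blast+
    hence "op_on (z t) exp_dom = op_on (y t) exp_dom" using Y(2)[OF _ t] Yy[OF t] by simp
    moreover have "bc (z t)" using z t sf_bc unfolding exp_solution_def by blast
    ultimately show "z t = y t" using op_ext_op_on[OF exp_dom_dense] yb[OF t] by metis
  qed
  have "process_in A Y" unfolding process_in_def
  proof (intro conjI allI impI ballI op)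
    fix t :: real and f g :: "real \<Rightarrow> 'k" assume t: "0 <= t" and g: "g \<in> step_fun"
    show "slice f (Y t) g \<in> A" unfolding Yy[OF t] slice_op_on[OF g] by (rule obs_slice[OF y_obs[OF t]])
  qed
  thus ?thesis unfolding multiplier_cocycle_def y_def[symmetric] using assms(5) y_zero cocycle by blast
qed

end
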